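(* Fix integers $m,n\ge1$. Let $\widehat F_{m,n}$ be the set of those $f\in F_1$ with $m=N_0(f)+1$ and $n=\mu(f)+1$. Denote by $\mathcal{S}(f)_1\in\mathbb{C}$ the coefficient of the linear term (the term $\lambda^1$) of the Schwarzian derivative $\mathcal{S}(f)(\lambda)$. Then the mapping $$\Pi:\widehat F_{m,n}\to\mathbb{C},\qquad f\mapsto-\tfrac14\mathcal{S}(f)_1,$$ is a bijection between the set $\widehat F_{m,n}$ and the set of roots of the generalised Hermite polynomial $H_{m,n}(z)$.
   Context: Generalised Hermite polynomials $H_{m,n}(z)$, $m,n\in\mathbb{N}=\{0,1,2,\dots\}$, are defined recursively by $2mH_{m+1,n}H_{m-1,n}=H_{m,n}H_{m,n}''-(H_{m,n}')^2+2mH_{m,n}^2$ and $2nH_{m,n+1}H_{m,n-1}=-H_{m,n}H_{m,n}''+(H_{m,n}')^2+2nH_{m,n}^2$, with $H_{0,0}=H_{1,0}=H_{0,1}=1$, $H_{1,1}=2z$. Schwarzian derivative: $\mathcal{S}(f)=\frac{f'''}{f'}-\frac32\left(\frac{f''}{f'}\right)^2$; for $f\in F_1$ it is a Laurent polynomial in $\lambda$. Stokes sectors: $\Omega_k=\{|\arg\lambda-\frac{k\pi}{2}|<\frac\pi4\}$, $k=0,1,2,-1$. Family $F_1$. A meromorphic function $f:\mathbb{C}\to\mathbb{P}^1$ belongs to $F_1$ if it has a unique critical point and exactly four transcendental singularities (all direct), with two asymptotic values coinciding with the critical value, normalised so that: $\mathcal{S}(f)(\lambda)=-2\lambda^2+\mathcal{O}(\lambda)$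 as $\lambda\to\infty$; the critical point is $\lambda=0$; and, denoting by $w_k$ the asymptotic value of $f$ in $\Omega_k$ (limit as $\lambda\to\infty$ in $\Omega_k$ along curves not tangential to the boundary), $w_0=w_2=f(0)=0$, $w_1=i$, $w_{-1}=-i$. The degenerate case in which $\lambda=0$ is a zero of multiplicity one (critical point "of multiplicity $0$", no other critical points) is included. For $f\in F_1$, $\mu(f)$ is the multiplicity of the critical point $\lambda=0$, i.e. $f$ has a zero of order exactly $\mu(f)+1$ at $0$, and $N_0(f)$ is the number of further solutions $\lambda\ne0$ of $f(\lambda)=0$ (all simple). *)

theory Defs
  imports
    "HOL-Complex_Analysis.Complex_Analysis"
    "HOL-Computational_Algebra.Polynomial"
begin

section \<open>Generalised Hermite polynomials\<close>

definition hirota :: "complex poly \<Rightarrow> complex poly" where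
  "hirota h = h * pderiv (pderiv h) - (pderiv h)\<^sup>2"

text \<open>
  The defining recurrences and initial values for a doubly indexed family of polynomials.
\<close>

definition generalised_hermite_family :: "(nat \<Rightarrow> nat \<Rightarrow> complex poly) \<Rightarrow> bool" where
  "generalised_hermite_family H \<longleftrightarrow>
     H 0 0 = 1 \<and> H 1 0 = 1 \<and> H 0 1 = 1 \<and> H 1 1 = [:0, 2:] \<and>
     (\<forall>m\<ge>1. \<forall>n. smult (2 * of_nat m) (H (m + 1) n * H (m - 1) n) =
                 hirota (H m n) + smult (2 * of_nat m) ((H m n)\<^sup>2)) \<and>
     (\<forall>m. \<forall>n\<ge>1. smult (2 * of_nat n) (H m (n + 1) * H m (n - 1)) =
                 - hirota (H m n) + smult (2 * of_nat n) ((H m n)\<^sup>2))"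

text \<open>
  The recurrences solved for the polynomial of highest index.  All the divisions are exact
  (the generalised Hermite polynomials are well defined), so \<^verbatim>\<open>div\<close> is the true quotient.
  The first recurrence is used for all \<^verbatim>\<open>m \<ge> 2\<close> and the second one in the columns \<^verbatim>\<open>m = 0, 1\<close>;
  the lemma \<^verbatim>\<open>generalised_hermite_unique\<close> shows that any solution of the full system of
  recurrences is the family computed here.
\<close>

fun generalised_hermite :: "nat \<Rightarrow> nat \<Rightarrow> complex poly" where
  "generalised_hermite (Suc (Suc m)) n =
     (let h = generalised_hermite (Suc m) n; c = 2 * of_nat (Suc m)
      in (hirota h + smult c (h\<^sup>2)) div smult c (generalised_hermite m n))"
| "generalised_hermite m (Suc (Suc n)) =
     (let h = generalised_hermite m (Suc n); c = 2 * of_nat (Suc n)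
      in (- hirota h + smult c (h\<^sup>2)) div smult c (generalised_hermite m n))"
| "generalised_hermite (Suc 0) (Suc 0) = [:0, 2:]"
| "generalised_hermite m n = 1"

lemma hirota_plus_square_nonzero:
  assumes "h \<noteq> 0" "c \<noteq> 0"
  shows   "hirota h + smult c (h\<^sup>2) \<noteq> 0" "- hirota h + smult c (h\<^sup>2) \<noteq> 0"
proof -
  have c0: "coeff (hirota h) (2 * degree h) = 0"
  proof (cases "degree h = 0")
    case True
    then obtain a where "h = [:a:]" by (meson degree_eq_zeroE)
    thus ?thesis by (simp add: hirota_def)
  next
    case False
    have "degree (h * pderiv (pderiv h)) < 2 * degree h"
      using False degree_mult_le[of h "pderiv (pderiv h)"] by (simp add: degree_pderiv)
    moreover have "degree ((pderiv h)\<^sup>2) < 2 * degree h"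
      using False degree_power_le[of "pderiv h" 2] by (simp add: degree_pderiv)
    ultimately show ?thesis
      by (simp add: hirota_def coeff_eq_0)
  qed
  have "coeff (h\<^sup>2) (2 * degree h) = (lead_coeff h)\<^sup>2"
    by (simp add: power2_eq_square coeff_mult_degree_sum mult_2)
  hence "coeff (hirota h + smult c (h\<^sup>2)) (2 * degree h) \<noteq> 0"
    "coeff (- hirota h + smult c (h\<^sup>2)) (2 * degree h) \<noteq> 0"
    using c0 assms by simp_all
  thus "hirota h + smult c (h\<^sup>2) \<noteq> 0" "- hirota h + smult c (h\<^sup>2) \<noteq> 0"
    by (metis coeff_0)+
qed

lemma generalised_hermite_unique:
  assumes "generalised_hermite_family H"
  shows   "H m n = generalised_hermite m n"
proof -
  have init: "H 0 0 = 1" "H (Suc 0) 0 = 1" "H 0 (Suc 0) = 1" "H (Suc 0) (Suc 0) = [:0, 2:]"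
    using assms by (auto simp: generalised_hermite_family_def)
  have A: "smult (2 * of_nat (Suc m)) (H (Suc (Suc m)) n * H m n) =
             hirota (H (Suc m) n) + smult (2 * of_nat (Suc m)) ((H (Suc m) n)\<^sup>2)" for m n
    using assms unfolding generalised_hermite_family_def
    by (metis Suc_eq_plus1 diff_Suc_1 le_add2)
  have B: "smult (2 * of_nat (Suc n)) (H m (Suc (Suc n)) * H m n) =
             - hirota (H m (Suc n)) + smult (2 * of_nat (Suc n)) ((H m (Suc n))\<^sup>2)" for m n
    using assms unfolding generalised_hermite_family_def
    by (metis Suc_eq_plus1 diff_Suc_1 le_add2)
  have nz: "2 * of_nat (Suc k) \<noteq> (0 :: complex)" for k
    by (simp del: of_nat_Suc)
  have quot: "p = r div smult c q" if "smult c (p * q) = r" "c \<noteq> 0" "q \<noteq> 0"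
    for p q r :: "complex poly" and c
    using that by (metis mult_smult_right nonzero_mult_div_cancel_right smult_eq_0_iff)
  have "H m n \<noteq> 0 \<and> H m n = generalised_hermite m n"
  proof (induction m n rule: generalised_hermite.induct)
    case (1 m n)
    note IH = 1(1) 1(2)[OF refl refl]
    have "H (Suc (Suc m)) n \<noteq> 0"
      using A[of m n] hirota_plus_square_nonzero(1)[OF _ nz] IH by (metis mult_zero_left smult_0_right)
    thus ?case using quot[OF A nz, of m n] IH by (auto simp add: Let_def simp del: of_nat_Suc)
  next
    case ("2_1" n)
    note IH = "2_1"(1) "2_1"(2)[OF refl refl]
    have "H 0 (Suc (Suc n)) \<noteq> 0"
      using B[of n 0] hirota_plus_square_nonzero(2)[OF _ nz] IH by (metis mult_zero_left smult_0_right)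
    thus ?case using quot[OF B nz, of 0 n] IH by (auto simp add: Let_def simp del: of_nat_Suc)
  next
    case ("2_2" n)
    note IH = "2_2"(1) "2_2"(2)[OF refl refl]
    have "H (Suc 0) (Suc (Suc n)) \<noteq> 0"
      using B[of n "Suc 0"] hirota_plus_square_nonzero(2)[OF _ nz] IH by (metis mult_zero_left smult_0_right)
    thus ?case using quot[OF B nz, of "Suc 0" n] IH by (auto simp add: Let_def simp del: of_nat_Suc)
  qed (simp_all add: init)
  thus ?thesis by blast
qed


section \<open>Meromorphic functions as maps into the Riemann sphere\<close>

text \<open>
  The Riemann sphere is \<^typ>\<open>complex option\<close>, with \<^const>\<open>None\<close> as the point at infinity.
  A meromorphic function on the plane is represented by the unique function
  \<^verbatim>\<open>f :: complex \<Rightarrow> complex\<close> with \<^verbatim>\<open>f nicely_meromorphic_on UNIV\<close>: it is continuous off the poles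
  and takes the dummy value \<^verbatim>\<open>0\<close> at the poles.  The corresponding map into the sphere is
  \<^verbatim>\<open>sphere_map f\<close>; all values of \<^verbatim>\<open>f\<close> are to be read off from it.
\<close>

definition sphere_map :: "(complex \<Rightarrow> complex) \<Rightarrow> complex \<Rightarrow> complex option" where
  "sphere_map f z = (if is_pole f z then None else Some (f z))"

fun chordal_dist :: "complex option \<Rightarrow> complex option \<Rightarrow> real" where
  "chordal_dist (Some z) (Some w) =
     norm (z - w) / (sqrt (1 + (norm z)\<^sup>2) * sqrt (1 + (norm w)\<^sup>2))"
| "chordal_dist (Some z) None = 1 / sqrt (1 + (norm z)\<^sup>2)"
| "chordal_dist None (Some w) = 1 / sqrt (1 + (norm w)\<^sup>2)"
| "chordal_dist None None = 0"

text \<open>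
  The points near which the map into the sphere is not injective: zeros of the derivative and
  multiple poles.
\<close>

definition critical_point :: "(complex \<Rightarrow> complex) \<Rightarrow> complex \<Rightarrow> bool" where
  "critical_point f z \<longleftrightarrow> (if is_pole f z then zorder f z \<noteq> -1 else deriv f z = 0)"

text \<open>
  Iversen's definition: a transcendental singularity of the inverse of \<^verbatim>\<open>f\<close> over the point \<^verbatim>\<open>a\<close> is a
  choice, monotone in \<^verbatim>\<open>r\<close>, of components \<^verbatim>\<open>U r\<close> of the preimages of the spherical discs of
  radius \<^verbatim>\<open>r\<close> about \<^verbatim>\<open>a\<close> such that the \<^verbatim>\<open>U r\<close> have empty intersection.  The value of \<^verbatim>\<open>U\<close> at radii
  \<^verbatim>\<open>r \<le> 0\<close> is fixed in order that such choices can be counted.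
\<close>

definition transcendental_singularity ::
    "(complex \<Rightarrow> complex) \<Rightarrow> complex option \<Rightarrow> (real \<Rightarrow> complex set) \<Rightarrow> bool" where
  "transcendental_singularity f a U \<longleftrightarrow>
     (\<forall>r>0. U r \<in> components {z. chordal_dist (sphere_map f z) a < r}) \<and>
     (\<forall>r\<le>0. U r = {}) \<and>
     (\<forall>r s. 0 < r \<and> r \<le> s \<longrightarrow> U r \<subseteq> U s) \<and>
     (\<Inter>r\<in>{0<..}. U r) = {}"

definition direct_singularity ::
    "(complex \<Rightarrow> complex) \<Rightarrow> complex option \<Rightarrow> (real \<Rightarrow> complex set) \<Rightarrow> bool" where
  "direct_singularity f a U \<longleftrightarrow>
     transcendental_singularity f a U \<and> (\<exists>r>0. \<forall>z\<in>U r. sphere_map f z \<noteq> a)"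


section \<open>Asymptotic values in the Stokes sectors\<close>

text \<open>
  The open sector of half-opening \<^verbatim>\<open>\<delta>\<close> about the ray \<^verbatim>\<open>arg z = k \<pi> / 2\<close>.
\<close>

definition sector :: "int \<Rightarrow> real \<Rightarrow> complex set" where
  "sector k \<delta> = {z. z \<noteq> 0 \<and> (\<exists>\<theta>. is_Arg z \<theta> \<and> \<bar>\<theta> - of_int k * pi / 2\<bar> < \<delta>)}"

definition stokes_sector :: "int \<Rightarrow> complex set" where
  "stokes_sector k = sector k (pi / 4)"

text \<open>
  A curve in a Stokes sector is not tangential to the boundary (at infinity) if it
  eventually stays in a strictly smaller sector about the same axis.
\<close>

definition nontangential_curve :: "int \<Rightarrow> (real \<Rightarrow> complex) \<Rightarrow> bool" where
  "nontangential_curve k \<gamma> \<longleftrightarrow>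
     continuous_on {0..} \<gamma> \<and> \<gamma> ` {0..} \<subseteq> stokes_sector k \<and> filterlim \<gamma> at_infinity at_top \<and>
     (\<exists>\<delta><pi / 4. \<forall>\<^sub>F t in at_top. \<gamma> t \<in> sector k \<delta>)"

definition has_asymptotic_value ::
    "(complex \<Rightarrow> complex) \<Rightarrow> int \<Rightarrow> complex option \<Rightarrow> bool" where
  "has_asymptotic_value f k w \<longleftrightarrow>
     (\<forall>\<gamma>. nontangential_curve k \<gamma> \<longrightarrow>
        ((\<lambda>t. chordal_dist (sphere_map f (\<gamma> t)) w) \<longlongrightarrow> 0) at_top)"


section \<open>The Schwarzian derivative\<close>

text \<open>
  As a meromorphic function: the defining expression has removable singularities at the simple
  poles of \<^verbatim>\<open>f\<close>, where the pointwise derivatives are meaningless.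
\<close>

definition schwarzian :: "(complex \<Rightarrow> complex) \<Rightarrow> complex \<Rightarrow> complex" where
  "schwarzian f = remove_sings
     (\<lambda>z. (deriv ^^ 3) f z / deriv f z - 3 / 2 * ((deriv ^^ 2) f z / deriv f z)\<^sup>2)"

text \<open>
  When the Schwarzian derivative is a Laurent polynomial in \<^verbatim>\<open>\<lambda>\<close>, as it is for the family below,
  its coefficients are those of its Laurent expansion at the origin.
\<close>

definition schwarzian_coeff :: "(complex \<Rightarrow> complex) \<Rightarrow> int \<Rightarrow> complex" where
  "schwarzian_coeff f j = fls_nth (laurent_expansion (schwarzian f) 0) j"


section \<open>The family of Nevanlinna functions\<close>

text \<open>
  The origin is the only possible critical point; it is not required to be one, which
  includes the degenerate case of a simple zero at the origin.
\<close>

definition F1 :: "(complex \<Rightarrow> complex) set" where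
  "F1 = {f. f nicely_meromorphic_on UNIV \<and>
     (\<forall>z. critical_point f z \<longrightarrow> z = 0) \<and>
     card {(a, U). transcendental_singularity f a U} = 4 \<and>
     (\<forall>a U. transcendental_singularity f a U \<longrightarrow> direct_singularity f a U) \<and>
     card {U. transcendental_singularity f (sphere_map f 0) U} = 2 \<and>
     (\<lambda>z. schwarzian f z + 2 * z\<^sup>2) \<in> O[at_infinity](\<lambda>z. z) \<and>
     sphere_map f 0 = Some 0 \<and>
     has_asymptotic_value f 0 (Some 0) \<and>
     has_asymptotic_value f 2 (Some 0) \<and>
     has_asymptotic_value f 1 (Some \<i>) \<and>
     has_asymptotic_value f (-1) (Some (-\<i>))}"

definition crit_mult :: "(complex \<Rightarrow> complex) \<Rightarrow> nat" where
  "crit_mult f = nat (zorder f 0 - 1)"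

definition other_zeros :: "(complex \<Rightarrow> complex) \<Rightarrow> complex set" where
  "other_zeros f = {z. z \<noteq> 0 \<and> sphere_map f z = Some 0}"

definition F1_hat :: "nat \<Rightarrow> nat \<Rightarrow> (complex \<Rightarrow> complex) set" where
  "F1_hat m n = {f \<in> F1. finite (other_zeros f) \<and>
     m = card (other_zeros f) + 1 \<and> n = crit_mult f + 1}"

end

theory Submission
  imports Defs "Jordan_Normal_Form.Char_Poly" "HOL-Real_Asymp.Real_Asymp"
begin

text \<open>
  Fix \<open>a\<close>, write \<open>w = z + a\<close>, let \<open>q\<close> be the primitive of \<open>exp (t\<^sup>2)\<close> that vanishes at \<open>0\<close>, taken at \<open>w\<close>,
  and let \<open>\<plusminus> \<i> * L\<close> be its limits along vertical lines.  The functions of the family that are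
  mapped to \<open>a\<close> are the quotients

    \<open>f = - L * A / (A * q + s * exp (w\<^sup>2))\<close>,  \<open>A = z ^ n * P\<close>,

  where \<open>P\<close> is monic of degree \<open>m - 1\<close>, \<open>s\<close> is a polynomial, and the Wronskian of numerator and
  denominator is a constant times \<open>z ^ (n - 1) * exp (w\<^sup>2)\<close>.  The last condition is the polynomial
  equation \<open>A\<^sup>2 + s' * A - s * A' + 2 * w * s * A = \<kappa> * z ^ (n - 1)\<close>, written \<open>gauss_wronskian\<close> below.
  The theorem thus splits into a question about polynomials and the analytic claim that the
  family consists of exactly these quotients.

  Polynomials.  If \<open>A\<close> is a combination of the Hermite polynomials in \<open>w\<close> with lowest index \<open>k0\<close> and
  highest index \<open>k1\<close>, then with the right choice of \<open>s\<close> the left-hand side has degree exactly \<open>k1 - k0\<close>.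
  Therefore the equation is solvable with \<open>\<kappa> \<noteq> 0\<close> if and only if \<open>A\<close> lies in the span of
  the Hermite polynomials of index \<open>m, \<dots>, m + n - 1\<close> (\<open>gauss_wronskian_monom\<close>,
  \<open>gauss_wronskian_monom_imp\<close>), and then \<open>P\<close> and \<open>s\<close> are unique.  Membership in the span is orthogonality
  of \<open>z ^ n * P\<close> to \<open>1, \<dots>, z ^ (m - 1)\<close> with respect to the weight \<open>exp (- w\<^sup>2)\<close>; such a \<open>P\<close> exists if and
  only if a Hankel determinant of moments vanishes (\<open>hankel_eq_0_iff\<close>).  As a function of \<open>a\<close> this
  determinant is the generalised Hermite polynomial up to a constant, because both satisfy the same
  Toda equation, by the Desnanot--Jacobi identity (\<open>generalised_hermite_hankel\<close>).

  From polynomials to functions.  In the upper and in the lower half-plane the quotient \<open>- L / f\<close> is a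
  constant plus a term \<open>c * exp (w\<^sup>2) * w ^ (- N)\<close> (\<open>G_asymptotic\<close>).  It follows that \<open>f\<close>
  has one tract about each axis of the Stokes sectors, inside a half-plane, and that these four tracts
  account for all transcendental singularities (\<open>singularities\<close>, \<open>tracts\<close>).  The Schwarzian derivative is computed from the
  Wronskian; its linear coefficient is \<open>- 4 * a\<close> (\<open>schwarzian_coeff_1\<close>).

  From functions to polynomials.  For \<open>f\<close> in the family let \<open>A\<close> collect its finitely many zeros.  Then
  \<open>B = A / f\<close> is entire and the Wronskian of \<open>A\<close> and \<open>B\<close> is \<open>z ^ (n - 1) * exp h\<close> with \<open>h\<close> entire, as there are
  no other critical points.  The growth of the Schwarzian derivative gives a Riccati equation for the
  logarithmic derivative of \<open>(1 / f)'\<close>.  Its solutions cannot be much larger than the square root of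
  the right-hand side (\<open>riccati_bound\<close>), so \<open>h'\<close> is linear, and \<open>h' = \<plusminus> 2 * w\<close> for some \<open>a\<close>.  The
  asymptotic value \<open>0\<close> on the positive axis decides the sign (\<open>exponent_sign\<close>); the asymptotic values
  \<open>\<plusminus> \<i>\<close> show that \<open>(B + A * q / L) * exp (- w\<^sup>2)\<close> is of polynomial growth (\<open>D_growth\<close>), which gives \<open>s\<close>.
\<close>

hide_const (open) Module.smult

section \<open>The Desnanot--Jacobi identity\<close>

text \<open>
  Replacing the last two columns of the identity matrix by the last two columns of the adjugate
  gives a matrix \<open>C\<close> whose product with \<open>A\<close> is block triangular.  Comparing determinants, one
  factor \<open>det A\<close> can be cancelled, as it is nonzero.
\<close>

lemma jacobi_nonzero:
  fixes A :: "'a :: idom mat"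
  assumes A: "A \<in> carrier_mat (k + 2) (k + 2)" and nz: "Determinant.det A \<noteq> 0"
  shows "cofactor A k k * cofactor A (Suc k) (Suc k) - cofactor A k (Suc k) * cofactor A (Suc k) k
         = Determinant.det (Matrix.mat k k (($$) A)) * Determinant.det A"
proof -
  let ?det = "Determinant.det"
  define D where "D = ?det A"
  define X where "X = Matrix.mat k 2 (\<lambda>(i, j). adj_mat A $$ (i, k + j))"
  define Y where "Y = Matrix.mat 2 2 (\<lambda>(i, j). adj_mat A $$ (k + i, k + j))"
  \<comment> \<open>\<open>A * C\<close> is block lower triangular with \<open>A0\<close> and \<open>D\<close> times the identity on its diagonal.\<close>
  define C where "C = four_block_mat (1\<^sub>m k) X (0\<^sub>m 2 k) Y"
  define A0 where "A0 = Matrix.mat k k (($$) A)"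
  define Z where "Z = Matrix.mat 2 k (\<lambda>(i, j). A $$ (k + i, j))"
  have adj: "adj_mat A \<in> carrier_mat (k+2) (k+2)" "A * adj_mat A = D \<cdot>\<^sub>m 1\<^sub>m (k+2)"
    using adj_mat[OF A] by (auto simp: D_def)
  have detC: "?det C = ?det Y"
    unfolding C_def by (subst det_four_block_mat_lower_left_zero[of _ k _ 2]) (auto simp: X_def Y_def)
  have AC: "A * C = four_block_mat A0 (0\<^sub>m k 2) Z (D \<cdot>\<^sub>m 1\<^sub>m 2)"
  proof (rule eq_matI)
    fix i j assume ij: "i < dim_row (four_block_mat A0 (0\<^sub>m k 2) Z (D \<cdot>\<^sub>m 1\<^sub>m 2))"
       "j < dim_col (four_block_mat A0 (0\<^sub>m k 2) Z (D \<cdot>\<^sub>m 1\<^sub>m 2))"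
    hence ij': "i < k + 2" "j < k + 2" by (auto simp: A0_def Z_def)
    have Cdim: "C \<in> carrier_mat (k+2) (k+2)" by (auto simp: C_def X_def Y_def)
    have e: "(A * C) $$ (i, j) = (\<Sum>l<k+2. A $$ (i, l) * C $$ (l, j))"
      using A Cdim ij' by (auto simp: scalar_prod_def lessThan_atLeast0)
    show "(A * C) $$ (i, j) = four_block_mat A0 (0\<^sub>m k 2) Z (D \<cdot>\<^sub>m 1\<^sub>m 2) $$ (i, j)"
    proof (cases "j < k")
      case True
      have "(\<Sum>l<k+2. A $$ (i, l) * C $$ (l, j)) = (\<Sum>l<k+2. if l = j then A $$ (i, l) else 0)"
        using True by (intro sum.cong) (auto simp: C_def X_def Y_def)
      also have "\<dots> = A $$ (i, j)" using ij' by (simp add: sum.delta)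
      finally show ?thesis using e True ij' by (auto simp: A0_def Z_def)
    next
      case False
      have "(\<Sum>l<k+2. A $$ (i, l) * C $$ (l, j)) = (\<Sum>l<k+2. A $$ (i, l) * adj_mat A $$ (l, j))"
        using False ij' by (intro sum.cong) (auto simp: C_def X_def Y_def)
      also have "\<dots> = (A * adj_mat A) $$ (i, j)"
        using A adj(1) ij' by (auto simp: scalar_prod_def lessThan_atLeast0)
      also have "\<dots> = (if i = j then D else 0)" using ij' by (simp add: adj(2))
      finally show ?thesis using e False ij' by (auto simp: A0_def Z_def)
    qed
  qed (use A in \<open>auto simp: C_def X_def Y_def A0_def Z_def\<close>)
  have "?det (A * C) = D * ?det Y"
  proof -
    have "C \<in> carrier_mat (k+2) (k+2)" by (auto simp: C_def X_def Y_def)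
    thus ?thesis using det_mult[OF A, of C] detC by (simp add: D_def)
  qed
  moreover have "?det (A * C) = ?det A0 * D\<^sup>2"
    unfolding AC by (subst det_four_block_mat_upper_right_zero[of _ k _ 2]) (auto simp: A0_def Z_def)
  ultimately have "D * ?det Y = D * (?det A0 * D)" by (auto simp: power2_eq_square)
  hence "?det Y = ?det A0 * D" using nz by (simp add: D_def)
  moreover have "?det Y = Y $$ (0,0) * Y $$ (1,1) - Y $$ (0,1) * Y $$ (1,0)"
  proof -
    have Y: "Y \<in> carrier_mat 2 2" by (simp add: Y_def)
    have del: "mat_delete Y i 0 \<in> carrier_mat 1 1" if "i < 2" for i
      using Y that by (auto simp: mat_delete_def)
    have "?det Y = (\<Sum>i<2. Y $$ (i, 0) * cofactor Y i 0)"
      by (rule laplace_expansion_column[OF Y]) simp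
    also have "\<dots> = Y $$ (0, 0) * cofactor Y 0 0 + Y $$ (1, 0) * cofactor Y 1 0"
      by (simp add: numeral_2_eq_2)
    also have "cofactor Y 0 0 = Y $$ (1, 1)"
      unfolding cofactor_def by (subst det_single[OF del]) (use Y in \<open>auto simp: mat_delete_def\<close>)
    also have "cofactor Y 1 0 = - Y $$ (0, 1)"
      unfolding cofactor_def by (subst det_single[OF del]) (use Y in \<open>auto simp: mat_delete_def\<close>)
    finally show ?thesis by (simp add: mult.commute)
  qed
  moreover have "adj_mat A $$ (i, j) = cofactor A j i" if "i < k + 2" "j < k + 2" for i j
    using A that by (auto simp: adj_mat_def)
  ultimately show ?thesis by (simp add: Y_def A0_def D_def mult.commute)
qed

text \<open>
  The identity is polynomial in the entries, so it suffices to have it for the generic perturbation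
  \<open>A + x I\<close>, whose determinant is a monic polynomial in \<open>x\<close> and hence nonzero, and then to put \<open>x = 0\<close>.
\<close>

lemma desnanot_jacobi:
  fixes A :: "'a :: idom mat"
  assumes A: "A \<in> carrier_mat (k + 2) (k + 2)"
  shows "cofactor A k k * cofactor A (Suc k) (Suc k) - cofactor A k (Suc k) * cofactor A (Suc k) k
         = Determinant.det (Matrix.mat k k (($$) A)) * Determinant.det A"
proof -
  define B where "B = char_poly_matrix (- A)"
  define ev where "ev = (\<lambda>p :: 'a poly. poly p 0)"
  interpret ev: comm_ring_hom ev by unfold_locales (auto simp: ev_def)
  have mA: "- A \<in> carrier_mat (k+2) (k+2)" using A by auto
  have B: "B \<in> carrier_mat (k+2) (k+2)" using mA by (auto simp: B_def)
  have evB: "map_mat ev B = A"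
    using A by (intro eq_matI) (auto simp: B_def char_poly_matrix_def ev_def)
  have "monic (char_poly (- A))" using degree_monic_char_poly[OF mA] by auto
  hence nz: "Determinant.det B \<noteq> 0" by (auto simp: B_def char_poly_def)
  have cof: "ev (cofactor B i j) = cofactor A i j" if "i < k+2" "j < k+2" for i j
  proof -
    have "map_mat ev (mat_delete B i j) = mat_delete (map_mat ev B) i j"
      using B that by (intro eq_matI) (auto simp: mat_delete_def)
    hence "ev (Determinant.det (mat_delete B i j)) = Determinant.det (mat_delete A i j)"
      by (simp add: evB flip: ev.hom_det)
    thus ?thesis by (simp add: cofactor_def hom_distribs)
  qed
  have sub: "ev (Determinant.det (Matrix.mat k k (($$) B)))
          = Determinant.det (Matrix.mat k k (($$) A))"
    unfolding ev.hom_det[symmetric] using B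
    by (intro arg_cong[where f = Determinant.det] eq_matI) (auto simp flip: evB)
  note sub' = sub[unfolded ev.hom_det[symmetric]]
  from jacobi_nonzero[OF B nz, THEN arg_cong, of ev] show ?thesis
    by (simp add: hom_distribs cof sub' evB flip: ev.hom_det)
qed

section \<open>Generalised Hermite polynomials as Hankel determinants\<close>

text \<open>
  Up to signs and an imaginary rescaling of the variable these are the classical Hermite polynomials:
  the generating function is \<open>exp (2 z x + x\<^sup>2)\<close>.  They form the column \<open>m = 1\<close> of the generalised
  Hermite polynomials, and, up to powers of \<open>-2\<close>, they are the moments of a shifted Gaussian weight.
\<close>

fun moment_poly :: "nat \<Rightarrow> complex poly" where
  "moment_poly 0 = 1"
| "moment_poly (Suc 0) = [:0, 2:]"
| "moment_poly (Suc (Suc k)) = [:0, 2:] * moment_poly (Suc k) + smult (2 * of_nat (Suc k)) (moment_poly k)"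

lemma moment_poly_Suc:
  "moment_poly (Suc k) = [:0, 2:] * moment_poly k + smult (2 * of_nat k) (moment_poly (k - 1))"
  by (cases k) auto

lemma pderiv_moment_poly: "pderiv (moment_poly k) = smult (2 * of_nat k) (moment_poly (k - 1))"
proof (induction k rule: moment_poly.induct)
  case (3 k)
  have "pderiv (moment_poly (Suc (Suc k)))
     = smult 2 (moment_poly (Suc k)) + [:0, 2:] * pderiv (moment_poly (Suc k))
       + smult (2 * of_nat (Suc k)) (pderiv (moment_poly k))"
    by (simp add: pderiv_add pderiv_mult pderiv_smult pderiv_pCons numeral_poly)
  also have "\<dots> = smult 2 (moment_poly (Suc k)) + smult (2 * of_nat (Suc k))
       ([:0, 2:] * moment_poly k + smult (2 * of_nat k) (moment_poly (k - 1)))"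
    by (simp only: 3) (simp add: algebra_simps smult_add_right)
  also have "\<dots> = smult (2 * of_nat (Suc (Suc k))) (moment_poly (Suc k))"
    by (simp only: moment_poly_Suc[symmetric]) (simp add: smult_add_left[symmetric] algebra_simps del: smult_add_left)
  finally show ?case by simp
qed (auto simp: pderiv_pCons pderiv_1)

text \<open>
  This form of the derivative makes the Hankel determinants below a Toda chain: up to the factor
  \<open>exp (z\<^sup>2)\<close>, differentiating an entry raises its index by one.
\<close>

lemma pderiv_moment_poly': "pderiv (moment_poly k) = moment_poly (Suc k) - [:0, 2:] * moment_poly k"
  by (simp add: pderiv_moment_poly moment_poly_Suc)

lemma moment_poly_toda:
  "smult (2 * of_nat (Suc n)) (moment_poly (Suc (Suc n)) * moment_poly n)
     = - hirota (moment_poly (Suc n)) + smult (2 * of_nat (Suc n)) ((moment_poly (Suc n))\<^sup>2)"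
proof -
  define x where "x = [:0, 2 :: complex:]"
  define N where "N = [:2 * of_nat (Suc n) :: complex:]"
  define M where "M = [:2 * of_nat n :: complex:]"
  define a b c d where abcd: "a = moment_poly (Suc (Suc n))" "b = moment_poly (Suc n)"
    "c = moment_poly n" "d = moment_poly (n - 1)"
  have sm: "smult k p = [:k:] * p" for k :: complex and p by simp
  have a: "a = x * b + N * c" unfolding abcd x_def N_def sm[symmetric] by simp
  have b: "b = x * c + M * d" unfolding abcd x_def M_def sm[symmetric] by (rule moment_poly_Suc)
  have b': "pderiv b = N * c" unfolding abcd N_def sm[symmetric] pderiv_moment_poly by simp
  have c': "pderiv c = M * d" unfolding abcd M_def sm[symmetric] pderiv_moment_poly by simp
  have b'': "pderiv (pderiv b) = N * (M * d)"
    unfolding b' N_def sm[symmetric] pderiv_smult c' ..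
  have "N * (a * c) = - (b * (N * (M * d)) - (N * c)\<^sup>2) + N * b\<^sup>2"
    unfolding a by (simp add: b power2_eq_square algebra_simps)
  thus ?thesis
    unfolding hirota_def abcd(1-3)[symmetric] b'' unfolding b' sm N_def by (simp only:)
qed

definition offset_det :: "nat \<Rightarrow> (nat \<Rightarrow> nat) \<Rightarrow> (nat \<Rightarrow> nat) \<Rightarrow> complex poly" where
  "offset_det m r c = Determinant.det (Matrix.mat m m (\<lambda>(i, j). moment_poly (r i + c j)))"

lemma offset_det_swap: "offset_det m r c = offset_det m c r"
proof -
  have "Matrix.mat m m (\<lambda>(i, j). moment_poly (c i + r j)) =
        transpose_mat (Matrix.mat m m (\<lambda>(i, j). moment_poly (r i + c j)))"
    by (intro eq_matI) (auto simp: add.commute)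
  thus ?thesis by (simp add: offset_det_def det_transpose[of _ m])
qed

lemma offset_det_eq_0:
  assumes "i < m" "j < m" "i \<noteq> j" "r i = r j"
  shows "offset_det m r c = 0"
  unfolding offset_det_def
  by (rule det_identical_rows[of _ m i j]) (use assms in \<open>auto intro!: eq_vecI\<close>)

text \<open>
  Index sequence \<open>0, 1, \<dots>, m - 2, m\<close>.
\<close>

definition skip_last :: "nat \<Rightarrow> nat \<Rightarrow> nat" where
  "skip_last m i = (if Suc i = m then m else i)"

text \<open>
  Differentiating row by row, the raised row coincides with the next one, except for the last row;
  so only one determinant survives besides the scalar term.
\<close>

lemma pderiv_offset_det:
  assumes m: "m > 0"
  shows "pderiv (offset_det m (\<lambda>i. i) c) =
     offset_det m (skip_last m) c - smult (2 * of_nat m) ([:0, 1:] * offset_det m (\<lambda>i. i) c)"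
proof -
  let ?P = "{p. p permutes {0..<m}}"
  have det: "offset_det m r c = (\<Sum>p\<in>?P. signof p * (\<Prod>i=0..<m. moment_poly (r i + c (p i))))" for r
    unfolding offset_det_def by (subst det_def'[of _ m]) (auto intro!: sum.cong prod.cong dest: permutes_in_image)
  have fin: "finite ?P" by (simp add: finite_permutations)
  have up: "(\<Prod>i=0..<m. moment_poly (((\<lambda>i. i)(k := Suc k)) i + c (p i)))
      = moment_poly (Suc k + c (p k)) * (\<Prod>i\<in>{0..<m}-{k}. moment_poly (i + c (p i)))" if "k < m" for k p
    using that by (subst prod.remove[of _ k]) auto
  have pd: "pderiv (\<Prod>i=0..<m. moment_poly (i + c (p i)))
      = (\<Sum>k=0..<m. \<Prod>i=0..<m. moment_poly (((\<lambda>i. i)(k := Suc k)) i + c (p i)))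
        - of_nat m * [:0, 2:] * (\<Prod>i=0..<m. moment_poly (i + c (p i)))" for p
  proof -
    have "pderiv (\<Prod>i=0..<m. moment_poly (i + c (p i)))
       = (\<Sum>k=0..<m. (\<Prod>i\<in>{0..<m}-{k}. moment_poly (i + c (p i))) * pderiv (moment_poly (k + c (p k))))"
      by (rule pderiv_prod)
    also have "\<dots> = (\<Sum>k=0..<m. (\<Prod>i=0..<m. moment_poly (((\<lambda>i. i)(k := Suc k)) i + c (p i)))
            - [:0, 2:] * (\<Prod>i=0..<m. moment_poly (i + c (p i))))"
    proof (rule sum.cong)
      fix k assume k: "k \<in> {0..<m}"
      have "(\<Prod>i=0..<m. moment_poly (i + c (p i))) =
           moment_poly (k + c (p k)) * (\<Prod>i\<in>{0..<m}-{k}. moment_poly (i + c (p i)))"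
        using k by (subst prod.remove[of _ k]) auto
      thus "(\<Prod>i\<in>{0..<m}-{k}. moment_poly (i + c (p i))) * pderiv (moment_poly (k + c (p k)))
         = (\<Prod>i=0..<m. moment_poly (((\<lambda>i. i)(k := Suc k)) i + c (p i)))
            - [:0, 2:] * (\<Prod>i=0..<m. moment_poly (i + c (p i)))"
        using up[of k p] k by (simp add: pderiv_moment_poly' algebra_simps del: moment_poly.simps mult_pCons_left mult_pCons_right)
    qed simp
    also have "\<dots> = (\<Sum>k=0..<m. \<Prod>i=0..<m. moment_poly (((\<lambda>i. i)(k := Suc k)) i + c (p i)))
        - of_nat m * [:0, 2:] * (\<Prod>i=0..<m. moment_poly (i + c (p i)))"
      by (simp add: sum_subtractf mult.assoc del: mult_pCons_left mult_pCons_right)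
    finally show ?thesis .
  qed
  have sg: "pderiv (signof p * q) = signof p * pderiv q" for p :: "nat \<Rightarrow> nat" and q :: "complex poly"
    by (simp add: sign_def pderiv_minus)
  have "pderiv (offset_det m (\<lambda>i. i) c)
      = (\<Sum>p\<in>?P. signof p * pderiv (\<Prod>i=0..<m. moment_poly (i + c (p i))))"
    unfolding det by (simp only: pderiv_sum sg)
  also have "\<dots> = (\<Sum>p\<in>?P. (\<Sum>k=0..<m. signof p * (\<Prod>i=0..<m. moment_poly (((\<lambda>i. i)(k := Suc k)) i + c (p i))))
        - of_nat m * [:0, 2:] * (signof p * (\<Prod>i=0..<m. moment_poly (i + c (p i)))))"
    unfolding pd by (simp add: right_diff_distrib sum_distrib_left mult.left_commute mult.assoc del: mult_pCons_left mult_pCons_right)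
  also have "\<dots> = (\<Sum>k=0..<m. offset_det m ((\<lambda>i. i)(k := Suc k)) c) - of_nat m * [:0, 2:] * offset_det m (\<lambda>i. i) c"
    unfolding det by (simp only: sum_subtractf sum_distrib_left sum.swap[of _ ?P])
  also have "(\<Sum>k=0..<m. offset_det m ((\<lambda>i. i)(k := Suc k)) c)
      = (\<Sum>k=0..<m. if k = m - 1 then offset_det m ((\<lambda>i. i)(k := Suc k)) c else 0)"
    by (rule sum.cong) (auto intro!: offset_det_eq_0[of k m "Suc k" for k])
  also have "\<dots> = offset_det m ((\<lambda>i. i)(m - 1 := m)) c" using m by (simp add: sum.delta)
  also have "offset_det m ((\<lambda>i. i)(m - 1 := m)) c = offset_det m (skip_last m) c"
    using m unfolding offset_det_def skip_last_def
    by (intro arg_cong[where f = Determinant.det] eq_matI) auto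
  also have "of_nat m * [:0, 2:] * offset_det m (\<lambda>i. i) c
      = smult (2 * of_nat m) ([:0, 1:] * offset_det m (\<lambda>i. i) c)"
    by (simp add: of_nat_poly)
  finally show ?thesis .
qed

definition hankel :: "nat \<Rightarrow> nat \<Rightarrow> complex poly" where
  "hankel m n = Determinant.det (Matrix.mat m m (\<lambda>(i, j). moment_poly (n + i + j)))"

text \<open>
  With the derivatives expressed through minors, the left-hand side is a \<open>2 \<times> 2\<close> expression in four
  minors of the Hankel matrix of size \<open>m + 2\<close>, which the Desnanot--Jacobi identity evaluates.
\<close>

lemma hirota_hankel:
  "hirota (hankel (Suc m) n) + smult (2 * of_nat (Suc m)) ((hankel (Suc m) n)\<^sup>2)
     = hankel (Suc (Suc m)) n * hankel m n"
proof -
  let ?M = "Suc m"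
  define D where "D = hankel ?M n"
  define E where "E = offset_det ?M (skip_last ?M) (\<lambda>j. n + j)"
  define F where "F = offset_det ?M (skip_last ?M) (\<lambda>j. n + skip_last ?M j)"
  define x where "x = [:0, 2 * of_nat ?M :: complex:]"
  have D: "D = offset_det ?M (\<lambda>i. i) (\<lambda>j. n + j)"
    unfolding D_def hankel_def offset_det_def by (simp add: ac_simps)
  have shift: "offset_det ?M r (\<lambda>j. n + c j) = offset_det ?M (\<lambda>i. n + r i) c" for r c
    unfolding offset_det_def by (simp add: ac_simps)
  have E2: "E = offset_det ?M (\<lambda>i. i) (\<lambda>j. n + skip_last ?M j)"
    unfolding E_def shift[of _ "\<lambda>j. j"] by (rule offset_det_swap)
  have sx: "smult (2 * of_nat ?M) ([:0, 1:] * p) = x * p" for p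
    by (simp add: x_def)
  have D': "pderiv D = E - x * D"
    unfolding D E_def using pderiv_offset_det[of ?M] by (simp only: sx zero_less_Suc)
  have E': "pderiv E = F - x * E"
    unfolding E2 F_def using pderiv_offset_det[of ?M] by (simp only: sx zero_less_Suc)
  have x': "pderiv x = [:2 * of_nat ?M:]" by (simp add: x_def pderiv_pCons)
  have "hirota D = D * F - E\<^sup>2 - [:2 * of_nat ?M:] * D\<^sup>2"
    unfolding hirota_def by (simp only: D' pderiv_diff pderiv_mult E' x') (simp add: power2_eq_square algebra_simps)
  hence "hirota D + smult (2 * of_nat ?M) (D\<^sup>2) = D * F - E\<^sup>2" by simp
  also have "\<dots> = hankel (Suc ?M) n * hankel m n"
  proof -
    define A where "A = Matrix.mat (m+2) (m+2) (\<lambda>(i, j). moment_poly (n + i + j))"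
    have A: "A \<in> carrier_mat (m+2) (m+2)" by (simp add: A_def)
    have del: "mat_delete A i j = Matrix.mat ?M ?M (\<lambda>(i', j'). moment_poly
           (n + (if i' < i then i' else Suc i') + (if j' < j then j' else Suc j')))" for i j
      by (intro eq_matI) (auto simp: mat_delete_def A_def)
    have eqm: "Determinant.det (Matrix.mat ?M ?M f) = Determinant.det (Matrix.mat ?M ?M g)"
      if "\<And>i j. i \<le> m \<Longrightarrow> j \<le> m \<Longrightarrow> f (i, j) = g (i, j)" for f g :: "nat \<times> nat \<Rightarrow> complex poly"
      using that by (intro arg_cong[where f = Determinant.det] eq_matI) auto
    have c1: "cofactor A m m = F"
      unfolding cofactor_def del F_def offset_det_def
      by (simp, intro eqm) (auto simp: skip_last_def ac_simps)
    have c2: "cofactor A ?M ?M = D"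
      unfolding cofactor_def del D_def hankel_def by (simp, intro eqm) auto
    have c3: "cofactor A m ?M = - E"
      unfolding cofactor_def del E_def offset_det_def
      by (simp, intro eqm) (auto simp: skip_last_def ac_simps)
    have c4: "cofactor A ?M m = - E"
      unfolding cofactor_def del E2 offset_det_def
      by (simp, intro eqm) (auto simp: skip_last_def ac_simps)
    have "Matrix.mat m m (($$) A) = Matrix.mat m m (\<lambda>(i, j). moment_poly (n + i + j))"
      by (intro eq_matI) (auto simp: A_def)
    moreover have "Determinant.det A = hankel (Suc ?M) n" by (simp add: A_def hankel_def)
    ultimately show ?thesis using desnanot_jacobi[OF A] unfolding c1 c2 c3 c4
      by (simp add: hankel_def power2_eq_square mult.commute)
  qed
  finally show ?thesis by (simp add: D_def)
qed

lemma hankel_0 [simp]: "hankel 0 n = 1"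
  by (simp add: hankel_def)

lemma hankel_1 [simp]: "hankel (Suc 0) n = moment_poly n"
  by (simp add: hankel_def det_single)

lemma hirota_smult: "hirota (smult c p) = smult (c\<^sup>2) (hirota p)"
  by (simp add: hirota_def pderiv_smult power2_eq_square smult_diff_right algebra_simps)

lemma moment_poly_nonzero: "moment_poly n \<noteq> 0"
proof -
  have "moment_poly n \<noteq> 0 \<and> moment_poly (Suc n) \<noteq> 0"
  proof (induction n)
    case (Suc n)
    have "(2 * of_nat (Suc n) :: complex) \<noteq> 0" by (simp del: of_nat_Suc)
    from hirota_plus_square_nonzero(2)[OF _ this, of "moment_poly (Suc n)"] Suc moment_poly_toda[of n]
    show ?case by (metis mult_zero_left smult_0_right)
  qed simp
  thus ?thesis by simp
qed

lemma hankel_nonzero: "hankel m n \<noteq> 0"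
proof -
  have "hankel m n \<noteq> 0 \<and> hankel (Suc m) n \<noteq> 0"
  proof (induction m)
    case (Suc m)
    have "(2 * of_nat (Suc m) :: complex) \<noteq> 0" by (simp del: of_nat_Suc)
    from hirota_plus_square_nonzero(1)[OF _ this, of "hankel (Suc m) n"] Suc hirota_hankel[of m n]
    show ?case by (metis mult_zero_left)
  qed (simp add: moment_poly_nonzero)
  thus ?thesis by simp
qed

lemma generalised_hermite_column: "generalised_hermite 0 n = 1" "generalised_hermite (Suc 0) n = moment_poly n"
proof -
  have "generalised_hermite 0 n = 1 \<and> generalised_hermite 0 (Suc n) = 1"
  proof (induction n)
    case (Suc n)
    have nz: "(2 * of_nat (Suc n) :: complex) \<noteq> 0" by (simp del: of_nat_Suc)
    have "hirota 1 = 0" by (simp add: hirota_def)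
    have "generalised_hermite 0 (Suc (Suc n)) = smult (2 * of_nat (Suc n)) 1 div smult (2 * of_nat (Suc n)) 1"
      using Suc \<open>hirota 1 = 0\<close> by (simp add: Let_def del: of_nat_Suc)
    also have "\<dots> = 1" using nz by (intro div_self) simp
    finally show ?case using Suc by simp
  qed simp
  thus "generalised_hermite 0 n = 1" by simp
  have "generalised_hermite (Suc 0) n = moment_poly n \<and> generalised_hermite (Suc 0) (Suc n) = moment_poly (Suc n)"
  proof (induction n)
    case (Suc n)
    have nz: "(2 * of_nat (Suc n) :: complex) \<noteq> 0" by (simp del: of_nat_Suc)
    have "generalised_hermite (Suc 0) (Suc (Suc n)) =
        (- hirota (moment_poly (Suc n)) + smult (2 * of_nat (Suc n)) ((moment_poly (Suc n))\<^sup>2))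
          div smult (2 * of_nat (Suc n)) (moment_poly n)"
      using Suc by (simp add: Let_def del: of_nat_Suc moment_poly.simps)
    also have "\<dots> = moment_poly (Suc (Suc n))"
      unfolding moment_poly_toda[symmetric] mult_smult_right[symmetric]
      using nz moment_poly_nonzero[of n] by (intro nonzero_mult_div_cancel_right) (simp del: of_nat_Suc)
    finally show ?case using Suc by simp
  qed simp
  thus "generalised_hermite (Suc 0) n = moment_poly n" by simp
qed

text \<open>
  Both families satisfy the recurrence in the first index up to constant factors, with proportional
  initial columns.
\<close>

theorem generalised_hermite_hankel: "\<exists>c\<noteq>0. generalised_hermite m n = smult c (hankel m n)"
proof -
  have "(\<exists>c\<noteq>0. generalised_hermite m n = smult c (hankel m n)) \<and>
        (\<exists>c\<noteq>0. generalised_hermite (Suc m) n = smult c (hankel (Suc m) n))"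
  proof (induction m)
    case 0
    show ?case by (auto simp: generalised_hermite_column intro!: exI[of _ 1])
  next
    case (Suc m)
    then obtain c d where c: "c \<noteq> 0" "generalised_hermite m n = smult c (hankel m n)"
      and d: "d \<noteq> 0" "generalised_hermite (Suc m) n = smult d (hankel (Suc m) n)" by blast
    define N where "N = (2 * of_nat (Suc m) :: complex)"
    have N: "N \<noteq> 0" by (simp add: N_def del: of_nat_Suc)
    have "generalised_hermite (Suc (Suc m)) n =
       (hirota (generalised_hermite (Suc m) n) + smult N ((generalised_hermite (Suc m) n)\<^sup>2))
          div smult N (generalised_hermite m n)"
      by (simp add: Let_def N_def)
    also have "hirota (generalised_hermite (Suc m) n) + smult N ((generalised_hermite (Suc m) n)\<^sup>2)
       = smult (d\<^sup>2) (hirota (hankel (Suc m) n) + smult N ((hankel (Suc m) n)\<^sup>2))"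
      by (simp add: d hirota_smult smult_add_right power2_eq_square ac_simps)
    also have "\<dots> = smult (d\<^sup>2) (hankel (Suc (Suc m)) n * hankel m n)"
      unfolding N_def hirota_hankel ..
    also have "\<dots> = smult (d\<^sup>2 / (N * c)) (hankel (Suc (Suc m)) n) * smult N (generalised_hermite m n)"
      using N c by simp
    also have "\<dots> div smult N (generalised_hermite m n) = smult (d\<^sup>2 / (N * c)) (hankel (Suc (Suc m)) n)"
      using N c hankel_nonzero[of m n] by (intro nonzero_mult_div_cancel_right) simp
    finally show ?case using Suc c d N by (intro conjI) (auto intro!: exI[of _ "d\<^sup>2 / (N * c)"])
  qed
  thus ?thesis by simp
qed

section \<open>Shifted Hermite polynomials and a Wronskian with Gaussian factor\<close>

definition shift_var :: "complex \<Rightarrow> complex poly" where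
  "shift_var a = [:a, 1:]"

lemma shift_var_simps [simp]:
  "degree (shift_var a) = 1" "shift_var a \<noteq> 0" "pderiv (shift_var a) = 1"
  "poly (shift_var a) x = a + x"
  by (simp_all add: shift_var_def pderiv_pCons one_pCons)

lemma coeff_shift_var_mult: "coeff (shift_var a * p) (Suc k) = a * coeff p (Suc k) + coeff p k"
  by (simp add: shift_var_def)

text \<open>
  The monic Hermite polynomials in \<open>w = z + a\<close> and a second solution of their recurrence.  The
  point of the pair is that, with a primitive \<open>q\<close> of the Gaussian \<open>exp (w\<^sup>2)\<close>, the combinations
  \<open>herm * q + assoc_herm * exp (w\<^sup>2)\<close> are derivatives of each other up to constants, see
  \<open>assoc_herm_ode\<close>.
\<close>

fun herm :: "complex \<Rightarrow> nat \<Rightarrow> complex poly" where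
  "herm a 0 = 1"
| "herm a (Suc 0) = shift_var a"
| "herm a (Suc (Suc k)) = shift_var a * herm a (Suc k) - smult (of_nat (Suc k) / 2) (herm a k)"

fun assoc_herm :: "complex \<Rightarrow> nat \<Rightarrow> complex poly" where
  "assoc_herm a 0 = 0"
| "assoc_herm a (Suc 0) = [:- 1 / 2:]"
| "assoc_herm a (Suc (Suc k)) =
     shift_var a * assoc_herm a (Suc k) - smult (of_nat (Suc k) / 2) (assoc_herm a k)"

lemma herm_Suc: "herm a (Suc k) = shift_var a * herm a k - smult (of_nat k / 2) (herm a (k - 1))"
  by (cases k) auto

lemma assoc_herm_Suc:
  "k > 0 \<Longrightarrow> assoc_herm a (Suc k) = shift_var a * assoc_herm a k - smult (of_nat k / 2) (assoc_herm a (k - 1))"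
  by (cases k) auto

lemma pderiv_herm: "pderiv (herm a k) = smult (of_nat k) (herm a (k - 1))"
proof (induction k rule: less_induct)
  case (less k)
  show ?case
  proof (cases k)
    case (Suc l)
    define w where "w = shift_var a"
    have w': "pderiv w = 1" by (simp add: w_def)
    have "pderiv (herm a (Suc l)) = herm a l + w * pderiv (herm a l)
            - smult (of_nat l / 2) (pderiv (herm a (l - 1)))"
      unfolding herm_Suc w_def[symmetric] by (simp add: pderiv_diff pderiv_mult pderiv_smult w')
    also have "pderiv (herm a l) = smult (of_nat l) (herm a (l - 1))" using less Suc by simp
    also have "pderiv (herm a (l - 1)) = smult (of_nat (l - 1)) (herm a (l - 1 - 1))"
      using less[of "l - 1"] Suc by (cases l) simp_all
    also have "herm a l + w * smult (of_nat l) (herm a (l - 1))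
          - smult (of_nat l / 2) (smult (of_nat (l - 1)) (herm a (l - 1 - 1)))
        = herm a l + smult (of_nat l) (w * herm a (l - 1) - smult (of_nat (l - 1) / 2) (herm a (l - 1 - 1)))"
      by (simp add: smult_diff_right)
    also have "\<dots> = herm a l + smult (of_nat l) (herm a l)"
      by (cases l) (simp_all only: of_nat_0 smult_0_left diff_Suc_1 herm_Suc[symmetric] w_def)
    finally show ?thesis using Suc by (simp add: smult_add_left)
  qed (simp add: pderiv_1)
qed

lemma assoc_herm_ode:
  "pderiv (assoc_herm a (Suc k)) + smult 2 (shift_var a * assoc_herm a (Suc k)) + herm a (Suc k)
     = smult (of_nat (Suc k)) (assoc_herm a k)"
proof (induction k rule: less_induct)
  case (less k)
  define w where "w = shift_var a"
  have w': "pderiv w = 1" by (simp add: w_def)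
  consider "k = 0" | "k = 1" | l where "k = Suc (Suc l)" by (metis One_nat_def nat.exhaust)
  thus ?case
  proof cases
    case 1
    thus ?thesis by (simp add: shift_var_def pderiv_pCons)
  next
    case 2
    thus ?thesis by (simp add: shift_var_def pderiv_pCons)
  next
    case (3 l)
    define S T U where "S = assoc_herm a (Suc (Suc l))" "T = assoc_herm a (Suc l)" "U = assoc_herm a l"
    define c where "c = (of_nat (Suc (Suc l)) / 2 :: complex)"
    define P Q where "P = herm a (Suc (Suc l))" "Q = herm a (Suc l)"
    note defs = S_T_U_def P_Q_def
    have c2: "2 * c = of_nat (Suc (Suc l))" by (simp add: c_def)
    have i1: "pderiv S = smult (2 * c) T - smult 2 (w * S) - P"
      using less[of "Suc l"] 3 unfolding c2 by (simp add: defs w_def algebra_simps del: assoc_herm.simps herm.simps)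
    have i2: "pderiv T = smult (of_nat (Suc l)) U - smult 2 (w * T) - Q"
      using less[of "l"] 3 by (simp add: defs w_def algebra_simps del: assoc_herm.simps herm.simps)
    have V: "assoc_herm a (Suc k) = w * S - smult c T"
      using 3 by (simp add: defs c_def w_def)
    have H: "herm a (Suc k) = w * P - smult c Q"
      using 3 by (simp add: defs c_def w_def)
    have S: "S = w * T - smult (of_nat (Suc l) / 2) U"
      by (simp add: defs w_def)
    have "pderiv (assoc_herm a (Suc k)) + smult 2 (w * assoc_herm a (Suc k)) + herm a (Suc k)
       = S + smult (2 * c) (w * T) - smult (c * of_nat (Suc l)) U"
      unfolding V H by (simp add: pderiv_diff pderiv_mult pderiv_smult w' i1 i2 algebra_simps smult_diff_right smult_add_right del: of_nat_Suc)
    also have "\<dots> = S + smult (2 * c) (w * T - smult (of_nat (Suc l) / 2) U)"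
      by (simp add: smult_diff_right del: of_nat_Suc)
    also have "\<dots> = smult (of_nat (Suc k)) S"
    proof -
      have "(2 * c + 1 :: complex) = of_nat (Suc k)" using 3 by (simp add: c_def)
      thus ?thesis unfolding S[symmetric] by (metis add.commute smult_1_left smult_add_left)
    qed
    finally show ?thesis using 3 by (simp add: w_def defs del: assoc_herm.simps herm.simps)
  qed
qed

definition exact_degree :: "complex poly \<Rightarrow> nat \<Rightarrow> bool" where
  "exact_degree p d \<longleftrightarrow> p \<noteq> 0 \<and> degree p = d"

lemma exact_degree_step:
  assumes "exact_degree p (Suc d)" "exact_degree q d"
  shows "exact_degree (shift_var a * p - smult c q) (Suc (Suc d))"
proof -
  have "degree (smult c q) < degree (shift_var a * p)"
    using assms by (auto simp: exact_degree_def degree_mult_eq)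
  moreover have "degree (shift_var a * p) = Suc (Suc d)"
    using assms by (subst degree_mult_eq) (auto simp: exact_degree_def)
  ultimately have "degree (shift_var a * p - smult c q) = Suc (Suc d)"
    by (metis degree_add_eq_left degree_minus diff_conv_add_uminus)
  thus ?thesis by (auto simp: exact_degree_def)
qed

lemma exact_degree_herm: "exact_degree (herm a k) k"
proof -
  have "exact_degree (herm a k) k \<and> exact_degree (herm a (Suc k)) (Suc k)"
  proof (induction k)
    case 0
    show ?case by (auto simp: exact_degree_def)
  next
    case (Suc k)
    thus ?case using exact_degree_step by (simp del: of_nat_Suc)
  qed
  thus ?thesis by simp
qed

lemma monic_herm: "coeff (herm a k) k = 1"
proof -
  have "coeff (herm a k) k = 1 \<and> coeff (herm a (Suc k)) (Suc k) = 1"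
  proof (induction k)
    case (Suc k)
    note [simp] = coeff_shift_var_mult
    have "coeff (herm a k) (Suc (Suc k)) = 0"
      using exact_degree_herm[of a k] by (intro coeff_eq_0) (simp add: exact_degree_def)
    moreover have "coeff (herm a (Suc k)) (Suc (Suc k)) = 0"
      using exact_degree_herm[of a "Suc k"] by (intro coeff_eq_0) (simp add: exact_degree_def)
    ultimately show ?case using Suc by simp
  qed (simp add: shift_var_def)
  thus ?thesis by simp
qed

text \<open>
  The Casoratian of the two solutions of the three-term recurrence; its degree in \<open>z\<close> measures the
  distance of the indices.
\<close>

definition casorati :: "complex \<Rightarrow> nat \<Rightarrow> nat \<Rightarrow> complex poly" where
  "casorati a k l = herm a k * assoc_herm a l - assoc_herm a k * herm a l"

lemma casorati_swap: "casorati a k l = - casorati a l k"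
  by (simp add: casorati_def algebra_simps)

lemma casorati_Suc_right:
  "l > 0 \<Longrightarrow> casorati a k (Suc l) = shift_var a * casorati a k l - smult (of_nat l / 2) (casorati a k (l - 1))"
proof -
  assume l: "l > 0"
  define w where "w = shift_var a"
  show ?thesis unfolding casorati_def herm_Suc[of a l] assoc_herm_Suc[OF l] w_def[symmetric]
    by (simp add: algebra_simps smult_diff_right)
qed

lemma casorati_next: "exact_degree (casorati a k (Suc k)) 0"
proof (induction k)
  case 0
  show ?case by (simp add: casorati_def exact_degree_def)
next
  case (Suc k)
  have "casorati a (Suc k) (Suc (Suc k)) = smult (of_nat (Suc k) / 2) (casorati a k (Suc k))"
    by (subst casorati_Suc_right)
       (auto simp: casorati_swap[of a "Suc k" k] casorati_def[of a "Suc k" "Suc k"] simp del: of_nat_Suc)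
  thus ?case using Suc by (simp add: exact_degree_def del: of_nat_Suc)
qed

lemma exact_degree_casorati: "exact_degree (casorati a k (Suc (k + j))) j"
proof -
  have "exact_degree (casorati a k (Suc (k + j))) j \<and> exact_degree (casorati a k (Suc (k + Suc j))) (Suc j)"
  proof (induction j)
    case 0
    have "casorati a k (Suc (Suc k)) = shift_var a * casorati a k (Suc k)"
      by (subst casorati_Suc_right) (auto simp: casorati_def[of a k k])
    thus ?case using casorati_next[of a k] by (auto simp: exact_degree_def degree_mult_eq)
  next
    case (Suc j)
    have "casorati a k (Suc (k + Suc (Suc j))) = shift_var a * casorati a k (Suc (k + Suc j))
        - smult (of_nat (Suc (k + Suc j)) / 2) (casorati a k (Suc (k + j)))"
      by (subst casorati_Suc_right) auto
    thus ?case using Suc exact_degree_step[of _ j] by simp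
  qed
  thus ?thesis by simp
qed

definition herm_sum :: "complex \<Rightarrow> (nat \<Rightarrow> complex) \<Rightarrow> nat \<Rightarrow> nat \<Rightarrow> complex poly" where
  "herm_sum a \<gamma> k0 k1 = (\<Sum>k=k0..k1. smult (\<gamma> k) (herm a k))"

definition assoc_sum :: "complex \<Rightarrow> (nat \<Rightarrow> complex) \<Rightarrow> nat \<Rightarrow> nat \<Rightarrow> complex poly" where
  "assoc_sum a \<gamma> k0 k1 = (\<Sum>k=k0..k1. smult (\<gamma> k) (assoc_herm a k))"

text \<open>
  If \<open>B = c * A * q + s * exp (w\<^sup>2)\<close>, where \<open>q' = exp (w\<^sup>2)\<close> and \<open>w = z + a\<close>, then
  \<open>A * B' - A' * B = gauss_wronskian a c A s * exp (w\<^sup>2)\<close>.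
\<close>

definition gauss_wronskian :: "complex \<Rightarrow> complex \<Rightarrow> complex poly \<Rightarrow> complex poly \<Rightarrow> complex poly" where
  "gauss_wronskian a c A s =
     smult c (A\<^sup>2) + pderiv s * A - s * pderiv A + smult 2 (shift_var a * s * A)"

definition wronskian_term :: "complex \<Rightarrow> nat \<Rightarrow> nat \<Rightarrow> complex poly" where
  "wronskian_term a k l = (if l = 0 then herm a k else smult (of_nat l) (casorati a k (l - 1)))"

text \<open>
  The combination of the associated polynomials with the same coefficients is the right choice of \<open>s\<close>:
  by \<open>assoc_herm_ode\<close> all terms combine into Casoratians.
\<close>

lemma gauss_wronskian_sum:
  "gauss_wronskian a 1 (herm_sum a \<gamma> k0 k1) (assoc_sum a \<gamma> k0 k1)
     = (\<Sum>k=k0..k1. \<Sum>l=k0..k1. smult (\<gamma> k * \<gamma> l) (wronskian_term a k l))"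
proof -
  define A s where "A = herm_sum a \<gamma> k0 k1" "s = assoc_sum a \<gamma> k0 k1"
  define w where "w = shift_var a"
  define t where "t = (\<lambda>l. if l = 0 then 1 else smult (of_nat l) (assoc_herm a (l - 1)))"
  have t: "herm a l + pderiv (assoc_herm a l) + smult 2 (w * assoc_herm a l) = t l" for l
    using assoc_herm_ode[of a "l - 1"] by (cases l) (auto simp: t_def w_def A_s_def algebra_simps)
  have At: "A + pderiv s + smult 2 (w * s) = (\<Sum>l=k0..k1. smult (\<gamma> l) (t l))"
    unfolding A_s_def(1,2) herm_sum_def assoc_sum_def t[symmetric]
    by (simp add: pderiv_sum pderiv_smult smult_add_right sum.distrib sum_distrib_left smult_sum2 del: pCons_one)
       (simp add: mult.commute)
  have A': "pderiv A = (\<Sum>l=k0..k1. smult (\<gamma> l * of_nat l) (herm a (l - 1)))"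
    by (simp add: A_s_def herm_sum_def pderiv_sum pderiv_smult pderiv_herm)
  have "gauss_wronskian a 1 A s = A * (A + pderiv s + smult 2 (w * s)) - s * pderiv A"
    by (simp add: gauss_wronskian_def w_def power2_eq_square algebra_simps)
  also have "\<dots> = (\<Sum>k=k0..k1. \<Sum>l=k0..k1. smult (\<gamma> k * \<gamma> l) (herm a k * t l - smult (of_nat l) (assoc_herm a k * herm a (l - 1))))"
    unfolding At A' unfolding A_s_def(1,2) herm_sum_def assoc_sum_def
    by (simp add: sum_product smult_diff_right sum_subtractf)
       (intro arg_cong2[where f = "(-)"] sum.cong refl; simp add: mult_ac)
  also have "\<dots> = (\<Sum>k=k0..k1. \<Sum>l=k0..k1. smult (\<gamma> k * \<gamma> l) (wronskian_term a k l))"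
    by (intro sum.cong arg_cong2[where f = smult] refl)
       (auto simp: t_def wronskian_term_def casorati_def smult_diff_right)
  finally show ?thesis by (simp add: A_s_def)
qed

lemma exact_degree_wronskian_term:
  assumes "l \<le> k" shows "exact_degree (wronskian_term a k l) (k - l)"
proof (cases l)
  case (Suc l')
  have "exact_degree (casorati a l' k) (k - l)"
    using exact_degree_casorati[of a l' "k - l"] assms Suc by simp
  thus ?thesis using Suc
    by (simp add: wronskian_term_def casorati_swap[of a k l'] exact_degree_def del: of_nat_Suc)
qed (simp add: wronskian_term_def exact_degree_herm)

lemma degree_wronskian_term:
  assumes "k < l" shows "degree (wronskian_term a k l) \<le> l - k - 1"
proof (cases "l = Suc k")
  case True
  thus ?thesis by (simp add: wronskian_term_def casorati_def)
next
  case False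
  hence "exact_degree (casorati a k (l - 1)) (l - k - 2)"
    using exact_degree_casorati[of a k "l - k - 2"] assms by (simp add: Suc_diff_Suc numeral_2_eq_2)
  thus ?thesis using assms by (simp add: wronskian_term_def exact_degree_def)
qed

text \<open>
  Among all terms of the double sum the one with the largest first and the smallest second index has
  strictly the largest degree, so no cancellation can occur.
\<close>

lemma exact_degree_gauss_wronskian:
  assumes "k0 \<le> k1" "\<gamma> k0 \<noteq> 0" "\<gamma> k1 \<noteq> 0"
  shows "exact_degree (gauss_wronskian a 1 (herm_sum a \<gamma> k0 k1) (assoc_sum a \<gamma> k0 k1)) (k1 - k0)"
proof -
  define d where "d = k1 - k0"
  let ?\<omega> = "gauss_wronskian a 1 (herm_sum a \<gamma> k0 k1) (assoc_sum a \<gamma> k0 k1)"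
  have *: "coeff (wronskian_term a k l) e = 0"
    if "k \<in> {k0..k1}" "l \<in> {k0..k1}" "e \<ge> d" "e > d \<or> k \<noteq> k1 \<or> l \<noteq> k0" for k l e
  proof (rule coeff_eq_0)
    show "degree (wronskian_term a k l) < e"
    proof (cases "l \<le> k")
      case True
      thus ?thesis using exact_degree_wronskian_term[OF True, of a] that
        by (auto simp: exact_degree_def d_def)
    next
      case False
      thus ?thesis using degree_wronskian_term[of k l a] that by (auto simp: d_def)
    qed
  qed
  have "coeff ?\<omega> e = 0" if "e > d" for e
    unfolding gauss_wronskian_sum using * that by (simp add: coeff_sum)
  moreover have "coeff ?\<omega> d \<noteq> 0"
  proof -
    have "coeff ?\<omega> d = (\<Sum>k=k0..k1. \<Sum>l=k0..k1. if k = k1 \<and> l = k0 then \<gamma> k1 * \<gamma> k0 * coeff (wronskian_term a k1 k0) d else 0)"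
      unfolding gauss_wronskian_sum coeff_sum by (intro sum.cong refl) (use * in auto)
    also have "\<dots> = (\<Sum>k=k0..k1. if k = k1 then \<gamma> k1 * \<gamma> k0 * coeff (wronskian_term a k1 k0) d else 0)"
      using assms by (intro sum.cong refl) (auto simp: sum.delta)
    also have "\<dots> = \<gamma> k1 * \<gamma> k0 * coeff (wronskian_term a k1 k0) d"
      using assms by (simp add: sum.delta)
    moreover have "coeff (wronskian_term a k1 k0) d \<noteq> 0"
      using exact_degree_wronskian_term[OF assms(1), of a]
      unfolding exact_degree_def d_def by (metis leading_coeff_0_iff)
    ultimately show ?thesis using assms by simp
  qed
  ultimately show ?thesis unfolding d_def[symmetric] exact_degree_def
    by (metis coeff_0 le_degree leading_coeff_0_iff linorder_neqE_nat order_less_le_trans not_less)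
qed

lemma herm_expansion: "\<exists>\<gamma>. A = herm_sum a \<gamma> 0 N" if "degree A \<le> N"
  using that
proof (induction N arbitrary: A)
  case 0
  then obtain c where "A = [:c:]" by (metis degree_eq_zeroE le_zero_eq)
  thus ?case by (intro exI[of _ "\<lambda>_. c"]) (simp add: herm_sum_def)
next
  case (Suc N)
  define B where "B = A - smult (coeff A (Suc N)) (herm a (Suc N))"
  have "coeff B i = 0" if "i > N" for i
  proof (cases "i = Suc N")
    case True
    thus ?thesis by (simp add: B_def monic_herm del: herm.simps)
  next
    case False
    thus ?thesis using that Suc.prems exact_degree_herm[of a "Suc N"]
      by (auto simp: B_def exact_degree_def coeff_eq_0 simp del: herm.simps)
  qed
  hence "degree B \<le> N" by (intro degree_le) auto
  with Suc.IH obtain \<gamma> where g: "B = herm_sum a \<gamma> 0 N" by blast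
  have "A = herm_sum a (\<gamma>(Suc N := coeff A (Suc N))) 0 (Suc N)"
  proof -
    have "herm_sum a (\<gamma>(Suc N := coeff A (Suc N))) 0 (Suc N) = herm_sum a \<gamma> 0 N + smult (coeff A (Suc N)) (herm a (Suc N))"
      by (simp add: herm_sum_def)
    thus ?thesis unfolding g[symmetric] B_def by simp
  qed
  thus ?case by blast
qed

lemma herm_sum_trim:
  assumes "A = herm_sum a \<gamma> K N" "A \<noteq> 0"
  obtains k0 k1 where "K \<le> k0" "k0 \<le> k1" "k1 \<le> N" "\<gamma> k0 \<noteq> 0" "\<gamma> k1 \<noteq> 0" "degree A = k1"
    "A = herm_sum a \<gamma> k0 k1" "assoc_sum a \<gamma> K N = assoc_sum a \<gamma> k0 k1"
proof -
  define X where "X = {k\<in>{K..N}. \<gamma> k \<noteq> 0}"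
  have X: "finite X" "X \<noteq> {}"
    using assms by (auto simp: X_def herm_sum_def)
  define k0 k1 where "k0 = Min X" "k1 = Max X"
  have in': "k0 \<in> X" "k1 \<in> X" "\<And>k. k \<in> X \<Longrightarrow> k0 \<le> k \<and> k \<le> k1"
    using X by (auto simp: k0_k1_def)
  have 1: "A = herm_sum a \<gamma> k0 k1"
    unfolding assms(1) herm_sum_def using in' by (intro sum.mono_neutral_right) (auto simp: X_def)
  have 2: "assoc_sum a \<gamma> K N = assoc_sum a \<gamma> k0 k1"
    unfolding assoc_sum_def using in' by (intro sum.mono_neutral_right) (auto simp: X_def)
  have le: "k0 \<le> k1" using in' by blast
  have c: "coeff A e = (if e = k1 then \<gamma> k1 else 0)" if "e \<ge> k1" for e
  proof -
    have "coeff A e = (\<Sum>k=k0..k1. if k = e then \<gamma> k else 0)"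
      unfolding 1 herm_sum_def coeff_sum
    proof (intro sum.cong refl)
      fix k assume "k \<in> {k0..k1}"
      thus "coeff (smult (\<gamma> k) (herm a k)) e = (if k = e then \<gamma> k else 0)"
        using that exact_degree_herm[of a k] monic_herm[of a k] by (auto simp: exact_degree_def coeff_eq_0)
    qed
    thus ?thesis using that le by (auto simp: sum.delta)
  qed
  have "degree A = k1"
    using c[of k1] c in'(2) by (intro antisym degree_le le_degree) (auto simp: X_def)
  thus thesis using that[of k0 k1] 1 2 in' le by (auto simp: X_def)
qed

lemma gauss_wronskian_minus:
  "gauss_wronskian a c A s - gauss_wronskian a c A s' = gauss_wronskian a 0 A (s - s')"
  by (simp add: gauss_wronskian_def pderiv_diff algebra_simps smult_diff_right)

lemma gauss_wronskian_smult:
  "gauss_wronskian a (c * b) A (smult c s) = smult c (gauss_wronskian a b A s)"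
  by (simp add: gauss_wronskian_def pderiv_smult algebra_simps smult_diff_right smult_add_right)

lemma degree_gauss_wronskian_0:
  assumes "s \<noteq> 0" "A \<noteq> 0"
  shows "degree (gauss_wronskian a 0 A s) = Suc (degree A + degree s)"
proof -
  have d: "degree (smult 2 (shift_var a * s * A)) = Suc (degree A + degree s)"
    using assms by (subst degree_smult_eq) (simp add: degree_mult_eq)
  have "degree (pderiv s * A) \<le> degree A + degree s" 
    by (rule order.trans[OF degree_mult_le]) (simp add: degree_pderiv)
  moreover have "degree (s * pderiv A) \<le> degree A + degree s"
    by (rule order.trans[OF degree_mult_le]) (simp add: degree_pderiv)
  ultimately have "degree (pderiv s * A - s * pderiv A) \<le> degree A + degree s"
    by (intro degree_diff_le)
  hence "degree (pderiv s * A - s * pderiv A + smult 2 (shift_var a * s * A)) = Suc (degree A + degree s)"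
    unfolding d[symmetric] by (intro degree_add_eq_right) (use d in simp)
  thus ?thesis by (simp add: gauss_wronskian_def)
qed

lemma gauss_wronskian_unique:
  assumes "gauss_wronskian a c A s = monom \<kappa> k" "gauss_wronskian a c A s' = monom \<kappa>' k"
    and "A \<noteq> 0" "k \<le> degree A"
  shows "s = s'"
proof (rule ccontr)
  assume "s \<noteq> s'"
  hence "degree (gauss_wronskian a c A s - gauss_wronskian a c A s') = Suc (degree A + degree (s - s'))"
    unfolding gauss_wronskian_minus using assms by (intro degree_gauss_wronskian_0) auto
  moreover have "degree (monom \<kappa> k - monom \<kappa>' k) \<le> k"
    unfolding diff_monom by (rule degree_monom_le)
  ultimately show False using assms by simp
qed

text \<open>
  Expand \<open>A\<close> in Hermite polynomials with indices from \<open>k0\<close> to \<open>k1\<close>.  The associated sum with the same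
  coefficients is one candidate for \<open>s\<close>; any other would make the Wronskian too large in degree.
  Hence \<open>k1 - k0 = n - 1\<close>, and \<open>k1 = degree A\<close> then forces \<open>k0 = m\<close>.
\<close>

theorem gauss_wronskian_monom_imp:
  assumes eq: "gauss_wronskian a c A s = monom \<kappa> (n - 1)" and "c \<noteq> 0" "\<kappa> \<noteq> 0"
    and deg: "degree A = m + n - 1" and "n \<ge> 1" "A \<noteq> 0"
  shows "\<exists>\<gamma>. A = herm_sum a \<gamma> m (m + n - 1) \<and> s = smult c (assoc_sum a \<gamma> m (m + n - 1))"
proof -
  obtain \<gamma> where "A = herm_sum a \<gamma> 0 (m + n - 1)" using herm_expansion[of A] deg by auto
  then obtain k0 k1 where k: "k0 \<le> k1" "\<gamma> k0 \<noteq> 0" "\<gamma> k1 \<noteq> 0" "degree A = k1" "A = herm_sum a \<gamma> k0 k1"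
    using herm_sum_trim[of A a \<gamma> 0 "m + n - 1"] \<open>A \<noteq> 0\<close> by metis
  define t where "t = smult c (assoc_sum a \<gamma> k0 k1)"
  have w: "exact_degree (gauss_wronskian a c A t) (k1 - k0)"
    using exact_degree_gauss_wronskian[of k0 k1 \<gamma> a] k gauss_wronskian_smult[of a c 1 A "assoc_sum a \<gamma> k0 k1"] \<open>c \<noteq> 0\<close>
    by (simp add: t_def exact_degree_def)
  have "s = t"
  proof (rule ccontr)
    assume "s \<noteq> t"
    hence "degree (gauss_wronskian a c A s - gauss_wronskian a c A t) = Suc (degree A + degree (s - t))"
      unfolding gauss_wronskian_minus using \<open>A \<noteq> 0\<close> by (intro degree_gauss_wronskian_0) auto
    moreover have "degree (gauss_wronskian a c A s - gauss_wronskian a c A t) \<le> degree A"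
      using w k(1,4) deg by (intro degree_diff_le) (simp_all add: eq degree_monom_eq \<open>\<kappa> \<noteq> 0\<close> exact_degree_def)
    ultimately show False by simp
  qed
  hence "k1 - k0 = n - 1" using w eq \<open>\<kappa> \<noteq> 0\<close> by (simp add: exact_degree_def degree_monom_eq)
  hence "k0 = m" using k deg \<open>n \<ge> 1\<close> by linarith
  thus ?thesis using k deg \<open>s = t\<close> t_def by auto
qed

lemma monom_dvd_pderiv: "monom 1 n dvd A \<Longrightarrow> monom 1 (n - 1) dvd pderiv (A :: complex poly)"
proof -
  assume "monom 1 n dvd A"
  then obtain P where P: "A = monom 1 n * P" by (auto elim: dvdE)
  have 1: "monom 1 (n - 1) dvd (monom 1 n :: complex poly)"
    by (rule dvdI[of _ _ "monom 1 (n - (n - 1))"]) (simp add: mult_monom)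
  have 2: "monom 1 (n - 1) dvd (monom (of_nat n) (n - 1) :: complex poly)"
    by (rule dvdI[of _ _ "monom (of_nat n) 0"]) (simp add: mult_monom)
  show ?thesis unfolding P pderiv_mult pderiv_monom using 1 2 by (simp add: dvd_add)
qed

text \<open>
  The converse: the Wronskian has degree at most \<open>n - 1\<close> and is divisible by \<open>z ^ (n - 1)\<close>, so it is a
  multiple of this monomial, and the extreme Hermite coefficients of \<open>A\<close> cannot vanish.
\<close>

theorem gauss_wronskian_monom:
  assumes A: "A = herm_sum a \<gamma> m (m + n - 1)" "A \<noteq> 0" "n \<ge> 1" and dvd: "monom 1 n dvd A"
  shows "\<exists>\<kappa>\<noteq>0. gauss_wronskian a 1 A (assoc_sum a \<gamma> m (m + n - 1)) = monom \<kappa> (n - 1)"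
    and "degree A = m + n - 1"
proof -
  define s where "s = assoc_sum a \<gamma> m (m + n - 1)"
  obtain k0 k1 where k: "m \<le> k0" "k0 \<le> k1" "k1 \<le> m + n - 1" "\<gamma> k0 \<noteq> 0" "\<gamma> k1 \<noteq> 0" "degree A = k1"
    "A = herm_sum a \<gamma> k0 k1" "s = assoc_sum a \<gamma> k0 k1"
    using herm_sum_trim[of A a \<gamma> m "m + n - 1"] A unfolding s_def by metis
  define \<omega> where "\<omega> = gauss_wronskian a 1 A s"
  have w: "\<omega> \<noteq> 0" "degree \<omega> = k1 - k0"
    using exact_degree_gauss_wronskian[of k0 k1 \<gamma> a] k by (auto simp: \<omega>_def exact_degree_def)
  have "monom (1::complex) n = monom 1 (n - 1) * monom 1 1" using \<open>n \<ge> 1\<close> by (simp add: mult_monom)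
  hence "monom 1 (n - 1) dvd A" using dvd by (metis dvd_mult_left)
  moreover have "monom 1 (n - 1) dvd pderiv A" by (rule monom_dvd_pderiv[OF dvd])
  ultimately have "monom 1 (n - 1) dvd \<omega>"
    unfolding \<omega>_def gauss_wronskian_def power2_eq_square by (intro dvd_add dvd_diff dvd_smult dvd_mult) auto
  then obtain q where q: "\<omega> = monom 1 (n - 1) * q" by (auto elim: dvdE)
  have dq: "degree \<omega> = n - 1 + degree q" "q \<noteq> 0"
    using w q by (auto simp: degree_mult_eq degree_monom_eq)
  hence kk: "degree q = 0" "k1 - k0 = n - 1" using w k by linarith+
  then obtain \<kappa> where "q = [:\<kappa>:]" by (meson degree_eq_zeroE)
  hence "\<omega> = monom \<kappa> (n - 1)" "\<kappa> \<noteq> 0" using q dq by (auto simp: smult_monom mult.commute)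
  thus "\<exists>\<kappa>\<noteq>0. gauss_wronskian a 1 A (assoc_sum a \<gamma> m (m + n - 1)) = monom \<kappa> (n - 1)"
    unfolding \<omega>_def s_def by blast
  show "degree A = m + n - 1" using kk k \<open>n \<ge> 1\<close> by linarith
qed

section \<open>Roots of the Hankel determinant and the Gaussian functional\<close>

text \<open>
  The moments of the weight \<open>exp (- (z + a)\<^sup>2)\<close>, normalised to total mass \<open>1\<close>.
\<close>

definition moment :: "complex \<Rightarrow> nat \<Rightarrow> complex" where
  "moment a k = poly (moment_poly k) a / (-2) ^ k"

definition functional :: "complex \<Rightarrow> complex poly \<Rightarrow> complex" where
  "functional a p = (\<Sum>i\<le>degree p. coeff p i * moment a i)"

lemma functional_altdef: "degree p \<le> N \<Longrightarrow> functional a p = (\<Sum>i\<le>N. coeff p i * moment a i)"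
  unfolding functional_def by (rule sum.mono_neutral_left) (auto simp: coeff_eq_0)

lemma functional_add: "functional a (p + q) = functional a p + functional a q"
proof -
  define N where "N = max (degree p) (degree q)"
  have "degree (p + q) \<le> N" by (simp add: N_def degree_add_le)
  thus ?thesis
    by (simp add: functional_altdef[of _ N] N_def algebra_simps sum.distrib)
qed

lemma functional_smult: "functional a (smult c p) = c * functional a p"
  by (simp add: functional_altdef[of _ "degree p"] degree_smult_le sum_distrib_left mult.assoc)

lemma functional_diff: "functional a (p - q) = functional a p - functional a q"
  using functional_add[of a "p - q" q] by simp

lemma functional_0 [simp]: "functional a 0 = 0"
  using functional_smult[of a 0 0] by simp

lemma functional_sum: "functional a (sum f X) = (\<Sum>x\<in>X. functional a (f x))"
  by (induction X rule: infinite_finite_induct) (auto simp: functional_add)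

lemma functional_monom: "functional a (monom c k) = c * moment a k"
proof (cases "c = 0")
  case False
  thus ?thesis by (simp add: functional_altdef[of _ k] degree_monom_eq sum.delta if_distrib[of "\<lambda>x. x * _"] cong: if_cong)
qed simp

lemma moment_rec: "2 * moment a (Suc k) + 2 * a * moment a k = of_nat k * moment a (k - 1)"
  by (cases k) (simp_all add: moment_def moment_poly_Suc[of "Suc _"] field_simps del: moment_poly.simps(3))

text \<open>
  Integration by parts against the Gaussian weight; on monomials it is the recurrence of the moments.
\<close>

lemma functional_gauss: "functional a (smult 2 (shift_var a * p)) = functional a (pderiv p)"
proof -
  have *: "functional a (smult 2 (shift_var a * monom c k)) = functional a (pderiv (monom c k))" for c k
  proof -
    have "smult 2 (shift_var a * monom c k) = smult 2 (monom c (Suc k) + smult a (monom c k))"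
      by (simp add: shift_var_def monom_Suc add.commute)
    thus ?thesis using arg_cong[OF moment_rec[of a k], of "\<lambda>x. c * x"]
      by (simp add: functional_smult functional_add functional_monom pderiv_monom algebra_simps)
  qed
  have p: "p = (\<Sum>i\<le>degree p. monom (coeff p i) i)" by (simp add: poly_as_sum_of_monoms)
  have "functional a (smult 2 (shift_var a * (\<Sum>i\<le>degree p. monom (coeff p i) i)))
      = functional a (pderiv (\<Sum>i\<le>degree p. monom (coeff p i) i))"
    using * by (simp add: sum_distrib_left smult_sum2 pderiv_sum functional_sum)
  thus ?thesis using p by simp
qed

lemma functional_herm_Suc: "functional a (herm a (Suc k) * p) = functional a (herm a k * pderiv p) / 2"
proof -
  have "functional a (smult 2 (shift_var a * (herm a k * p))) = functional a (pderiv (herm a k * p))"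
    by (rule functional_gauss)
  hence "2 * functional a (shift_var a * (herm a k * p)) =
      functional a (herm a k * pderiv p) + of_nat k * functional a (herm a (k - 1) * p)"
    by (simp add: pderiv_mult pderiv_herm functional_smult functional_add mult.commute)
  thus ?thesis
    unfolding herm_Suc by (simp add: algebra_simps functional_diff functional_smult)
qed

lemma functional_herm: "functional a (herm a k * p) = functional a ((pderiv ^^ k) p) / 2 ^ k"
proof (induction k arbitrary: p)
  case (Suc k)
  thus ?case by (simp add: functional_herm_Suc funpow_swap1 del: herm.simps)
qed simp

lemma higher_pderiv_monom_less: "j < k \<Longrightarrow> (pderiv ^^ k) (monom (c :: complex) j) = 0"
proof (induction k arbitrary: c j)
  case (Suc k)
  show ?case
  proof (cases j)
    case 0
    have "(pderiv ^^ k) (0 :: complex poly) = 0" by (induction k) auto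
    thus ?thesis using 0 by (simp add: funpow_swap1[of pderiv k] pderiv_monom del: funpow.simps) (simp add: funpow_swap1 pderiv_monom)
  next
    case (Suc j')
    thus ?thesis using Suc.IH[of j'] Suc.prems by (simp add: funpow_swap1 pderiv_monom)
  qed
qed simp

lemma higher_pderiv_monom_eq: "(pderiv ^^ k) (monom (c :: complex) k) = [:c * fact k:]"
proof (induction k arbitrary: c)
  case (Suc k)
  thus ?case by (simp add: funpow_swap1 pderiv_monom algebra_simps)
qed (simp add: monom_0)

lemma moment_0 [simp]: "moment a 0 = 1"
  by (simp add: moment_def)

lemma functional_herm_monom:
  "j < k \<Longrightarrow> functional a (herm a k * monom 1 j) = 0"
  "functional a (herm a k * monom 1 k) \<noteq> 0"
proof -
  show "j < k \<Longrightarrow> functional a (herm a k * monom 1 j) = 0"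
    by (simp only: functional_herm higher_pderiv_monom_less) simp
  show "functional a (herm a k * monom 1 k) \<noteq> 0"
    by (simp only: functional_herm higher_pderiv_monom_eq) (simp add: functional_def)
qed

text \<open>
  By the Rodrigues formula \<open>functional_herm\<close> the polynomials \<open>herm\<close> are orthogonal to lower powers,
  so orthogonality to \<open>1, \<dots>, z ^ (m - 1)\<close> kills the Hermite coefficients below \<open>m\<close> one after the other.
\<close>

lemma herm_sum_iff_functional:
  assumes "degree A \<le> N"
  shows "(\<exists>\<gamma>. A = herm_sum a \<gamma> m N) \<longleftrightarrow> (\<forall>j<m. functional a (A * monom 1 j) = 0)"
proof
  assume "\<exists>\<gamma>. A = herm_sum a \<gamma> m N"
  thus "\<forall>j<m. functional a (A * monom 1 j) = 0"
    by (auto simp: herm_sum_def sum_distrib_right functional_sum functional_smult functional_herm_monom)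
next
  assume *: "\<forall>j<m. functional a (A * monom 1 j) = 0"
  obtain \<gamma> where A: "A = herm_sum a \<gamma> 0 N" using herm_expansion[OF assms] by blast
  have g0: "\<gamma> k = 0" if "k < m" "k \<le> N" for k
    using that
  proof (induction k rule: less_induct)
    case (less k)
    have "0 = functional a (A * monom 1 k)" using * less.prems by simp
    also have "\<dots> = (\<Sum>l=0..N. \<gamma> l * functional a (herm a l * monom 1 k))"
      by (simp add: A herm_sum_def sum_distrib_right functional_sum functional_smult)
    also have "\<dots> = (\<Sum>l=0..N. if l = k then \<gamma> k * functional a (herm a k * monom 1 k) else 0)"
    proof (intro sum.cong refl)
      fix l assume "l \<in> {0..N}"
      thus "\<gamma> l * functional a (herm a l * monom 1 k) = (if l = k then \<gamma> k * functional a (herm a k * monom 1 k) else 0)"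
        using less functional_herm_monom(1)[of k l a] by (cases l k rule: linorder_cases) auto
    qed
    also have "\<dots> = \<gamma> k * functional a (herm a k * monom 1 k)" using less.prems by (simp add: sum.delta)
    finally show ?case using functional_herm_monom(2) by simp
  qed
  have "A = herm_sum a \<gamma> m N"
    unfolding A herm_sum_def using g0 by (intro sum.mono_neutral_right) auto
  thus "\<exists>\<gamma>. A = herm_sum a \<gamma> m N" by blast
qed

text \<open>
  The polynomials \<open>P\<close> whose roots will be the zeros of a Nevanlinna function away from the origin; the
  numerator of that function is \<open>z ^ n * P\<close>.
\<close>

definition hermite_kernel :: "complex \<Rightarrow> nat \<Rightarrow> nat \<Rightarrow> complex poly set" where
  "hermite_kernel a m n =
     {P. degree P = m - 1 \<and> lead_coeff P = 1 \<and> (\<exists>\<gamma>. monom 1 n * P = herm_sum a \<gamma> m (m + n - 1))}"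

text \<open>
  The Hankel matrix at \<open>a\<close> is, up to diagonal scalings by powers of \<open>-2\<close>, the Gram matrix of the powers
  \<open>1, \<dots>, z ^ (m - 1)\<close> for the functional \<open>p \<mapsto> functional a (z ^ n * p)\<close>.
\<close>

lemma hankel_eq_0_iff:
  assumes "m \<ge> 1"
  shows "poly (hankel m n) a = 0 \<longleftrightarrow>
    (\<exists>P. P \<noteq> 0 \<and> degree P \<le> m - 1 \<and> (\<forall>i<m. functional a (monom 1 n * P * monom 1 i) = 0))"
proof -
  define M where "M = Matrix.mat m m (\<lambda>(i, j). poly (moment_poly (n + i + j)) a)"
  have M: "M \<in> carrier_mat m m" by (simp add: M_def)
  have ev: "comm_ring_hom (\<lambda>p. poly p a)" by unfold_locales auto
  have "map_mat (\<lambda>p. poly p a) (Matrix.mat m m (\<lambda>(i, j). moment_poly (n + i + j))) = M"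
    by (intro eq_matI) (auto simp: M_def)
  hence det: "poly (hankel m n) a = Determinant.det M"
    unfolding hankel_def by (metis comm_ring_hom.hom_det[OF ev])
  have row: "vec_index (M *\<^sub>v Matrix.vec m v) i = (-2) ^ (n + i) * (\<Sum>j<m. v j * (-2) ^ j * moment a (n + i + j))"
    if "i < m" for i v
    using that by (simp add: M_def scalar_prod_def moment_def lessThan_atLeast0 sum_distrib_left power_add mult_ac)
  have fexp: "functional a (monom 1 n * P * monom 1 i) = (\<Sum>j<m. coeff P j * moment a (n + i + j))"
    if "degree P \<le> m - 1" for P i
  proof -
    have "P = (\<Sum>j\<le>m-1. monom (coeff P j) j)" using that by (simp add: poly_as_sum_of_monoms')
    also have "{..m-1} = {..<m}" using assms by auto
    finally have "functional a (monom 1 n * P * monom 1 i)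
       = functional a (monom 1 n * (\<Sum>j<m. monom (coeff P j) j) * monom 1 i)" by simp
    also have "\<dots> = (\<Sum>j<m. functional a (monom (coeff P j) (n + i + j)))"
      by (simp add: sum_distrib_left sum_distrib_right mult_monom functional_sum ac_simps)
    finally show ?thesis by (simp add: functional_monom)
  qed
  show ?thesis
  proof
    assume "poly (hankel m n) a = 0"
    then obtain v where v: "v \<in> carrier_vec m" "v \<noteq> 0\<^sub>v m" "M *\<^sub>v v = 0\<^sub>v m"
      using det_0_iff_vec_prod_zero[OF M] det by auto
    define P where "P = (\<Sum>j<m. monom (vec_index v j * (-2) ^ j) j)"
    have cP: "coeff P j = (if j < m then vec_index v j * (-2) ^ j else 0)" for j
      by (auto simp: P_def coeff_sum sum.delta)
    have deg: "degree P \<le> m - 1" using assms by (intro degree_le) (auto simp: cP)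
    have "P \<noteq> 0"
    proof
      assume "P = 0"
      hence "vec_index v j = 0" if "j < m" for j using cP[of j] that by simp
      hence "v = 0\<^sub>v m" using v(1) by (intro eq_vecI) auto
      thus False using v by simp
    qed
    moreover have "functional a (monom 1 n * P * monom 1 i) = 0" if "i < m" for i
    proof -
      have "v = Matrix.vec m (vec_index v)" using v(1) by (intro eq_vecI) auto
      hence "vec_index (M *\<^sub>v Matrix.vec m (vec_index v)) i = 0" using v(3) that by simp
      hence "(\<Sum>j<m. vec_index v j * (-2) ^ j * moment a (n + i + j)) = 0" using row[OF that] by simp
      thus ?thesis using fexp[OF deg] by (simp add: cP)
    qed
    ultimately show "\<exists>P. P \<noteq> 0 \<and> degree P \<le> m - 1 \<and> (\<forall>i<m. functional a (monom 1 n * P * monom 1 i) = 0)"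
      using deg by blast
  next
    assume "\<exists>P. P \<noteq> 0 \<and> degree P \<le> m - 1 \<and> (\<forall>i<m. functional a (monom 1 n * P * monom 1 i) = 0)"
    then obtain P where P: "P \<noteq> 0" "degree P \<le> m - 1" "\<forall>i<m. functional a (monom 1 n * P * monom 1 i) = 0" by blast
    define v where "v = Matrix.vec m (\<lambda>j. coeff P j / (-2) ^ j)"
    have "v \<noteq> 0\<^sub>v m"
    proof
      assume "v = 0\<^sub>v m"
      moreover have "degree P < m" using P(2) assms by linarith
      ultimately have "vec_index v (degree P) = 0" by simp
      thus False using P(1) \<open>degree P < m\<close> by (simp add: v_def)
    qed
    moreover have "M *\<^sub>v v = 0\<^sub>v m"
    proof (rule eq_vecI)
      fix i assume "i < dim_vec (0\<^sub>v m :: complex Matrix.vec)"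
      hence i: "i < m" by simp
      have "(\<Sum>j<m. coeff P j / (-2) ^ j * (-2) ^ j * moment a (n + i + j)) = 0"
        using P(3) fexp[OF P(2)] i by simp
      thus "vec_index (M *\<^sub>v v) i = vec_index (0\<^sub>v m) i"
        using row[OF i] i by (simp add: v_def)
    qed (simp add: M_def v_def)
    ultimately show "poly (hankel m n) a = 0"
      using det det_0_iff_vec_prod_zero[OF M] vec_carrier[of m "\<lambda>j. coeff P j / (-2) ^ j"]
      unfolding v_def by metis
  qed
qed

theorem generalised_hermite_root_iff:
  assumes "m \<ge> 1" "n \<ge> 1"
  shows "poly (generalised_hermite m n) a = 0 \<longleftrightarrow> hermite_kernel a m n \<noteq> {}"
proof -
  obtain c where "c \<noteq> 0" "generalised_hermite m n = smult c (hankel m n)"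
    using generalised_hermite_hankel by blast
  hence "poly (generalised_hermite m n) a = 0 \<longleftrightarrow> poly (hankel m n) a = 0" by simp
  also have "\<dots> \<longleftrightarrow> (\<exists>P. P \<noteq> 0 \<and> degree P \<le> m - 1 \<and> (\<forall>i<m. functional a (monom 1 n * P * monom 1 i) = 0))"
    by (rule hankel_eq_0_iff[OF assms(1)])
  also have "\<dots> \<longleftrightarrow> (\<exists>P. P \<noteq> 0 \<and> degree P \<le> m - 1 \<and> (\<exists>\<gamma>. monom 1 n * P = herm_sum a \<gamma> m (m + n - 1)))"
  proof -
    have "degree (monom 1 n * P) \<le> m + n - 1" if "degree P \<le> m - 1" for P :: "complex poly"
      using degree_mult_le[of "monom 1 n" P] that assms by (simp add: degree_monom_eq)
    thus ?thesis using herm_sum_iff_functional by (metis (no_types, lifting))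
  qed
  also have "\<dots> \<longleftrightarrow> hermite_kernel a m n \<noteq> {}"
  proof
    assume "\<exists>P. P \<noteq> 0 \<and> degree P \<le> m - 1 \<and> (\<exists>\<gamma>. monom 1 n * P = herm_sum a \<gamma> m (m + n - 1))"
    then obtain P \<gamma> where P: "P \<noteq> 0" "monom 1 n * P = herm_sum a \<gamma> m (m + n - 1)" by blast
    have "degree (monom 1 n * P) = m + n - 1"
      using gauss_wronskian_monom(2)[OF P(2) _ assms(2) dvd_triv_left] P(1) by simp
    hence deg: "degree P = m - 1" using P(1) by (simp add: degree_mult_eq degree_monom_eq)
    define c where "c = inverse (lead_coeff P)"
    have c: "c \<noteq> 0" using P by (simp add: c_def)
    have "monom 1 n * smult c P = herm_sum a (\<lambda>k. c * \<gamma> k) m (m + n - 1)"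
      using arg_cong[OF P(2), of "smult c"] by (simp add: herm_sum_def smult_sum2)
    hence "smult c P \<in> hermite_kernel a m n"
      using c deg P by (auto simp: hermite_kernel_def c_def lead_coeff_smult)
    thus "hermite_kernel a m n \<noteq> {}" by blast
  next
    assume "hermite_kernel a m n \<noteq> {}"
    then obtain P where P: "degree P = m - 1" "lead_coeff P = 1"
        "\<exists>\<gamma>. monom 1 n * P = herm_sum a \<gamma> m (m + n - 1)"
      unfolding hermite_kernel_def by blast
    have "P \<noteq> 0" using P(2) by auto
    thus "\<exists>P. P \<noteq> 0 \<and> degree P \<le> m - 1 \<and> (\<exists>\<gamma>. monom 1 n * P = herm_sum a \<gamma> m (m + n - 1))"
      using P(1,3) by (intro exI[of _ P]) simp
  qed
  finally show ?thesis .
qed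

text \<open>
  The difference of two monic solutions would be a solution of smaller degree, but the degree of a
  nonzero solution is determined.
\<close>

lemma hermite_kernel_unique:
  assumes "n \<ge> 1" "P \<in> hermite_kernel a m n" "Q \<in> hermite_kernel a m n"
  shows "P = Q"
proof (rule ccontr)
  assume "P \<noteq> Q"
  from assms obtain \<gamma> \<delta> where P: "degree P = m - 1" "lead_coeff P = 1" "monom 1 n * P = herm_sum a \<gamma> m (m + n - 1)"
    and Q: "degree Q = m - 1" "lead_coeff Q = 1" "monom 1 n * Q = herm_sum a \<delta> m (m + n - 1)"
    by (auto simp: hermite_kernel_def)
  have "monom 1 n * (P - Q) = herm_sum a (\<lambda>k. \<gamma> k - \<delta> k) m (m + n - 1)"
    using P(3) Q(3) by (simp add: herm_sum_def right_diff_distrib smult_diff_left sum_subtractf)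
  from gauss_wronskian_monom(2)[OF this _ assms(1) dvd_triv_left] \<open>P \<noteq> Q\<close>
  have "degree (monom 1 n * (P - Q)) = m + n - 1" by simp
  hence "degree (P - Q) = m - 1" using \<open>P \<noteq> Q\<close> by (simp add: degree_mult_eq degree_monom_eq)
  hence "coeff (P - Q) (degree (P - Q)) = 0" using P Q by simp
  thus False using \<open>P \<noteq> Q\<close> by (subst (asm) leading_coeff_0_iff) simp
qed

lemma hermite_kernel_wronskian:
  assumes "n \<ge> 1" "P \<in> hermite_kernel a m n"
  obtains s \<kappa> where "\<kappa> \<noteq> 0" "gauss_wronskian a 1 (monom 1 n * P) s = monom \<kappa> (n - 1)"
proof -
  from assms obtain \<gamma> where P: "lead_coeff P = 1" "monom 1 n * P = herm_sum a \<gamma> m (m + n - 1)"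
    unfolding hermite_kernel_def by blast
  hence "P \<noteq> 0" by auto
  thus thesis using gauss_wronskian_monom(1)[OF P(2) _ assms(1) dvd_triv_left] that by auto
qed

lemma hermite_kernelI:
  assumes "gauss_wronskian a c (monom 1 n * P) s = monom \<kappa> (n - 1)" "c \<noteq> 0" "\<kappa> \<noteq> 0"
    and "degree P = m - 1" "lead_coeff P = 1" "m \<ge> 1" "n \<ge> 1"
  shows "P \<in> hermite_kernel a m n"
proof -
  have "P \<noteq> 0" using assms by auto
  hence "degree (monom 1 n * P) = m + n - 1" using assms by (simp add: degree_mult_eq degree_monom_eq)
  from gauss_wronskian_monom_imp[OF assms(1-3) this assms(7)] \<open>P \<noteq> 0\<close> assms(4,5)
  show ?thesis by (auto simp: hermite_kernel_def)
qed

text \<open>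
  Dividing the Wronskian by \<open>z ^ (n - 1)\<close> leaves the nonzero constant \<open>\<kappa>\<close>; evaluated at \<open>0\<close> it is a multiple
  of \<open>P 0\<close>, and at a root of \<open>P\<close> it is a multiple of the value of \<open>P'\<close> there.
\<close>

lemma hermite_kernel_roots:
  assumes "n \<ge> 1" "P \<in> hermite_kernel a m n"
  shows "poly P 0 \<noteq> 0" "poly P r = 0 \<Longrightarrow> poly (pderiv P) r \<noteq> 0"
proof -
  obtain s \<kappa> where s: "\<kappa> \<noteq> 0" "gauss_wronskian a 1 (monom 1 n * P) s = monom \<kappa> (n - 1)"
    using hermite_kernel_wronskian[OF assms] .
  obtain k where n: "n = Suc k" using assms(1) by (cases n) auto
  define A where "A = monom 1 n * P"
  define X x where "X = monom (1::complex) k" and "x = monom (1::complex) 1"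
  have AX: "A = X * (x * P)" by (simp add: A_def X_def x_def n mult_monom flip: mult.assoc)
  have A': "pderiv A = X * (smult (of_nat n) P + x * pderiv P)"
  proof -
    have "pderiv A = monom 1 n * pderiv P + P * smult (of_nat n) X"
      by (simp add: A_def X_def pderiv_mult pderiv_monom n smult_monom del: of_nat_Suc)
    also have "monom 1 n = X * x" by (simp add: X_def x_def n mult_monom)
    finally show ?thesis by (simp add: algebra_simps)
  qed
  have "X * smult \<kappa> 1 = gauss_wronskian a 1 A s"
    using s by (simp add: A_def X_def n smult_monom)
  also have "\<dots> = A * A + pderiv s * A - s * pderiv A + smult 2 (shift_var a * s * A)"
    by (simp add: gauss_wronskian_def power2_eq_square)
  also have "\<dots> = A * (X * (x * P)) + pderiv s * (X * (x * P)) - s * pderiv A + smult 2 (shift_var a * s * (X * (x * P)))"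
    unfolding AX[symmetric] ..
  also have "\<dots> = X * (A * (x * P) + pderiv s * (x * P) - s * (smult (of_nat n) P + x * pderiv P)
       + smult 2 (shift_var a * s * (x * P)))"
    unfolding A' by (simp add: algebra_simps)
  finally have U: "smult \<kappa> 1 = A * (x * P) + pderiv s * (x * P) - s * (smult (of_nat n) P + x * pderiv P)
       + smult 2 (shift_var a * s * (x * P))"
    by (subst (asm) mult_cancel_left) (simp add: X_def)
  have E: "\<kappa> = poly A r * (r * poly P r) + poly (pderiv s) r * (r * poly P r)
        - poly s r * (of_nat n * poly P r + r * poly (pderiv P) r)
       + 2 * ((a + r) * poly s r * (r * poly P r))" for r
    using arg_cong[OF U, of "\<lambda>p. poly p r"] by (simp add: poly_monom x_def)
  show "poly P 0 \<noteq> 0" using E[of 0] s(1) by auto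
  show "poly (pderiv P) r \<noteq> 0" if "poly P r = 0" using E[of r] s(1) that by auto
qed

lemma hermite_kernel_card_roots:
  assumes "n \<ge> 1" "P \<in> hermite_kernel a m n"
  shows "card {r. poly P r = 0} = m - 1"
proof -
  have P: "lead_coeff P = 1" "degree P = m - 1" using assms by (auto simp: hermite_kernel_def)
  have "rsquarefree P"
    unfolding rsquarefree_roots using hermite_kernel_roots(2)[OF assms] by blast
  hence "(\<Prod>z | poly P z = 0. [:-z, 1:]) = P"
    using complex_poly_decompose_rsquarefree[of P] P by simp
  hence "degree (\<Prod>z | poly P z = 0. [:-z, 1:]) = m - 1" using P by simp
  moreover have "degree (\<Prod>z | poly P z = 0. [:-z, 1:]) = (\<Sum>z | poly P z = 0. degree [:-z, 1:])"
    by (rule degree_prod_sum_eq) simp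
  ultimately show ?thesis by simp
qed

section \<open>Quotients of entire functions without further critical points\<close>

text \<open>
  The common analytic form of the functions in question.  The Wronskian of \<open>z ^ n * P\<close> and \<open>B\<close> is
  \<open>z ^ (n - 1) * exp (h z)\<close>; the equation \<open>wr\<close> has the monomial divided out, which makes it usable at
  the origin.
\<close>

locale zero_quotient =
  fixes n :: nat and P :: "complex poly" and B h f :: "complex \<Rightarrow> complex"
  assumes holB: "B holomorphic_on UNIV" and holh: "h holomorphic_on UNIV"
    and wr: "\<And>z. z * poly P z * deriv B z - (of_nat n * poly P z + z * poly (pderiv P) z) * B z = exp (h z)"
    and f_eq: "\<And>z. f z = z ^ n * poly P z / B z"
begin

lemma n_pos: "n > 0" and P_0: "poly P 0 \<noteq> 0" and B_0: "B 0 \<noteq> 0"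
  using wr[of 0] by (auto intro!: Nat.gr0I)

lemma B_deriv: "(B has_field_derivative deriv B z) (at z)"
  and h_deriv: "(h has_field_derivative deriv h z) (at z)"
  using holB holh by (auto intro: holomorphic_derivI)

lemma P_root_B: "poly P z = 0 \<Longrightarrow> B z \<noteq> 0"
  and B_root_P: "B z = 0 \<Longrightarrow> z \<noteq> 0 \<and> poly P z \<noteq> 0"
  and B_root_simple: "B z = 0 \<Longrightarrow> deriv B z \<noteq> 0"
  using wr[of z] by auto

lemma h_deriv2: "(deriv h has_field_derivative deriv (deriv h) z) (at z)"
  using holh by (auto intro!: holomorphic_derivI[of _ UNIV] holomorphic_deriv)

lemma wr': "z ^ n * poly P z * deriv B z - (of_nat n * z ^ (n - 1) * poly P z + z ^ n * poly (pderiv P) z) * B z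
     = z ^ (n - 1) * exp (h z)"
proof -
  have "z ^ n = z ^ (n - 1) * z" using n_pos by (metis power_minus_mult)
  thus ?thesis unfolding wr[of z, symmetric] by (simp only:) (simp add: algebra_simps)
qed

lemma f_deriv:
  assumes "B z \<noteq> 0"
  shows "(f has_field_derivative - (z ^ (n - 1) * exp (h z)) / (B z)\<^sup>2) (at z)"
proof -
  have "((\<lambda>z. z ^ n * poly P z / B z) has_field_derivative - (z ^ (n - 1) * exp (h z)) / (B z)\<^sup>2) (at z)"
    unfolding wr'[of z, symmetric]
    by (rule derivative_eq_intros poly_DERIV B_deriv refl assms)+ (simp add: power2_eq_square algebra_simps)
  moreover have "f = (\<lambda>z. z ^ n * poly P z / B z)" using f_eq by (rule ext)
  ultimately show ?thesis by (simp only:)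
qed

lemma open_B: "open {z. B z \<noteq> 0}"
proof -
  have "continuous_on UNIV B" by (rule holomorphic_on_imp_continuous_on[OF holB])
  thus ?thesis by (simp add: open_Collect_neq continuous_on_const)
qed

lemma f_holomorphic: "f holomorphic_on {z. B z \<noteq> 0}"
  unfolding holomorphic_on_open[OF open_B] using f_deriv by blast

lemma f_analytic: "B z \<noteq> 0 \<Longrightarrow> f analytic_on {z}"
  using f_holomorphic open_B by (auto simp: analytic_at)

lemma B_nz_near: "\<forall>\<^sub>F w in at z. B w \<noteq> 0"
  using non_zero_neighbour_alt[of B UNIV z 0] holB B_0 by (auto elim: eventually_mono)

lemma f_isCont_B: "isCont B z"
  using B_deriv DERIV_isCont by blast

lemma f_pole_iff: "is_pole f z \<longleftrightarrow> B z = 0"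
proof
  assume "B z = 0"
  have "(\<lambda>z. z ^ n * poly P z / B z) = f" using f_eq by auto
  moreover have "filterlim B (at 0) (at z)"
    using f_isCont_B[of z] \<open>B z = 0\<close> B_nz_near[of z] by (auto simp: filterlim_at isCont_def)
  ultimately show "is_pole f z"
    using is_pole_divide[of z "\<lambda>z. z ^ n * poly P z" B] B_root_P[OF \<open>B z = 0\<close>] by auto
qed (use f_analytic analytic_at_imp_no_pole in blast)

lemma sphere_f: "sphere_map f z = (if B z = 0 then None else Some (z ^ n * poly P z / B z))"
  by (simp add: sphere_map_def f_pole_iff f_eq)

lemma f_isolated: "isolated_singularity_at f z"
proof -
  from B_nz_near[of z] obtain r where r: "r > 0" "\<And>w. w \<noteq> z \<Longrightarrow> dist w z < r \<Longrightarrow> B w \<noteq> 0"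
    by (auto simp: eventually_at)
  have "f analytic_on ball z r - {z}"
    using r f_analytic by (subst analytic_on_analytic_at) (auto simp: dist_commute)
  thus ?thesis using r(1) by (auto simp: isolated_singularity_at_def)
qed

lemma f_nicely_meromorphic: "f nicely_meromorphic_on UNIV"
proof (rule nicely_meromorphic_onI_open[of _ _ "{z. B z = 0}"])
  show "f analytic_on UNIV - {z. B z = 0}"
    using f_analytic by (subst analytic_on_analytic_at) auto
qed (auto simp: f_pole_iff f_isolated f_eq)

lemma f_zorder_0: "zorder f 0 = int n"
proof (rule zorder_eqI[OF open_B])
  show "(\<lambda>z. poly P z / B z) holomorphic_on {z. B z \<noteq> 0}"
    using holB by (intro holomorphic_intros) (auto intro: holomorphic_on_subset)
qed (use B_0 P_0 in \<open>auto simp: f_eq\<close>)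

lemma f_pole_simple:
  assumes "B z = 0" shows "zorder f z = -1"
proof -
  let ?A = "\<lambda>z. z ^ n * poly P z"
  have "?A holomorphic_on UNIV" by (intro holomorphic_intros)
  hence A: "?A analytic_on {z}" "?A z \<noteq> 0" using B_root_P[OF assms] by (auto simp: analytic_at)
  have Ban: "B analytic_on {z}" using holB by (auto simp: analytic_at)
  have zB: "zorder B z = 1"
    by (rule zorder_zero_eqI') (use assms B_root_simple Ban in auto)
  have zA: "zorder ?A z = 0"
    by (rule zorder_zero_eqI') (use A in auto)
  have freq: "\<exists>\<^sub>F w in at z. ?A w \<noteq> 0" "\<exists>\<^sub>F w in at z. B w \<noteq> 0"
  proof -
    have "?A \<midarrow>z\<rightarrow> ?A z" using A(1) by (meson analytic_at_imp_isCont isContD)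
    hence "\<forall>\<^sub>F w in at z. ?A w \<noteq> 0" using A(2) by (rule tendsto_imp_eventually_ne)
    thus "\<exists>\<^sub>F w in at z. ?A w \<noteq> 0" by (rule eventually_frequently[rotated]) simp
    show "\<exists>\<^sub>F w in at z. B w \<noteq> 0" using B_nz_near by (rule eventually_frequently[rotated]) simp
  qed
  have "zorder (\<lambda>z. ?A z / B z) z = zorder ?A z - zorder B z"
    using A Ban freq by (intro zorder_divide analytic_on_imp_meromorphic_on) auto
  moreover have "(\<lambda>z. ?A z / B z) = f" using f_eq by auto
  ultimately show ?thesis using zA zB by simp
qed

lemma f_critical: "critical_point f z \<Longrightarrow> z = 0"
proof (rule ccontr)
  assume "critical_point f z" "z \<noteq> 0"
  thus False using f_pole_simple[of z] f_deriv[THEN DERIV_imp_deriv, of z]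
    by (auto simp: critical_point_def f_pole_iff)
qed

lemma f_crit_mult: "crit_mult f + 1 = n"
  using n_pos by (simp add: crit_mult_def f_zorder_0)

lemma f_other_zeros: "other_zeros f = {z. poly P z = 0}"
  using P_0 P_root_B by (auto simp: other_zeros_def sphere_f)

lemma sphere_f_0: "sphere_map f 0 = Some 0"
  using B_0 n_pos by (simp add: sphere_f)

text \<open>
  The logarithmic derivative of \<open>(1 / f)'\<close>, and its derivative.  As \<open>f\<close> and \<open>1 / f\<close> have the same
  Schwarzian derivative, this gives a formula for it that involves the polynomial \<open>P\<close> and the function
  \<open>h\<close> only, and not \<open>B\<close>.
\<close>

definition lder :: "complex \<Rightarrow> complex" where
  "lder z = deriv h z - of_nat (n + 1) / z - 2 * poly (pderiv P) z / poly P z"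

definition lder' :: "complex \<Rightarrow> complex" where
  "lder' z = deriv (deriv h) z + of_nat (n + 1) / z\<^sup>2
     - 2 * (poly (pderiv (pderiv P)) z * poly P z - (poly (pderiv P) z)\<^sup>2) / (poly P z)\<^sup>2"

lemma lder_deriv: "z \<noteq> 0 \<Longrightarrow> poly P z \<noteq> 0 \<Longrightarrow> (lder has_field_derivative lder' z) (at z)"
  unfolding lder_def lder'_def
  by (rule derivative_eq_intros poly_DERIV h_deriv2 refl | assumption)+ (simp add: field_simps power2_eq_square)

text \<open>
  The logarithmic derivative of \<open>f'\<close>.
\<close>

definition pre_schw :: "complex \<Rightarrow> complex" where
  "pre_schw z = of_nat (n - 1) / z + deriv h z - 2 * deriv B z / B z"

lemma open_zB: "open {z. z \<noteq> 0 \<and> B z \<noteq> 0}"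
  unfolding Collect_conj_eq by (intro open_Int open_B open_Collect_neq continuous_intros)

lemma pre_schw_holo: "pre_schw holomorphic_on {z. z \<noteq> 0 \<and> B z \<noteq> 0}"
  unfolding pre_schw_def using holB holh
  by (intro holomorphic_intros holomorphic_deriv) (auto intro: holomorphic_on_subset open_zB)

lemma f_deriv_eqs:
  assumes "z \<noteq> 0" "B z \<noteq> 0"
  shows "deriv f z \<noteq> 0" "deriv (deriv f) z = deriv f z * pre_schw z"
    "deriv (deriv (deriv f)) z = deriv f z * (deriv pre_schw z + (pre_schw z)\<^sup>2)"
proof -
  define S where "S = {z. z \<noteq> 0 \<and> B z \<noteq> 0}"
  have S: "open S" "z \<in> S" using open_zB assms by (auto simp: S_def)
  have d1: "deriv f w = - (w ^ (n - 1) * exp (h w)) / (B w)\<^sup>2" if "w \<in> S" for w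
    using f_deriv[THEN DERIV_imp_deriv, of w] that by (auto simp: S_def)
  show "deriv f z \<noteq> 0" using d1 assms S by simp
  have D: "(deriv f has_field_derivative deriv f w * pre_schw w) (at w)" if w: "w \<in> S" for w
  proof -
    have w': "w \<noteq> 0" "B w \<noteq> 0" using w by (auto simp: S_def)
    define W where "W = (\<lambda>w::complex. w ^ (n - 1))"
    have W': "(W has_field_derivative of_nat (n - 1) / w * W w) (at w)"
      unfolding W_def by (rule derivative_eq_intros refl)+ (use w' in \<open>cases "n - 1"; simp\<close>)
    have "((\<lambda>w. - (W w * exp (h w)) * (inverse (B w))\<^sup>2) has_field_derivative
            - (W w * exp (h w)) * (inverse (B w))\<^sup>2 * pre_schw w) (at w)"
      by (rule derivative_eq_intros B_deriv h_deriv W' refl | simp add: w')+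
         (simp add: pre_schw_def power2_eq_square divide_inverse algebra_simps)
    hence "((\<lambda>w. - (w ^ (n - 1) * exp (h w)) / (B w)\<^sup>2) has_field_derivative
            - (w ^ (n - 1) * exp (h w)) / (B w)\<^sup>2 * pre_schw w) (at w)" by (simp add: W_def divide_inverse power_inverse)
    thus ?thesis
      using d1[OF w] by (subst has_field_derivative_cong_ev[where g = "\<lambda>w. - (w ^ (n - 1) * exp (h w)) / (B w)\<^sup>2"])
         (use d1 S(1) w in \<open>auto simp: eventually_nhds\<close>)
  qed
  show "deriv (deriv f) z = deriv f z * pre_schw z" using D[OF S(2)] by (rule DERIV_imp_deriv)
  have "(pre_schw has_field_derivative deriv pre_schw z) (at z)"
    using pre_schw_holo S by (auto simp: S_def intro: holomorphic_derivI)
  hence "((\<lambda>w. deriv f w * pre_schw w) has_field_derivative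
           deriv f z * pre_schw z * pre_schw z + deriv pre_schw z * deriv f z) (at z)"
    by (rule DERIV_mult[OF D[OF S(2)]])
  moreover have "\<forall>\<^sub>F w in nhds z. deriv (deriv f) w = deriv f w * pre_schw w"
    using D[THEN DERIV_imp_deriv] S by (auto simp: eventually_nhds)
  ultimately show "deriv (deriv (deriv f)) z = deriv f z * (deriv pre_schw z + (pre_schw z)\<^sup>2)"
    by (auto simp: DERIV_imp_deriv deriv_cong_ev algebra_simps power2_eq_square)
qed

definition schw_formula :: "complex \<Rightarrow> complex" where
  "schw_formula z = (deriv ^^ 3) f z / deriv f z - 3 / 2 * ((deriv ^^ 2) f z / deriv f z)\<^sup>2"

lemma schw_formula_eq:
  assumes "z \<noteq> 0" "B z \<noteq> 0"
  shows "schw_formula z = deriv pre_schw z - (pre_schw z)\<^sup>2 / 2"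
  using f_deriv_eqs[OF assms] by (simp add: schw_formula_def numeral_3_eq_3 numeral_2_eq_2 field_simps)

text \<open>
  The two logarithmic derivatives differ by \<open>2 * y\<close> with a function \<open>y\<close> that satisfies
  \<open>y' = y * (lder - y)\<close>; the terms in \<open>y\<close> cancel in the Schwarzian derivative.
\<close>

lemma schw_formula_lder:
  assumes z: "z \<noteq> 0" "B z \<noteq> 0" "poly P z \<noteq> 0"
  shows "schw_formula z = lder' z - (lder z)\<^sup>2 / 2"
proof -
  define y where "y = (\<lambda>w. exp (h w) / (w * poly P w * B w))"
  define S where "S = {z. z \<noteq> 0 \<and> B z \<noteq> 0 \<and> poly P z \<noteq> 0}"
  have "open {z. poly P z \<noteq> 0}"
    by (intro open_Collect_neq continuous_intros)
  hence S: "open S" "z \<in> S"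
    using open_Int[OF open_zB, of "{z. poly P z \<noteq> 0}"] z by (auto simp: S_def Collect_conj_eq Int_assoc)
  have e: "pre_schw w = lder w - 2 * y w" if "w \<in> S" for w
  proof -
    have w: "w \<noteq> 0" "B w \<noteq> 0" "poly P w \<noteq> 0" using that by (auto simp: S_def)
    have "of_nat (n - 1) = (of_nat n - 1 :: complex)" using n_pos by (simp add: of_nat_diff)
    thus ?thesis using w
      unfolding pre_schw_def lder_def y_def wr[of w, symmetric] by (simp add: divide_simps) (simp add: algebra_simps)
  qed
  have y': "(y has_field_derivative y z * (lder z - y z)) (at z)"
  proof -
    have "(y has_field_derivative y z * (deriv h z - 1 / z - poly (pderiv P) z / poly P z - deriv B z / B z)) (at z)"
      unfolding y_def
      by (rule derivative_eq_intros B_deriv h_deriv poly_DERIV refl | simp add: z)+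
         (use z in \<open>simp add: field_simps\<close>)
    moreover have "deriv h z - 1 / z - poly (pderiv P) z / poly P z - deriv B z / B z = lder z - y z"
      using z unfolding lder_def y_def wr[of z, symmetric] by (simp add: divide_simps) (simp add: algebra_simps)
    ultimately show ?thesis by simp
  qed
  have "((\<lambda>w. lder w - 2 * y w) has_field_derivative lder' z - 2 * (y z * (lder z - y z))) (at z)"
    by (rule derivative_eq_intros lder_deriv y' z refl)+ simp
  moreover have "\<forall>\<^sub>F w in nhds z. pre_schw w = lder w - 2 * y w"
    using e S by (auto simp: eventually_nhds)
  ultimately have d: "deriv pre_schw z = lder' z - 2 * (y z * (lder z - y z))"
    by (metis DERIV_imp_deriv deriv_cong_ev)
  show ?thesis unfolding schw_formula_eq[OF z(1,2)] e[OF S(2)] d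
    by (simp add: field_simps power2_eq_square)
qed

lemma schwarzian_lder:
  assumes z: "z \<noteq> 0" "poly P z \<noteq> 0"
  shows "schwarzian f z = lder' z - (lder z)\<^sup>2 / 2"
proof -
  have "isCont lder' z" using z
    unfolding lder'_def by (intro continuous_intros DERIV_isCont[OF h_deriv2] DERIV_isCont[OF holomorphic_derivI[of _ UNIV]] holomorphic_deriv) (auto simp: holh)
  moreover have "isCont lder z" using lder_deriv[OF z] by (rule DERIV_isCont)
  ultimately have "isCont (\<lambda>z. lder' z - (lder z)\<^sup>2 / 2) z" by (intro continuous_intros) auto
  hence "(\<lambda>z. lder' z - (lder z)\<^sup>2 / 2) \<midarrow>z\<rightarrow> lder' z - (lder z)\<^sup>2 / 2" by (rule isContD)
  moreover have "\<forall>\<^sub>F w in at z. schw_formula w = lder' w - (lder w)\<^sup>2 / 2"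
  proof -
    have "\<forall>\<^sub>F w in at z. w \<noteq> 0" using z by (intro t1_space_nhds eventually_at_in_open' | simp add: eventually_neq_at_within)+
    moreover have "\<forall>\<^sub>F w in at z. poly P w \<noteq> 0"
      using z by (intro tendsto_imp_eventually_ne[of _ "poly P z"]) (auto intro!: tendsto_intros)
    ultimately show ?thesis using B_nz_near[of z] by eventually_elim (rule schw_formula_lder)
  qed
  ultimately have "schw_formula \<midarrow>z\<rightarrow> lder' z - (lder z)\<^sup>2 / 2"
    by (simp add: tendsto_cong)
  thus ?thesis unfolding schwarzian_def by (intro remove_sings_eqI) (simp add: schw_formula_def[abs_def])
qed

lemma schwarzian_analytic:
  assumes "z \<noteq> 0" shows "schwarzian f analytic_on {z}"
proof (cases "poly P z = 0")
  case True
  define S where "S = {z. z \<noteq> 0 \<and> B z \<noteq> 0}"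
  have S: "open S" "z \<in> S" using open_zB assms P_root_B[OF True] by (auto simp: S_def)
  have hol: "(\<lambda>w. deriv pre_schw w - (pre_schw w)\<^sup>2 / 2) holomorphic_on S"
    using pre_schw_holo S(1) by (auto intro!: holomorphic_intros holomorphic_deriv simp: S_def)
  hence "schw_formula holomorphic_on S"
    by (rule holomorphic_transform) (auto simp: S_def schw_formula_eq)
  hence "schw_formula analytic_on {z}" using S by (auto simp: analytic_at)
  hence "remove_sings schw_formula analytic_on {z}"
    using eventually_remove_sings_eq_nhds analytic_at_cong by blast
  thus ?thesis unfolding schwarzian_def by (simp add: schw_formula_def[abs_def])
next
  case False
  define S where "S = {z. z \<noteq> 0 \<and> poly P z \<noteq> 0}"
  have S: "open S" "z \<in> S" unfolding S_def Collect_conj_eq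
    by (intro open_Int open_Collect_neq continuous_intros) (use False assms in auto)
  have "(\<lambda>w. lder' w - (lder w)\<^sup>2 / 2) holomorphic_on S"
    using holh unfolding lder'_def lder_def
    by (intro holomorphic_intros holomorphic_deriv S(1)) (auto simp: S_def intro: holomorphic_on_subset)
  hence "schwarzian f holomorphic_on S"
    by (rule holomorphic_transform) (auto simp: S_def schwarzian_lder)
  thus ?thesis using S by (auto simp: analytic_at)
qed

lemma lder_quadratic:
  assumes dh: "\<And>z. deriv h z = 2 * (z + a)" and z: "z \<noteq> 0" "poly P z \<noteq> 0"
  defines "r \<equiv> of_nat (n + 1) / z + 2 * (poly (pderiv P) z / poly P z)"
  shows "schwarzian f z = - 2 * z\<^sup>2 - 4 * a * z +
     (2 - 2 * a\<^sup>2 + 2 * (z + a) * r - r\<^sup>2 / 2 + of_nat (n + 1) / z\<^sup>2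
       - 2 * (poly (pderiv (pderiv P)) z / poly P z) + 2 * (poly (pderiv P) z / poly P z)\<^sup>2)"
proof -
  have "deriv h = (\<lambda>z. 2 * (z + a))" using dh by blast
  hence "deriv (deriv h) z = 2"
    by (auto intro!: DERIV_imp_deriv derivative_eq_intros)
  hence l': "lder' z = 2 + of_nat (n + 1) / z\<^sup>2
       - 2 * (poly (pderiv (pderiv P)) z / poly P z) + 2 * (poly (pderiv P) z / poly P z)\<^sup>2"
    using z by (simp add: lder'_def field_simps power2_eq_square)
  have l: "lder z = 2 * (z + a) - r"
    by (simp add: lder_def dh r_def)
  have sq: "(2 * (z + a) - r)\<^sup>2 / 2 = 2 * z\<^sup>2 + 4 * a * z + 2 * a\<^sup>2 - 2 * (z + a) * r + r\<^sup>2 / 2"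
    by (simp add: power2_eq_square field_simps)
  show ?thesis
    unfolding schwarzian_lder[OF z] l l' sq by (simp add: algebra_simps del: of_nat_add)
qed

end

lemma poly_ratio_bounded:
  fixes p q :: "complex poly"
  assumes "p \<noteq> 0" "q = 0 \<or> degree q + k \<le> degree p"
  shows "\<exists>C R. \<forall>z. norm z \<ge> R \<longrightarrow> poly p z \<noteq> 0 \<and> norm (z ^ k * (poly q z / poly p z)) \<le> C"
proof -
  have nz: "\<forall>\<^sub>F z in at_infinity. poly p z / z ^ degree p \<noteq> 0"
    using poly_divide_tendsto_aux[of p] assms(1) by (intro tendsto_imp_eventually_ne) auto
  define d where "d = degree p - degree q - k"
  have "((\<lambda>z. (poly q z / z ^ degree q) / (poly p z / z ^ degree p)) \<longlongrightarrow> lead_coeff q / lead_coeff p) at_infinity"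
    using assms(1) by (intro tendsto_divide poly_divide_tendsto_aux) auto
  hence "\<forall>\<^sub>F z in at_infinity. norm ((poly q z / z ^ degree q) / (poly p z / z ^ degree p)) < norm (lead_coeff q / lead_coeff p) + 1"
    by (intro order_tendstoD(2)[OF tendsto_norm]) auto
  hence "\<forall>\<^sub>F z in at_infinity. poly p z \<noteq> 0 \<and> norm (z ^ k * (poly q z / poly p z)) \<le> norm (lead_coeff q / lead_coeff p) + 1"
    using nz eventually_at_infinityI[of 1 "\<lambda>z :: complex. norm z \<ge> 1", simplified]
  proof eventually_elim
    case (elim z)
    have z: "z \<noteq> 0" using elim by auto
    show ?case
    proof (cases "q = 0")
      case False
      hence "degree p = degree q + k + d" using assms(2) by (simp add: d_def)
      hence "z ^ degree p = z ^ degree q * z ^ k * z ^ d" by (simp add: power_add)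
      hence "(poly q z / z ^ degree q) / (poly p z / z ^ degree p) = z ^ k * (poly q z / poly p z) * z ^ d"
        using z by simp
      hence "norm (z ^ k * (poly q z / poly p z)) * 1 \<le> norm ((poly q z / z ^ degree q) / (poly p z / z ^ degree p))"
        using elim(3) unfolding norm_mult[of "_ * _" "z ^ d"]
        by (simp only: norm_mult norm_power) (intro mult_left_mono one_le_power, auto)
      thus ?thesis using elim by auto
    qed (use elim in auto)
  qed
  then obtain R where "\<forall>z. norm z \<ge> R \<longrightarrow> poly p z \<noteq> 0 \<and> norm (z ^ k * (poly q z / poly p z)) \<le> norm (lead_coeff q / lead_coeff p) + 1"
    unfolding eventually_at_infinity by blast
  thus ?thesis by blast
qed

lemma pderiv_ratio_bounded:
  fixes p :: "complex poly"
  assumes "p \<noteq> 0"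
  shows "\<exists>C R. \<forall>z. norm z \<ge> R \<longrightarrow> poly p z \<noteq> 0 \<and> norm (z * (poly (pderiv p) z / poly p z)) \<le> C"
    "\<exists>C R. \<forall>z. norm z \<ge> R \<longrightarrow> poly p z \<noteq> 0 \<and> norm (z\<^sup>2 * (poly (pderiv (pderiv p)) z / poly p z)) \<le> C"
proof -
  have "pderiv p = 0 \<or> degree (pderiv p) + 1 \<le> degree p"
    by (auto simp: degree_pderiv pderiv_eq_0_iff)
  from poly_ratio_bounded[OF assms this] show "\<exists>C R. \<forall>z. norm z \<ge> R \<longrightarrow> poly p z \<noteq> 0 \<and> norm (z * (poly (pderiv p) z / poly p z)) \<le> C"
    by simp
  have "pderiv (pderiv p) = 0 \<or> degree (pderiv (pderiv p)) + 2 \<le> degree p"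
    by (auto simp: degree_pderiv pderiv_eq_0_iff)
  from poly_ratio_bounded[OF assms this] show "\<exists>C R. \<forall>z. norm z \<ge> R \<longrightarrow> poly p z \<noteq> 0 \<and> norm (z\<^sup>2 * (poly (pderiv (pderiv p)) z / poly p z)) \<le> C"
    by simp
qed

context zero_quotient
begin

lemma schwarzian_bounded_part:
  assumes dh: "\<And>z. deriv h z = 2 * (z + a)"
  shows "\<exists>C R. \<forall>z. norm z \<ge> R \<longrightarrow> norm (schwarzian f z + 2 * z\<^sup>2 + 4 * a * z) \<le> C"
proof -
  have P: "P \<noteq> 0" using P_0 by auto
  obtain C1 R1 where 1: "\<And>z. norm z \<ge> R1 \<Longrightarrow> poly P z \<noteq> 0 \<and> norm (z * (poly (pderiv P) z / poly P z)) \<le> C1"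
    using pderiv_ratio_bounded(1)[OF P] by blast
  obtain C2 R2 where 2: "\<And>z. norm z \<ge> R2 \<Longrightarrow> norm (z\<^sup>2 * (poly (pderiv (pderiv P)) z / poly P z)) \<le> C2"
    using pderiv_ratio_bounded(2)[OF P] by blast
  define R where "R = Max {1, R1, R2}"
  define C0 where "C0 = of_nat (n + 1) + 2 * C1"
  define C where "C = 2 + 2 * norm a ^ 2 + 2 * (1 + norm a) * C0 + C0 ^ 2 / 2 + of_nat (n + 1) + 2 * C2 + 2 * C1 ^ 2"
  have "norm (schwarzian f z + 2 * z\<^sup>2 + 4 * a * z) \<le> C" if "norm z \<ge> R" for z
  proof -
    have z: "norm z \<ge> 1" "norm z \<ge> R1" "norm z \<ge> R2" using that by (auto simp: R_def)
    hence z0: "z \<noteq> 0" "poly P z \<noteq> 0" using 1 by auto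
    define p1 where "p1 = poly (pderiv P) z / poly P z"
    define p2 where "p2 = poly (pderiv (pderiv P)) z / poly P z"
    define r where "r = of_nat (n + 1) / z + 2 * p1"
    have zp1: "norm (z * p1) \<le> C1" and zp2: "norm (z\<^sup>2 * p2) \<le> C2"
      using 1 2 z by (auto simp: p1_def p2_def)
    have ge: "norm x \<le> norm (z * x)" for x
      using z(1) mult_right_mono[of 1 "norm z" "norm x"] by (simp add: norm_mult)
    have p1: "norm p1 \<le> C1" using ge[of p1] zp1 by linarith
    have p2: "norm p2 \<le> C2" using ge[of p2] ge[of "z * p2"] zp2 by (simp add: power2_eq_square mult.assoc)
    have zr: "norm (z * r) \<le> C0"
    proof -
      have "z * r = of_nat (n + 1) + 2 * (z * p1)" using z0 by (simp add: r_def field_simps)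
      also have "norm \<dots> \<le> norm (of_nat (n + 1) :: complex) + norm (2 * (z * p1))" by (rule norm_triangle_ineq)
      also have "\<dots> \<le> C0" using zp1 unfolding C0_def norm_of_nat norm_mult[of 2] by simp
      finally show ?thesis .
    qed
    have r: "norm r \<le> C0" using ge[of r] zr by linarith
    have C0: "C0 \<ge> 0" using r norm_ge_zero order.trans by blast
    have C1: "C1 \<ge> 0" using p1 norm_ge_zero order.trans by blast
    have b1: "norm (2 * (z + a) * r) \<le> 2 * (1 + norm a) * C0"
    proof -
      have "2 * (z + a) * r = 2 * (z * r) + 2 * (a * r)" by (simp add: algebra_simps)
      also have "norm \<dots> \<le> 2 * norm (z * r) + 2 * (norm a * norm r)"
        by (rule order.trans[OF norm_triangle_ineq]) (simp add: norm_mult)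
      also have "\<dots> \<le> 2 * C0 + 2 * (norm a * C0)"
        using zr r by (intro add_mono mult_left_mono) auto
      finally show ?thesis by (simp add: algebra_simps)
    qed
    have b2: "norm (r\<^sup>2 / 2) \<le> C0\<^sup>2 / 2"
      using r power_mono[OF r, of 2] by (simp add: norm_power norm_divide)
    have b3: "norm (of_nat (n + 1) / z\<^sup>2) \<le> of_nat (n + 1)"
    proof -
      have "norm (z\<^sup>2) \<ge> 1" using z(1) by (simp add: norm_power)
      hence "real (n + 1) / norm (z\<^sup>2) \<le> real (n + 1) / 1" by (intro divide_left_mono) auto
      thus ?thesis by (simp add: norm_divide del: of_nat_Suc of_nat_add) 
    qed
    have b4: "norm (2 * p1\<^sup>2) \<le> 2 * C1\<^sup>2"
      using power_mono[OF p1, of 2] by (simp add: norm_power norm_mult)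
    have b5: "norm (2 - 2 * a\<^sup>2) \<le> 2 + 2 * (norm a)\<^sup>2"
      by (rule order.trans[OF norm_triangle_ineq4]) (simp add: norm_mult norm_power)
    have "schwarzian f z + 2 * z\<^sup>2 + 4 * a * z = (2 - 2 * a\<^sup>2) + 2 * (z + a) * r - r\<^sup>2 / 2 + of_nat (n + 1) / z\<^sup>2 - 2 * p2 + 2 * p1\<^sup>2"
      unfolding lder_quadratic[OF dh z0] r_def p1_def p2_def by (simp del: of_nat_add of_nat_Suc)
    also have "norm \<dots> \<le> norm (2 - 2 * a\<^sup>2) + norm (2 * (z + a) * r) + norm (r\<^sup>2 / 2) + norm (of_nat (n + 1) / z\<^sup>2) + norm (2 * p2) + norm (2 * p1\<^sup>2)"
      by (intro norm_triangle_le norm_triangle_le_diff add_mono order.refl)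
    also have "\<dots> \<le> C"
      using b1 b2 b3 b4 b5 p2 unfolding C_def norm_mult[of 2 p2] by simp
    finally show ?thesis .
  qed
  thus ?thesis by blast
qed

lemma schwarzian_bigo:
  assumes dh: "\<And>z. deriv h z = 2 * (z + a)"
  shows "(\<lambda>z. schwarzian f z + 2 * z\<^sup>2) \<in> O[at_infinity](\<lambda>z. z)"
proof -
  obtain C R where CR: "\<And>z. norm z \<ge> R \<Longrightarrow> norm (schwarzian f z + 2 * z\<^sup>2 + 4 * a * z) \<le> C"
    using schwarzian_bounded_part[OF dh] by blast
  have "\<forall>\<^sub>F z in at_infinity. norm (schwarzian f z + 2 * z\<^sup>2) \<le> (\<bar>C\<bar> + 4 * norm a) * norm z"
  proof (rule eventually_at_infinityI[of "max 1 R"])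
    fix z :: complex assume z: "norm z \<ge> max 1 R"
    have "schwarzian f z + 2 * z\<^sup>2 = (schwarzian f z + 2 * z\<^sup>2 + 4 * a * z) - 4 * a * z" by simp
    also have "norm \<dots> \<le> C + 4 * norm a * norm z"
      using CR[of z] z by (intro order.trans[OF norm_triangle_ineq4] add_mono) (auto simp: norm_mult)
    also have "C \<le> \<bar>C\<bar> * norm z" using z by (smt (verit) max.bounded_iff mult_left_le mult_le_cancel_left1)
    finally show "norm (schwarzian f z + 2 * z\<^sup>2) \<le> (\<bar>C\<bar> + 4 * norm a) * norm z" by (simp add: algebra_simps)
  qed
  thus ?thesis by (rule bigoI)
qed

text \<open>
  The Schwarzian derivative has at most a double pole at the origin and quadratic growth at infinity,
  so \<open>z\<^sup>2\<close> times it is a polynomial by Liouville's theorem.  Its Laurent polynomial at the origin can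
  therefore be read off at infinity.
\<close>

lemma schwarzian_coeff_1:
  assumes dh: "\<And>z. deriv h z = 2 * (z + a)"
  shows "schwarzian_coeff f 1 = - 4 * a"
proof -
  obtain C R where CR: "\<And>z. norm z \<ge> R \<Longrightarrow> norm (schwarzian f z + 2 * z\<^sup>2 + 4 * a * z) \<le> C"
    using schwarzian_bounded_part[OF dh] by blast
  define D where "D = (\<lambda>z. z\<^sup>2 * (schwarzian f z + 2 * z\<^sup>2 + 4 * a * z))"
  have Dhol: "D holomorphic_on UNIV - {0}"
  proof -
    have "schwarzian f holomorphic_on UNIV - {0}"
      using schwarzian_analytic by (intro analytic_imp_holomorphic) (subst analytic_on_analytic_at, auto)
    thus ?thesis unfolding D_def by (intro holomorphic_intros)
  qed
  have "\<exists>l. (D \<longlongrightarrow> l) (at 0)"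
  proof -
    define g where "g = (\<lambda>z. 2 * z\<^sup>2 + 2 * (z + a) * (of_nat (n + 1) * z + 2 * z\<^sup>2 * (poly (pderiv P) z / poly P z)) - 2 * a\<^sup>2 * z\<^sup>2
       - (of_nat (n + 1) + 2 * z * (poly (pderiv P) z / poly P z))\<^sup>2 / 2 + of_nat (n + 1)
       - 2 * z\<^sup>2 * (poly (pderiv (pderiv P)) z / poly P z) + 2 * z\<^sup>2 * (poly (pderiv P) z / poly P z)\<^sup>2)"
    have "isCont g 0" unfolding g_def using P_0 by (intro continuous_intros) auto
    hence "g \<midarrow>0\<rightarrow> g 0" by (rule isContD)
    moreover have "\<forall>\<^sub>F z in at 0. D z = g z"
    proof -
      have "\<forall>\<^sub>F w in at 0. poly P w \<noteq> 0"
        using P_0 by (intro tendsto_imp_eventually_ne[of _ "poly P 0"]) (auto intro!: tendsto_intros)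
      moreover have "\<forall>\<^sub>F w in at 0. w \<noteq> (0::complex)" by (auto simp: eventually_at_filter)
      ultimately show ?thesis
      proof eventually_elim
        case (elim z)
        define p1 where "p1 = poly (pderiv P) z / poly P z"
        define p2 where "p2 = poly (pderiv (pderiv P)) z / poly P z"
        define N where "N = (of_nat (n + 1) :: complex)"
        show ?case unfolding D_def lder_quadratic[OF dh elim(2,1)] g_def
          unfolding p1_def[symmetric] p2_def[symmetric] N_def[symmetric]
          using elim(2) by (simp add: field_simps power2_eq_square)
      qed
    qed
    ultimately show ?thesis by (metis tendsto_cong)
  qed
  then obtain l where l: "(D \<longlongrightarrow> l) (at 0)" by blast
  define E where "E = (\<lambda>z. if z = 0 then l else D z)"
  have Ehol: "E holomorphic_on UNIV"
    unfolding E_def using removable_singularity[of D UNIV 0 l] Dhol l by simp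
  have Ebd: "norm (E z) \<le> C * norm z ^ 2" if "max 1 R \<le> norm z" for z
  proof -
    have "norm (E z) = norm z ^ 2 * norm (schwarzian f z + 2 * z\<^sup>2 + 4 * a * z)"
      using that by (auto simp: E_def D_def norm_mult norm_power)
    also have "\<dots> \<le> norm z ^ 2 * C" using CR[of z] that by (intro mult_left_mono) auto
    finally show ?thesis by (simp add: mult.commute)
  qed
  define c where "c = (\<lambda>k. (deriv ^^ k) E 0 / fact k)"
  have c: "E z = (\<Sum>k\<le>2. c k * z ^ k)" for z
    using Liouville_polynomial[OF Ehol, of "max 1 R" C 2] Ebd by (simp add: c_def)
  define F where "F = fls_const (- 2) * fls_X\<^sup>2 + fls_const (- 4 * a) * fls_X + fls_const (c 2) + fls_const (c 1) * fls_X_inv + fls_const (c 0) * fls_X_inv\<^sup>2"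
  have "(\<lambda>z. - 2 * z\<^sup>2 + - 4 * a * z + c 2 + c 1 * inverse z + c 0 * (inverse z)\<^sup>2) has_laurent_expansion F"
    unfolding F_def by (intro laurent_expansion_intros has_laurent_expansion_fls_X_inv)
  moreover have ev: "\<forall>\<^sub>F z in at 0. - 2 * z\<^sup>2 + - 4 * a * z + c 2 + c 1 * inverse z + c 0 * (inverse z)\<^sup>2 = schwarzian f z"
  proof -
    have "\<forall>\<^sub>F w in at 0. w \<noteq> (0::complex)" by (auto simp: eventually_at_filter)
    thus ?thesis
    proof eventually_elim
      case (elim z)
      have "z\<^sup>2 * (schwarzian f z + 2 * z\<^sup>2 + 4 * a * z) = c 0 + c 1 * z + c 2 * z\<^sup>2"
        using c[of z] elim by (simp add: E_def D_def numeral_2_eq_2)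
      hence "schwarzian f z + 2 * z\<^sup>2 + 4 * a * z = (c 0 + c 1 * z + c 2 * z\<^sup>2) / z\<^sup>2"
        using elim by (simp add: field_simps)
      also have "\<dots> = c 2 + c 1 * inverse z + c 0 * (inverse z)\<^sup>2"
        using elim by (simp add: field_simps power2_eq_square)
      finally show ?case by (simp add: algebra_simps)
    qed
  qed
  ultimately have "schwarzian f has_laurent_expansion F"
    using has_laurent_expansion_cong[OF ev refl] by simp
  hence "laurent_expansion (schwarzian f) 0 = F" by (rule laurent_expansion_0_eqI)
  thus ?thesis unfolding schwarzian_coeff_def F_def
    by simp
qed

end

section \<open>The primitive of the Gaussian\<close>

lemma gauss_prim_exists:
  "\<exists>q. q 0 = 0 \<and> (\<forall>w. (q has_field_derivative exp (w\<^sup>2)) (at (w :: complex)))"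
proof -
  have "(\<lambda>w :: complex. exp (w\<^sup>2)) holomorphic_on UNIV" by (intro holomorphic_intros)
  then obtain g where g: "\<And>w. (g has_field_derivative exp (w\<^sup>2)) (at (w :: complex))"
    using holomorphic_convex_primitive'[of UNIV "\<lambda>w. exp (w\<^sup>2)"] by auto
  have "((\<lambda>w. g w - g 0) has_field_derivative exp (w\<^sup>2)) (at w)" for w
    by (rule derivative_eq_intros g refl)+ simp
  thus ?thesis by (intro exI[of _ "\<lambda>w. g w - g 0"]) auto
qed

definition gauss_prim :: "complex \<Rightarrow> complex" where
  "gauss_prim = (SOME q. q 0 = 0 \<and> (\<forall>w. (q has_field_derivative exp (w\<^sup>2)) (at w)))"

lemma gauss_prim_0 [simp]: "gauss_prim 0 = 0"
  and gauss_prim_deriv: "(gauss_prim has_field_derivative exp (w\<^sup>2)) (at w)"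
  using someI_ex[OF gauss_prim_exists] unfolding gauss_prim_def by auto

lemma gauss_prim_minus: "gauss_prim (- w) = - gauss_prim w"
proof -
  have "((\<lambda>w. gauss_prim w + gauss_prim (- w)) has_field_derivative 0) (at w)" for w
    by (rule derivative_eq_intros gauss_prim_deriv DERIV_chain2[OF gauss_prim_deriv] refl)+ simp
  then obtain c where c: "\<And>w. gauss_prim w + gauss_prim (- w) = c"
    using has_field_derivative_zero_constant[of UNIV "\<lambda>w. gauss_prim w + gauss_prim (- w)"] by auto
  from c[of 0] c[of w] show ?thesis by (simp add: add_eq_0_iff)
qed

text \<open>
  Moving away from the real axis along a vertical line only adds a real part \<open>- t\<^sup>2 - 2 t \<bar>Im w\<bar>\<close> to \<open>w\<^sup>2\<close>.
\<close>

lemma exp_vertical_le: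
  assumes \<sigma>: "\<sigma> = 1 \<or> \<sigma> = - 1" and "\<sigma> * Im w \<ge> 0" "t \<ge> 0"
  shows "norm (exp ((w + \<i> * of_real (\<sigma> * t))\<^sup>2)) \<le> norm (exp (w\<^sup>2)) * inverse (1 + t\<^sup>2)"
    and "norm (exp ((w + \<i> * of_real (\<sigma> * t))\<^sup>2)) \<le> norm (exp (w\<^sup>2)) * exp (- t\<^sup>2)"
proof -
  have "Re ((w + \<i> * of_real (\<sigma> * t))\<^sup>2) = Re (w\<^sup>2) - 2 * t * (\<sigma> * Im w) - t\<^sup>2"
    using \<sigma> by (auto simp: power2_eq_square algebra_simps)
  also have "\<dots> \<le> Re (w\<^sup>2) - t\<^sup>2" using assms by simp
  finally have "exp (Re ((w + \<i> * of_real (\<sigma> * t))\<^sup>2)) \<le> exp (Re (w\<^sup>2)) * exp (- t\<^sup>2)"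
    by (simp flip: exp_add)
  thus 1: "norm (exp ((w + \<i> * of_real (\<sigma> * t))\<^sup>2)) \<le> norm (exp (w\<^sup>2)) * exp (- t\<^sup>2)"
    by simp
  have "exp (- t\<^sup>2) \<le> inverse (1 + t\<^sup>2)"
    using exp_ge_add_one_self[of "t\<^sup>2"] unfolding exp_minus
    by (intro le_imp_inverse_le) (auto simp: add_pos_nonneg)
  hence "norm (exp (w\<^sup>2)) * exp (- t\<^sup>2) \<le> norm (exp (w\<^sup>2)) * inverse (1 + t\<^sup>2)"
    by (intro mult_left_mono) auto
  with 1 show "norm (exp ((w + \<i> * of_real (\<sigma> * t))\<^sup>2)) \<le> norm (exp (w\<^sup>2)) * inverse (1 + t\<^sup>2)"
    by linarith
qed

text \<open>
  The mean value theorem in the form that compares with \<open>arctan\<close>: on the vertical line the derivative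
  is dominated by a multiple of \<open>1 / (1 + t\<^sup>2)\<close>.
\<close>

lemma vertical_increment:
  fixes F b :: "complex \<Rightarrow> complex"
  assumes \<sigma>: "\<sigma> = 1 \<or> \<sigma> = - 1" and w: "\<sigma> * Im (z + a) \<ge> 0" and T: "T > 0"
    and d: "\<And>t. t \<ge> 0 \<Longrightarrow> (F has_field_derivative exp ((z + a + \<i> * of_real (\<sigma> * t))\<^sup>2) * b (z + \<i> * of_real (\<sigma> * t))) (at (z + \<i> * of_real (\<sigma> * t)))"
    and bd: "\<And>t. t \<ge> 0 \<Longrightarrow> norm (b (z + \<i> * of_real (\<sigma> * t))) \<le> M"
  shows "norm (F (z + \<i> * of_real (\<sigma> * T)) - F z) \<le> M * norm (exp ((z + a)\<^sup>2)) * arctan T"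
proof -
  define E where "E = norm (exp ((z + a)\<^sup>2))"
  define \<gamma> where "\<gamma> = (\<lambda>t::real. z + \<i> * of_real (\<sigma> * t))"
  have g: "(\<gamma> has_vector_derivative \<i> * of_real \<sigma>) (at t)" for t
    unfolding \<gamma>_def by (auto intro!: derivative_eq_intros simp: has_vector_derivative_def scaleR_conv_of_real algebra_simps)
  have Fg: "((F \<circ> \<gamma>) has_vector_derivative (\<i> * of_real \<sigma>) * (exp ((z + a + \<i> * of_real (\<sigma> * t))\<^sup>2) * b (\<gamma> t))) (at t)" if "t \<ge> 0" for t
    using field_vector_diff_chain_at[OF g[of t], of F] d[OF that] by (simp add: \<gamma>_def)
  have "norm ((F \<circ> \<gamma>) T - (F \<circ> \<gamma>) 0) \<le> M * E * arctan T - M * E * arctan 0"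
  proof (rule differentiable_bound_general[OF T])
    show "continuous_on {0..T} (\<lambda>t. M * E * arctan t)" by (intro continuous_intros)
    show "continuous_on {0..T} (F \<circ> \<gamma>)"
      using has_vector_derivative_continuous[OF Fg] by (intro continuous_at_imp_continuous_on) simp
    fix t :: real assume t: "0 < t" "t < T"
    show "((F \<circ> \<gamma>) has_vector_derivative (\<i> * of_real \<sigma>) * (exp ((z + a + \<i> * of_real (\<sigma> * t))\<^sup>2) * b (\<gamma> t))) (at t)"
      using Fg t by simp
    show "((\<lambda>t. M * E * arctan t) has_vector_derivative M * E * inverse (1 + t\<^sup>2)) (at t)"
      unfolding has_real_derivative_iff_has_vector_derivative[symmetric]
      by (rule derivative_eq_intros refl)+ simp
    have "norm ((\<i> * of_real \<sigma>) * (exp ((z + a + \<i> * of_real (\<sigma> * t))\<^sup>2) * b (\<gamma> t)))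
       = norm (exp ((z + a + \<i> * of_real (\<sigma> * t))\<^sup>2)) * norm (b (\<gamma> t))"
      using \<sigma> by (auto simp: norm_mult)
    also have "\<dots> \<le> (E * inverse (1 + t\<^sup>2)) * M"
      using exp_vertical_le(1)[OF \<sigma> w, of t] bd[of t] t
      by (intro mult_mono) (auto simp: E_def \<gamma>_def)
    finally show "norm ((\<i> * of_real \<sigma>) * (exp ((z + a + \<i> * of_real (\<sigma> * t))\<^sup>2) * b (\<gamma> t))) \<le> M * E * inverse (1 + t\<^sup>2)"
      by (simp add: mult_ac)
  qed
  thus ?thesis by (simp add: \<gamma>_def E_def)
qed

text \<open>
  A function with a Gaussian factor in its derivative that tends to zero along a vertical line is itself
  of Gaussian size; this replaces all estimates of contour integrals below.
\<close>

lemma vertical_decay: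
  fixes F b :: "complex \<Rightarrow> complex"
  assumes \<sigma>: "\<sigma> = 1 \<or> \<sigma> = - 1" and w: "\<sigma> * Im (z + a) \<ge> 0"
    and d: "\<And>t. t \<ge> 0 \<Longrightarrow> (F has_field_derivative exp ((z + a + \<i> * of_real (\<sigma> * t))\<^sup>2) * b (z + \<i> * of_real (\<sigma> * t))) (at (z + \<i> * of_real (\<sigma> * t)))"
    and bd: "\<And>t. t \<ge> 0 \<Longrightarrow> norm (b (z + \<i> * of_real (\<sigma> * t))) \<le> M"
    and lim: "((\<lambda>t. F (z + \<i> * of_real (\<sigma> * t))) \<longlongrightarrow> 0) at_top"
  shows "norm (F z) \<le> 2 * M * norm (exp ((z + a)\<^sup>2))"
proof -
  define K where "K = 2 * M * norm (exp ((z + a)\<^sup>2))"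
  have M: "M \<ge> 0" using bd[of 0] norm_ge_zero order.trans by blast
  have "norm (F z) \<le> K + norm (F (z + \<i> * of_real (\<sigma> * t)))" if "t > 0" for t
  proof -
    have "norm (F z) \<le> norm (F (z + \<i> * of_real (\<sigma> * t)) - F z) + norm (F (z + \<i> * of_real (\<sigma> * t)))"
      by norm
    moreover have "M * norm (exp ((z + a)\<^sup>2)) * arctan t \<le> M * norm (exp ((z + a)\<^sup>2)) * 2"
      using arctan_ubound[of t] pi_less_4 M by (intro mult_left_mono) auto
    ultimately show ?thesis using vertical_increment[OF \<sigma> w that d bd] by (simp add: K_def)
  qed
  moreover have "((\<lambda>t. K + norm (F (z + \<i> * of_real (\<sigma> * t)))) \<longlongrightarrow> K + 0) at_top"
    using lim by (intro tendsto_intros) (auto simp: tendsto_norm_zero_iff)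
  ultimately show ?thesis
    by (intro tendsto_lowerbound[where f = "\<lambda>t. K + norm (F (z + \<i> * of_real (\<sigma> * t)))" and F = at_top])
       (auto simp: K_def intro!: eventually_at_top_linorderI[of 1])
qed

lemma gauss_prim_imag:
  obtains g :: "real \<Rightarrow> real" where "\<And>t. gauss_prim (\<i> * of_real t) = \<i> * of_real (g t)"
    "\<And>t. (g has_real_derivative exp (- t\<^sup>2)) (at t)"
proof -
  define g where "g = (\<lambda>t. Im (gauss_prim (\<i> * of_real t)))"
  define k where "k = (\<lambda>t. Re (gauss_prim (\<i> * of_real t)))"
  have D: "((\<lambda>t. gauss_prim (\<i> * of_real t)) has_vector_derivative \<i> * of_real (exp (- t\<^sup>2))) (at t)" for t :: real
  proof -
    have "((\<lambda>t::real. \<i> * of_real t) has_vector_derivative \<i>) (at t)"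
      by (auto intro!: derivative_eq_intros simp: has_vector_derivative_def scaleR_conv_of_real)
    from field_vector_diff_chain_at[OF this gauss_prim_deriv] show ?thesis
      by (simp add: o_def power_mult_distrib exp_of_real[symmetric])
  qed
  have "(g has_real_derivative exp (- t\<^sup>2)) (at t)" for t
    using bounded_linear.has_vector_derivative[OF bounded_linear_Im D[of t]] by (simp add: g_def has_real_derivative_iff_has_vector_derivative)
  moreover have "(k has_real_derivative 0) (at t)" for t
    using bounded_linear.has_vector_derivative[OF bounded_linear_Re D[of t]] by (simp add: k_def has_real_derivative_iff_has_vector_derivative)
  hence "k t = k 0" for t by (metis DERIV_const_ratio_const2 DERIV_isconst_all)
  hence "k t = 0" for t by (simp add: k_def)
  hence "gauss_prim (\<i> * of_real t) = \<i> * of_real (g t)" for t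
    by (simp add: complex_eq_iff g_def k_def)
  ultimately show thesis using that by blast
qed

lemma gauss_limit_exists:
  "\<exists>L>0. ((\<lambda>t. gauss_prim (\<i> * of_real t)) \<longlongrightarrow> \<i> * of_real L) at_top"
proof -
  obtain g where g: "\<And>t. gauss_prim (\<i> * of_real t) = \<i> * of_real (g t)"
    and g': "\<And>t. (g has_real_derivative exp (- t\<^sup>2)) (at t)" by (rule gauss_prim_imag) blast
  have mono: "g s < g t" if "s < t" for s t
    using DERIV_pos_imp_increasing[OF that, of g] g' by (meson exp_gt_zero)
  have g0: "g 0 = 0" using g[of 0] by simp
  have bd: "g t \<le> 2" if "t > 0" for t
  proof -
    have "norm (gauss_prim (0 + \<i> * of_real (1 * t)) - gauss_prim 0) \<le> 1 * norm (exp ((0 + 0 :: complex)\<^sup>2)) * arctan t"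
      by (rule vertical_increment[where b = "\<lambda>_. 1"]) (use that gauss_prim_deriv in auto)
    hence "\<bar>g t\<bar> \<le> arctan t" using g[of t] by (simp add: norm_mult)
    thus ?thesis using arctan_ubound[of t] pi_less_4 by linarith
  qed
  define L where "L = (SUP t\<in>{0<..}. g t)"
  have bdd: "bdd_above (g ` {0<..})" using bd by (auto simp: bdd_above_def)
  have le: "g t \<le> L" if "t > 0" for t unfolding L_def using bdd that by (intro cSUP_upper) auto
  have "(g \<longlongrightarrow> L) at_top"
  proof (rule order_tendstoI)
    fix x assume "x < L"
    then obtain t where t: "t > 0" "x < g t"
      unfolding L_def using less_cSUP_iff[OF _ bdd, of x] by auto
    thus "\<forall>\<^sub>F s in at_top. x < g s"
      by (intro eventually_at_top_linorderI[of t]) (metis mono order_less_le_trans order_le_less)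
  next
    fix x assume "L < x"
    moreover have "g s \<le> L" if "s \<ge> 1" for s using le[of s] that by simp
    ultimately have "g s < x" if "s \<ge> 1" for s using that by (meson order_le_less_trans)
    thus "\<forall>\<^sub>F s in at_top. g s < x"
      by (intro eventually_at_top_linorderI[of 1]) auto
  qed
  hence "((\<lambda>t. \<i> * of_real (g t)) \<longlongrightarrow> \<i> * of_real L) at_top" by (intro tendsto_intros)
  moreover have "L > 0" using le[of 1] mono[of 0 1] g0 by simp
  ultimately show ?thesis using g by auto
qed

text \<open>
  The integral of \<open>exp (- t\<^sup>2)\<close> over the positive half-line, obtained as a limit of the primitive.
\<close>

definition gauss_limit :: real where
  "gauss_limit = (SOME L. L > 0 \<and> ((\<lambda>t. gauss_prim (\<i> * of_real t)) \<longlongrightarrow> \<i> * of_real L) at_top)"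

lemma gauss_limit_pos: "gauss_limit > 0"
  and gauss_limit: "((\<lambda>t. gauss_prim (\<i> * of_real t)) \<longlongrightarrow> \<i> * of_real gauss_limit) at_top"
  using someI_ex[OF gauss_limit_exists] unfolding gauss_limit_def by auto

lemma gauss_prim_vertical_limit:
  assumes \<sigma>: "\<sigma> = 1 \<or> \<sigma> = - 1"
  shows "((\<lambda>t. gauss_prim (w + \<i> * of_real (\<sigma> * t))) \<longlongrightarrow> \<i> * of_real (\<sigma> * gauss_limit)) at_top"
proof -
  define x y where "x = Re w" "y = Im w"
  have sh: "filterlim (\<lambda>t. \<sigma> * y + t) at_top at_top"
    by (rule filterlim_tendsto_add_at_top[OF tendsto_const filterlim_ident])
  have "((\<lambda>t. gauss_prim (\<i> * of_real (\<sigma> * t))) \<longlongrightarrow> \<i> * of_real (\<sigma> * gauss_limit)) at_top"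
  proof (cases "\<sigma> = 1")
    case False
    hence "\<sigma> = -1" using \<sigma> by simp
    thus ?thesis using tendsto_minus[OF gauss_limit] by (simp add: gauss_prim_minus)
  qed (use gauss_limit in simp)
  from filterlim_compose[OF this sh]
  have 1: "((\<lambda>t. gauss_prim (\<i> * of_real (\<sigma> * (\<sigma> * y + t)))) \<longlongrightarrow> \<i> * of_real (\<sigma> * gauss_limit)) at_top" .
  have 2: "((\<lambda>t. gauss_prim (w + \<i> * of_real (\<sigma> * t)) - gauss_prim (\<i> * of_real (\<sigma> * (\<sigma> * y + t)))) \<longlongrightarrow> 0) at_top"
  proof (rule Lim_null_comparison)
    show "\<forall>\<^sub>F t in at_top. norm (gauss_prim (w + \<i> * of_real (\<sigma> * t)) - gauss_prim (\<i> * of_real (\<sigma> * (\<sigma> * y + t))))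
        \<le> exp (x\<^sup>2 - (\<sigma> * y + t)\<^sup>2) * \<bar>x\<bar>"
    proof (rule always_eventually, rule allI)
      fix t :: real
      define \<tau> where "\<tau> = \<sigma> * (\<sigma> * y + t)"
      have \<tau>: "\<tau> = y + \<sigma> * t" using \<sigma> by (auto simp: \<tau>_def algebra_simps)
      have w: "w + \<i> * of_real (\<sigma> * t) = Complex x \<tau>" by (simp add: \<tau> x_y_def complex_eq_iff)
      have i: "\<i> * of_real \<tau> = Complex 0 \<tau>" by (simp add: complex_eq_iff)
      have "norm (gauss_prim (Complex x \<tau>) - gauss_prim (Complex 0 \<tau>)) \<le> exp (x\<^sup>2 - \<tau>\<^sup>2) * norm (Complex x \<tau> - Complex 0 \<tau>)"
      proof (rule field_differentiable_bound[where S = "closed_segment (Complex 0 \<tau>) (Complex x \<tau>)"])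
        fix z assume "z \<in> closed_segment (Complex 0 \<tau>) (Complex x \<tau>)"
        then obtain u where u: "0 \<le> u" "u \<le> 1" "z = (1 - u) *\<^sub>R Complex 0 \<tau> + u *\<^sub>R Complex x \<tau>"
          by (auto simp: in_segment)
        have "Im z = (1 - u) * \<tau> + u * \<tau>" by (simp add: u(3))
        hence "Re z = u * x" "Im z = \<tau>" by (simp_all add: u(3) left_diff_distrib)
        hence "Re (z\<^sup>2) = (u * x)\<^sup>2 - \<tau>\<^sup>2" by (simp add: power2_eq_square)
        moreover have "(u * x)\<^sup>2 \<le> x\<^sup>2"
          using u by (simp add: power_mult_distrib mult_left_le_one_le power_le_one)
        ultimately show "norm (exp (z\<^sup>2)) \<le> exp (x\<^sup>2 - \<tau>\<^sup>2)" by simp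
        show "(gauss_prim has_field_derivative exp (z\<^sup>2)) (at z within closed_segment (Complex 0 \<tau>) (Complex x \<tau>))"
          using gauss_prim_deriv by (rule has_field_derivative_at_within)
      qed auto
      moreover have "norm (Complex x \<tau> - Complex 0 \<tau>) = \<bar>x\<bar>" by (simp add: cmod_def)
      moreover have "\<tau>\<^sup>2 = (\<sigma> * y + t)\<^sup>2" using \<sigma> by (auto simp: \<tau>_def power2_commute)
      ultimately show "norm (gauss_prim (w + \<i> * of_real (\<sigma> * t)) - gauss_prim (\<i> * of_real (\<sigma> * (\<sigma> * y + t))))
        \<le> exp (x\<^sup>2 - (\<sigma> * y + t)\<^sup>2) * \<bar>x\<bar>"
        unfolding w \<tau>_def[symmetric] i by simp
    qed
    have "((\<lambda>s. exp (x\<^sup>2 - s\<^sup>2) * \<bar>x\<bar>) \<longlongrightarrow> 0) at_top" by real_asymp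
    from filterlim_compose[OF this sh] show "((\<lambda>t. exp (x\<^sup>2 - (\<sigma> * y + t)\<^sup>2) * \<bar>x\<bar>) \<longlongrightarrow> 0) at_top" .
  qed
  from tendsto_add[OF 2 1] show ?thesis by simp
qed

section \<open>Transcendental singularities of a function with four tracts\<close>

lemma unit_mult_cnj: "norm u = 1 \<Longrightarrow> u * cnj u = 1"
  using complex_norm_square[of u] by simp

text \<open>
  The part of a circle that lies in a half-plane is an arc centred on the axis of the half-plane.
\<close>

lemma connected_arc:
  fixes u :: complex
  assumes u: "norm u = 1" and c: "0 \<le> c" "c \<le> \<rho>" and \<rho>: "\<rho> > 0"
  shows "connected {z. norm (z + a) = \<rho> \<and> Re ((z + a) * cnj u) \<ge> c}"
proof -
  define \<theta> where "\<theta> = arccos (c / \<rho>)"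
  have c1: "- 1 \<le> c / \<rho>" "c / \<rho> \<le> 1"
    using c \<rho> order.trans[of "-1" 0 "c / \<rho>"] by auto
  have uu: "u * cnj u = 1" using u by (rule unit_mult_cnj)
  have "{z. norm (z + a) = \<rho> \<and> Re ((z + a) * cnj u) \<ge> c} = (\<lambda>t. of_real \<rho> * u * cis t - a) ` {- \<theta>..\<theta>}"
  proof (intro equalityI subsetI)
    fix z assume "z \<in> {z. norm (z + a) = \<rho> \<and> Re ((z + a) * cnj u) \<ge> c}"
    hence z: "norm (z + a) = \<rho>" "Re ((z + a) * cnj u) \<ge> c" by auto
    define v where "v = (z + a) * cnj u"
    have nv: "norm v = \<rho>" using z u by (simp add: v_def norm_mult)
    define t where "t = Arg v"
    have v: "v = of_real \<rho> * cis t"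
      using rcis_cmod_Arg[of v] nv by (simp add: t_def rcis_def)
    have t: "\<bar>t\<bar> \<le> pi" using Arg_bounded[of v] by (auto simp: t_def)
    have "c \<le> \<rho> * cos t" using z(2) unfolding v_def[symmetric] v by simp
    hence "c / \<rho> \<le> cos \<bar>t\<bar>" using \<rho> by (simp add: field_simps cos_abs_real)
    moreover have tt: "t \<in> {- \<theta>..\<theta>}" if "\<bar>t\<bar> \<le> \<theta>" using that by auto
    ultimately have "\<bar>t\<bar> \<le> \<theta>" unfolding \<theta>_def using t c1
      by (metis abs_ge_zero arccos_cos arccos_le_mono cos_ge_minus_one cos_le_one abs_le_iff cos_abs_real arccos_le_arccos)
    moreover have "z = of_real \<rho> * u * cis t - a"
    proof -
      have "v * u = z + a" unfolding v_def using uu by (simp add: mult.assoc mult.commute)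
      thus ?thesis unfolding v by (simp add: algebra_simps)
    qed
    ultimately show "z \<in> (\<lambda>t. of_real \<rho> * u * cis t - a) ` {- \<theta>..\<theta>}" using tt by blast
  next
    fix z assume "z \<in> (\<lambda>t. of_real \<rho> * u * cis t - a) ` {- \<theta>..\<theta>}"
    then obtain t where t': "z = of_real \<rho> * u * cis t - a" "t \<in> {- \<theta>..\<theta>}" by (rule imageE)
    hence t: "\<bar>t\<bar> \<le> \<theta>" "z = of_real \<rho> * u * cis t - a" by auto
    have "cos \<theta> \<le> cos \<bar>t\<bar>"
      unfolding \<theta>_def using t c1 by (intro cos_monotone_0_pi_le) (auto simp: \<theta>_def arccos_ubound)
    hence "c / \<rho> \<le> cos t" using c1 by (simp add: \<theta>_def cos_abs_real)
    moreover have "(z + a) * cnj u = of_real \<rho> * cis t"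
    proof -
      have "(z + a) * cnj u = of_real \<rho> * cis t * (u * cnj u)" using t by (simp add: mult_ac)
      thus ?thesis unfolding uu by simp
    qed
    hence "Re ((z + a) * cnj u) = \<rho> * cos t" by simp
    moreover have "norm (z + a) = \<rho>" using t \<rho> u by (simp add: norm_mult)
    ultimately show "z \<in> {z. norm (z + a) = \<rho> \<and> Re ((z + a) * cnj u) \<ge> c}"
      using \<rho> by (simp add: pos_divide_le_eq mult.commute)
  qed
  moreover have "connected ((\<lambda>t. of_real \<rho> * u * cis t - a) ` {- \<theta>..\<theta>})"
    by (intro connected_continuous_image continuous_intros) auto
  ultimately show ?thesis by simp
qed

lemma sqrt_one_plus_sq_pos: "sqrt (1 + (norm z)\<^sup>2) > 0"
  by (simp add: add_pos_nonneg)

lemma chordal_dist_pos: "x \<noteq> y \<Longrightarrow> chordal_dist x y > 0"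
proof (cases x; cases y)
  fix z w assume "x \<noteq> y" "x = Some z" "y = Some w"
  hence "norm (z - w) > 0" by simp
  thus "chordal_dist x y > 0"
    using \<open>x = Some z\<close> \<open>y = Some w\<close> sqrt_one_plus_sq_pos by (simp only: chordal_dist.simps) (intro divide_pos_pos mult_pos_pos)
qed (use sqrt_one_plus_sq_pos in \<open>simp_all only: chordal_dist.simps zero_less_divide_1_iff\<close>, simp)

text \<open>
  Unit vectors on the axes of the four Stokes sectors.
\<close>

definition directions :: "complex set" where
  "directions = {1, -1, \<i>, - \<i>}"

definition tract_value :: "complex \<Rightarrow> complex option" where
  "tract_value u = (if Im u = 0 then Some 0 else Some u)"

text \<open>
  Everything about \<open>f\<close> near infinity that determines its transcendental singularities.  For each
  direction \<open>u\<close> the set \<open>\<Omega>\<close> of points with \<open>\<bar>z + a\<bar> > R\<close> in the half-plane about \<open>u\<close> contains the tract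
  of \<open>u\<close>: on the boundary of \<open>\<Omega>\<close> the function stays away from the asymptotic value (\<open>boundary\<close>), which is
  omitted in \<open>\<Omega>\<close> (\<open>omitted\<close>) and is the limit along the axis (\<open>ray\<close>).  Moving on a circle towards the
  axis keeps the function near the value (\<open>arc\<close>), and far away there is no other place where
  \<open>f\<close> can be near any value \<open>v\<close> on an unbounded connected set (\<open>classify\<close>).
\<close>

locale tracts =
  fixes f :: "complex \<Rightarrow> complex" and a :: complex and R :: real
  assumes cont: "\<And>v. continuous_on UNIV (\<lambda>z. chordal_dist (sphere_map f z) v)"
    and R_pos: "R > 0"
    and boundary: "\<And>u. u \<in> directions \<Longrightarrow> \<exists>\<delta>>0. \<forall>z. R \<le> norm (z + a) \<and> Re ((z + a) * cnj u) \<ge> 0 \<and>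
          (norm (z + a) = R \<or> Re ((z + a) * cnj u) = 0) \<longrightarrow> \<delta> \<le> chordal_dist (sphere_map f z) (tract_value u)"
    and omitted: "\<And>u z. u \<in> directions \<Longrightarrow> R \<le> norm (z + a) \<Longrightarrow> Re ((z + a) * cnj u) \<ge> 0 \<Longrightarrow>
          sphere_map f z \<noteq> tract_value u"
    and arc: "\<And>u r. u \<in> directions \<Longrightarrow> r > 0 \<Longrightarrow> \<exists>r'>0. \<forall>z z'. R \<le> norm (z + a) \<and> 0 < Re ((z + a) * cnj u) \<and>
          chordal_dist (sphere_map f z) (tract_value u) < r' \<and>
          norm (z' + a) = norm (z + a) \<and> Re ((z' + a) * cnj u) \<ge> Re ((z + a) * cnj u) \<longrightarrow>
          chordal_dist (sphere_map f z') (tract_value u) < r"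
    and ray: "\<And>u r. u \<in> directions \<Longrightarrow> r > 0 \<Longrightarrow>
          \<exists>T. \<forall>t\<ge>T. chordal_dist (sphere_map f (of_real t * u - a)) (tract_value u) < r"
    and classify: "\<And>v. \<exists>r0>0. \<exists>R'. \<forall>U. connected U \<and> \<not> bounded U \<and>
          (\<forall>z\<in>U. R' < norm (z + a) \<and> chordal_dist (sphere_map f z) v < r0) \<longrightarrow>
          (\<exists>u\<in>directions. v = tract_value u \<and> (\<forall>z\<in>U. Re ((z + a) * cnj u) > 0))"
begin

abbreviation sub :: "complex option \<Rightarrow> real \<Rightarrow> complex set" where
  "sub v r \<equiv> {z. chordal_dist (sphere_map f z) v < r}"

lemma norm_dir: "u \<in> directions \<Longrightarrow> norm u = 1"
  by (auto simp: directions_def)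

text \<open>
  A radius from which on the axis lies in the preimage of the disc of radius \<open>r\<close>.
\<close>

definition start :: "complex \<Rightarrow> real \<Rightarrow> real" where
  "start u r = (SOME T. T > R \<and> (\<forall>t\<ge>T. chordal_dist (sphere_map f (of_real t * u - a)) (tract_value u) < r))"

lemma start:
  assumes "u \<in> directions" "r > 0"
  shows "start u r > R" "\<And>t. t \<ge> start u r \<Longrightarrow> of_real t * u - a \<in> sub (tract_value u) r"
proof -
  obtain T where "\<forall>t\<ge>T. chordal_dist (sphere_map f (of_real t * u - a)) (tract_value u) < r"
    using ray[OF assms] by blast
  hence "max T (R + 1) > R \<and> (\<forall>t\<ge>max T (R + 1). chordal_dist (sphere_map f (of_real t * u - a)) (tract_value u) < r)"
    by auto
  from someI[of "\<lambda>T. T > R \<and> (\<forall>t\<ge>T. chordal_dist (sphere_map f (of_real t * u - a)) (tract_value u) < r)", OF this]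
  show "start u r > R" "\<And>t. t \<ge> start u r \<Longrightarrow> of_real t * u - a \<in> sub (tract_value u) r"
    unfolding start_def[symmetric] by auto
qed

text \<open>
  The component that contains the far end of the axis.
\<close>

definition tract :: "complex \<Rightarrow> real \<Rightarrow> complex set" where
  "tract u r = (if r \<le> 0 then {} else
     connected_component_set (sub (tract_value u) r) (of_real (start u r) * u - a))"

lemma tract_eq:
  assumes u: "u \<in> directions" "r > 0" "t \<ge> start u r"
  shows "tract u r = connected_component_set (sub (tract_value u) r) (of_real t * u - a)"
proof -
  let ?C = "(\<lambda>t. of_real t * u - a) ` {start u r..}"
  have "connected ?C" by (intro connected_continuous_image continuous_intros) (rule connected_Ici)
  moreover have "?C \<subseteq> sub (tract_value u) r" using start(2)[OF u(1,2)] by blast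
  ultimately have "connected_component (sub (tract_value u) r) (of_real (start u r) * u - a) (of_real t * u - a)"
    unfolding connected_component_def using u(3) by (intro exI[of _ ?C]) auto
  hence "of_real t * u - a \<in> connected_component_set (sub (tract_value u) r) (of_real (start u r) * u - a)"
    by simp
  from connected_component_eq[OF this] show ?thesis using u(2) by (simp add: tract_def)
qed

lemma tract_component:
  assumes "u \<in> directions" "r > 0"
  shows "tract u r \<in> components (sub (tract_value u) r)" "\<And>t. t \<ge> start u r \<Longrightarrow> of_real t * u - a \<in> tract u r"
proof -
  have s: "of_real (start u r) * u - a \<in> sub (tract_value u) r" using start(2)[OF assms] by simp
  thus "tract u r \<in> components (sub (tract_value u) r)"
    using assms unfolding tract_def by (auto simp: components_def)
  fix t assume t: "t \<ge> start u r"
  show "of_real t * u - a \<in> tract u r"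
    unfolding tract_eq[OF assms t] using start(2)[OF assms t] by (simp add: connected_component_refl_eq)
qed

lemma tract_mono:
  assumes "u \<in> directions" "0 < r" "r \<le> s"
  shows "tract u r \<subseteq> tract u s"
proof -
  define t where "t = max (start u r) (start u s)"
  have "tract u r = connected_component_set (sub (tract_value u) r) (of_real t * u - a)"
    by (rule tract_eq) (use assms in \<open>auto simp: t_def\<close>)
  moreover have "tract u s = connected_component_set (sub (tract_value u) s) (of_real t * u - a)"
    by (rule tract_eq) (use assms in \<open>auto simp: t_def\<close>)
  ultimately show ?thesis using assms by (auto intro!: connected_component_mono)
qed

text \<open>
  A connected set that meets \<open>\<Omega>\<close> and leaves it must meet its frontier, where \<open>f\<close> is not close to the
  asymptotic value.
\<close>

lemma tract_inside:
  assumes u: "u \<in> directions"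
  obtains \<delta> where "\<delta> > 0" "\<And>r z. r \<le> \<delta> \<Longrightarrow> z \<in> tract u r \<Longrightarrow> R < norm (z + a) \<and> 0 < Re ((z + a) * cnj u)"
proof -
  obtain \<delta> where \<delta>0: "\<delta> > 0" "\<forall>z. R \<le> norm (z + a) \<and> Re ((z + a) * cnj u) \<ge> 0 \<and>
          (norm (z + a) = R \<or> Re ((z + a) * cnj u) = 0) \<longrightarrow> \<delta> \<le> chordal_dist (sphere_map f z) (tract_value u)"
    using boundary[OF u] by (elim exE conjE)
  note \<delta> = \<delta>0(1) \<delta>0(2)[rule_format, OF conjI[OF _ conjI]]
  define \<Omega> where "\<Omega> = {z. R < norm (z + a) \<and> 0 < Re ((z + a) * cnj u)}"
  have op: "open \<Omega>" unfolding \<Omega>_def Collect_conj_eq by (intro open_Int open_Collect_less continuous_intros)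
  have "closed {z. R \<le> norm (z + a) \<and> 0 \<le> Re ((z + a) * cnj u)}"
    unfolding Collect_conj_eq by (intro closed_Int closed_Collect_le continuous_intros)
  hence cl: "closure \<Omega> \<subseteq> {z. R \<le> norm (z + a) \<and> 0 \<le> Re ((z + a) * cnj u)}"
    by (intro closure_minimal) (auto simp: \<Omega>_def)
  have "tract u r \<subseteq> \<Omega>" if r: "0 < r" "r \<le> \<delta>" for r
  proof (rule ccontr)
    assume *: "\<not> tract u r \<subseteq> \<Omega>"
    have con: "connected (tract u r)" using tract_component(1)[OF u r(1)] in_components_connected by blast
    define t where "t = start u r"
    have t: "of_real t * u - a \<in> tract u r" "t > R" using tract_component(2)[OF u r(1)] start(1)[OF u r(1)] by (auto simp: t_def)
    have uu: "u * cnj u = 1" using norm_dir[OF u] by (rule unit_mult_cnj)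
    have "Re ((of_real t * u - a + a) * cnj u) = t" using uu by (simp add: mult.assoc)
    hence "of_real t * u - a \<in> \<Omega>" using t R_pos norm_dir[OF u] by (auto simp: \<Omega>_def norm_mult)
    hence "tract u r \<inter> frontier \<Omega> \<noteq> {}" using con t(1) * by (intro connected_Int_frontier) auto
    then obtain z where z: "z \<in> tract u r" "z \<in> closure \<Omega>" "z \<notin> \<Omega>"
      using op by (auto simp: frontier_def interior_open)
    have "\<delta> \<le> chordal_dist (sphere_map f z) (tract_value u)"
      using z cl by (intro \<delta>(2)) (auto simp: \<Omega>_def)
    moreover have "chordal_dist (sphere_map f z) (tract_value u) < r"
      using z(1) in_components_subset[OF tract_component(1)[OF u r(1)]] by blast
    ultimately show False using r by simp
  qed
  moreover have "tract u r = {}" if "r \<le> 0" for r using that by (simp add: tract_def)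
  ultimately have "tract u r \<subseteq> \<Omega>" if "r \<le> \<delta>" for r using that by (cases "r \<le> 0") auto
  thus thesis using that[of \<delta>] \<delta>(1) by (auto simp: \<Omega>_def)
qed

lemma tract_direct:
  assumes u: "u \<in> directions"
  shows "direct_singularity f (tract_value u) (tract u)"
proof -
  obtain \<delta> where \<delta>: "\<delta> > 0" "\<And>r z. r \<le> \<delta> \<Longrightarrow> z \<in> tract u r \<Longrightarrow> R < norm (z + a) \<and> 0 < Re ((z + a) * cnj u)"
    using tract_inside[OF u] by blast
  have om: "sphere_map f z \<noteq> tract_value u" if "z \<in> tract u \<delta>" for z
    using omitted[OF u, of z] \<delta>(2)[OF order.refl that] by auto
  have "(\<Inter>r\<in>{0<..}. tract u r) = {}"
  proof (rule ccontr)
    assume "(\<Inter>r\<in>{0<..}. tract u r) \<noteq> {}"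
    then obtain z where z: "\<And>r. r > 0 \<Longrightarrow> z \<in> tract u r" by auto
    have "chordal_dist (sphere_map f z) (tract_value u) < r" if "r > 0" for r
      using z[OF that] in_components_subset[OF tract_component(1)[OF u that]] by blast
    hence "chordal_dist (sphere_map f z) (tract_value u) \<le> 0"
      by (rule dense_ge[OF less_imp_le])
    moreover have "chordal_dist (sphere_map f z) (tract_value u) > 0"
      by (rule chordal_dist_pos[OF om[OF z[OF \<delta>(1)]]])
    ultimately show False by simp
  qed
  moreover have "\<forall>r>0. tract u r \<in> components (sub (tract_value u) r)"
    using tract_component(1)[OF u] by blast
  moreover have "\<forall>r\<le>0. tract u r = {}" by (simp add: tract_def)
  moreover have "\<forall>r s. 0 < r \<and> r \<le> s \<longrightarrow> tract u r \<subseteq> tract u s"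
    using tract_mono[OF u] by blast
  ultimately have ts: "transcendental_singularity f (tract_value u) (tract u)"
    unfolding transcendental_singularity_def by (intro conjI)
  show ?thesis unfolding direct_singularity_def
    by (intro conjI ts exI[of _ \<delta>] \<delta>(1) ballI om)
qed

text \<open>
  Otherwise the closures of the \<open>U r\<close> have a common point in \<open>K\<close> by compactness.  A component is
  relatively closed, so this point would lie in all \<open>U r\<close>, whose intersection is empty.
\<close>

lemma singularity_escapes:
  assumes U: "transcendental_singularity f v U" and "compact K"
  shows "\<exists>r>0. \<forall>s. 0 < s \<and> s \<le> r \<longrightarrow> U s \<inter> K = {}"
proof (rule ccontr)
  assume not: "\<not> ?thesis"
  have comp: "\<And>r. r > 0 \<Longrightarrow> U r \<in> components (sub v r)" and mono: "\<And>r s. 0 < r \<Longrightarrow> r \<le> s \<Longrightarrow> U r \<subseteq> U s"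
    and int: "(\<Inter>r\<in>{0<..}. U r) = {}"
    using U by (auto simp: transcendental_singularity_def)
  have ne: "U r \<inter> K \<noteq> {}" if "r > 0" for r
    using not that mono by (metis (no_types, lifting) Int_mono bot.extremum_uniqueI order.refl)
  have "K \<inter> (\<Inter>r\<in>{0<..}. closure (U r)) \<noteq> {}"
  proof (rule compact_imp_fip_image[OF \<open>compact K\<close>])
    fix I assume I: "finite I" "I \<subseteq> {0::real<..}"
    show "K \<inter> (\<Inter>r\<in>I. closure (U r)) \<noteq> {}"
    proof (cases "I = {}")
      case True
      thus ?thesis using ne[of 1] by auto
    next
      case False
      hence M: "Min I \<in> I" "\<And>r. r \<in> I \<Longrightarrow> Min I \<le> r" using I by auto
      hence "U (Min I) \<subseteq> closure (U r)" if "r \<in> I" for r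
        using mono[of "Min I" r] I that closure_subset by blast
      thus ?thesis using ne[of "Min I"] M I by blast
    qed
  qed auto
  then obtain z where z: "\<And>r. r > 0 \<Longrightarrow> z \<in> closure (U r)" by auto
  have zd: "chordal_dist (sphere_map f z) v \<le> r" if r: "r > 0" for r
  proof -
    have "closed {z. chordal_dist (sphere_map f z) v \<le> r}"
      using cont[of v] by (intro closed_Collect_le continuous_intros) auto
    moreover have "U r \<subseteq> {z. chordal_dist (sphere_map f z) v \<le> r}"
      using in_components_subset[OF comp[OF r]] by auto
    ultimately show ?thesis using z[OF r] closure_minimal by blast
  qed
  have "z \<in> U r" if r: "r > 0" for r
  proof -
    have "connected (insert z (U r))"
      by (rule connected_intermediate_closure[of "U r"])
         (use z[OF r] in_components_connected[OF comp[OF r]] closure_subset in auto)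
    moreover have "insert z (U r) \<subseteq> sub v r"
      using zd[of "r / 2"] r in_components_subset[OF comp[OF r]] by auto
    moreover have "U r \<inter> insert z (U r) \<noteq> {}" using ne[OF r] by auto
    ultimately have "insert z (U r) \<subseteq> U r" using components_maximal[OF comp[OF r]] by blast
    thus ?thesis by simp
  qed
  thus False using int by auto
qed

text \<open>
  For small \<open>r\<close> the set \<open>U r\<close> is unbounded, connected and far out, so \<open>classify\<close> finds its direction.
  From any of its points an arc of a circle leads to the axis inside a slightly larger preimage, so that
  the two components agree.
\<close>

lemma singularity_is_tract:
  assumes U: "transcendental_singularity f v U"
  shows "\<exists>u\<in>directions. v = tract_value u \<and> U = tract u"
proof -
  have comp: "\<And>r. r > 0 \<Longrightarrow> U r \<in> components (sub v r)" and mono: "\<And>r s. 0 < r \<Longrightarrow> r \<le> s \<Longrightarrow> U r \<subseteq> U s"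
    and neg: "\<And>r. r \<le> 0 \<Longrightarrow> U r = {}"
    using U by (auto simp: transcendental_singularity_def)
  have unb: "\<not> bounded (U r)" if r: "r > 0" for r
  proof
    assume "bounded (U r)"
    hence "compact (closure (U r))" by simp
    then obtain s where s: "s > 0" "\<And>t. 0 < t \<Longrightarrow> t \<le> s \<Longrightarrow> U t \<inter> closure (U r) = {}"
      using singularity_escapes[OF U] by meson
    define t where "t = min r s"
    have "U t \<inter> closure (U r) = {}" using s r by (auto simp: t_def)
    moreover have "U t \<subseteq> U r" using mono[of t r] r s by (auto simp: t_def)
    moreover have "U t \<noteq> {}" using in_components_nonempty[OF comp[of t]] r s by (auto simp: t_def)
    ultimately show False using closure_subset by blast
  qed
  have esc: "\<exists>r>0. \<forall>s z. 0 < s \<and> s \<le> r \<and> z \<in> U s \<longrightarrow> \<rho> < norm (z + a)" for \<rho>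
  proof -
    obtain r where r: "r > 0" "\<And>s. 0 < s \<Longrightarrow> s \<le> r \<Longrightarrow> U s \<inter> cball (-a) \<rho> = {}"
      using singularity_escapes[OF U compact_cball] by meson
    have "\<rho> < norm (z + a)" if "0 < s" "s \<le> r" "z \<in> U s" for s z
    proof -
      have "z \<notin> cball (-a) \<rho>" using r(2)[of s] that by blast
      thus ?thesis by (simp add: dist_norm norm_minus_commute[of "-a"] )
    qed
    thus ?thesis using r(1) by blast
  qed
  obtain r0 R' where r0: "r0 > 0" "\<And>U. connected U \<Longrightarrow> \<not> bounded U \<Longrightarrow>
          (\<forall>z\<in>U. R' < norm (z + a) \<and> chordal_dist (sphere_map f z) v < r0) \<Longrightarrow>
          (\<exists>u\<in>directions. v = tract_value u \<and> (\<forall>z\<in>U. Re ((z + a) * cnj u) > 0))"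
    using classify[of v] by blast
  obtain r1 where r1: "r1 > 0" "\<And>s z. 0 < s \<Longrightarrow> s \<le> r1 \<Longrightarrow> z \<in> U s \<Longrightarrow> R' < norm (z + a)"
    using esc by meson
  define r2 where "r2 = min r0 r1"
  have r2: "r2 > 0" using r0 r1 by (simp add: r2_def)
  have "\<forall>z\<in>U r2. R' < norm (z + a) \<and> chordal_dist (sphere_map f z) v < r0"
    using r1(2)[of r2] r2 in_components_subset[OF comp[OF r2]] by (auto simp: r2_def)
  then obtain u where u: "u \<in> directions" "v = tract_value u" "\<And>z. z \<in> U r2 \<Longrightarrow> Re ((z + a) * cnj u) > 0"
    using r0(2)[of "U r2"] unb[OF r2] in_components_connected[OF comp[OF r2]] by blast
  have nu: "norm u = 1" using norm_dir u by blast
  have "U r = tract u r" for r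
  proof (cases "r > 0")
    case r: True
    obtain r' where r': "r' > 0" "\<And>z z'. R \<le> norm (z + a) \<Longrightarrow> 0 < Re ((z + a) * cnj u) \<Longrightarrow>
          chordal_dist (sphere_map f z) (tract_value u) < r' \<Longrightarrow>
          norm (z' + a) = norm (z + a) \<Longrightarrow> Re ((z' + a) * cnj u) \<ge> Re ((z + a) * cnj u) \<Longrightarrow>
          chordal_dist (sphere_map f z') (tract_value u) < r"
      using arc[OF u(1) r] by meson
    obtain r3 where r3: "r3 > 0" "\<And>s z. 0 < s \<Longrightarrow> s \<le> r3 \<Longrightarrow> z \<in> U s \<Longrightarrow> max R (start u r) < norm (z + a)"
      using esc by meson
    \<comment> \<open>Small enough to be in the half-plane (\<open>r2\<close>), beyond the start of the axis (\<open>r3\<close>) and to apply \<open>arc\<close> (\<open>r'\<close>).\<close>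
    define r4 where "r4 = min (min r r') (min r2 r3)"
    have r4: "r4 > 0" "r4 \<le> r" "r4 \<le> r'" "r4 \<le> r2" "r4 \<le> r3" using r r' r2 r3 by (auto simp: r4_def)
    obtain z where z: "z \<in> U r4" using in_components_nonempty[OF comp[OF r4(1)]] by blast
    define \<rho> where "\<rho> = norm (z + a)"
    define c where "c = Re ((z + a) * cnj u)"
    have \<rho>: "\<rho> \<ge> R" "\<rho> \<ge> start u r" using r3(2)[OF r4(1,5) z] by (auto simp: \<rho>_def)
    have c: "c > 0" using u(3)[of z] z mono[OF r4(1,4)] by (auto simp: c_def)
    have c\<rho>: "c \<le> \<rho>" using complex_Re_le_cmod[of "(z + a) * cnj u"] nu by (simp add: c_def \<rho>_def norm_mult)
    have dz: "chordal_dist (sphere_map f z) (tract_value u) < r'"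
      using in_components_subset[OF comp[OF r4(1)]] z r4(3) u(2) by auto
    define C where "C = {z'. norm (z' + a) = \<rho> \<and> Re ((z' + a) * cnj u) \<ge> c}"
    have "connected C" unfolding C_def
      by (rule connected_arc) (use nu c c\<rho> \<rho> R_pos in auto)
    moreover have "C \<subseteq> sub v r"
      using r'(2)[of z] \<rho> c dz u(2) by (auto simp: C_def \<rho>_def c_def)
    moreover have "z \<in> C" by (simp add: C_def \<rho>_def c_def)
    moreover have "of_real \<rho> * u - a \<in> C"
    proof -
      have uu: "u * cnj u = 1" using nu by (rule unit_mult_cnj)
      have "Re ((of_real \<rho> * u - a + a) * cnj u) = \<rho>" using uu by (simp add: mult.assoc)
      thus ?thesis using nu c\<rho> by (simp add: C_def norm_mult \<rho>_def)
    qed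
    ultimately have cc: "connected_component (sub v r) z (of_real \<rho> * u - a)"
      unfolding connected_component_def by blast
    have "z \<in> U r" using z mono[OF r4(1,2)] by blast
    moreover obtain x where "U r = connected_component_set (sub v r) x"
      using comp[OF r] unfolding components_iff by blast
    ultimately have "U r = connected_component_set (sub v r) z"
      using connected_component_eq[of z "sub v r" x] by simp
    also have "\<dots> = connected_component_set (sub v r) (of_real \<rho> * u - a)"
      using connected_component_eq[of "of_real \<rho> * u - a" "sub v r" z] cc by simp
    also have "\<dots> = tract u r" using tract_eq[OF u(1) r \<rho>(2)] u(2) by simp
    finally show ?thesis .
  next
    case False
    thus ?thesis using neg[of r] by (simp add: tract_def)
  qed
  thus ?thesis using u by auto
qed

lemma tract_inj: "inj_on (\<lambda>u. (tract_value u, tract u)) directions"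
proof (rule inj_onI)
  fix u u' assume u: "u \<in> directions" "u' \<in> directions" "(tract_value u, tract u) = (tract_value u', tract u')"
  show "u = u'"
  proof (rule ccontr)
    assume ne: "u \<noteq> u'"
    have v: "tract_value u = tract_value u'" "tract u = tract u'" using u(3) by auto
    have uv: "u' = - u"
      using u(1,2) v(1) ne by (auto simp: directions_def tract_value_def)
    obtain \<delta> where \<delta>: "\<delta> > 0" "\<And>r z. r \<le> \<delta> \<Longrightarrow> z \<in> tract u r \<Longrightarrow> R < norm (z + a) \<and> 0 < Re ((z + a) * cnj u)"
      using tract_inside[OF u(1)] by blast
    obtain \<delta>' where \<delta>': "\<delta>' > 0" "\<And>r z. r \<le> \<delta>' \<Longrightarrow> z \<in> tract u' r \<Longrightarrow> R < norm (z + a) \<and> 0 < Re ((z + a) * cnj u')"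
      using tract_inside[OF u(2)] by blast
    define r where "r = min \<delta> \<delta>'"
    have r: "r > 0" "r \<le> \<delta>" "r \<le> \<delta>'" using \<delta> \<delta>' by (auto simp: r_def)
    obtain z where z: "z \<in> tract u r" using in_components_nonempty[OF tract_component(1)[OF u(1) r(1)]] by blast
    show False using \<delta>(2)[OF r(2) z] \<delta>'(2)[OF r(3), of z] z v(2) uv by simp
  qed
qed

theorem singularities:
  shows "card {(v, U). transcendental_singularity f v U} = 4"
    and "transcendental_singularity f v U \<Longrightarrow> direct_singularity f v U"
    and "card {U. transcendental_singularity f (Some 0) U} = 2"
proof -
  have ts: "transcendental_singularity f (tract_value u) (tract u)" if "u \<in> directions" for u
    using tract_direct[OF that] by (simp add: direct_singularity_def)
  have "{(v, U). transcendental_singularity f v U} = (\<lambda>u. (tract_value u, tract u)) ` directions"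
    using singularity_is_tract ts by blast
  moreover have "card directions = 4"
    by (auto simp: directions_def complex_eq_iff card_insert_if)
  ultimately show "card {(v, U). transcendental_singularity f v U} = 4"
    using card_image[OF tract_inj] by simp
  show "transcendental_singularity f v U \<Longrightarrow> direct_singularity f v U"
    using singularity_is_tract tract_direct by blast
  have *: "tract_value u = Some 0 \<longleftrightarrow> u \<in> {1, -1}" if "u \<in> directions" for u
    using that by (auto simp: directions_def tract_value_def complex_eq_iff)
  have "{U. transcendental_singularity f (Some 0) U} = tract ` {1, -1}"
  proof (intro equalityI subsetI)
    fix U assume "U \<in> {U. transcendental_singularity f (Some 0) U}"
    then obtain u where "u \<in> directions" "Some 0 = tract_value u" "U = tract u"
      using singularity_is_tract[of "Some 0" U] by auto
    thus "U \<in> tract ` {1, -1}" using * by (metis image_eqI)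
  next
    fix U assume "U \<in> tract ` {1, -1}"
    then obtain u where u: "u \<in> {1, -1}" "U = tract u" by blast
    have ud: "u \<in> directions" using u(1) by (auto simp: directions_def)
    have "tract_value u = Some 0" using *[OF ud] u(1) by simp
    thus "U \<in> {U. transcendental_singularity f (Some 0) U}" using ts[OF ud] u(2) by simp
  qed
  moreover have "tract 1 \<noteq> tract (- 1)"
  proof
    assume "tract 1 = tract (- 1)"
    hence "(1 :: complex) = - 1"
      by (intro inj_onD[OF tract_inj]) (simp_all add: directions_def tract_value_def)
    thus False by simp
  qed
  ultimately show "card {U. transcendental_singularity f (Some 0) U} = 2" by simp
qed

end

section \<open>Asymptotics of solutions of the Wronskian equation\<close>

lemma poly_ratio_tendsto:
  fixes p q :: "complex poly"
  assumes "p \<noteq> 0" "degree q \<le> degree p"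
  shows "((\<lambda>z. poly q z / poly p z) \<longlongrightarrow> coeff q (degree p) / lead_coeff p) at_infinity"
proof (cases "degree q < degree p")
  case True
  thus ?thesis using poly_divide_tendsto_0_at_infinity[OF True] by (simp add: coeff_eq_0)
next
  case False
  hence deg: "degree q = degree p" using assms by simp
  have "((\<lambda>z. (poly q z / z ^ degree q) / (poly p z / z ^ degree p)) \<longlongrightarrow> lead_coeff q / lead_coeff p) at_infinity"
    using assms(1) by (intro tendsto_divide poly_divide_tendsto_aux) auto
  moreover have "\<forall>\<^sub>F z in at_infinity. (poly q z / z ^ degree q) / (poly p z / z ^ degree p) = poly q z / poly p z"
    by (rule eventually_at_infinityI[of 1]) (auto simp: deg)
  ultimately show ?thesis unfolding deg by (rule Lim_transform_eventually)
qed

text \<open>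
  The number \<open>N\<close> is the order of decay of \<open>z ^ (n - 1) / ((z + a) * A\<^sup>2)\<close>, where \<open>A\<close> has degree \<open>d\<close>.
\<close>

locale gauss_solution =
  fixes a \<kappa> :: complex and n d N :: nat and A s :: "complex poly"
  assumes wronskian: "gauss_wronskian a 1 A s = monom \<kappa> (n - 1)" and \<kappa>: "\<kappa> \<noteq> 0"
    and monic: "lead_coeff A = 1" and degree_A: "degree A = d"
    and n: "n \<ge> 1" "n \<le> d + 1" and N: "N + n = 2 * d + 2"
begin

lemma A_nz: "A \<noteq> 0"
  using monic by auto

lemma wronskian_eval:
  "(poly A z)\<^sup>2 + poly (pderiv s) z * poly A z - poly s z * poly (pderiv A) z + 2 * (z + a) * poly s z * poly A z = \<kappa> * z ^ (n - 1)"
  using arg_cong[OF wronskian, of "\<lambda>p. poly p z"] by (simp add: gauss_wronskian_def poly_monom algebra_simps)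

lemma s_over_A_tendsto: "((\<lambda>z. poly s z / poly A z) \<longlongrightarrow> 0) at_infinity"
proof (cases "s = 0")
  case False
  have "degree s < d"
  proof (rule ccontr)
    assume "\<not> degree s < d"
    have e: "gauss_wronskian a 1 A s = A\<^sup>2 + gauss_wronskian a 0 A s"
      by (simp add: gauss_wronskian_def)
    have d0: "degree (gauss_wronskian a 0 A s) = Suc (d + degree s)"
      using degree_gauss_wronskian_0[OF False A_nz] degree_A by simp
    hence "degree (A\<^sup>2) < degree (gauss_wronskian a 0 A s)"
      using \<open>\<not> degree s < d\<close> degree_A by (simp add: degree_power_eq A_nz)
    hence "degree (gauss_wronskian a 1 A s) = Suc (d + degree s)"
      unfolding e using d0 by (simp add: degree_add_eq_right)
    moreover have "degree (gauss_wronskian a 1 A s) = n - 1"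
      using \<kappa> by (simp add: wronskian degree_monom_eq)
    ultimately show False using n by simp
  qed
  thus ?thesis using poly_divide_tendsto_0_at_infinity[of s A] degree_A by simp
qed simp

text \<open>
  Up to a constant factor this is the quotient of the denominator and the numerator of a Nevanlinna
  function.
\<close>

definition G :: "complex \<Rightarrow> complex" where
  "G z = gauss_prim (z + a) + poly s z / poly A z * exp ((z + a)\<^sup>2)"

text \<open>
  The first term of the asymptotic expansion: \<open>2 * (z + a) * \<rho> * exp ((z + a)\<^sup>2)\<close> is the derivative
  of \<open>G\<close>, so \<open>\<rho> * exp ((z + a)\<^sup>2)\<close> is a primitive of it up to the error term with \<open>\<rho>'\<close>.
\<close>

definition \<rho> :: "complex \<Rightarrow> complex" where
  "\<rho> z = \<kappa> * z ^ (n - 1) / (2 * (z + a) * (poly A z)\<^sup>2)"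

definition \<rho>' :: "complex \<Rightarrow> complex" where
  "\<rho>' z = \<rho> z * (of_nat (n - 1) / z - 1 / (z + a) - 2 * poly (pderiv A) z / poly A z)"

lemma G_deriv:
  assumes "poly A z \<noteq> 0"
  shows "(G has_field_derivative \<kappa> * z ^ (n - 1) / (poly A z)\<^sup>2 * exp ((z + a)\<^sup>2)) (at z)"
proof -
  have aux: "X * 1 + ((s' * b - s * b') / (b * b) * X + X * (2 * w) * (s / b)) = (b\<^sup>2 + s' * b - s * b' + 2 * w * s * b) / b\<^sup>2 * X"
    if "b \<noteq> 0" for X s s' b b' w :: complex
    using that by (simp add: field_simps power2_eq_square)
  have q: "((\<lambda>z. gauss_prim (z + a)) has_field_derivative exp ((z + a)\<^sup>2) * 1) (at z)"
    by (rule DERIV_chain2[OF gauss_prim_deriv]) (auto intro!: derivative_eq_intros)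
  have e: "((\<lambda>z. exp ((z + a)\<^sup>2)) has_field_derivative exp ((z + a)\<^sup>2) * (2 * (z + a))) (at z)"
    by (rule derivative_eq_intros refl)+ simp
  show ?thesis
    unfolding wronskian_eval[symmetric] aux[OF assms, symmetric] G_def[abs_def]
    by (intro DERIV_add DERIV_mult q e DERIV_divide poly_DERIV assms)
qed

lemma \<rho>_mult:
  assumes "z + a \<noteq> 0"
  shows "2 * (z + a) * \<rho> z = \<kappa> * z ^ (n - 1) / (poly A z)\<^sup>2"
proof -
  define v where "v = z + a"
  show ?thesis using assms unfolding \<rho>_def v_def[symmetric] by simp
qed

lemma \<rho>_deriv:
  assumes "poly A z \<noteq> 0" "z + a \<noteq> 0" "z \<noteq> 0"
  shows "(\<rho> has_field_derivative \<rho>' z) (at z)"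
proof -
  define W where "W = (\<lambda>w::complex. w ^ (n - 1))"
  have W': "(W has_field_derivative of_nat (n - 1) * inverse z * W z) (at z)"
    unfolding W_def by (rule derivative_eq_intros refl)+ (use assms in \<open>cases "n - 1"; simp\<close>)
  have v': "((\<lambda>z. inverse (z + a)) has_field_derivative - (inverse (z + a) * 1 * inverse (z + a))) (at z)"
    by (rule DERIV_inverse') (use assms in \<open>auto intro!: derivative_eq_intros\<close>)
  have A': "((\<lambda>z. inverse (poly A z)) has_field_derivative - (inverse (poly A z) * poly (pderiv A) z * inverse (poly A z))) (at z)"
    by (rule DERIV_inverse'[OF poly_DERIV assms(1)])
  define D where "D = (\<kappa> / 2) * (of_nat (n - 1) * inverse z * W z * (inverse (z + a) * (inverse (poly A z) * inverse (poly A z)))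
       + (- (inverse (z + a) * 1 * inverse (z + a)) * (inverse (poly A z) * inverse (poly A z))
          + (- (inverse (poly A z) * poly (pderiv A) z * inverse (poly A z)) * inverse (poly A z)
             + - (inverse (poly A z) * poly (pderiv A) z * inverse (poly A z)) * inverse (poly A z)) * inverse (z + a)) * W z)"
  have "((\<lambda>z. (\<kappa> / 2) * (W z * (inverse (z + a) * (inverse (poly A z) * inverse (poly A z))))) has_field_derivative D) (at z)"
    unfolding D_def by (rule DERIV_cmult[OF DERIV_mult[OF W' DERIV_mult[OF v' DERIV_mult[OF A' A']]]])
  moreover have eq: "(\<kappa> / 2) * (W z * (inverse (z + a) * (inverse (poly A z) * inverse (poly A z)))) = \<rho> z" for z
  proof -
    have aux: "(c / 2) * (X * (inverse v * (inverse b * inverse b))) = c * X / (2 * v * b\<^sup>2)" for c X v b :: complex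
      by (simp only: divide_inverse power2_eq_square inverse_mult_distrib mult_ac)
    show ?thesis unfolding aux W_def \<rho>_def ..
  qed
  moreover have "D = \<rho>' z"
  proof -
    have a1: "(- (vi * 1 * vi) * (bi * bi)
          + (- (bi * b' * bi) * bi + - (bi * b' * bi) * bi) * vi)
       = (vi * (bi * bi)) * (- vi - 2 * b' * bi)" for vi bi b' :: complex
      by (simp add: algebra_simps)
    have a2: "c * (m * zi * X * Y + (Y * e) * X) = c * (X * Y) * (m * zi + e)" for c m zi X Y e :: complex
      by (simp add: algebra_simps)
    have "D = \<rho> z * (of_nat (n - 1) * inverse z + (- inverse (z + a) - 2 * poly (pderiv A) z * inverse (poly A z)))"
      unfolding D_def a1 a2 eq ..
    thus ?thesis by (simp only: \<rho>'_def divide_inverse mult_1_left diff_conv_add_uminus add.assoc)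
  qed
  ultimately show ?thesis by (simp only:)
qed

lemma \<rho>_tendsto: "((\<lambda>z. (z + a) ^ N * \<rho> z) \<longlongrightarrow> \<kappa> / 2) at_infinity"
proof -
  define Q where "Q = monom 1 (n - 1) * shift_var a ^ (N - 1)"
  have N1: "N \<ge> 1" using N n by simp
  have sh: "lead_coeff (shift_var a) = 1" by (simp add: shift_var_def)
  have dQ: "degree Q = 2 * d"
    using N n N1 by (simp add: Q_def degree_mult_eq degree_power_eq degree_monom_eq)
  have lQ: "lead_coeff Q = 1" 
    unfolding Q_def lead_coeff_mult lead_coeff_power sh by (simp add: degree_monom_eq)
  have dA: "degree (A\<^sup>2) = 2 * d" by (simp add: degree_power_eq A_nz degree_A)
  have "((\<lambda>z. poly Q z / poly (A\<^sup>2) z) \<longlongrightarrow> coeff Q (degree (A\<^sup>2)) / lead_coeff (A\<^sup>2)) at_infinity"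
    by (rule poly_ratio_tendsto) (use dA dQ A_nz in auto)
  also have "coeff Q (degree (A\<^sup>2)) / lead_coeff (A\<^sup>2) = 1"
  proof -
    have "lead_coeff (A\<^sup>2) = 1" unfolding lead_coeff_power monic by simp
    thus ?thesis using dA dQ lQ by simp
  qed
  finally have "((\<lambda>z. \<kappa> / 2 * (poly Q z / poly (A\<^sup>2) z)) \<longlongrightarrow> \<kappa> / 2 * 1) at_infinity"
    by (rule tendsto_mult_left)
  moreover have "\<forall>\<^sub>F z in at_infinity. \<kappa> / 2 * (poly Q z / poly (A\<^sup>2) z) = (z + a) ^ N * \<rho> z"
  proof (rule eventually_at_infinityI[of "norm a + 1"])
    fix z :: complex assume "norm z \<ge> norm a + 1"
    hence "z + a \<noteq> 0" by (metis add.inverse_inverse add_eq_0_iff2 norm_minus_cancel add.commute le_add_same_cancel1 not_one_le_zero add_le_same_cancel1)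
    moreover define v where "v = z + a"
    moreover have "v ^ N = v ^ (N - 1) * v" using N1 by (metis power_minus_mult less_eq_Suc_le One_nat_def)
    moreover have "poly Q z = z ^ (n - 1) * v ^ (N - 1)" by (simp add: Q_def v_def poly_monom add.commute)
    ultimately show "\<kappa> / 2 * (poly Q z / poly (A\<^sup>2) z) = (z + a) ^ N * \<rho> z"
      unfolding \<rho>_def v_def[symmetric] by simp
  qed
  ultimately show ?thesis by (simp add: tendsto_cong)
qed

lemma \<rho>'_bound:
  "\<exists>C R. \<forall>z. norm z \<ge> R \<longrightarrow> poly A z \<noteq> 0 \<and> z \<noteq> 0 \<and> z + a \<noteq> 0 \<and> norm (\<rho>' z) \<le> C / norm (z + a) ^ Suc N"
proof -
  have t1: "((\<lambda>z. of_nat (n - 1) * (poly (shift_var a) z / poly (monom 1 1) z)) \<longlongrightarrow>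
      of_nat (n - 1) * (coeff (shift_var a) (degree (monom (1::complex) 1)) / lead_coeff (monom 1 1))) at_infinity"
    by (intro tendsto_mult_left poly_ratio_tendsto) (auto simp: degree_monom_eq)
  have t2: "((\<lambda>z. poly (shift_var a) z / poly (shift_var a) z) \<longlongrightarrow>
       coeff (shift_var a) (degree (shift_var a)) / lead_coeff (shift_var a)) at_infinity"
    by (intro poly_ratio_tendsto) auto
  have t3: "((\<lambda>z. 2 * (poly (shift_var a * pderiv A) z / poly A z)) \<longlongrightarrow>
       2 * (coeff (shift_var a * pderiv A) (degree A) / lead_coeff A)) at_infinity"
  proof (intro tendsto_mult_left poly_ratio_tendsto A_nz)
    show "degree (shift_var a * pderiv A) \<le> degree A"
    proof (cases "pderiv A = 0")
      case False
      hence "degree A \<noteq> 0" by (simp add: pderiv_eq_0_iff)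
      thus ?thesis using False by (simp add: degree_mult_eq degree_pderiv)
    qed simp
  qed
  from tendsto_diff[OF tendsto_diff[OF t1 t2] t3] obtain c where c: "((\<lambda>z. of_nat (n - 1) * (poly (shift_var a) z / poly (monom 1 1) z) - poly (shift_var a) z / poly (shift_var a) z
      - 2 * (poly (shift_var a * pderiv A) z / poly A z)) \<longlongrightarrow> c) at_infinity"
    by blast
  have "((\<lambda>z. (z + a) ^ N * \<rho> z * (of_nat (n - 1) * (poly (shift_var a) z / poly (monom 1 1) z) - poly (shift_var a) z / poly (shift_var a) z
      - 2 * (poly (shift_var a * pderiv A) z / poly A z))) \<longlongrightarrow> \<kappa> / 2 * c) at_infinity"
    by (intro tendsto_mult \<rho>_tendsto c)
  hence "\<forall>\<^sub>F z in at_infinity. norm ((z + a) ^ N * \<rho> z * (of_nat (n - 1) * (poly (shift_var a) z / poly (monom 1 1) z) - poly (shift_var a) z / poly (shift_var a) z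
      - 2 * (poly (shift_var a * pderiv A) z / poly A z))) < norm (\<kappa> / 2 * c) + 1"
    by (intro order_tendstoD(2)[OF tendsto_norm]) auto
  moreover have "\<forall>\<^sub>F z in at_infinity. poly A z \<noteq> 0"
  proof -
    have "\<forall>\<^sub>F z in at_infinity. poly A z / z ^ degree A \<noteq> 0"
      using poly_divide_tendsto_aux[of A] monic by (intro tendsto_imp_eventually_ne) auto
    thus ?thesis by eventually_elim auto
  qed
  moreover have "\<forall>\<^sub>F z in at_infinity. z + a \<noteq> 0 \<and> z \<noteq> 0"
  proof (rule eventually_at_infinityI[of "norm a + 1"])
    fix z :: complex assume z: "norm z \<ge> norm a + 1"
    have "norm (z + a) \<ge> norm z - norm a" by (metis norm_diff_ineq)
    moreover have "norm z > 0" using z norm_ge_zero[of a] by linarith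
    ultimately show "z + a \<noteq> 0 \<and> z \<noteq> 0" using z by auto
  qed
  ultimately have "\<forall>\<^sub>F z in at_infinity. poly A z \<noteq> 0 \<and> z \<noteq> 0 \<and> z + a \<noteq> 0 \<and> norm (\<rho>' z) \<le> (norm (\<kappa> / 2 * c) + 1) / norm (z + a) ^ Suc N"
  proof eventually_elim
    case (elim z)
    define w where "w = z + a"
    have "(z + a) ^ N * \<rho> z * (of_nat (n - 1) * (poly (shift_var a) z / poly (monom 1 1) z) - poly (shift_var a) z / poly (shift_var a) z
      - 2 * (poly (shift_var a * pderiv A) z / poly A z)) = w ^ Suc N * \<rho>' z"
    proof -
      have sv: "poly (shift_var a) z = w" "poly (monom 1 1) z = z" "poly (shift_var a * pderiv A) z = w * poly (pderiv A) z"
        by (simp_all add: w_def poly_monom add.commute)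
      have "w \<noteq> 0" using elim by (simp add: w_def)
      thus ?thesis unfolding sv unfolding \<rho>'_def w_def[symmetric] by (simp add: algebra_simps)
    qed
    hence "norm w ^ Suc N * norm (\<rho>' z) \<le> norm (\<kappa> / 2 * c) + 1" using elim(1) by (simp add: norm_mult norm_power)
    moreover have "norm w ^ Suc N > 0" using elim by (auto simp: w_def)
    ultimately show ?case using elim by (simp add: w_def field_simps)
  qed
  thus ?thesis unfolding eventually_at_infinity by blast
qed

text \<open>
  In the upper (\<open>\<sigma> = 1\<close>) and in the lower (\<open>\<sigma> = -1\<close>) half-plane \<open>G\<close> equals a constant plus a term that is
  exponentially large near the real axis and exponentially small near the imaginary axis.  The
  remainder \<open>F = G - const - \<rho> * exp ((z + a)\<^sup>2)\<close> tends to zero along vertical lines and its derivative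
  is smaller than that of \<open>G\<close> by two powers, so \<open>vertical_decay\<close> bounds it.
\<close>

theorem G_asymptotic:
  assumes \<sigma>: "\<sigma> = 1 \<or> \<sigma> = - 1" and \<epsilon>: "\<epsilon> > 0"
  shows "\<exists>R. \<forall>z. norm (z + a) \<ge> R \<and> \<sigma> * Im (z + a) \<ge> 0 \<longrightarrow>
    norm ((G z - \<i> * of_real (\<sigma> * gauss_limit)) * (z + a) ^ N * exp (- (z + a)\<^sup>2) - \<kappa> / 2) \<le> \<epsilon>"
proof -
  obtain C R1 where CR: "\<And>z. norm z \<ge> R1 \<Longrightarrow> poly A z \<noteq> 0 \<and> z \<noteq> 0 \<and> z + a \<noteq> 0 \<and> norm (\<rho>' z) \<le> C / norm (z + a) ^ Suc N"
    using \<rho>'_bound by blast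
  have "\<forall>\<^sub>F z in at_infinity. dist ((z + a) ^ N * \<rho> z) (\<kappa> / 2) < \<epsilon> / 2"
    by (rule tendstoD[OF \<rho>_tendsto]) (use \<epsilon> in auto)
  then obtain R2 where R2: "\<And>z. norm z \<ge> R2 \<Longrightarrow> dist ((z + a) ^ N * \<rho> z) (\<kappa> / 2) < \<epsilon> / 2"
    unfolding eventually_at_infinity by blast
  define l where "l = \<i> * of_real (\<sigma> * gauss_limit)"
  define F where "F = (\<lambda>z. G z - l - exp ((z + a)\<^sup>2) * \<rho> z)"
  define R where "R = max (max R1 R2 + norm a) (max 1 (4 * \<bar>C\<bar> / \<epsilon>))"
  show ?thesis
  proof (intro exI[of _ R] allI impI)
    fix z assume z: "norm (z + a) \<ge> R \<and> \<sigma> * Im (z + a) \<ge> 0"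
    define w where "w = z + a"
    define zt where "zt = (\<lambda>t::real. z + \<i> * of_real (\<sigma> * t))"
    have w: "norm w \<ge> 1" "norm w \<ge> 4 * \<bar>C\<bar> / \<epsilon>" "norm w \<ge> R1 + norm a" "norm w \<ge> R2 + norm a"
      using z by (auto simp: R_def w_def)
    have zta: "norm (zt t + a) \<ge> norm w" if "t \<ge> 0" for t
    proof -
      have "\<bar>Im w + \<sigma> * t\<bar> \<ge> \<bar>Im w\<bar>" using \<sigma> z that by (auto simp: w_def abs_if)
      hence "(Im w + \<sigma> * t)\<^sup>2 \<ge> (Im w)\<^sup>2" by (simp add: abs_le_square_iff)
      thus ?thesis by (simp add: zt_def w_def cmod_def algebra_simps)
    qed
    have ztR: "norm (zt t) \<ge> R1" if "t \<ge> 0" for t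
      using zta[OF that] w norm_triangle_ineq[of "zt t" a] by linarith
    have zR: "norm z \<ge> R1" "norm z \<ge> R2" using w norm_triangle_ineq[of z a] by (auto simp: w_def)
    have "norm (F z) \<le> 2 * (\<bar>C\<bar> / norm w ^ Suc N) * norm (exp ((z + a)\<^sup>2))"
    proof (rule vertical_decay[where b = "\<lambda>z. - \<rho>' z" and \<sigma> = \<sigma>])
      fix t :: real assume t: "t \<ge> 0"
      have nz: "poly A (zt t) \<noteq> 0" "zt t \<noteq> 0" "zt t + a \<noteq> 0" "norm (\<rho>' (zt t)) \<le> C / norm (zt t + a) ^ Suc N"
        using CR[OF ztR[OF t]] by auto
      define X where "X = exp ((zt t + a)\<^sup>2)"
      have dX: "((\<lambda>z. exp ((z + a)\<^sup>2)) has_field_derivative X * (2 * (zt t + a))) (at (zt t))"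
        unfolding X_def by (rule derivative_eq_intros refl)+ simp
      have "(F has_field_derivative (\<kappa> * zt t ^ (n - 1) / (poly A (zt t))\<^sup>2 * X - 0) - (X * (2 * (zt t + a)) * \<rho> (zt t) + \<rho>' (zt t) * X)) (at (zt t))"
        unfolding F_def X_def
        by (intro DERIV_diff DERIV_const G_deriv DERIV_mult dX[unfolded X_def] \<rho>_deriv nz)
      moreover have "(\<kappa> * zt t ^ (n - 1) / (poly A (zt t))\<^sup>2 * X - 0) - (X * (2 * (zt t + a)) * \<rho> (zt t) + \<rho>' (zt t) * X) = X * - \<rho>' (zt t)"
        unfolding \<rho>_mult[OF nz(3), symmetric] by (simp add: algebra_simps)
      ultimately have fd: "(F has_field_derivative exp ((zt t + a)\<^sup>2) * - \<rho>' (zt t)) (at (zt t))"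
        by (simp add: X_def mult.commute)
      have eqz: "z + \<i> * of_real (\<sigma> * t) = zt t" "z + a + \<i> * of_real (\<sigma> * t) = zt t + a"
        by (simp_all add: zt_def)
      from fd show "(F has_field_derivative exp ((z + a + \<i> * complex_of_real (\<sigma> * t))\<^sup>2) * - \<rho>' (z + \<i> * complex_of_real (\<sigma> * t)))
          (at (z + \<i> * complex_of_real (\<sigma> * t)))"
        unfolding eqz .
      have "norm (\<rho>' (zt t)) \<le> \<bar>C\<bar> / norm (zt t + a) ^ Suc N"
        by (rule order.trans[OF nz(4)]) (intro divide_right_mono, auto)
      also have "\<dots> \<le> \<bar>C\<bar> / norm w ^ Suc N"
      proof -
        have "norm w ^ Suc N \<le> norm (zt t + a) ^ Suc N" using zta[OF t] by (intro power_mono) auto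
        moreover have "norm w ^ Suc N > 0" using w(1) by (intro zero_less_power) linarith
        ultimately show ?thesis by (intro frac_le) auto
      qed
      finally show "norm (- \<rho>' (z + \<i> * complex_of_real (\<sigma> * t))) \<le> \<bar>C\<bar> / norm w ^ Suc N" by (simp add: zt_def)
    next
      have zt_inf: "filterlim zt at_infinity at_top"
      proof (rule filterlim_norm_at_top_imp_at_infinity, rule filterlim_at_top_mono)
        show "filterlim (\<lambda>t. t - norm z) at_top at_top" by real_asymp
        show "\<forall>\<^sub>F t in at_top. t - norm z \<le> norm (zt t)"
        proof (rule eventually_at_top_linorderI[of 0])
          fix t :: real assume "t \<ge> 0"
          hence "norm (\<i> * of_real (\<sigma> * t)) = t" using \<sigma> by (auto simp: norm_mult)
          thus "t - norm z \<le> norm (zt t)"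
            using norm_diff_ineq[of "\<i> * of_real (\<sigma> * t)" z] by (simp add: zt_def add.commute)
        qed
      qed
      have lim1: "((\<lambda>t. gauss_prim (zt t + a) - l) \<longlongrightarrow> 0) at_top"
        using tendsto_diff[OF gauss_prim_vertical_limit[OF \<sigma>, of "z + a"] tendsto_const[of l]]
        by (simp add: zt_def l_def algebra_simps)
      have "((\<lambda>z. (z + a) ^ N * \<rho> z * (1 / (z + a)) ^ N) \<longlongrightarrow> \<kappa> / 2 * 0 ^ N) at_infinity"
        by (rule tendsto_mult[OF \<rho>_tendsto tendsto_power[OF tendsto_divide_0[OF tendsto_const
              tendsto_add_filterlim_at_infinity'[OF filterlim_ident tendsto_const]]]])
      hence "((\<lambda>z. (z + a) ^ N * \<rho> z * (1 / (z + a)) ^ N) \<longlongrightarrow> 0) at_infinity"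
        using N n by (simp add: power_0_left)
      moreover have "\<forall>\<^sub>F z in at_infinity. (z + a) ^ N * \<rho> z * (1 / (z + a)) ^ N = \<rho> z"
      proof (rule eventually_at_infinityI[of R1])
        fix z :: complex assume "norm z \<ge> R1"
        hence "z + a \<noteq> 0" using CR by blast
        hence "(z + a) ^ N * (1 / (z + a)) ^ N = 1" by (simp add: power_divide)
        thus "(z + a) ^ N * \<rho> z * (1 / (z + a)) ^ N = \<rho> z" by (metis mult.assoc mult.commute mult_1)
      qed
      ultimately have "(\<rho> \<longlongrightarrow> 0) at_infinity" by (simp add: tendsto_cong)
      from tendsto_diff[OF s_over_A_tendsto this]
      have "((\<lambda>z. poly s z / poly A z - \<rho> z) \<longlongrightarrow> 0) at_infinity" by simp
      from filterlim_compose[OF this zt_inf]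
      have lim2: "((\<lambda>t. poly s (zt t) / poly A (zt t) - \<rho> (zt t)) \<longlongrightarrow> 0) at_top" .
      have lim3: "((\<lambda>t. exp ((zt t + a)\<^sup>2) * (poly s (zt t) / poly A (zt t) - \<rho> (zt t))) \<longlongrightarrow> 0) at_top"
      proof (rule Lim_null_comparison)
        have "((\<lambda>t. norm (exp (w\<^sup>2)) * norm (poly s (zt t) / poly A (zt t) - \<rho> (zt t))) \<longlongrightarrow> norm (exp (w\<^sup>2)) * 0) at_top"
          by (intro tendsto_mult_left) (use tendsto_norm[OF lim2] in simp)
        thus "((\<lambda>t. norm (exp (w\<^sup>2)) * norm (poly s (zt t) / poly A (zt t) - \<rho> (zt t))) \<longlongrightarrow> 0) at_top" by simp
        show "\<forall>\<^sub>F t in at_top. norm (exp ((zt t + a)\<^sup>2) * (poly s (zt t) / poly A (zt t) - \<rho> (zt t)))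
            \<le> norm (exp (w\<^sup>2)) * norm (poly s (zt t) / poly A (zt t) - \<rho> (zt t))"
        proof (rule eventually_at_top_linorderI[of 0])
          fix t :: real assume t: "t \<ge> 0"
          have "norm (exp ((w + \<i> * of_real (\<sigma> * t))\<^sup>2)) \<le> norm (exp (w\<^sup>2)) * exp (- t\<^sup>2)"
            using exp_vertical_le(2)[OF \<sigma> _ t, of w] z by (simp add: w_def)
          also have "\<dots> \<le> norm (exp (w\<^sup>2)) * 1" by (intro mult_left_mono) auto
          also have "w + \<i> * of_real (\<sigma> * t) = zt t + a" by (simp add: w_def zt_def)
          finally show "norm (exp ((zt t + a)\<^sup>2) * (poly s (zt t) / poly A (zt t) - \<rho> (zt t)))
            \<le> norm (exp (w\<^sup>2)) * norm (poly s (zt t) / poly A (zt t) - \<rho> (zt t))"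
            unfolding norm_mult by (intro mult_right_mono) auto
        qed
      qed
      have "(\<lambda>t. F (zt t)) = (\<lambda>t. (gauss_prim (zt t + a) - l) + exp ((zt t + a)\<^sup>2) * (poly s (zt t) / poly A (zt t) - \<rho> (zt t)))"
        by (auto simp: F_def G_def algebra_simps)
      with tendsto_add[OF lim1 lim3] show "((\<lambda>t. F (z + \<i> * complex_of_real (\<sigma> * t))) \<longlongrightarrow> 0) at_top"
        by (simp add: zt_def)
    qed (use \<sigma> z in auto)
    hence "norm (F z) * norm w ^ N * norm (exp (- w\<^sup>2)) \<le> 2 * (\<bar>C\<bar> / norm w ^ Suc N) * norm (exp (w\<^sup>2)) * norm w ^ N * norm (exp (- w\<^sup>2))"
      unfolding w_def by (intro mult_right_mono) auto
    also have "\<dots> = 2 * \<bar>C\<bar> / norm w * (norm (exp (w\<^sup>2)) * norm (exp (- w\<^sup>2)))"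
      using w by (auto simp: field_simps)
    also have "norm (exp (w\<^sup>2)) * norm (exp (- w\<^sup>2)) = 1" by (simp flip: norm_mult exp_add)
    finally have Fb: "norm (F z * w ^ N * exp (- w\<^sup>2)) \<le> 2 * \<bar>C\<bar> / norm w" by (simp add: norm_mult norm_power)
    have "4 * \<bar>C\<bar> \<le> norm w * \<epsilon>" using w(2) \<epsilon> by (simp add: pos_divide_le_eq)
    moreover have "norm w > 0" using w(1) by linarith
    ultimately have "4 * \<bar>C\<bar> / norm w \<le> \<epsilon>" by (simp add: pos_divide_le_eq mult.commute)
    hence "2 * \<bar>C\<bar> / norm w \<le> \<epsilon> / 2" by simp
    moreover have "norm (w ^ N * \<rho> z - \<kappa> / 2) < \<epsilon> / 2" using R2[OF zR(2)] by (simp add: dist_norm w_def)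
    moreover have E: "(G z - l) * w ^ N * exp (- w\<^sup>2) - \<kappa> / 2 = F z * w ^ N * exp (- w\<^sup>2) + (w ^ N * \<rho> z - \<kappa> / 2)"
    proof -
      have e1: "exp (w\<^sup>2) * exp (- w\<^sup>2) = 1" by (simp flip: exp_add)
      have "F z * w ^ N * exp (- w\<^sup>2) = (G z - l) * w ^ N * exp (- w\<^sup>2) - (exp (w\<^sup>2) * exp (- w\<^sup>2)) * (w ^ N * \<rho> z)"
      proof -
        have *: "(g - X * r) * W * Y = g * W * Y - (X * Y) * (W * r)" for g X r W Y :: complex
          by (simp add: algebra_simps)
        have "F z = (G z - l) - exp (w\<^sup>2) * \<rho> z" by (simp add: F_def w_def)
        thus ?thesis by (simp only: *)
      qed
      thus ?thesis unfolding e1 by simp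
    qed
    ultimately have "norm ((G z - l) * w ^ N * exp (- w\<^sup>2) - \<kappa> / 2) \<le> \<epsilon>"
      using Fb norm_triangle_ineq[of "F z * w ^ N * exp (- w\<^sup>2)" "w ^ N * \<rho> z - \<kappa> / 2"]
      unfolding E by linarith
    thus "norm ((G z - \<i> * of_real (\<sigma> * gauss_limit)) * (z + a) ^ N * exp (- (z + a)\<^sup>2) - \<kappa> / 2) \<le> \<epsilon>"
      by (simp add: w_def l_def)
  qed
qed

end

section \<open>The four tracts\<close>

lemma sqrt_sum_sq_le: "x \<ge> 0 \<Longrightarrow> y \<ge> 0 \<Longrightarrow> sqrt (x\<^sup>2 + y\<^sup>2) \<le> x + y"
  by (rule real_le_lsqrt) (auto simp: power2_sum)

lemma sqrt_sum_sq_ge: "x \<ge> 0 \<Longrightarrow> y \<ge> 0 \<Longrightarrow> x \<le> sqrt (x\<^sup>2 + y\<^sup>2)" "x \<ge> 0 \<Longrightarrow> y \<ge> 0 \<Longrightarrow> y \<le> sqrt (x\<^sup>2 + y\<^sup>2)"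
  by (auto intro: real_le_rsqrt)

lemma power_le_exp_eventually: "\<exists>T\<ge>1. \<forall>t\<ge>T. t ^ N \<le> exp (t :: real)"
proof -
  have "((\<lambda>t. t ^ N / exp t) \<longlongrightarrow> (0::real)) at_top" by (rule tendsto_power_div_exp_0)
  hence "\<forall>\<^sub>F t in at_top. t ^ N / exp t < (1::real)" by (rule order_tendstoD) simp
  then obtain T where "\<And>t. t \<ge> T \<Longrightarrow> t ^ N / exp t < (1::real)"
    unfolding eventually_at_top_linorder by blast
  thus ?thesis by (intro exI[of _ "max 1 T"]) (auto intro: less_imp_le)
qed

lemma connected_sign:
  fixes g :: "complex \<Rightarrow> real"
  assumes "connected U" "continuous_on U g" "\<And>z. z \<in> U \<Longrightarrow> g z \<noteq> 0"
  shows "(\<forall>z\<in>U. g z > 0) \<or> (\<forall>z\<in>U. g z < 0)"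
proof (rule ccontr)
  assume "\<not> ?thesis"
  then obtain x y where xy: "x \<in> U" "g x \<le> 0" "y \<in> U" "g y \<ge> 0" by (auto simp: not_less)
  have "connected (g ` U)" by (rule connected_continuous_image[OF assms(2,1)])
  hence "0 \<in> g ` U" using xy unfolding connected_iff_interval by blast
  thus False using assms(3) by auto
qed

text \<open>
  A function \<open>- L / G\<close> near infinity whose denominator has the asymptotic behaviour established above.
\<close>

locale gauss_tracts =
  fixes f G :: "complex \<Rightarrow> complex" and a c0 :: complex and L R0 :: real and N :: nat
  assumes L: "L > 0" and c0: "c0 \<noteq> 0"
    and cont: "\<And>v. continuous_on UNIV (\<lambda>z. chordal_dist (sphere_map f z) v)"
    and sph: "\<And>z. norm (z + a) \<ge> R0 \<Longrightarrow> sphere_map f z = (if G z = 0 then None else Some (- of_real L / G z))"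
    and asym: "\<And>z \<sigma>. \<sigma> = 1 \<or> \<sigma> = -1 \<Longrightarrow> norm (z + a) \<ge> R0 \<Longrightarrow> \<sigma> * Im (z + a) \<ge> 0 \<Longrightarrow>
      norm ((G z - \<i> * of_real (\<sigma> * L)) * (z + a) ^ N * exp (- (z + a)\<^sup>2) - c0) \<le> norm c0 / 4"
begin

text \<open>
  The modulus of the exponential term in the asymptotics of \<open>G\<close>.
\<close>

definition M :: "complex \<Rightarrow> real" where
  "M z = exp (Re ((z + a)\<^sup>2)) / norm (z + a) ^ N"

definition R :: real where
  "R = max R0 (SOME T. T \<ge> 1 \<and> (\<forall>t\<ge>T. t ^ N \<le> exp (t :: real)))"

lemma R: "R \<ge> R0" "R \<ge> 1" "\<And>t. t \<ge> R \<Longrightarrow> t ^ N \<le> exp t"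
  using someI_ex[OF power_le_exp_eventually[of N]] unfolding R_def by auto

lemma M_pos: "norm (z + a) \<ge> R \<Longrightarrow> M z > 0"
  using R(2) unfolding M_def by (intro divide_pos_pos zero_less_power) (auto intro: order.strict_trans2)

lemma G_approx:
  assumes \<sigma>: "\<sigma> = 1 \<or> \<sigma> = -1" and z: "norm (z + a) \<ge> R" "\<sigma> * Im (z + a) \<ge> 0"
  shows "norm ((G z - \<i> * of_real (\<sigma> * L)) - c0 * (exp ((z + a)\<^sup>2) / (z + a) ^ N)) \<le> norm c0 / 4 * M z"
proof -
  have w: "norm (z + a) > 0" using z R(2) by linarith
  hence w0: "z + a \<noteq> 0" by auto
  define X where "X = exp ((z + a)\<^sup>2) / (z + a) ^ N"
  have nX: "norm X = M z" by (simp add: X_def M_def norm_divide norm_power)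
  have e1: "exp (- (z + a)\<^sup>2) * exp ((z + a)\<^sup>2) = 1" by (simp flip: exp_add)
  have "(z + a) ^ N * exp (- (z + a)\<^sup>2) * X = (exp (- (z + a)\<^sup>2) * exp ((z + a)\<^sup>2)) * ((z + a) ^ N / (z + a) ^ N)"
    by (simp add: X_def)
  hence e: "(z + a) ^ N * exp (- (z + a)\<^sup>2) * X = 1" using w0 e1 by simp
  have "(G z - \<i> * of_real (\<sigma> * L)) - c0 * X = ((G z - \<i> * of_real (\<sigma> * L)) * ((z + a) ^ N * exp (- (z + a)\<^sup>2) * X)) - c0 * X"
    unfolding e by simp
  also have "\<dots> = ((G z - \<i> * of_real (\<sigma> * L)) * (z + a) ^ N * exp (- (z + a)\<^sup>2) - c0) * X"
    by (simp only: left_diff_distrib mult.assoc)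
  also have "norm \<dots> \<le> norm c0 / 4 * M z"
    unfolding norm_mult nX using asym[OF \<sigma> order.trans[OF R(1) z(1)] z(2)] M_pos[OF z(1)] by (intro mult_right_mono) auto
  finally show ?thesis by (simp add: X_def)
qed

lemma G_bounds:
  assumes \<sigma>: "\<sigma> = 1 \<or> \<sigma> = -1" and z: "norm (z + a) \<ge> R" "\<sigma> * Im (z + a) \<ge> 0"
  shows "norm c0 / 2 * M z \<le> norm (G z - \<i> * of_real (\<sigma> * L))" "norm (G z - \<i> * of_real (\<sigma> * L)) \<le> 2 * norm c0 * M z"
proof -
  have n: "norm (c0 * (exp ((z + a)\<^sup>2) / (z + a) ^ N)) = norm c0 * M z"
    by (simp add: M_def norm_mult norm_divide norm_power)
  have pos: "norm c0 * M z \<ge> 0" using M_pos[OF z(1)] by simp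
  note * = G_approx[OF assms] norm_triangle_ineq2[of "c0 * (exp ((z + a)\<^sup>2) / (z + a) ^ N)" "G z - \<i> * of_real (\<sigma> * L)"]
     norm_triangle_ineq2[of "G z - \<i> * of_real (\<sigma> * L)" "c0 * (exp ((z + a)\<^sup>2) / (z + a) ^ N)"]
     norm_minus_commute[of "c0 * (exp ((z + a)\<^sup>2) / (z + a) ^ N)" "G z - \<i> * of_real (\<sigma> * L)"]
  show "norm c0 / 2 * M z \<le> norm (G z - \<i> * of_real (\<sigma> * L))" using * n pos by simp
  show "norm (G z - \<i> * of_real (\<sigma> * L)) \<le> 2 * norm c0 * M z" using * n pos by simp
qed

lemma G_norm_bounds:
  assumes z: "norm (z + a) \<ge> R"
  shows "norm (G z) \<le> L + 2 * norm c0 * M z" "norm c0 / 2 * M z - L \<le> norm (G z)"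
proof -
  define \<sigma> :: real where "\<sigma> = (if Im (z + a) \<ge> 0 then 1 else -1)"
  have \<sigma>: "\<sigma> = 1 \<or> \<sigma> = -1" "\<sigma> * Im (z + a) \<ge> 0" by (auto simp: \<sigma>_def)
  have l: "norm (\<i> * of_real (\<sigma> * L)) = L" using \<sigma>(1) L by (auto simp: norm_mult)
  note b = G_bounds[OF \<sigma>(1) z \<sigma>(2)]
  show "norm (G z) \<le> L + 2 * norm c0 * M z"
    using b norm_triangle_ineq[of "G z - \<i> * of_real (\<sigma> * L)" "\<i> * of_real (\<sigma> * L)"] l by simp
  show "norm c0 / 2 * M z - L \<le> norm (G z)"
    using b norm_triangle_ineq4[of "G z" "\<i> * of_real (\<sigma> * L)"] l by simp
qed

lemma Re_sq: "Re (w\<^sup>2) = 2 * (Re w)\<^sup>2 - (norm w)\<^sup>2" "Re (w\<^sup>2) = (norm w)\<^sup>2 - 2 * (Im w)\<^sup>2"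
proof -
  have "(norm w)\<^sup>2 = (Re w)\<^sup>2 + (Im w)\<^sup>2" by (rule cmod_power2)
  moreover have "Re (w\<^sup>2) = (Re w)\<^sup>2 - (Im w)\<^sup>2" by (simp add: power2_eq_square)
  ultimately show "Re (w\<^sup>2) = 2 * (Re w)\<^sup>2 - (norm w)\<^sup>2" "Re (w\<^sup>2) = (norm w)\<^sup>2 - 2 * (Im w)\<^sup>2"
    by linarith+
qed

lemma M_Re_0:
  assumes "norm (z + a) \<ge> R" "Re (z + a) = 0" shows "M z \<le> 1"
proof -
  have "exp (Re ((z + a)\<^sup>2)) \<le> 1" using assms(2) by (simp add: Re_sq(1))
  moreover have "norm (z + a) ^ N \<ge> 1" using assms(1) R(2) by (intro one_le_power) linarith
  ultimately have "M z \<le> 1 / 1" unfolding M_def by (intro frac_le) auto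
  thus ?thesis by simp
qed

lemma M_Im_0:
  assumes "norm (z + a) \<ge> R" "Im (z + a) = 0"
  shows "M z \<ge> exp ((norm (z + a))\<^sup>2 - norm (z + a))"
proof -
  have "norm (z + a) ^ N > 0" using assms(1) R(2) by (intro zero_less_power) linarith
  hence "exp ((norm (z + a))\<^sup>2) / exp (norm (z + a)) \<le> exp ((norm (z + a))\<^sup>2) / norm (z + a) ^ N"
    using R(3)[OF assms(1)] by (intro divide_left_mono) auto
  moreover have "Re ((z + a)\<^sup>2) = (norm (z + a))\<^sup>2" using assms(2) by (simp add: Re_sq(2))
  ultimately show ?thesis unfolding M_def by (simp add: exp_diff)
qed

lemma chordal_0:
  assumes "norm (z + a) \<ge> R"
  shows "chordal_dist (sphere_map f z) (Some 0) = L / sqrt (L\<^sup>2 + (norm (G z))\<^sup>2)"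
proof (cases "G z = 0")
  case True
  thus ?thesis using sph[of z] R(1) assms L by simp
next
  case False
  define g where "g = norm (G z)"
  have g: "g > 0" using False by (simp add: g_def)
  have "chordal_dist (sphere_map f z) (Some 0) = (L / g) / sqrt (1 + (L / g)\<^sup>2)"
    using sph[of z] R(1) assms False L by (simp add: norm_divide g_def)
  also have "1 + (L / g)\<^sup>2 = (L\<^sup>2 + g\<^sup>2) / g\<^sup>2" using g by (simp add: field_simps)
  also have "sqrt \<dots> = sqrt (L\<^sup>2 + g\<^sup>2) / g" using g by (simp add: real_sqrt_divide)
  finally show ?thesis using g by (simp add: g_def)
qed

text \<open>
  For \<open>v \<noteq> 0\<close> the function \<open>- L / G\<close> is close to \<open>v\<close> in the chordal metric exactly when \<open>G\<close> is close to
  \<open>tb v\<close>; the factor \<open>tk v\<close> accounts for the distortion of the metric at \<open>v\<close>.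
\<close>

definition tb :: "complex option \<Rightarrow> complex" where
  "tb v = (case v of None \<Rightarrow> 0 | Some c \<Rightarrow> - of_real L / c)"

definition tk :: "complex option \<Rightarrow> real" where
  "tk v = (case v of None \<Rightarrow> 1 | Some c \<Rightarrow> norm c / sqrt (1 + (norm c)\<^sup>2))"

lemma tk_pos: "v \<noteq> Some 0 \<Longrightarrow> tk v > 0"
  using sqrt_one_plus_sq_pos by (auto simp: tk_def split: option.splits intro!: divide_pos_pos)

lemma chordal_nz:
  assumes z: "norm (z + a) \<ge> R" and v: "v \<noteq> Some 0"
  shows "chordal_dist (sphere_map f z) v = tk v * norm (G z - tb v) / sqrt (L\<^sup>2 + (norm (G z))\<^sup>2)"
proof (cases "G z = 0")
  case True
  show ?thesis
  proof (cases v)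
    case (Some c)
    hence "c \<noteq> 0" using v by simp
    thus ?thesis using Some True sph[of z] R(1) z L by (simp add: tk_def tb_def norm_divide)
  qed (use True sph[of z] R(1) z in \<open>simp add: tb_def\<close>)
next
  case False
  define g where "g = norm (G z)"
  have g: "g > 0" using False by (simp add: g_def)
  have q: "sqrt (1 + (L / g)\<^sup>2) = sqrt (L\<^sup>2 + g\<^sup>2) / g"
  proof -
    have "1 + (L / g)\<^sup>2 = (L\<^sup>2 + g\<^sup>2) / g\<^sup>2" using g by (simp add: field_simps)
    thus ?thesis using g by (simp add: real_sqrt_divide)
  qed
  have s: "sphere_map f z = Some (- of_real L / G z)" using sph[of z] R(1) z False by simp
  have n: "norm (- of_real L / G z) = L / g" using L by (simp add: norm_divide g_def)
  show ?thesis
  proof (cases v)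
    case None
    thus ?thesis unfolding s None chordal_dist.simps n q by (simp add: tk_def tb_def g_def)
  next
    case (Some c)
    hence c: "c \<noteq> 0" using v by simp
    have "- of_real L / G z - c = - c * (G z - tb v) / G z" using False c Some by (simp add: tb_def field_simps)
    hence "norm (- of_real L / G z - c) = norm c * norm (G z - tb v) / g" by (simp add: norm_mult norm_divide g_def)
    thus ?thesis unfolding s Some chordal_dist.simps n q using g by (simp add: tk_def g_def)
  qed
qed

lemma chordal_0_less_imp:
  assumes "norm (z + a) \<ge> R" "chordal_dist (sphere_map f z) (Some 0) < r" "r > 0"
  shows "norm (G z) > L / r - L"
proof -
  have s: "sqrt (L\<^sup>2 + (norm (G z))\<^sup>2) > 0" using L by (simp add: add_pos_nonneg)
  have "L < r * sqrt (L\<^sup>2 + (norm (G z))\<^sup>2)"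
    using assms(2) s unfolding chordal_0[OF assms(1)] by (simp add: pos_divide_less_eq)
  also have "\<dots> \<le> r * (L + norm (G z))" using sqrt_sum_sq_le[of L "norm (G z)"] L assms(3) by (intro mult_left_mono) auto
  finally show ?thesis using assms(3) by (simp add: field_simps)
qed

lemma chordal_0_lessI:
  assumes "norm (z + a) \<ge> R" "norm (G z) > L / r" "r > 0"
  shows "chordal_dist (sphere_map f z) (Some 0) < r"
proof -
  have s: "sqrt (L\<^sup>2 + (norm (G z))\<^sup>2) > 0" using L by (simp add: add_pos_nonneg)
  have "L < r * norm (G z)" using assms by (simp add: field_simps)
  also have "\<dots> \<le> r * sqrt (L\<^sup>2 + (norm (G z))\<^sup>2)" using sqrt_sum_sq_ge(2)[of L "norm (G z)"] L assms(3) by (intro mult_left_mono) auto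
  finally show ?thesis unfolding chordal_0[OF assms(1)] using s by (simp add: pos_divide_less_eq)
qed

lemma chordal_nz_less_imp:
  assumes "norm (z + a) \<ge> R" "v \<noteq> Some 0" "chordal_dist (sphere_map f z) v < r" "r \<le> tk v / 2"
  shows "norm (G z - tb v) < 2 * r * (L + norm (tb v)) / tk v"
proof -
  define x where "x = norm (G z - tb v)"
  define k where "k = tk v"
  have k: "k > 0" using tk_pos assms(2) by (simp add: k_def)
  have s: "sqrt (L\<^sup>2 + (norm (G z))\<^sup>2) > 0" using L by (simp add: add_pos_nonneg)
  have kx: "k * x < r * sqrt (L\<^sup>2 + (norm (G z))\<^sup>2)"
    using assms(3) s unfolding chordal_nz[OF assms(1,2)] by (simp add: pos_divide_less_eq x_def k_def)
  have "0 \<le> k * x" using k by (simp add: x_def)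
  hence r: "r > 0" using kx s by (smt (verit) mult_nonpos_nonneg)
  have "sqrt (L\<^sup>2 + (norm (G z))\<^sup>2) \<le> L + norm (G z)" using sqrt_sum_sq_le[of L "norm (G z)"] L by auto
  also have "norm (G z) \<le> x + norm (tb v)" using norm_triangle_ineq[of "G z - tb v" "tb v"] by (simp add: x_def)
  finally have "r * sqrt (L\<^sup>2 + (norm (G z))\<^sup>2) \<le> r * (L + norm (tb v)) + r * x"
    using r by (simp add: distrib_left[symmetric] mult_left_mono)
  moreover have "r * x \<le> k / 2 * x" using assms(4) by (intro mult_right_mono) (auto simp: k_def x_def)
  ultimately have "k * x < 2 * r * (L + norm (tb v))" using kx by simp
  thus ?thesis using k unfolding x_def[symmetric] k_def[symmetric] by (simp add: pos_less_divide_eq mult.commute)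
qed

lemma chordal_nz_lessI:
  assumes "norm (z + a) \<ge> R" "v \<noteq> Some 0" "norm (G z - tb v) < r * L / tk v" "r > 0"
  shows "chordal_dist (sphere_map f z) v < r"
proof -
  have s: "sqrt (L\<^sup>2 + (norm (G z))\<^sup>2) > 0" using L by (simp add: add_pos_nonneg)
  have "tk v * norm (G z - tb v) < r * L" using assms(3) tk_pos[OF assms(2)] by (simp add: pos_less_divide_eq mult.commute)
  also have "\<dots> \<le> r * sqrt (L\<^sup>2 + (norm (G z))\<^sup>2)" using sqrt_sum_sq_ge(1)[of L "norm (G z)"] L assms(4) by (intro mult_left_mono) auto
  finally show ?thesis unfolding chordal_nz[OF assms(1,2)] using s by (simp add: pos_divide_less_eq)
qed

text \<open>
  On the real directions the asymptotic value \<open>0\<close> corresponds to large \<open>G\<close>; on the imaginary directions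
  \<open>\<plusminus> \<i>\<close> corresponds to \<open>G\<close> near its limit in the respective half-plane.
\<close>

lemma direction_cases:
  assumes "u \<in> directions"
  obtains (real) "tract_value u = Some 0" "\<And>w. (Re (w * cnj u))\<^sup>2 = (Re w)\<^sup>2" "norm u = 1" "\<And>w. Re (w * cnj u) = 0 \<Longrightarrow> Re w = 0"
       "\<And>t. Re ((of_real t * u)\<^sup>2) = t\<^sup>2"
  | (imag) \<sigma> where "\<sigma> = 1 \<or> \<sigma> = -1" "u = \<i> * of_real \<sigma>" "tract_value u = Some u" "tb (Some u) = \<i> * of_real (\<sigma> * L)"
       "\<And>w. Re (w * cnj u) = \<sigma> * Im w" "norm u = 1" "u \<noteq> 0" "\<And>t. Re ((of_real t * u)\<^sup>2) = - (t\<^sup>2)"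
proof -
  consider "u = 1 \<or> u = -1" | "u = \<i>" | "u = - \<i>" using assms by (auto simp: directions_def)
  thus thesis
  proof cases
    case 1
    thus thesis by (intro real) (auto simp: tract_value_def power2_eq_square)
  next
    case 2
    thus thesis using L by (intro imag[of 1]) (auto simp: tract_value_def tb_def power2_eq_square field_simps)
  next
    case 3
    thus thesis using L by (intro imag[of "-1"]) (auto simp: tract_value_def tb_def power2_eq_square field_simps)
  qed
qed

lemma boundary:
  assumes u: "u \<in> directions"
  shows "\<exists>\<delta>>0. \<forall>z. R \<le> norm (z + a) \<and> Re ((z + a) * cnj u) \<ge> 0 \<and>
          (norm (z + a) = R \<or> Re ((z + a) * cnj u) = 0) \<longrightarrow> \<delta> \<le> chordal_dist (sphere_map f z) (tract_value u)"
proof -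
  have expR: "exp (Re (w\<^sup>2)) \<le> exp (R\<^sup>2)" "exp (- (R\<^sup>2)) \<le> exp (Re (w\<^sup>2))" if "norm w = R" for w
  proof -
    have "\<bar>Re (w\<^sup>2)\<bar> \<le> R\<^sup>2" using abs_Re_le_cmod[of "w\<^sup>2"] that by (simp add: norm_power)
    thus "exp (Re (w\<^sup>2)) \<le> exp (R\<^sup>2)" "exp (- (R\<^sup>2)) \<le> exp (Re (w\<^sup>2))" by auto
  qed
  have RN: "R ^ N \<ge> 1" using R(2) by simp
  from u show ?thesis
  proof (cases rule: direction_cases)
    case real
    define K where "K = L + 2 * norm c0 * exp (R\<^sup>2)"
    have K: "K > 0" using L by (auto simp: K_def intro!: add_pos_nonneg)
    have "L / (L + K) \<le> chordal_dist (sphere_map f z) (tract_value u)"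
      if z: "R \<le> norm (z + a)" "norm (z + a) = R \<or> Re ((z + a) * cnj u) = 0" for z
    proof -
      have "M z \<le> exp (R\<^sup>2)"
      proof (cases "norm (z + a) = R")
        case True
        have "M z \<le> exp (R\<^sup>2) / 1" unfolding M_def True
          using expR(1)[OF True] RN by (intro frac_le) auto
        thus ?thesis by simp
      next
        case False
        hence "Re ((z + a) * cnj u) = 0" using z(2) by blast
        hence "M z \<le> 1" using M_Re_0[OF z(1) real(4)] by blast
        also have "1 \<le> exp (R\<^sup>2)" by simp
        finally show ?thesis .
      qed
      hence "2 * norm c0 * M z \<le> 2 * norm c0 * exp (R\<^sup>2)" by (intro mult_left_mono) auto
      hence g: "norm (G z) \<le> K" using G_norm_bounds(1)[OF z(1)] by (simp add: K_def)
      have "sqrt (L\<^sup>2 + (norm (G z))\<^sup>2) \<le> L + norm (G z)" using L by (intro sqrt_sum_sq_le) auto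
      hence "sqrt (L\<^sup>2 + (norm (G z))\<^sup>2) \<le> L + K" using g by simp
      moreover have "sqrt (L\<^sup>2 + (norm (G z))\<^sup>2) > 0" using L by (simp add: add_pos_nonneg)
      ultimately show ?thesis unfolding real(1) chordal_0[OF z(1)] using L K
        by (intro divide_left_mono mult_pos_pos) auto
    qed
    moreover have "L / (L + K) > 0" using L K by simp
    ultimately show ?thesis by blast
  next
    case (imag \<sigma>)
    define m where "m = min 1 (exp (- (R\<^sup>2)) / R ^ N)"
    have m: "m > 0" using RN by (auto simp: m_def)
    define x0 where "x0 = norm c0 / 2 * m"
    have x0: "x0 > 0" using m c0 by (simp add: x0_def)
    have nz: "Some u \<noteq> Some 0" using imag by simp
    define k where "k = tk (Some u)"
    have k: "k > 0" using tk_pos[OF nz] by (simp add: k_def)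
    have "k * (x0 / (2 * L + x0)) \<le> chordal_dist (sphere_map f z) (tract_value u)"
      if z: "R \<le> norm (z + a)" "Re ((z + a) * cnj u) \<ge> 0" "norm (z + a) = R \<or> Re ((z + a) * cnj u) = 0" for z
    proof -
      have "M z \<ge> m"
      proof (cases "norm (z + a) = R")
        case True
        have "exp (- (R\<^sup>2)) / R ^ N \<le> M z" unfolding M_def True
          using expR(2)[OF True] RN by (intro divide_right_mono) auto
        thus ?thesis by (simp add: m_def)
      next
        case False
        hence "\<sigma> * Im (z + a) = 0" using z(3) unfolding imag(5) by blast
        hence "Im (z + a) = 0" using imag(1) by auto
        hence "M z \<ge> exp ((norm (z + a))\<^sup>2 - norm (z + a))" using z by (intro M_Im_0) auto
        moreover have "norm (z + a) \<le> (norm (z + a))\<^sup>2" using z(1) R(2)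
          mult_left_mono[of 1 "norm (z + a)" "norm (z + a)"] by (simp add: power2_eq_square)
        hence "exp ((norm (z + a))\<^sup>2 - norm (z + a)) \<ge> 1" by simp
        ultimately have "M z \<ge> 1" by linarith
        thus ?thesis by (simp add: m_def)
      qed
      hence "norm c0 / 2 * m \<le> norm c0 / 2 * M z" by (intro mult_left_mono) auto
      define x where "x = norm (G z - tb (Some u))"
      have "\<sigma> * Im (z + a) \<ge> 0" using z(2) unfolding imag(5) .
      from G_bounds(1)[OF imag(1) z(1) this] have x: "x \<ge> x0"
        using \<open>norm c0 / 2 * m \<le> norm c0 / 2 * M z\<close> unfolding x_def x0_def imag(4) by linarith
      have "norm (tb (Some u)) = L" using imag(1,4) L by (auto simp: norm_mult)
      hence gx: "norm (G z) \<le> x + L" using norm_triangle_ineq[of "G z - tb (Some u)" "tb (Some u)"] by (simp add: x_def)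
      have "sqrt (L\<^sup>2 + (norm (G z))\<^sup>2) \<le> L + norm (G z)" using L by (intro sqrt_sum_sq_le) auto
      hence s: "sqrt (L\<^sup>2 + (norm (G z))\<^sup>2) \<le> 2 * L + x" using gx by simp
      have sp: "sqrt (L\<^sup>2 + (norm (G z))\<^sup>2) > 0" using L by (simp add: add_pos_nonneg)
      have "x0 * (2 * L + x) \<le> x * (2 * L + x0)" using x L by (simp add: algebra_simps mult_left_mono)
      hence "x0 \<le> x * (2 * L + x0) / (2 * L + x)" using x x0 L by (intro mult_imp_le_div_pos) auto
      hence "x0 / (2 * L + x0) \<le> x / (2 * L + x)" using x x0 L by (intro mult_imp_div_pos_le) auto
      also have "\<dots> \<le> x / sqrt (L\<^sup>2 + (norm (G z))\<^sup>2)" using s sp x x0 L by (intro divide_left_mono mult_pos_pos) auto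
      finally have "k * (x0 / (2 * L + x0)) \<le> k * (x / sqrt (L\<^sup>2 + (norm (G z))\<^sup>2))" using k by (intro mult_left_mono) auto
      thus ?thesis unfolding imag(3) chordal_nz[OF z(1) nz] by (simp add: k_def x_def)
    qed
    moreover have "k * (x0 / (2 * L + x0)) > 0" using k x0 L by simp
    ultimately show ?thesis by blast
  qed
qed

lemma omitted:
  assumes u: "u \<in> directions" and z: "R \<le> norm (z + a)" "Re ((z + a) * cnj u) \<ge> 0"
  shows "sphere_map f z \<noteq> tract_value u"
  using u
proof (cases rule: direction_cases)
  case real
  show ?thesis unfolding real(1) using sph[of z] z(1) R(1) L by auto
next
  case (imag \<sigma>)
  have nz: "Some u \<noteq> Some 0" using imag by simp
  have "norm c0 / 2 * M z > 0" using c0 M_pos[OF z(1)] by simp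
  moreover have "\<sigma> * Im (z + a) \<ge> 0" using z(2) unfolding imag(5) .
  ultimately have "norm (G z - tb (Some u)) > 0"
    using G_bounds(1)[OF imag(1) z(1)] unfolding imag(4) by linarith
  moreover have "sqrt (L\<^sup>2 + (norm (G z))\<^sup>2) > 0" using L by (simp add: add_pos_nonneg)
  ultimately have "chordal_dist (sphere_map f z) (Some u) > 0"
    unfolding chordal_nz[OF z(1) nz] using tk_pos[OF nz] by simp
  thus ?thesis unfolding imag(3) by auto
qed

lemma arc:
  assumes u: "u \<in> directions" and r: "r > 0"
  shows "\<exists>r'>0. \<forall>z z'. R \<le> norm (z + a) \<and> 0 < Re ((z + a) * cnj u) \<and>
          chordal_dist (sphere_map f z) (tract_value u) < r' \<and>
          norm (z' + a) = norm (z + a) \<and> Re ((z' + a) * cnj u) \<ge> Re ((z + a) * cnj u) \<longrightarrow>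
          chordal_dist (sphere_map f z') (tract_value u) < r"
  using u
proof (cases rule: direction_cases)
  case real
  define r' where "r' = 1 / (4 / r + 7)"
  have r': "r' > 0" "L / r' = 4 * (L / r) + 7 * L" using r by (auto simp: r'_def add_pos_pos algebra_simps)
  have "chordal_dist (sphere_map f z') (tract_value u) < r"
    if z: "R \<le> norm (z + a)" "0 < Re ((z + a) * cnj u)" "chordal_dist (sphere_map f z) (tract_value u) < r'"
      "norm (z' + a) = norm (z + a)" "Re ((z' + a) * cnj u) \<ge> Re ((z + a) * cnj u)" for z z'
  proof -
    have z': "R \<le> norm (z' + a)" using z by simp
    have "(Re ((z + a) * cnj u))\<^sup>2 \<le> (Re ((z' + a) * cnj u))\<^sup>2" using z by (intro power_mono) auto
    hence "Re ((z + a)\<^sup>2) \<le> Re ((z' + a)\<^sup>2)" unfolding Re_sq(1) real(2) z(4) by simp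
    hence "M z \<le> M z'" unfolding M_def z(4) using R(2) z(1) by (intro divide_right_mono) auto
    hence "norm c0 * M z \<le> norm c0 * M z'" by (intro mult_left_mono) auto
    moreover have "norm (G z) > L / r' - L" using z(3) r' unfolding real(1) by (intro chordal_0_less_imp[OF z(1)])
    ultimately have "norm (G z') > L / r"
      using G_norm_bounds(1)[OF z(1)] G_norm_bounds(2)[OF z'] r'(2) L by simp
    thus ?thesis unfolding real(1) by (rule chordal_0_lessI[OF z' _ r])
  qed
  thus ?thesis using r'(1) by blast
next
  case (imag \<sigma>)
  have nz: "Some u \<noteq> Some 0" using imag by simp
  define k where "k = tk (Some u)"
  have k: "k > 0" using tk_pos[OF nz] by (simp add: k_def)
  define r' where "r' = min (k / 2) (r / 16)"
  have r': "r' > 0" "r' \<le> k / 2" "16 * r' \<le> r" using r k by (auto simp: r'_def)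
  have "chordal_dist (sphere_map f z') (tract_value u) < r"
    if z: "R \<le> norm (z + a)" "0 < Re ((z + a) * cnj u)" "chordal_dist (sphere_map f z) (tract_value u) < r'"
      "norm (z' + a) = norm (z + a)" "Re ((z' + a) * cnj u) \<ge> Re ((z + a) * cnj u)" for z z'
  proof -
    have z': "R \<le> norm (z' + a)" using z by simp
    have s: "\<sigma> * Im (z + a) > 0" "\<sigma> * Im (z' + a) \<ge> \<sigma> * Im (z + a)" using z(2,5) unfolding imag(5) by auto
    hence "(\<sigma> * Im (z + a))\<^sup>2 \<le> (\<sigma> * Im (z' + a))\<^sup>2" by (intro power_mono) auto
    hence "(Im (z + a))\<^sup>2 \<le> (Im (z' + a))\<^sup>2" using imag(1) by (auto simp: power_mult_distrib)
    hence "Re ((z' + a)\<^sup>2) \<le> Re ((z + a)\<^sup>2)" unfolding Re_sq(2) z(4) by simp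
    hence "M z' \<le> M z" unfolding M_def z(4) using R(2) z(1) by (intro divide_right_mono) auto
    hence "norm c0 * M z' \<le> norm c0 * M z" by (intro mult_left_mono) auto
    moreover have "norm (G z - tb (Some u)) < 2 * r' * (L + norm (tb (Some u))) / k"
      using chordal_nz_less_imp[OF z(1) nz] z(3) r'(2) unfolding imag(3) k_def by blast
    moreover have "norm (tb (Some u)) = L" using imag(1,4) L by (auto simp: norm_mult)
    moreover have "norm c0 / 2 * M z \<le> norm (G z - tb (Some u))" using G_bounds(1)[OF imag(1) z(1)] s imag(4) by simp
    moreover have "norm (G z' - tb (Some u)) \<le> 2 * norm c0 * M z'" using G_bounds(2)[OF imag(1) z'] s imag(4) by simp
    ultimately have "norm (G z' - tb (Some u)) < 4 * (2 * r' * (L + L) / k)" by simp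
    also have "\<dots> = 16 * r' * L / k" by simp
    also have "\<dots> \<le> r * L / k" using r'(3) L k by (intro divide_right_mono mult_right_mono) auto
    finally show ?thesis unfolding imag(3) k_def by (intro chordal_nz_lessI[OF z' nz _ r])
  qed
  thus ?thesis using r'(1) by blast
qed

lemma ray:
  assumes u: "u \<in> directions" and r: "r > 0"
  shows "\<exists>T. \<forall>t\<ge>T. chordal_dist (sphere_map f (of_real t * u - a)) (tract_value u) < r"
  using u
proof (cases rule: direction_cases)
  case real
  define K where "K = (L / r + L + 1) / (norm c0 / 2)"
  have "chordal_dist (sphere_map f (of_real t * u - a)) (tract_value u) < r" if t: "t \<ge> max (R + 1) (K + 1)" for t
  proof -
    define z where "z = of_real t * u - a"
    have za: "z + a = of_real t * u" "norm (z + a) = t" using real(3) t R(2) by (auto simp: z_def norm_mult)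
    have tN: "t ^ N > 0" "t ^ N \<le> exp t" using t R by (auto intro!: zero_less_power)
    have "K \<le> t\<^sup>2 - t"
    proof -
      have "(t - 1) * 1 \<le> (t - 1) * t" using t R(2) by (intro mult_left_mono) auto
      thus ?thesis using t by (simp add: power2_eq_square algebra_simps)
    qed
    also have "\<dots> \<le> exp (t\<^sup>2 - t)" using exp_ge_add_one_self[of "t\<^sup>2 - t"] by linarith
    also have "\<dots> = exp (t\<^sup>2) / exp t" by (simp add: exp_diff)
    also have "\<dots> \<le> exp (t\<^sup>2) / t ^ N" using tN by (intro divide_left_mono) auto
    also have "Re ((z + a)\<^sup>2) = t\<^sup>2" unfolding za(1) by (rule real(5))
    hence "exp (t\<^sup>2) / t ^ N = M z" by (simp add: M_def za(2))
    finally have "norm c0 / 2 * K \<le> norm c0 / 2 * M z" by (intro mult_left_mono) auto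
    moreover have "norm c0 / 2 * K = L / r + L + 1" using c0 by (simp add: K_def)
    moreover have "norm (z + a) \<ge> R" using za(2) t by simp
    ultimately have "norm (G z) > L / r" using G_norm_bounds(2)[of z] by linarith
    thus ?thesis unfolding real(1) z_def[symmetric] using za t by (intro chordal_0_lessI r) auto
  qed
  thus ?thesis by blast
next
  case (imag \<sigma>)
  have nz: "Some u \<noteq> Some 0" using imag by simp
  define k where "k = tk (Some u)"
  have k: "k > 0" using tk_pos[OF nz] by (simp add: k_def)
  define \<epsilon> where "\<epsilon> = r * L / k / (2 * norm c0)"
  have \<epsilon>: "\<epsilon> > 0" using r L k c0 by (simp add: \<epsilon>_def)
  have "chordal_dist (sphere_map f (of_real t * u - a)) (tract_value u) < r" if t: "t \<ge> max (R + 1) (1 / \<epsilon> + 1)" for t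
  proof -
    define z where "z = of_real t * u - a"
    have t0: "t > 1" using t R(2) by auto
    have za: "z + a = of_real t * u" "norm (z + a) = t" using imag(6) t R(2) by (auto simp: z_def norm_mult)
    have tN: "t ^ N \<ge> 1" using t0 by (intro one_le_power) auto
    have "Re ((z + a)\<^sup>2) = - (t\<^sup>2)" unfolding za(1) by (rule imag(8))
    hence Mz: "M z = exp (- (t\<^sup>2)) / t ^ N" by (simp add: M_def za(2))
    have "exp (- (t\<^sup>2)) / t ^ N \<le> exp (- (t\<^sup>2)) / 1" using tN by (intro divide_left_mono) auto
    also have "\<dots> = inverse (exp (t\<^sup>2))" by (simp add: exp_minus)
    also have "\<dots> < inverse (1 / \<epsilon>)"
    proof (rule less_imp_inverse_less)
      have "1 / \<epsilon> < t" using t by simp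
      also have "t \<le> t\<^sup>2" using t0 by (simp add: power2_eq_square)
      also have "\<dots> \<le> exp (t\<^sup>2)" using exp_ge_add_one_self[of "t\<^sup>2"] by linarith
      finally show "1 / \<epsilon> < exp (t\<^sup>2)" .
    qed (use \<epsilon> in auto)
    finally have "M z < \<epsilon>" using Mz by simp
    hence "2 * norm c0 * M z < 2 * norm c0 * \<epsilon>" using c0 by simp
    also have "\<dots> = r * L / k" using c0 by (simp add: \<epsilon>_def)
    finally have "2 * norm c0 * M z < r * L / k" .
    moreover have "\<sigma> * Im (z + a) \<ge> 0" using imag(1) t0 unfolding za imag(2) by auto
    ultimately have "norm (G z - tb (Some u)) < r * L / k"
      using G_bounds(2)[OF imag(1), of z] za t imag(4) by simp
    thus ?thesis unfolding imag(3) z_def[symmetric] k_def using za t by (intro chordal_nz_lessI nz r) auto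
  qed
  thus ?thesis by blast
qed

text \<open>
  Write the exponential term as \<open>exp \<psi>\<close> with \<open>\<psi> = w\<^sup>2 - N * Ln w\<close>.  If its modulus is pinched between
  positive constants and the phase \<open>Im \<psi>\<close> is bounded, then \<open>\<bar>w\<bar>\<^sup>2\<close> is at most a constant plus
  \<open>N * \<bar>w\<bar>\<close>, so \<open>w\<close> is bounded.
\<close>

lemma unbounded_phase:
  assumes U: "\<not> bounded U" and far: "\<And>z. z \<in> U \<Longrightarrow> norm (z + a) \<ge> R"
    and M: "\<And>z. z \<in> U \<Longrightarrow> \<kappa>1 \<le> M z \<and> M z \<le> \<kappa>2" and \<kappa>1: "\<kappa>1 > 0"
  shows "\<exists>z\<in>U. \<bar>Im ((z + a)\<^sup>2 - of_nat N * Ln (z + a))\<bar> > K"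
proof (rule ccontr)
  assume "\<not> ?thesis"
  hence le: "\<bar>Im ((z + a)\<^sup>2 - of_nat N * Ln (z + a))\<bar> \<le> K" if "z \<in> U" for z using that by (auto simp: not_less)
  define K' where "K' = K + N * pi + \<bar>ln \<kappa>1\<bar> + \<bar>ln \<kappa>2\<bar>"
  have "norm z \<le> \<bar>K'\<bar> + real N + 1 + norm a" if z: "z \<in> U" for z
  proof -
    define \<rho> where "\<rho> = norm (z + a)"
    have \<rho>: "\<rho> \<ge> 1" using far[OF z] R(2) by (simp add: \<rho>_def)
    hence w0: "z + a \<noteq> 0" by (auto simp: \<rho>_def)
    have "\<bar>Im (Ln (z + a))\<bar> \<le> pi"
      using mpi_less_Im_Ln[OF w0] Im_Ln_le_pi[OF w0] by linarith
    hence "\<bar>real N * Im (Ln (z + a))\<bar> \<le> real N * pi" by (simp add: abs_mult mult_left_mono)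
    moreover have "Im ((z + a)\<^sup>2 - of_nat N * Ln (z + a)) = Im ((z + a)\<^sup>2) - real N * Im (Ln (z + a))"
      by (simp only: minus_complex.sel times_complex.sel) simp
    ultimately have i: "\<bar>Im ((z + a)\<^sup>2)\<bar> \<le> K + N * pi" using le[OF z] by linarith
    have "ln (M z) = Re ((z + a)\<^sup>2) - real N * ln \<rho>"
      using \<rho> by (simp add: M_def \<rho>_def[symmetric] ln_div ln_realpow)
    moreover have "ln \<kappa>1 \<le> ln (M z)" "ln (M z) \<le> ln \<kappa>2" using M[OF z] \<kappa>1 by auto
    moreover have "ln \<rho> \<le> \<rho>" "ln \<rho> \<ge> 0" using \<rho> ln_le_minus_one[of \<rho>] by auto
    hence "real N * ln \<rho> \<le> real N * \<rho>" "real N * ln \<rho> \<ge> 0" by (auto intro: mult_left_mono)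
    ultimately have r: "\<bar>Re ((z + a)\<^sup>2)\<bar> \<le> \<bar>ln \<kappa>1\<bar> + \<bar>ln \<kappa>2\<bar> + real N * \<rho>" by linarith
    have "\<rho>\<^sup>2 = norm ((z + a)\<^sup>2)" by (simp add: \<rho>_def norm_power)
    also have "\<dots> \<le> \<bar>Re ((z + a)\<^sup>2)\<bar> + \<bar>Im ((z + a)\<^sup>2)\<bar>" by (rule cmod_le)
    also have "\<dots> \<le> K' + real N * \<rho>" using i r by (simp add: K'_def)
    also have "\<dots> \<le> \<bar>K'\<bar> * \<rho> + real N * \<rho>"
      using \<rho> mult_left_mono[of 1 \<rho> "\<bar>K'\<bar>"] by simp
    finally have "\<rho> * \<rho> \<le> (\<bar>K'\<bar> + real N) * \<rho>" by (simp add: power2_eq_square algebra_simps)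
    hence "\<rho> \<le> \<bar>K'\<bar> + real N" using \<rho> by (intro mult_right_le_imp_le[of \<rho> \<rho>]) auto
    thus ?thesis using norm_diff_ineq[of z a] by (simp add: \<rho>_def)
  qed
  hence "bounded U" by (auto simp: bounded_iff)
  thus False using U by blast
qed

lemma phase_hits:
  fixes g :: "complex \<Rightarrow> real"
  assumes "connected U" "continuous_on U g" and unb: "\<And>K. \<exists>z\<in>U. \<bar>g z\<bar> > K"
  shows "\<exists>z\<in>U. \<exists>j::int. g z = \<theta> + 2 * pi * of_int j"
proof -
  have con: "connected (g ` U)" by (rule connected_continuous_image[OF assms(2,1)])
  obtain z0 where z0: "z0 \<in> U" using unb[of 0] by blast
  obtain z1 where z1: "z1 \<in> U" "\<bar>g z1\<bar> > \<bar>g z0\<bar> + 2 * pi" using unb by blast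
  define x where "x = min (g z0) (g z1)"
  define y where "y = max (g z0) (g z1)"
  have xy: "x \<in> g ` U" "y \<in> g ` U" "x + 2 * pi < y" using z0 z1 by (auto simp: x_def y_def min_def max_def)
  define j where "j = \<lceil>(x - \<theta>) / (2 * pi)\<rceil>"
  have "(x - \<theta>) / (2 * pi) \<le> of_int j" "of_int j < (x - \<theta>) / (2 * pi) + 1"
    unfolding j_def by linarith+
  hence "x \<le> \<theta> + 2 * pi * of_int j" "\<theta> + 2 * pi * of_int j < x + 2 * pi"
    by (simp_all add: field_simps)
  hence "\<theta> + 2 * pi * of_int j \<in> g ` U"
    using con xy unfolding connected_iff_interval by (meson less_imp_le order.trans)
  then obtain z where "\<theta> + 2 * pi * of_int j = g z" "z \<in> U" by (rule imageE)
  thus ?thesis by (intro bexI[of _ z] exI[of _ j]) simp_all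
qed

text \<open>
  If \<open>G\<close> stays near some \<open>b\<close> different from its limit \<open>l\<close>, then \<open>c0 * exp \<psi>\<close> stays near \<open>b - l\<close>, in
  particular its modulus is pinched.  By the unbounded phase it must somewhere point in the opposite
  direction, towards \<open>l - b\<close>, which is a contradiction.
\<close>

lemma bounded_off_value:
  assumes \<sigma>: "\<sigma> = 1 \<or> \<sigma> = -1" and U: "connected U" "\<not> bounded U"
    and far: "\<And>z. z \<in> U \<Longrightarrow> norm (z + a) \<ge> R \<and> \<sigma> * Im (z + a) > 0"
    and b: "\<And>z. z \<in> U \<Longrightarrow> norm (G z - b) < norm (b - \<i> * of_real (\<sigma> * L)) / 2"
  shows False
proof -
  define l where "l = \<i> * of_real (\<sigma> * L)"
  define e where "e = norm (b - l)"
  have "e > 0"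
  proof -
    obtain z where "z \<in> U" using U(2) by fastforce
    from b[OF this] show ?thesis using norm_ge_zero[of "G z - b"] unfolding e_def l_def by linarith
  qed
  define \<psi> where "\<psi> = (\<lambda>z. (z + a)\<^sup>2 - of_nat N * Ln (z + a))"
  have Mb: "e / (4 * norm c0) \<le> M z \<and> M z \<le> 4 * e / norm c0" if z: "z \<in> U" for z
  proof -
    have "norm (G z - l) \<le> 2 * e" "e / 2 \<le> norm (G z - l)"
      using b[OF z] norm_triangle_ineq[of "G z - b" "b - l"] norm_triangle_ineq2[of "b - l" "b - G z"]
        norm_minus_commute[of b "G z"] unfolding l_def[symmetric] e_def by auto
    hence "norm c0 / 2 * M z \<le> 2 * e" "e / 2 \<le> 2 * norm c0 * M z"
      using G_bounds[OF \<sigma>, of z] far[OF z] unfolding l_def by auto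
    thus ?thesis using c0 by (simp add: field_simps)
  qed
  have nr: "z + a \<notin> \<real>\<^sub>\<le>\<^sub>0" if "z \<in> U" for z
  proof
    assume "z + a \<in> \<real>\<^sub>\<le>\<^sub>0"
    hence "Im (z + a) = 0" by (auto simp: complex_nonpos_Reals_iff)
    thus False using far[OF that] by simp
  qed
  have "continuous_on U (\<lambda>z. Im (\<psi> z))"
    unfolding \<psi>_def by (intro continuous_intros) (use nr in auto)
  moreover have "\<exists>z\<in>U. \<bar>Im (\<psi> z)\<bar> > K" for K
    unfolding \<psi>_def by (rule unbounded_phase[OF U(2) _ Mb]) (use far c0 \<open>e > 0\<close> in auto)
  ultimately obtain z j where z: "z \<in> U" "Im (\<psi> z) = Arg ((l - b) / c0) + 2 * pi * of_int j"
    using phase_hits[OF U(1), of "\<lambda>z. Im (\<psi> z)" "Arg ((l - b) / c0)"] by blast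
  define X where "X = exp ((z + a)\<^sup>2) / (z + a) ^ N"
  have "norm (z + a) > 0" using far[OF z(1)] R(2) by linarith
  hence w0: "z + a \<noteq> 0" by auto
  have X: "X = exp (\<psi> z)"
    using w0 by (simp add: X_def \<psi>_def exp_diff exp_of_nat_mult)
  have nX: "norm X = M z" by (simp add: X_def M_def norm_divide norm_power)
  \<comment> \<open>At this point \<open>c0 * exp \<psi>\<close> is the positive multiple \<open>t\<close> of \<open>l - b\<close>.\<close>
  define t where "t = M z * norm c0 / e"
  have t: "t \<ge> 0" using M_pos[of z] far[OF z(1)] \<open>e > 0\<close> by (simp add: t_def)
  have cX: "c0 * X = of_real t * (l - b)"
  proof -
    define v where "v = (l - b) / c0"
    have nv: "norm v = e / norm c0" by (simp add: v_def e_def norm_divide norm_minus_commute)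
    have "X = of_real (norm X) * cis (Im (\<psi> z))"
      unfolding X norm_exp_eq_Re by (rule exp_eq_polar)
    also have "cis (Im (\<psi> z)) = cis (Arg v) * cis (2 * pi * of_int j)" unfolding z(2) v_def by (rule cis_mult[symmetric])
    also have "cis (2 * pi * of_int j) = 1" by (simp add: complex_eq_iff cos_int_2pin sin_int_2pin)
    finally have 1: "X = of_real (M z) * cis (Arg v)" unfolding nX by simp
    have "v = of_real (e / norm c0) * cis (Arg v)" using rcis_cmod_Arg[of v] by (simp add: rcis_def nv)
    hence "cis (Arg v) = of_real (norm c0 / e) * v" using \<open>e > 0\<close> c0 by (simp add: field_simps)
    hence "X = of_real t * v" using 1 by (simp add: t_def)
    thus ?thesis using c0 by (simp add: v_def)
  qed
  have "norm c0 / 4 * M z = t * e / 4" using \<open>e > 0\<close> by (simp add: t_def)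
  hence ap: "norm ((G z - l) - of_real t * (l - b)) \<le> t * e / 4"
    using G_approx[OF \<sigma>, of z] far[OF z(1)] unfolding X_def[symmetric] cX l_def[symmetric] by auto
  define \<Delta> where "\<Delta> = (G z - l) - of_real t * (l - b)"
  have E1: "G z - b = of_real (1 + t) * (l - b) + \<Delta>" by (simp add: \<Delta>_def algebra_simps)
  moreover have E2: "norm (of_real (1 + t) * (l - b)) = (1 + t) * e" 
    using t unfolding norm_mult norm_of_real by (simp add: e_def norm_minus_commute)
  have "norm (G z - b) \<ge> (1 + t) * e - t * e / 4"
    using ap norm_diff_ineq[of "of_real (1 + t) * (l - b)" \<Delta>] unfolding E1 E2 \<Delta>_def[symmetric] by linarith
  moreover have "(1 + t) * e - t * e / 4 \<ge> e" using t \<open>e > 0\<close> by (simp add: algebra_simps)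
  ultimately show False using b[OF z(1)] \<open>e > 0\<close> unfolding l_def[symmetric] e_def by simp
qed

text \<open>
  For \<open>v = 0\<close> the function \<open>G\<close> is large, which excludes the imaginary axis, where it is bounded.  For
  \<open>v \<noteq> 0\<close> it is bounded, which excludes the real axis; so the set lies in a half-plane, and
  \<open>bounded_off_value\<close> leaves only the limit of \<open>G\<close> there.  The radius \<open>r0\<close> is chosen so that \<open>G\<close> is
  closer to \<open>tb v\<close> than half the distance of \<open>tb v\<close> from either limit different from it.
\<close>

lemma classify:
  "\<exists>r0>0. \<exists>R'. \<forall>U. connected U \<and> \<not> bounded U \<and>
          (\<forall>z\<in>U. R' < norm (z + a) \<and> chordal_dist (sphere_map f z) v < r0) \<longrightarrow>
          (\<exists>u\<in>directions. v = tract_value u \<and> (\<forall>z\<in>U. Re ((z + a) * cnj u) > 0))"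
proof (cases "v = Some 0")
  case v: True
  define r0 where "r0 = L / (2 * L + 2 * norm c0)"
  have r0: "r0 > 0" "L / r0 = 2 * L + 2 * norm c0" using L by (auto simp: r0_def intro!: divide_pos_pos add_pos_nonneg)
  have "\<exists>u\<in>directions. v = tract_value u \<and> (\<forall>z\<in>U. Re ((z + a) * cnj u) > 0)"
    if U: "connected U" "\<And>z. z \<in> U \<Longrightarrow> R < norm (z + a) \<and> chordal_dist (sphere_map f z) v < r0" for U
  proof -
    have "Re (z + a) \<noteq> 0" if z: "z \<in> U" for z
    proof
      assume "Re (z + a) = 0"
      hence "M z \<le> 1" using U(2)[OF z] by (intro M_Re_0) auto
      hence "norm c0 * M z \<le> norm c0 * 1" by (intro mult_left_mono) auto
      hence "norm (G z) \<le> L + 2 * norm c0" using G_norm_bounds(1)[of z] U(2)[OF z] by simp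
      moreover have "norm (G z) > L / r0 - L" using U(2)[OF z] r0(1) unfolding v by (intro chordal_0_less_imp) auto
      ultimately show False unfolding r0(2) by simp
    qed
    moreover have "continuous_on U (\<lambda>z. Re (z + a))" by (intro continuous_intros)
    ultimately consider "\<forall>z\<in>U. Re (z + a) > 0" | "\<forall>z\<in>U. Re (z + a) < 0"
      using connected_sign[OF U(1), of "\<lambda>z. Re (z + a)"] by blast
    thus ?thesis
    proof cases
      case 1
      thus ?thesis by (intro bexI[of _ 1]) (auto simp: directions_def tract_value_def v)
    next
      case 2
      thus ?thesis by (intro bexI[of _ "-1"]) (auto simp: directions_def tract_value_def v)
    qed
  qed
  thus ?thesis using r0(1) by blast
next
  case v: False
  define b where "b = tb v"
  define k where "k = tk v"
  have k: "k > 0" using tk_pos[OF v] by (simp add: k_def)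
  define gap where "gap = (\<lambda>\<sigma>::real. if b = \<i> * of_real (\<sigma> * L) then 1 else norm (b - \<i> * of_real (\<sigma> * L)) / 2)"
  define \<epsilon> where "\<epsilon> = min 1 (min (gap 1) (gap (-1)))"
  have gap: "gap \<sigma> > 0" for \<sigma>
  proof (cases "b = \<i> * of_real (\<sigma> * L)")
    case False
    hence "norm (b - \<i> * of_real (\<sigma> * L)) > 0" by (simp only: zero_less_norm_iff right_minus_eq not_False_eq_True)
    thus ?thesis using False unfolding gap_def by simp
  qed (simp add: gap_def)
  have \<epsilon>: "\<epsilon> > 0" "\<epsilon> \<le> 1" "\<epsilon> \<le> gap 1" "\<epsilon> \<le> gap (-1)" using gap by (auto simp: \<epsilon>_def)
  define r0 where "r0 = min (k / 2) (\<epsilon> * k / (2 * (L + norm b)))"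
  have Lb: "L + norm b > 0" using L by (simp add: add_pos_nonneg)
  have r0: "r0 > 0" using k \<epsilon> Lb by (auto simp: r0_def)
  have r02: "r0 \<le> k / 2" unfolding r0_def by (rule min.cobounded1)
  have r0': "2 * r0 * (L + norm b) / k \<le> \<epsilon>"
  proof -
    have "r0 \<le> \<epsilon> * k / (2 * (L + norm b))" by (simp add: r0_def)
    hence "r0 * (2 * (L + norm b)) \<le> \<epsilon> * k" using Lb by (simp add: pos_le_divide_eq)
    thus ?thesis using k by (simp add: pos_divide_le_eq mult_ac)
  qed
  have close: "norm (G z - b) < \<epsilon>" if "norm (z + a) \<ge> R" "chordal_dist (sphere_map f z) v < r0" for z
    using chordal_nz_less_imp[OF that(1) v that(2)] r02 r0' unfolding b_def k_def by linarith
  define K where "K = (L + norm b + 1) / (norm c0 / 2)"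
  define R' where "R' = max R (K + 1)"
  have "\<exists>u\<in>directions. v = tract_value u \<and> (\<forall>z\<in>U. Re ((z + a) * cnj u) > 0)"
    if U: "connected U" "\<not> bounded U" "\<And>z. z \<in> U \<Longrightarrow> R' < norm (z + a) \<and> chordal_dist (sphere_map f z) v < r0" for U
  proof -
    have far: "norm (z + a) \<ge> R" if "z \<in> U" for z using U(3)[OF that] by (simp add: R'_def)
    have cl: "norm (G z - b) < \<epsilon>" if "z \<in> U" for z using close far U(3) that by blast
    have "Im (z + a) \<noteq> 0" if z: "z \<in> U" for z
    proof
      assume im: "Im (z + a) = 0"
      define t where "t = norm (z + a)"
      have t: "t > K + 1" "t \<ge> 1" using U(3)[OF z] R(2) far[OF z] by (auto simp: t_def R'_def)
      have "K \<le> t\<^sup>2 - t"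
      proof -
        have "(t - 1) * 1 \<le> (t - 1) * t" using t by (intro mult_left_mono) auto
        thus ?thesis using t by (simp add: power2_eq_square algebra_simps)
      qed
      also have "\<dots> \<le> exp (t\<^sup>2 - t)" using exp_ge_add_one_self[of "t\<^sup>2 - t"] by linarith
      also have "\<dots> \<le> M z" using M_Im_0[OF far[OF z] im] by (simp add: t_def)
      finally have "norm c0 / 2 * K \<le> norm c0 / 2 * M z" by (intro mult_left_mono) auto
      moreover have "norm c0 / 2 * K = L + norm b + 1" using c0 by (simp add: K_def)
      ultimately have "norm (G z) \<ge> norm b + 1" using G_norm_bounds(2)[OF far[OF z]] by simp
      thus False using cl[OF z] \<epsilon>(2) norm_triangle_ineq2[of "G z" b] by simp
    qed
    moreover have "continuous_on U (\<lambda>z. Im (z + a))" by (intro continuous_intros)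
    ultimately have "(\<forall>z\<in>U. Im (z + a) > 0) \<or> (\<forall>z\<in>U. Im (z + a) < 0)"
      using connected_sign[OF U(1), of "\<lambda>z. Im (z + a)"] by blast
    then obtain \<sigma> :: real where \<sigma>: "\<sigma> = 1 \<or> \<sigma> = -1" "\<And>z. z \<in> U \<Longrightarrow> \<sigma> * Im (z + a) > 0"
      by (metis mult_minus1 mult_1 neg_0_less_iff_less)
    have b_eq: "b = \<i> * of_real (\<sigma> * L)"
    proof (rule ccontr)
      assume "b \<noteq> \<i> * of_real (\<sigma> * L)"
      hence "\<epsilon> \<le> norm (b - \<i> * of_real (\<sigma> * L)) / 2" using \<sigma>(1) \<epsilon>(3,4) by (auto simp: gap_def)
      thus False using bounded_off_value[OF \<sigma>(1) U(1,2), of b] far cl \<sigma>(2) by fastforce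
    qed
    have "v = Some (\<i> * of_real \<sigma>)"
    proof (cases v)
      case None
      hence "b = 0" by (simp add: b_def tb_def)
      thus ?thesis using b_eq \<sigma>(1) L by auto
    next
      case (Some c)
      hence c: "c \<noteq> 0" "- of_real L / c = \<i> * of_real (\<sigma> * L)" using v b_eq by (auto simp: b_def tb_def)
      have s2: "of_real \<sigma> * of_real \<sigma> = (1 :: complex)" using \<sigma>(1) by auto
      have "- of_real L = (- of_real L / c) * c" using c(1) by simp
      hence "- of_real L = (\<i> * of_real \<sigma> * c) * of_real L" unfolding c(2) by (simp add: mult_ac)
      hence "(\<i> * of_real \<sigma> * c + 1) * of_real L = 0" by (metis add.left_inverse distrib_right mult_1)
      hence "\<i> * of_real \<sigma> * c = - 1" using L by (simp add: add_eq_0_iff2)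
      hence "\<i> * of_real \<sigma> * (\<i> * of_real \<sigma> * c) = - (\<i> * of_real \<sigma>)" by simp
      moreover have "\<i> * of_real \<sigma> * (\<i> * of_real \<sigma> * c) = (\<i> * \<i>) * (of_real \<sigma> * of_real \<sigma>) * c" by (simp only: mult_ac)
      ultimately have "c = \<i> * of_real \<sigma>" unfolding s2 by simp
      thus ?thesis using Some by simp
    qed
    moreover have "\<i> * of_real \<sigma> \<in> directions" using \<sigma>(1) by (auto simp: directions_def)
    moreover have "tract_value (\<i> * of_real \<sigma>) = Some (\<i> * of_real \<sigma>)" using \<sigma>(1) by (auto simp: tract_value_def)
    moreover have "Re ((z + a) * cnj (\<i> * of_real \<sigma>)) = \<sigma> * Im (z + a)" for z by simp
    ultimately show ?thesis using \<sigma>(2) by (intro bexI[of _ "\<i> * of_real \<sigma>"]) (auto simp: mult.commute)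
  qed
  thus ?thesis using r0 by blast
qed

lemma tracts: "tracts f a R"
  using cont R(2) boundary omitted arc ray classify by unfold_locales auto

lemma Re_shift_sq: "\<bar>Re ((z + a)\<^sup>2) - Re (z\<^sup>2)\<bar> \<le> 2 * norm a * norm z + (norm a)\<^sup>2"
proof -
  have "Re ((z + a)\<^sup>2) - Re (z\<^sup>2) = Re (2 * a * z + a\<^sup>2)" by (simp add: power2_sum algebra_simps)
  also have "\<bar>\<dots>\<bar> \<le> norm (2 * a * z + a\<^sup>2)" by (rule abs_Re_le_cmod)
  also have "\<dots> \<le> 2 * norm a * norm z + (norm a)\<^sup>2"
    by (rule order.trans[OF norm_triangle_ineq]) (simp add: norm_mult norm_power)
  finally show ?thesis .
qed

lemma eventually_far:
  assumes "filterlim \<gamma> at_infinity at_top"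
  shows "\<forall>\<^sub>F t in at_top. norm (\<gamma> t + a) \<ge> R"
proof -
  have "filterlim (\<lambda>t. \<gamma> t + a) at_infinity at_top"
    by (rule tendsto_add_filterlim_at_infinity'[OF assms tendsto_const])
  hence "filterlim (\<lambda>t. norm (\<gamma> t + a)) at_top at_top" by (rule filterlim_at_infinity_imp_norm_at_top)
  thus ?thesis by (simp add: filterlim_at_top)
qed

text \<open>
  In a closed subsector \<open>Re (z\<^sup>2)\<close> grows like \<open>\<bar>z\<bar>\<^sup>2\<close>, which dominates both the shift by \<open>a\<close> and the power
  of \<open>z + a\<close>.
\<close>

lemma asymptotic_value_0:
  assumes \<gamma>: "filterlim \<gamma> at_infinity at_top" and c: "c > 0" and re: "\<forall>\<^sub>F t in at_top. Re ((\<gamma> t)\<^sup>2) \<ge> c * (norm (\<gamma> t))\<^sup>2"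
  shows "((\<lambda>t. chordal_dist (sphere_map f (\<gamma> t)) (Some 0)) \<longlongrightarrow> 0) at_top"
proof (rule tendstoI)
  fix r :: real assume r: "r > 0"
  define K where "K = (L / r + L + 1) / (norm c0 / 2)"
  define \<alpha> where "\<alpha> = norm a"
  have "filterlim (\<lambda>x. c * x\<^sup>2 - (2 * \<alpha> + 1) * x - \<alpha>\<^sup>2 - \<alpha>) at_top at_top" using c by real_asymp
  from filterlim_compose[OF this filterlim_at_infinity_imp_norm_at_top[OF \<gamma>]]
  have "\<forall>\<^sub>F t in at_top. c * (norm (\<gamma> t))\<^sup>2 - (2 * \<alpha> + 1) * norm (\<gamma> t) - \<alpha>\<^sup>2 - \<alpha> \<ge> K"
    by (simp add: filterlim_at_top)
  thus "\<forall>\<^sub>F t in at_top. dist (chordal_dist (sphere_map f (\<gamma> t)) (Some 0)) 0 < r"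
    using re eventually_far[OF \<gamma>]
  proof eventually_elim
    case (elim t)
    define z where "z = \<gamma> t"
    have z: "norm (z + a) \<ge> R" using elim by (simp add: z_def)
    have pos: "norm (z + a) ^ N > 0" using z R(2) by (intro zero_less_power) linarith
    have "c * (norm z)\<^sup>2 - 2 * \<alpha> * norm z - \<alpha>\<^sup>2 \<le> Re ((z + a)\<^sup>2)"
      using Re_shift_sq[of z] elim(2) by (simp add: z_def \<alpha>_def abs_le_iff)
    moreover have "norm (z + a) \<le> norm z + \<alpha>" unfolding \<alpha>_def by (rule norm_triangle_ineq)
    ultimately have "K \<le> Re ((z + a)\<^sup>2) - norm (z + a)" using elim(1) by (simp add: z_def algebra_simps)
    also have "\<dots> \<le> exp (Re ((z + a)\<^sup>2) - norm (z + a))" using exp_ge_add_one_self[of "Re ((z + a)\<^sup>2) - norm (z + a)"] by linarith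
    also have "\<dots> = exp (Re ((z + a)\<^sup>2)) / exp (norm (z + a))" by (simp add: exp_diff)
    also have "\<dots> \<le> M z" unfolding M_def using R(3)[OF z] pos by (intro divide_left_mono) auto
    finally have "norm c0 / 2 * K \<le> norm c0 / 2 * M z" by (intro mult_left_mono) auto
    moreover have "norm c0 / 2 * K = L / r + L + 1" using c0 by (simp add: K_def)
    ultimately have "norm (G z) > L / r" using G_norm_bounds(2)[OF z] by linarith
    from chordal_0_lessI[OF z this r] show ?case using chordal_0[OF z] L by (simp add: z_def abs_of_nonneg)
  qed
qed

lemma asymptotic_value_imag:
  assumes \<gamma>: "filterlim \<gamma> at_infinity at_top" and c: "c > 0" "d > 0"
    and re: "\<forall>\<^sub>F t in at_top. Re ((\<gamma> t)\<^sup>2) \<le> - c * (norm (\<gamma> t))\<^sup>2"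
    and \<sigma>: "\<sigma> = 1 \<or> \<sigma> = -1" and im: "\<forall>\<^sub>F t in at_top. \<sigma> * Im (\<gamma> t) \<ge> d * norm (\<gamma> t)"
  shows "((\<lambda>t. chordal_dist (sphere_map f (\<gamma> t)) (Some (\<i> * of_real \<sigma>))) \<longlongrightarrow> 0) at_top"
proof (rule tendstoI)
  fix r :: real assume r: "r > 0"
  define v where "v = Some (\<i> * complex_of_real \<sigma>)"
  have v: "v \<noteq> Some 0" using \<sigma> by (auto simp: v_def)
  have tbv: "tb v = \<i> * of_real (\<sigma> * L)" using \<sigma> L by (auto simp: v_def tb_def field_simps)
  define k where "k = tk v"
  have k: "k > 0" using tk_pos[OF v] by (simp add: k_def)
  define \<epsilon> where "\<epsilon> = r * L / k / (2 * norm c0)"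
  have \<epsilon>: "\<epsilon> > 0" using r L k c0 by (simp add: \<epsilon>_def)
  define \<alpha> where "\<alpha> = norm a"
  have "((\<lambda>x. exp (- c * x\<^sup>2 + 2 * \<alpha> * x + \<alpha>\<^sup>2)) \<longlongrightarrow> 0) at_top" using c by real_asymp
  from filterlim_compose[OF this filterlim_at_infinity_imp_norm_at_top[OF \<gamma>]]
  have 1: "\<forall>\<^sub>F t in at_top. exp (- c * (norm (\<gamma> t))\<^sup>2 + 2 * \<alpha> * norm (\<gamma> t) + \<alpha>\<^sup>2) < \<epsilon>"
    by (rule order_tendstoD) (rule \<epsilon>)
  have "filterlim (\<lambda>x. d * x - \<alpha>) at_top at_top" using c by real_asymp
  from filterlim_compose[OF this filterlim_at_infinity_imp_norm_at_top[OF \<gamma>]]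
  have 2: "\<forall>\<^sub>F t in at_top. d * norm (\<gamma> t) - \<alpha> \<ge> 0" unfolding filterlim_at_top by blast
  from 1 2 show "\<forall>\<^sub>F t in at_top. dist (chordal_dist (sphere_map f (\<gamma> t)) (Some (\<i> * of_real \<sigma>))) 0 < r"
    using re im eventually_far[OF \<gamma>]
  proof eventually_elim
    case (elim t)
    define z where "z = \<gamma> t"
    have z: "norm (z + a) \<ge> R" using elim by (simp add: z_def)
    have pos: "norm (z + a) ^ N \<ge> 1" using z R(2) by (intro one_le_power) linarith
    have "\<bar>\<sigma> * Im a\<bar> \<le> \<alpha>" using \<sigma> abs_Im_le_cmod[of a] by (auto simp: \<alpha>_def)
    hence im: "\<sigma> * Im (z + a) \<ge> 0" using elim(2,4) by (simp add: z_def distrib_left)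
    have "Re ((z + a)\<^sup>2) \<le> - c * (norm z)\<^sup>2 + 2 * \<alpha> * norm z + \<alpha>\<^sup>2"
      using Re_shift_sq[of z] elim(3) by (simp add: z_def \<alpha>_def abs_le_iff)
    hence "exp (Re ((z + a)\<^sup>2)) < \<epsilon>" using elim(1) by (smt (verit) exp_le_cancel_iff z_def)
    moreover have "M z \<le> exp (Re ((z + a)\<^sup>2)) / 1" unfolding M_def using pos by (intro divide_left_mono) auto
    ultimately have "M z < \<epsilon>" by simp
    hence "2 * norm c0 * M z < 2 * norm c0 * \<epsilon>" using c0 by simp
    also have "\<dots> = r * L / k" using c0 by (simp add: \<epsilon>_def)
    finally have "norm (G z - tb v) < r * L / k" using G_bounds(2)[OF \<sigma> z im] unfolding tbv by simp
    from chordal_nz_lessI[OF z v this[unfolded k_def] r] show ?case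
      using chordal_nz[OF z v] tk_pos[OF v] unfolding v_def[symmetric] z_def[symmetric] by simp
  qed
qed

end

section \<open>From kernel polynomials to functions of the family\<close>

text \<open>
  Multiplying numerator and denominator by \<open>\<bar>B\<bar>\<close> turns the chordal distance into an expression in the
  homogeneous coordinates \<open>z ^ n * P\<close> and \<open>B\<close>, which have no common zero.
\<close>

lemma (in zero_quotient) chordal_continuous:
  "continuous_on UNIV (\<lambda>z. chordal_dist (sphere_map f z) v)"
proof -
  define X where "X = (\<lambda>z. z ^ n * poly P z)"
  define S where "S = (\<lambda>z. sqrt ((norm (X z))\<^sup>2 + (norm (B z))\<^sup>2))"
  have XB: "X z \<noteq> 0 \<or> B z \<noteq> 0" for z using B_root_P[of z] by (auto simp: X_def)
  have S: "S z > 0" for z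
  proof -
    have "(norm (X z))\<^sup>2 + (norm (B z))\<^sup>2 > 0"
      using XB[of z] by (metis add_nonneg_pos add_pos_nonneg norm_ge_zero zero_less_norm_iff zero_le_power2 zero_less_power)
    thus ?thesis by (simp add: S_def)
  qed
  have cB: "continuous_on UNIV B" by (rule holomorphic_on_imp_continuous_on[OF holB])
  have cX: "continuous_on UNIV X" unfolding X_def by (intro continuous_intros)
  have cS: "continuous_on UNIV S" unfolding S_def by (intro continuous_intros cB cX)
  have q: "sqrt (1 + (norm (X z / B z))\<^sup>2) = S z / norm (B z)" if "B z \<noteq> 0" for z
  proof -
    have "1 + (norm (X z / B z))\<^sup>2 = ((norm (X z))\<^sup>2 + (norm (B z))\<^sup>2) / (norm (B z))\<^sup>2"
      using that by (simp add: norm_divide field_simps)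
    thus ?thesis by (simp add: S_def real_sqrt_divide)
  qed
  show ?thesis
  proof (cases v)
    case None
    have "chordal_dist (sphere_map f z) v = norm (B z) / S z" for z
    proof (cases "B z = 0")
      case False
      hence "chordal_dist (sphere_map f z) v = 1 / sqrt (1 + (norm (X z / B z))\<^sup>2)"
        by (simp add: None sphere_f X_def)
      thus ?thesis unfolding q[OF False] by simp
    qed (simp add: None sphere_f)
    moreover have "continuous_on UNIV (\<lambda>z. norm (B z) / S z)"
      using S by (intro continuous_intros cB cS) (metis less_irrefl)
    ultimately show ?thesis by simp
  next
    case (Some c)
    have "chordal_dist (sphere_map f z) v = norm (X z - c * B z) / (S z * sqrt (1 + (norm c)\<^sup>2))" for z
    proof (cases "B z = 0")
      case True
      hence "S z = norm (X z)" by (simp add: S_def)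
      moreover have "X z \<noteq> 0" using XB[of z] True by simp
      ultimately show ?thesis using True by (simp add: Some sphere_f)
    next
      case False
      have "X z / B z - c = (X z - c * B z) / B z" using False by (simp add: field_simps)
      hence "norm (X z / B z - c) = norm (X z - c * B z) / norm (B z)" by (simp add: norm_divide)
      moreover have "chordal_dist (sphere_map f z) v
          = norm (X z / B z - c) / (sqrt (1 + (norm (X z / B z))\<^sup>2) * sqrt (1 + (norm c)\<^sup>2))"
        using False by (simp add: Some sphere_f X_def)
      ultimately show ?thesis using False unfolding q[OF False] by simp
    qed
    moreover have "continuous_on UNIV (\<lambda>z. norm (X z - c * B z) / (S z * sqrt (1 + (norm c)\<^sup>2)))"
    proof (intro continuous_intros cB cS cX ballI)
      fix z
      show "S z * sqrt (1 + (norm c)\<^sup>2) \<noteq> 0" using S[of z] sqrt_one_plus_sq_pos[of c] by (metis less_irrefl mult_pos_pos)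
    qed
    ultimately show ?thesis by simp
  qed
qed

text \<open>
  The denominator of the Nevanlinna function with numerator \<open>A\<close>; the normalisation puts the asymptotic
  values of the quotient at \<open>\<plusminus> \<i>\<close>.
\<close>

definition companion :: "complex \<Rightarrow> complex poly \<Rightarrow> complex poly \<Rightarrow> complex \<Rightarrow> complex" where
  "companion a A s z = - (poly A z * gauss_prim (z + a) + poly s z * exp ((z + a)\<^sup>2)) / of_real gauss_limit"

definition nevanlinna_fn :: "complex \<Rightarrow> nat \<Rightarrow> complex poly \<Rightarrow> complex poly \<Rightarrow> complex \<Rightarrow> complex" where
  "nevanlinna_fn a n P s z = z ^ n * poly P z / companion a (monom 1 n * P) s z"

lemma divide_out_monomial:
  fixes W W1 :: "complex \<Rightarrow> complex"
  assumes "\<And>z. z ^ k * W z = z ^ k * W1 z" and "continuous_on UNIV W" "continuous_on UNIV W1"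
  shows "W z = W1 z"
proof (cases "z = 0")
  case True
  have "(W \<longlongrightarrow> W 0) (at 0)" "(W1 \<longlongrightarrow> W1 0) (at 0)"
    using assms(2,3) by (auto simp: continuous_on_eq_continuous_at isCont_def)
  moreover have "\<forall>\<^sub>F z in at 0. W z = W1 z"
  proof -
    have "\<forall>\<^sub>F w in at 0. w \<noteq> (0::complex)" by (auto simp: eventually_at_filter)
    thus ?thesis by eventually_elim (use assms(1) in auto)
  qed
  ultimately have "(W1 \<longlongrightarrow> W 0) (at 0)" by (simp add: tendsto_cong)
  thus ?thesis using \<open>(W1 \<longlongrightarrow> W1 0) (at 0)\<close> True by (simp add: tendsto_unique[OF at_neq_bot])
qed (use assms(1)[of z] in auto)

lemma companion_deriv:
  "(companion a A s has_field_derivative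
     - (poly (pderiv A) z * gauss_prim (z + a) + (poly A z + poly (pderiv s) z + 2 * (z + a) * poly s z) * exp ((z + a)\<^sup>2))
       / of_real gauss_limit) (at z)"
proof -
  have q: "((\<lambda>z. gauss_prim (z + a)) has_field_derivative exp ((z + a)\<^sup>2) * 1) (at z)"
    by (rule DERIV_chain2[OF gauss_prim_deriv]) (auto intro!: derivative_eq_intros)
  have e: "((\<lambda>z. exp ((z + a)\<^sup>2)) has_field_derivative exp ((z + a)\<^sup>2) * (2 * (z + a))) (at z)"
    by (rule derivative_eq_intros refl)+ simp
  have "((\<lambda>z. - (poly A z * gauss_prim (z + a) + poly s z * exp ((z + a)\<^sup>2)) / of_real gauss_limit) has_field_derivative
     - ((poly (pderiv A) z * gauss_prim (z + a) + exp ((z + a)\<^sup>2) * 1 * poly A z)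
        + (poly (pderiv s) z * exp ((z + a)\<^sup>2) + exp ((z + a)\<^sup>2) * (2 * (z + a)) * poly s z)) / of_real gauss_limit) (at z)"
    by (rule DERIV_cdivide[OF DERIV_minus[OF DERIV_add[OF DERIV_mult[OF poly_DERIV q] DERIV_mult[OF poly_DERIV e]]]])
  thus ?thesis unfolding companion_def[abs_def] by (simp add: algebra_simps)
qed

lemma companion_wronskian:
  "poly A z * deriv (companion a A s) z - poly (pderiv A) z * companion a A s z
     = - poly (gauss_wronskian a 1 A s) z / of_real gauss_limit * exp ((z + a)\<^sup>2)"
proof -
  have w: "poly (gauss_wronskian a 1 A s) z
      = (poly A z)\<^sup>2 + poly (pderiv s) z * poly A z - poly s z * poly (pderiv A) z + 2 * (z + a) * poly s z * poly A z"
    by (simp add: gauss_wronskian_def algebra_simps)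
  have aux: "A * (- (A' * q + (A + s' + 2 * w * s) * X) / l) - A' * (- (A * q + s * X) / l)
     = - (A\<^sup>2 + s' * A - s * A' + 2 * w * s * A) / l * X" for A A' q s s' w X l :: complex
    by (simp add: divide_inverse power2_eq_square algebra_simps)
  show ?thesis unfolding w companion_deriv[THEN DERIV_imp_deriv] unfolding companion_def by (rule aux)
qed

text \<open>
  The data that parametrise the family: \<open>a\<close> is the parameter, \<open>P\<close> the kernel polynomial, \<open>s\<close> the
  polynomial that completes it.
\<close>

locale kernel_fn =
  fixes a :: complex and m n :: nat and P s :: "complex poly" and \<kappa> :: complex
  assumes n: "n \<ge> 1" and m: "m \<ge> 1" and P: "P \<in> hermite_kernel a m n" and \<kappa>: "\<kappa> \<noteq> 0"
    and wr: "gauss_wronskian a 1 (monom 1 n * P) s = monom \<kappa> (n - 1)"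
begin

abbreviation A where "A \<equiv> monom 1 n * P"

definition h :: "complex \<Rightarrow> complex" where "h z = (z + a)\<^sup>2 + Ln (- \<kappa> / of_real gauss_limit)"

lemma P_props: "degree P = m - 1" "lead_coeff P = 1" "P \<noteq> 0"
  using P by (auto simp: hermite_kernel_def)

sublocale gs: gauss_solution a \<kappa> n "n + m - 1" "n + 2 * m" A s
proof
  show "lead_coeff A = 1" unfolding lead_coeff_mult lead_coeff_monom P_props(2) by simp
  show "degree A = n + m - 1" using P_props m by (simp add: degree_mult_eq degree_monom_eq)
qed (use wr \<kappa> n m in auto)

sublocale zq: zero_quotient n P "companion a A s" h "nevanlinna_fn a n P s"
proof
  show hol: "companion a A s holomorphic_on UNIV"
    unfolding holomorphic_on_open[OF open_UNIV] using companion_deriv by blast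
  show hh: "h holomorphic_on UNIV" unfolding h_def[abs_def] by (intro holomorphic_intros)
  show "nevanlinna_fn a n P s z = z ^ n * poly P z / companion a A s z" for z
    by (rule nevanlinna_fn_def)
  define B where "B = companion a A s"
  have "- \<kappa> / of_real gauss_limit \<noteq> (0::complex)" using \<kappa> gauss_limit_pos by simp
  hence eh: "exp (h z) = - \<kappa> / of_real gauss_limit * exp ((z + a)\<^sup>2)" for z
    unfolding h_def exp_add by (simp add: exp_Ln mult.commute)
  have "z ^ (n - 1) * (z * poly P z * deriv B z - (of_nat n * poly P z + z * poly (pderiv P) z) * B z) = z ^ (n - 1) * exp (h z)" for z
  proof -
    have zn: "z ^ n = z ^ (n - 1) * z" using n by (metis power_minus_mult less_eq_Suc_le One_nat_def)
    have A: "poly A z = z ^ (n - 1) * z * poly P z" using zn by (simp add: poly_monom)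
    have A': "poly (pderiv A) z = z ^ (n - 1) * (of_nat n * poly P z + z * poly (pderiv P) z)"
      using zn by (simp add: pderiv_mult pderiv_monom poly_monom algebra_simps)
    have "poly A z * deriv B z - poly (pderiv A) z * B z = z ^ (n - 1) * (- \<kappa> / of_real gauss_limit * exp ((z + a)\<^sup>2))"
      unfolding B_def companion_wronskian wr poly_monom by simp
    thus ?thesis unfolding A A' eh by (simp only: right_diff_distrib mult_ac)
  qed
  moreover have "continuous_on UNIV (\<lambda>z. z * poly P z * deriv B z - (of_nat n * poly P z + z * poly (pderiv P) z) * B z)"
    using hol by (intro holomorphic_on_imp_continuous_on holomorphic_intros holomorphic_deriv) (auto simp: B_def)
  moreover have "continuous_on UNIV (\<lambda>z. exp (h z))"
    using hh by (intro holomorphic_on_imp_continuous_on holomorphic_intros)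
  ultimately show "z * poly P z * deriv (companion a A s) z - (of_nat n * poly P z + z * poly (pderiv P) z) * companion a A s z = exp (h z)" for z
    unfolding B_def[symmetric] by (rule divide_out_monomial)
qed

lemma h_deriv: "deriv h z = 2 * (z + a)"
  unfolding h_def[abs_def] by (rule DERIV_imp_deriv) (auto intro!: derivative_eq_intros)

lemma sphere_G:
  assumes "poly A z \<noteq> 0"
  shows "sphere_map (nevanlinna_fn a n P s) z = (if gs.G z = 0 then None else Some (- of_real gauss_limit / gs.G z))"
proof -
  define D where "D = poly A z"
  have D: "D \<noteq> 0" using assms by (simp add: D_def)
  have B: "companion a A s z = - poly A z * gs.G z / of_real gauss_limit"
  proof -
    have "D * (gauss_prim (z + a) + poly s z / D * exp ((z + a)\<^sup>2)) = D * gauss_prim (z + a) + poly s z * exp ((z + a)\<^sup>2)"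
      using D by (simp add: distrib_left)
    thus ?thesis unfolding companion_def gs.G_def D_def[symmetric] by simp
  qed
  have A: "z ^ n * poly P z = poly A z" by (simp add: poly_monom)
  show ?thesis unfolding zq.sphere_f A B using assms gauss_limit_pos by (auto simp: field_simps)
qed

lemma gauss_tracts_ex: "\<exists>R0. gauss_tracts (nevanlinna_fn a n P s) gs.G a (\<kappa> / 2) gauss_limit R0 (n + 2 * m)"
proof -
  obtain C R1 where R1: "\<And>z. norm z \<ge> R1 \<Longrightarrow> poly A z \<noteq> 0" using gs.\<rho>'_bound by blast
  have e: "norm (\<kappa> / 2) / 4 > 0" using \<kappa> by simp
  obtain R2 where R2: "\<And>z. norm (z + a) \<ge> R2 \<Longrightarrow> Im (z + a) \<ge> 0 \<Longrightarrow>
      norm ((gs.G z - \<i> * of_real (1 * gauss_limit)) * (z + a) ^ (n + 2 * m) * exp (- (z + a)\<^sup>2) - \<kappa> / 2) \<le> norm (\<kappa> / 2) / 4"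
    using gs.G_asymptotic[of 1, OF _ e] by auto
  obtain R3 where R3: "\<And>z. norm (z + a) \<ge> R3 \<Longrightarrow> - Im (z + a) \<ge> 0 \<Longrightarrow>
      norm ((gs.G z - \<i> * of_real (-1 * gauss_limit)) * (z + a) ^ (n + 2 * m) * exp (- (z + a)\<^sup>2) - \<kappa> / 2) \<le> norm (\<kappa> / 2) / 4"
    using gs.G_asymptotic[of "-1", OF _ e] by auto
  define R0 where "R0 = max (R1 + norm a) (max R2 R3)"
  have "gauss_tracts (nevanlinna_fn a n P s) gs.G a (\<kappa> / 2) gauss_limit R0 (n + 2 * m)"
  proof
    show "gauss_limit > 0" by (rule gauss_limit_pos)
    show "\<kappa> / 2 \<noteq> 0" using \<kappa> by simp
    show "continuous_on UNIV (\<lambda>z. chordal_dist (sphere_map (nevanlinna_fn a n P s) z) v)" for v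
      by (rule zq.chordal_continuous)
    fix z assume z: "norm (z + a) \<ge> R0"
    have "norm z \<ge> R1" using z norm_triangle_ineq[of z a] by (simp add: R0_def)
    thus "sphere_map (nevanlinna_fn a n P s) z = (if gs.G z = 0 then None else Some (- of_real gauss_limit / gs.G z))"
      by (intro sphere_G R1)
  next
    fix z and \<sigma> :: real assume \<sigma>: "\<sigma> = 1 \<or> \<sigma> = -1" and z: "norm (z + a) \<ge> R0" "\<sigma> * Im (z + a) \<ge> 0"
    from \<sigma> show "norm ((gs.G z - \<i> * of_real (\<sigma> * gauss_limit)) * (z + a) ^ (n + 2 * m) * exp (- (z + a)\<^sup>2) - \<kappa> / 2) \<le> norm (\<kappa> / 2) / 4"
    proof
      assume "\<sigma> = 1"
      thus ?thesis using R2[of z] z by (simp add: R0_def)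
    next
      assume "\<sigma> = -1"
      thus ?thesis using R3[of z] z by (simp add: R0_def)
    qed
  qed
  thus ?thesis by blast
qed

text \<open>
  A point of a sector in polar coordinates about its axis.  The bound \<open>1 / 2\<close> for the cosine is
  crude: the angle is less than \<open>\<pi> / 4 < \<pi> / 3\<close>.
\<close>

lemma sector_bounds:
  assumes "z \<in> sector k \<delta>" "\<delta> < pi / 4"
  obtains \<phi> where "\<bar>\<phi>\<bar> < \<delta>" "z = of_real (norm z) * cis (\<phi> + of_int k * pi / 2)" "cos (2 * \<delta>) > 0" "cos (2 * \<phi>) \<ge> cos (2 * \<delta>)" "cos \<phi> \<ge> 1 / 2"
proof -
  obtain \<theta> where \<theta>: "is_Arg z \<theta>" "\<bar>\<theta> - of_int k * pi / 2\<bar> < \<delta>" using assms by (auto simp: sector_def)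
  define \<phi> where "\<phi> = \<theta> - of_int k * pi / 2"
  have \<phi>: "\<bar>\<phi>\<bar> < \<delta>" using \<theta> by (simp add: \<phi>_def)
  have \<delta>: "\<delta> > 0" using \<phi> by linarith
  have 1: "cos (2 * \<delta>) > 0" using assms(2) \<delta> by (intro cos_gt_zero) auto
  have "cos (2 * \<delta>) \<le> cos (2 * \<bar>\<phi>\<bar>)" using \<phi> assms(2) by (intro cos_monotone_0_pi_le) auto
  hence 2: "cos (2 * \<phi>) \<ge> cos (2 * \<delta>)" by (auto simp: abs_if split: if_splits)
  have "cos (pi / 3) \<le> cos \<bar>\<phi>\<bar>" using \<phi> assms(2) by (intro cos_monotone_0_pi_le) auto
  hence 3: "cos \<phi> \<ge> 1 / 2" by (simp add: cos_60 cos_abs_real)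
  have "z = of_real (norm z) * cis (\<phi> + of_int k * pi / 2)"
    using \<theta>(1) by (simp add: \<phi>_def is_Arg_def cis_conv_exp mult.commute)
  thus thesis using that[of \<phi>] \<phi> 1 2 3 by blast
qed

lemma Re_cis_sq: "Re ((of_real \<rho> * cis \<theta>)\<^sup>2) = \<rho>\<^sup>2 * cos (2 * \<theta>)"
proof -
  have "cis \<theta> ^ 2 = cis (2 * \<theta>)" by (simp add: power2_eq_square cis_mult)
  hence "(of_real \<rho> * cis \<theta>)\<^sup>2 = of_real (\<rho>\<^sup>2) * cis (2 * \<theta>)" by (simp add: power_mult_distrib)
  thus ?thesis by simp
qed

lemma asymptotic_values:
  shows "has_asymptotic_value (nevanlinna_fn a n P s) 0 (Some 0)" "has_asymptotic_value (nevanlinna_fn a n P s) 2 (Some 0)"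
    "has_asymptotic_value (nevanlinna_fn a n P s) 1 (Some \<i>)" "has_asymptotic_value (nevanlinna_fn a n P s) (-1) (Some (- \<i>))"
proof -
  obtain R0 where "gauss_tracts (nevanlinna_fn a n P s) gs.G a (\<kappa> / 2) gauss_limit R0 (n + 2 * m)"
    using gauss_tracts_ex by blast
  then interpret gt: gauss_tracts "nevanlinna_fn a n P s" gs.G a "\<kappa> / 2" gauss_limit R0 "n + 2 * m" .
  have even: "has_asymptotic_value (nevanlinna_fn a n P s) k (Some 0)" if k: "k = 0 \<or> k = 2" for k
    unfolding has_asymptotic_value_def
  proof (intro allI impI)
    fix \<gamma> assume \<gamma>: "nontangential_curve k \<gamma>"
    then obtain \<delta> where \<delta>: "\<delta> < pi / 4" "\<forall>\<^sub>F t in at_top. \<gamma> t \<in> sector k \<delta>" and inf: "filterlim \<gamma> at_infinity at_top"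
      by (auto simp: nontangential_curve_def)
    obtain t0 where "\<gamma> t0 \<in> sector k \<delta>" using \<delta>(2) by (metis eventually_happens trivial_limit_at_top_linorder)
    hence c: "cos (2 * \<delta>) > 0" using sector_bounds[OF _ \<delta>(1)] by metis
    show "((\<lambda>t. chordal_dist (sphere_map (nevanlinna_fn a n P s) (\<gamma> t)) (Some 0)) \<longlongrightarrow> 0) at_top"
    proof (rule gt.asymptotic_value_0[OF inf c])
      show "\<forall>\<^sub>F t in at_top. Re ((\<gamma> t)\<^sup>2) \<ge> cos (2 * \<delta>) * (norm (\<gamma> t))\<^sup>2"
        using \<delta>(2)
      proof eventually_elim
        case (elim t)
        obtain \<phi> where \<phi>: "\<gamma> t = of_real (norm (\<gamma> t)) * cis (\<phi> + of_int k * pi / 2)" "cos (2 * \<phi>) \<ge> cos (2 * \<delta>)"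
          using sector_bounds[OF elim \<delta>(1)] by metis
        have "cos (2 * (\<phi> + of_int k * pi / 2)) = cos (2 * \<phi>)"
          using k by (auto simp: distrib_left cos_add)
        hence "Re ((\<gamma> t)\<^sup>2) = (norm (\<gamma> t))\<^sup>2 * cos (2 * \<phi>)"
          by (subst \<phi>(1)) (simp only: Re_cis_sq)
        thus ?case using mult_right_mono[OF \<phi>(2), of "(norm (\<gamma> t))\<^sup>2"] by (simp add: mult.commute)
      qed
    qed
  qed
  show "has_asymptotic_value (nevanlinna_fn a n P s) 0 (Some 0)" "has_asymptotic_value (nevanlinna_fn a n P s) 2 (Some 0)"
    using even by auto
  have odd: "has_asymptotic_value (nevanlinna_fn a n P s) k (Some (\<i> * of_real (of_int k)))" if k: "k = 1 \<or> k = -1" for k :: int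
    unfolding has_asymptotic_value_def
  proof (intro allI impI)
    fix \<gamma> assume \<gamma>: "nontangential_curve k \<gamma>"
    then obtain \<delta> where \<delta>: "\<delta> < pi / 4" "\<forall>\<^sub>F t in at_top. \<gamma> t \<in> sector k \<delta>" and inf: "filterlim \<gamma> at_infinity at_top"
      by (auto simp: nontangential_curve_def)
    obtain t0 where "\<gamma> t0 \<in> sector k \<delta>" using \<delta>(2) by (metis eventually_happens trivial_limit_at_top_linorder)
    hence c: "cos (2 * \<delta>) > 0" using sector_bounds[OF _ \<delta>(1)] by metis
    show "((\<lambda>t. chordal_dist (sphere_map (nevanlinna_fn a n P s) (\<gamma> t)) (Some (\<i> * of_real (of_int k)))) \<longlongrightarrow> 0) at_top"
    proof (rule gt.asymptotic_value_imag[OF inf c])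
      show "(0::real) < 1 / 2" by simp
      show "real_of_int k = 1 \<or> real_of_int k = - 1" using k by auto
      show "\<forall>\<^sub>F t in at_top. Re ((\<gamma> t)\<^sup>2) \<le> - cos (2 * \<delta>) * (norm (\<gamma> t))\<^sup>2"
        using \<delta>(2)
      proof eventually_elim
        case (elim t)
        obtain \<phi> where \<phi>: "\<gamma> t = of_real (norm (\<gamma> t)) * cis (\<phi> + of_int k * pi / 2)" "cos (2 * \<phi>) \<ge> cos (2 * \<delta>)"
          using sector_bounds[OF elim \<delta>(1)] by metis
        have "cos (2 * (\<phi> + of_int k * pi / 2)) = - cos (2 * \<phi>)"
          using k by (auto simp: distrib_left cos_add)
        hence "Re ((\<gamma> t)\<^sup>2) = - ((norm (\<gamma> t))\<^sup>2 * cos (2 * \<phi>))"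
          by (subst \<phi>(1)) (simp only: Re_cis_sq mult_minus_right)
        thus ?case using mult_right_mono[OF \<phi>(2), of "(norm (\<gamma> t))\<^sup>2"] by (simp add: mult.commute)
      qed
      show "\<forall>\<^sub>F t in at_top. 1 / 2 * norm (\<gamma> t) \<le> of_int k * Im (\<gamma> t)"
        using \<delta>(2)
      proof eventually_elim
        case (elim t)
        obtain \<phi> where \<phi>: "\<gamma> t = of_real (norm (\<gamma> t)) * cis (\<phi> + of_int k * pi / 2)" "cos \<phi> \<ge> 1 / 2"
          using sector_bounds[OF elim \<delta>(1)] by metis
        have "of_int k * sin (\<phi> + of_int k * pi / 2) = cos \<phi>" using k by (auto simp: sin_add)
        hence "of_int k * Im (\<gamma> t) = norm (\<gamma> t) * cos \<phi>"
          by (subst \<phi>(1)) (simp add: mult.left_commute)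
        thus ?case using mult_right_mono[OF \<phi>(2), of "norm (\<gamma> t)"] by (simp add: mult.commute)
      qed
    qed
  qed
  show "has_asymptotic_value (nevanlinna_fn a n P s) 1 (Some \<i>)" "has_asymptotic_value (nevanlinna_fn a n P s) (-1) (Some (- \<i>))"
    using odd[of 1] odd[of "-1"] by auto
qed

theorem in_F1_hat: "nevanlinna_fn a n P s \<in> F1_hat m n"
proof -
  obtain R0 where "gauss_tracts (nevanlinna_fn a n P s) gs.G a (\<kappa> / 2) gauss_limit R0 (n + 2 * m)"
    using gauss_tracts_ex by blast
  then interpret gt: gauss_tracts "nevanlinna_fn a n P s" gs.G a "\<kappa> / 2" gauss_limit R0 "n + 2 * m" .
  interpret tr: tracts "nevanlinna_fn a n P s" a gt.R by (rule gt.tracts)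
  have "nevanlinna_fn a n P s \<in> F1"
    unfolding F1_def using zq.f_nicely_meromorphic zq.f_critical tr.singularities zq.schwarzian_bigo[OF h_deriv]
      zq.sphere_f_0 asymptotic_values by auto
  moreover have "other_zeros (nevanlinna_fn a n P s) = {z. poly P z = 0}" by (rule zq.f_other_zeros)
  moreover have "finite {z. poly P z = 0}" using P_props by (intro poly_roots_finite) auto
  moreover have "m = card {z. poly P z = 0} + 1" using hermite_kernel_card_roots[OF n P] m by simp
  moreover have "n = crit_mult (nevanlinna_fn a n P s) + 1" using zq.f_crit_mult by simp
  ultimately show ?thesis unfolding F1_hat_def by simp
qed

theorem projection_eq: "- (1 / 4) * schwarzian_coeff (nevanlinna_fn a n P s) 1 = a"
  using zq.schwarzian_coeff_1[OF h_deriv] by simp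

end

section \<open>From functions of the family to quotients of entire functions\<close>

lemma chordal_dist_self [simp]: "chordal_dist v v = 0"
  by (cases v) auto

text \<open>
  A curve that stays in a vertical strip, high up; its argument differs from \<open>\<plusminus> \<pi> / 2\<close> by at most \<open>arctan (1 / 2) \<le> 1 / 2\<close>, and
  \<open>\<pi> / 4 - 1 / 100\<close> still exceeds \<open>1 / 2\<close>.
\<close>

lemma nontangential_vertical:
  assumes \<sigma>: "\<sigma> = 1 \<or> \<sigma> = -1" and x: "\<And>t. t \<ge> 0 \<Longrightarrow> \<bar>Re (\<gamma> t)\<bar> \<le> x" "x \<ge> 0"
    and im: "\<And>t. t \<ge> 0 \<Longrightarrow> of_int \<sigma> * Im (\<gamma> t) \<ge> 2 * x + 1 + t" and cont: "continuous_on {0..} \<gamma>"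
  shows "nontangential_curve \<sigma> \<gamma>"
proof -
  have sec: "\<gamma> t \<in> sector \<sigma> (pi / 4 - 1 / 100)" if t: "t \<ge> 0" for t
  proof -
    define y where "y = of_int \<sigma> * Im (\<gamma> t)"
    define v where "v = \<gamma> t * (- \<i> * of_int \<sigma>)"
    have s2: "(of_int \<sigma> * of_int \<sigma> :: complex) = 1" using \<sigma> by auto
    have v: "Re v = y" "Im v = - of_int \<sigma> * Re (\<gamma> t)" using \<sigma> by (auto simp: v_def y_def)
    have y: "y \<ge> 2 * x + 1" using im[OF t] t by (simp add: y_def)
    have y0: "y > 0" using y x(2) by linarith
    have v0: "v \<noteq> 0" using v y0 by auto
    have gv: "\<gamma> t = v * (\<i> * of_int \<sigma>)"
    proof -
      have "v * (\<i> * of_int \<sigma>) = \<gamma> t * (- (\<i> * \<i>)) * (of_int \<sigma> * of_int \<sigma>)" by (simp only: v_def mult_ac minus_mult_left[symmetric] minus_mult_right[symmetric])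
      thus ?thesis unfolding s2 by simp
    qed
    have "Arg v = arctan (Im v / Re v)" using v y0 by (intro arg_conv_arctan) auto
    moreover have "\<bar>Im v / Re v\<bar> \<le> 1 / 2"
    proof -
      have "\<bar>Im v\<bar> \<le> x" using x(1)[OF t] \<sigma> v by auto
      thus ?thesis using v y y0 x(2) by (simp add: abs_divide divide_le_eq)
    qed
    hence "\<bar>arctan (Im v / Re v)\<bar> \<le> 1 / 2"
      using abs_arctan_le[of "Im v / Re v"] by linarith
    ultimately have A: "\<bar>Arg v\<bar> \<le> 1 / 2" by simp
    have "cis (of_int \<sigma> * pi / 2) = \<i> * of_int \<sigma>" using \<sigma> by (auto simp: complex_eq_iff)
    moreover have "v = of_real (norm v) * cis (Arg v)" using rcis_cmod_Arg[of v] by (simp add: rcis_def)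
    ultimately have "\<gamma> t = of_real (norm v) * cis (Arg v + of_int \<sigma> * pi / 2)"
      using gv by (simp add: cis_mult[symmetric] mult.assoc)
    moreover have "norm (\<gamma> t) = norm v" using \<sigma> unfolding gv by (auto simp: norm_mult)
    ultimately have "is_Arg (\<gamma> t) (Arg v + of_int \<sigma> * pi / 2)"
      by (simp add: is_Arg_def cis_conv_exp mult.commute)
    moreover have "\<gamma> t \<noteq> 0" using v0 \<sigma> unfolding gv by auto
    moreover have "\<bar>Arg v\<bar> < pi / 4 - 1 / 100" using A pi_gt3 by simp
    ultimately show ?thesis unfolding sector_def by (auto intro!: exI[of _ "Arg v + of_int \<sigma> * pi / 2"])
  qed
  have inf: "filterlim \<gamma> at_infinity at_top"
  proof (rule filterlim_norm_at_top_imp_at_infinity, rule filterlim_at_top_mono[OF filterlim_ident])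
    show "\<forall>\<^sub>F t in at_top. t \<le> norm (\<gamma> t)"
    proof (rule eventually_at_top_linorderI[of 0])
      fix t :: real assume t: "t \<ge> 0"
      have "t \<le> \<bar>of_int \<sigma> * Im (\<gamma> t)\<bar>" using im[OF t] x(2) by linarith
      also have "\<dots> = \<bar>Im (\<gamma> t)\<bar>" using \<sigma> by auto
      finally show "t \<le> norm (\<gamma> t)" using abs_Im_le_cmod[of "\<gamma> t"] by linarith
    qed
  qed
  have sub: "sector \<sigma> (pi / 4 - 1 / 100) \<subseteq> stokes_sector \<sigma>" by (force simp: sector_def stokes_sector_def)
  show ?thesis unfolding nontangential_curve_def
    using sec sub cont inf by (auto intro!: exI[of _ "pi / 4 - 1 / 100"] eventually_at_top_linorderI[of 0])
qed

lemma nontangential_real: "x0 > 0 \<Longrightarrow> nontangential_curve 0 (\<lambda>t. of_real (x0 + t))"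
proof -
  assume x0: "x0 > 0"
  have sec: "of_real (x0 + t) \<in> sector 0 \<delta>" if "t \<ge> 0" "\<delta> > 0" for t \<delta>
    using x0 that unfolding sector_def by (auto intro!: exI[of _ 0] simp: is_Arg_def simp flip: of_real_add)
  have "filterlim (\<lambda>t. of_real (x0 + t) :: complex) at_infinity at_top"
  proof (rule filterlim_norm_at_top_imp_at_infinity, rule filterlim_at_top_mono[OF filterlim_ident])
    show "\<forall>\<^sub>F t in at_top. t \<le> norm (of_real (x0 + t) :: complex)"
      by (rule eventually_at_top_linorderI[of 0], unfold norm_of_real) (use x0 in auto)
  qed
  moreover have "continuous_on {0..} (\<lambda>t. of_real (x0 + t) :: complex)" by (intro continuous_intros)
  moreover have "\<exists>\<delta><pi / 4. \<forall>\<^sub>F t in at_top. of_real (x0 + t) \<in> sector 0 \<delta>"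
    by (intro exI[of _ "pi / 8"] conjI eventually_at_top_linorderI[of 0] sec) auto
  ultimately show ?thesis unfolding nontangential_curve_def stokes_sector_def using sec[of _ "pi / 4"] by auto
qed

locale F1_hat_fn =
  fixes m n :: nat and f :: "complex \<Rightarrow> complex"
  assumes m: "m \<ge> 1" and n: "n \<ge> 1" and f: "f \<in> F1_hat m n"
begin

lemma F1_props:
  shows mero: "f nicely_meromorphic_on UNIV" and crit: "\<And>z. critical_point f z \<Longrightarrow> z = 0"
    and schw_O: "(\<lambda>z. schwarzian f z + 2 * z\<^sup>2) \<in> O[at_infinity](\<lambda>z. z)"
    and sphere_0: "sphere_map f 0 = Some 0"
    and asym_0: "has_asymptotic_value f 0 (Some 0)"
    and asym_1: "has_asymptotic_value f 1 (Some \<i>)" and asym_m1: "has_asymptotic_value f (-1) (Some (-\<i>))"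
    and fin: "finite (other_zeros f)" and card: "card (other_zeros f) = m - 1" and ord: "crit_mult f = n - 1"
proof -
  have F1: "f \<in> F1" and o: "finite (other_zeros f)" "m = card (other_zeros f) + 1" "n = crit_mult f + 1"
    using f unfolding F1_hat_def by blast+
  show "finite (other_zeros f)" by (rule o(1))
  show "card (other_zeros f) = m - 1" "crit_mult f = n - 1" using o by linarith+
  note props = F1[unfolded F1_def mem_Collect_eq]
  show "f nicely_meromorphic_on UNIV" "(\<lambda>z. schwarzian f z + 2 * z\<^sup>2) \<in> O[at_infinity](\<lambda>z. z)"
    "sphere_map f 0 = Some 0" "has_asymptotic_value f 0 (Some 0)"
    "has_asymptotic_value f 1 (Some \<i>)" "has_asymptotic_value f (-1) (Some (-\<i>))"
    using props by blast+
  show "z = 0" if "critical_point f z" for z using props that by blast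
qed

lemma pole_value: "is_pole f z \<Longrightarrow> f z = 0"
proof -
  assume p: "is_pole f z"
  have "is_pole f z \<and> f z = 0 \<or> f \<midarrow>z\<rightarrow> f z" using mero unfolding nicely_meromorphic_on_def by blast
  moreover have "\<not> f \<midarrow>z\<rightarrow> f z"
    using not_tendsto_and_filterlim_at_infinity[of "at z" f "f z"] p unfolding is_pole_def by (meson at_neq_bot)
  ultimately show "f z = 0" by blast
qed

lemma analytic: "\<not> is_pole f z \<Longrightarrow> f analytic_on {z}"
  by (rule nicely_meromorphic_on_imp_analytic_at[OF mero UNIV_I])

lemma zero_0: "\<not> is_pole f 0" "f 0 = 0"
  using sphere_0 unfolding sphere_map_def by (cases "is_pole f 0"; simp)+

lemma other_zeros_iff: "z \<in> other_zeros f \<longleftrightarrow> z \<noteq> 0 \<and> \<not> is_pole f z \<and> f z = 0"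
  unfolding other_zeros_def sphere_map_def by simp

lemma nonconst: "\<exists>z. \<not> is_pole f z \<and> f z \<noteq> 0 \<or> is_pole f z"
proof -
  have "nontangential_curve 1 (\<lambda>t. \<i> * of_real (1 + t))"
    by (rule nontangential_vertical[where x = 0]) (auto intro!: continuous_intros)
  hence "((\<lambda>t. chordal_dist (sphere_map f (\<i> * of_real (1 + t))) (Some \<i>)) \<longlongrightarrow> 0) at_top"
    using asym_1 unfolding has_asymptotic_value_def by blast
  hence "\<forall>\<^sub>F t in at_top. chordal_dist (sphere_map f (\<i> * of_real (1 + t))) (Some \<i>) < 1 / sqrt 2"
    by (rule order_tendstoD(2)) simp
  then obtain t where "chordal_dist (sphere_map f (\<i> * of_real (1 + t))) (Some \<i>) < 1 / sqrt 2"
    by (rule eventually_happens'[OF trivial_limit_at_top_linorder, THEN exE])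
  moreover have "\<not> chordal_dist (Some 0) (Some \<i>) < 1 / sqrt 2" by simp
  ultimately have "sphere_map f (\<i> * of_real (1 + t)) \<noteq> Some 0" by metis
  thus ?thesis by (metis sphere_map_def)
qed

lemma f_nz_near: "\<forall>\<^sub>F w in at z. f w \<noteq> 0"
proof (rule ccontr)
  assume "\<not> ?thesis"
  hence "\<exists>\<^sub>F w in at z. f w = 0" by (simp add: frequently_def)
  from frequently_eq_meromorphic_imp_constant[OF this mero] have zero: "f w = 0" for w using connected_UNIV by simp
  hence "f = (\<lambda>_. 0)" by (rule ext)
  moreover have "\<not> is_pole (\<lambda>_. 0 :: complex) w" for w :: complex
    using not_tendsto_and_filterlim_at_infinity[OF at_neq_bot tendsto_const] unfolding is_pole_def by blast
  ultimately have "\<not> is_pole f w" for w by metis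
  thus False using nonconst zero by blast
qed

lemma zorder_0: "zorder f 0 = int n"
proof -
  obtain S where S: "open S" "0 \<in> S" "f holomorphic_on S" using analytic[OF zero_0(1)] by (auto simp: analytic_at)
  then obtain r where r: "r > 0" "ball 0 r \<subseteq> S" by (meson openE)
  have hol: "f holomorphic_on ball 0 r" using S r holomorphic_on_subset by blast
  have "\<exists>w\<in>ball 0 r. f w \<noteq> 0"
  proof -
    have "\<forall>\<^sub>F w in at 0. f w \<noteq> 0 \<and> w \<in> ball 0 r"
      by (intro eventually_conj f_nz_near eventually_at_in_open') (use r in auto)
    from eventually_happens'[OF at_neq_bot this] show ?thesis by blast
  qed
  hence "zorder f 0 > 0" using zorder_exist_zero[OF hol] r zero_0(2) by auto
  thus ?thesis using ord n by (simp add: crit_mult_def)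
qed

definition P :: "complex poly" where "P = (\<Prod>z\<in>other_zeros f. [:- z, 1:])"

lemma P_root_iff: "poly P z = 0 \<longleftrightarrow> z \<in> other_zeros f"
  using fin by (simp add: P_def poly_prod)

lemma P_props: "degree P = m - 1" "lead_coeff P = 1" "P \<noteq> 0" "poly P 0 \<noteq> 0"
proof -
  show "degree P = m - 1" unfolding P_def using card by (subst degree_prod_sum_eq) auto
  show "lead_coeff P = 1" unfolding P_def lead_coeff_prod by simp
  thus "P \<noteq> 0" by auto
  show "poly P 0 \<noteq> 0" by (simp add: P_root_iff other_zeros_iff)
qed

lemma P_simple: "poly P z = 0 \<Longrightarrow> poly (pderiv P) z \<noteq> 0"
proof -
  assume "poly P z = 0"
  hence z: "z \<in> other_zeros f" by (simp add: P_root_iff)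
  define Q where "Q = (\<Prod>w\<in>other_zeros f - {z}. [:- w, 1:])"
  have "P = [:- z, 1:] * Q" unfolding P_def Q_def using fin z by (rule prod.remove)
  moreover have "poly (pderiv ([:- z, 1:] * Q)) z = poly Q z" unfolding pderiv_mult by (simp add: pderiv_pCons)
  ultimately have "poly (pderiv P) z = poly Q z" by (simp only:)
  moreover have "poly Q z \<noteq> 0" using fin by (auto simp: Q_def poly_prod)
  ultimately show ?thesis by simp
qed

definition Ap :: "complex \<Rightarrow> complex" where "Ap z = z ^ n * poly P z"

lemma Ap_zero_iff: "Ap z = 0 \<longleftrightarrow> \<not> is_pole f z \<and> f z = 0"
  using n zero_0 by (cases "z = 0") (auto simp: Ap_def P_root_iff other_zeros_iff)

lemma Ap_deriv: "(Ap has_field_derivative of_nat n * z ^ (n - 1) * poly P z + z ^ n * poly (pderiv P) z) (at z)"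
  unfolding Ap_def[abs_def] by (rule derivative_eq_intros poly_DERIV refl)+ simp

text \<open>
  The numerator \<open>Ap\<close> has exactly the zeros of \<open>f\<close>, with multiplicities, so the quotient extends to an
  entire function whose zeros are the poles of \<open>f\<close>.
\<close>

definition B :: "complex \<Rightarrow> complex" where "B = remove_sings (\<lambda>z. Ap z / f z)"

lemma B_isolated: "isolated_singularity_at (\<lambda>z. Ap z / f z) z"
proof -
  have "(\<lambda>z. Ap z / f z) meromorphic_on UNIV"
  proof (rule meromorphic_on_divide)
    have "Ap holomorphic_on UNIV" unfolding Ap_def[abs_def] by (intro holomorphic_intros)
    thus "Ap meromorphic_on UNIV" by (intro analytic_on_imp_meromorphic_on) (simp add: analytic_on_open)
    show "f meromorphic_on UNIV" using mero by (simp add: nicely_meromorphic_on_def)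
  qed
  thus ?thesis using meromorphic_on_isolated_singularity by (metis meromorphic_on_subset UNIV_I empty_subsetI insert_subset)
qed

lemma B_limit_pole: "is_pole f z \<Longrightarrow> (\<lambda>z. Ap z / f z) \<midarrow>z\<rightarrow> 0"
proof -
  assume "is_pole f z"
  hence "filterlim f at_infinity (at z)" by (simp add: is_pole_def)
  moreover have "Ap \<midarrow>z\<rightarrow> Ap z" using Ap_deriv[THEN DERIV_isCont] by (rule isContD)
  ultimately show ?thesis by (intro tendsto_divide_0)
qed

lemma B_limit_regular: "\<not> is_pole f z \<Longrightarrow> f z \<noteq> 0 \<Longrightarrow> (\<lambda>z. Ap z / f z) \<midarrow>z\<rightarrow> Ap z / f z"
  using analytic[of z] Ap_deriv[THEN DERIV_isCont]
  by (intro tendsto_divide) (auto dest: analytic_at_imp_isCont isContD)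

lemma other_zero_deriv: "z \<in> other_zeros f \<Longrightarrow> deriv f z \<noteq> 0"
  using crit[of z] by (auto simp: other_zeros_iff critical_point_def)

lemma B_limit_other_zero:
  assumes z: "z \<in> other_zeros f"
  shows "(\<lambda>z. Ap z / f z) \<midarrow>z\<rightarrow> z ^ n * poly (pderiv P) z / deriv f z"
proof -
  have fz: "\<not> is_pole f z" "f z = 0" using z by (auto simp: other_zeros_iff)
  have "(f has_field_derivative deriv f z) (at z)"
    using analytic[OF fz(1)] by (metis analytic_at holomorphic_derivI)
  hence 1: "(\<lambda>w. (f w - f z) / (w - z)) \<midarrow>z\<rightarrow> deriv f z" by (simp add: has_field_derivative_iff)
  have Az: "Ap z = 0" "poly P z = 0" using fz z by (auto simp: Ap_zero_iff P_root_iff)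
  have 2: "(\<lambda>w. (Ap w - Ap z) / (w - z)) \<midarrow>z\<rightarrow> z ^ n * poly (pderiv P) z"
    using Ap_deriv[of z] Az(2) by (simp add: has_field_derivative_iff)
  have "(\<lambda>w. ((Ap w - Ap z) / (w - z)) / ((f w - f z) / (w - z))) \<midarrow>z\<rightarrow> z ^ n * poly (pderiv P) z / deriv f z"
    by (rule tendsto_divide[OF 2 1 other_zero_deriv[OF z]])
  moreover have "\<forall>\<^sub>F w in at z. ((Ap w - Ap z) / (w - z)) / ((f w - f z) / (w - z)) = Ap w / f w"
    by (auto simp: eventually_at_filter fz Az)
  ultimately show ?thesis by (rule Lim_transform_eventually)
qed

lemma B_limit_0: "\<exists>c. c \<noteq> 0 \<and> (\<lambda>z. Ap z / f z) \<midarrow>0\<rightarrow> c"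
proof -
  obtain S where S: "open S" "0 \<in> S" "f holomorphic_on S" using analytic[OF zero_0(1)] by (auto simp: analytic_at)
  then obtain r where r: "r > 0" "ball 0 r \<subseteq> S" by (meson openE)
  have hol: "f holomorphic_on ball 0 r" using S r holomorphic_on_subset by blast
  have "\<exists>w\<in>ball 0 r. f w \<noteq> 0"
  proof -
    have "\<forall>\<^sub>F w in at 0. f w \<noteq> 0 \<and> w \<in> ball 0 r"
      by (intro eventually_conj f_nz_near eventually_at_in_open') (use r in auto)
    from eventually_happens'[OF at_neq_bot this] show ?thesis by blast
  qed
  then obtain e where e: "e > 0" "zor_poly f 0 holomorphic_on cball 0 e"
     "\<And>w. w \<in> cball 0 e \<Longrightarrow> f w = zor_poly f 0 w * w ^ n \<and> zor_poly f 0 w \<noteq> 0"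
    using zorder_exist_zero[OF hol, of 0] r by (auto simp: zorder_0)
  define g where "g = zor_poly f 0"
  have "continuous_on (cball 0 e) g" using e(2) by (simp add: g_def holomorphic_on_imp_continuous_on)
  hence "isCont g 0" using e(1) continuous_on_interior[of "cball 0 e" g 0] by simp
  hence "g \<midarrow>0\<rightarrow> g 0" by (rule isContD)
  moreover have g0: "g 0 \<noteq> 0" using e(1) e(3)[of 0] by (simp add: g_def)
  ultimately have "(\<lambda>w. poly P w / g w) \<midarrow>0\<rightarrow> poly P 0 / g 0" by (intro tendsto_intros)
  moreover have "\<forall>\<^sub>F w in at 0. poly P w / g w = Ap w / f w"
  proof -
    have "\<forall>\<^sub>F w in at 0. w \<in> ball 0 e" using e(1) by (intro eventually_at_in_open') auto
    moreover have "\<forall>\<^sub>F w in at 0. w \<noteq> (0::complex)" by (auto simp: eventually_at_filter)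
    ultimately show ?thesis
    proof eventually_elim
      case (elim w)
      thus ?case using e(3)[of w] by (simp add: Ap_def g_def)
    qed
  qed
  ultimately have "(\<lambda>z. Ap z / f z) \<midarrow>0\<rightarrow> poly P 0 / g 0" by (rule Lim_transform_eventually)
  thus ?thesis using P_props(4) g0 by (intro exI[of _ "poly P 0 / g 0"]) auto
qed

lemma B_holomorphic: "B holomorphic_on UNIV"
proof -
  have "B analytic_on {z}" for z
  proof -
    obtain c where "(\<lambda>z. Ap z / f z) \<midarrow>z\<rightarrow> c"
      using B_limit_pole[of z] B_limit_regular[of z] B_limit_other_zero[of z] B_limit_0
      by (cases "is_pole f z"; cases "f z = 0"; cases "z = 0") (auto simp: other_zeros_iff)
    thus ?thesis unfolding B_def by (rule remove_sings_analytic_at[OF B_isolated])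
  qed
  hence "B analytic_on UNIV" by (subst analytic_on_analytic_at) auto
  thus ?thesis by (rule analytic_imp_holomorphic)
qed

lemma B_values:
  shows "is_pole f z \<Longrightarrow> B z = 0" and "\<not> is_pole f z \<Longrightarrow> f z \<noteq> 0 \<Longrightarrow> B z = Ap z / f z"
    and "z \<in> other_zeros f \<Longrightarrow> B z \<noteq> 0" and "B 0 \<noteq> 0"
proof -
  show "is_pole f z \<Longrightarrow> B z = 0" unfolding B_def by (intro remove_sings_eqI B_limit_pole)
  show "\<not> is_pole f z \<Longrightarrow> f z \<noteq> 0 \<Longrightarrow> B z = Ap z / f z" unfolding B_def by (intro remove_sings_eqI B_limit_regular)
  show "B z \<noteq> 0" if z: "z \<in> other_zeros f"
  proof -
    have "B z = z ^ n * poly (pderiv P) z / deriv f z"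
      unfolding B_def by (intro remove_sings_eqI B_limit_other_zero z)
    thus ?thesis using z P_simple[of z] other_zero_deriv[OF z] by (auto simp: P_root_iff other_zeros_iff)
  qed
  show "B 0 \<noteq> 0" using B_limit_0 remove_sings_eqI unfolding B_def by metis
qed

lemma f_eq: "f z = Ap z / B z"
proof (cases "is_pole f z")
  case False
  show ?thesis
  proof (cases "f z = 0")
    case True
    thus ?thesis using False by (simp add: Ap_zero_iff[THEN iffD2])
  next
    case nz: False
    hence "Ap z \<noteq> 0" using Ap_zero_iff by simp
    thus ?thesis using B_values(2)[OF False nz] nz by simp
  qed
qed (simp add: B_values pole_value)

lemma B_deriv: "(B has_field_derivative deriv B z) (at z)"
  using B_holomorphic by (auto intro: holomorphic_derivI)

lemma B_pole_simple:
  assumes z: "is_pole f z"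
  shows "deriv B z \<noteq> 0"
proof -
  have z0: "z \<noteq> 0" using z zero_0 by auto
  have zf: "zorder f z = -1" using crit[of z] z z0 by (auto simp: critical_point_def)
  obtain r where r: "r > 0" "f analytic_on ball z r - {z}"
    using is_pole_def z mero meromorphic_on_isolated_singularity[of f z]
    by (metis isolated_singularity_at_def meromorphic_on_subset nicely_meromorphic_on_def subset_UNIV)
  have "f holomorphic_on ball z r - {z}" using r(2) by (rule analytic_imp_holomorphic)
  from zorder_exist_pole[OF this _ _ z] r(1) obtain e where e: "zor_poly f z z \<noteq> 0" "e > 0" "zor_poly f z holomorphic_on cball z e"
     "\<And>w. w \<in> cball z e - {z} \<Longrightarrow> f w = zor_poly f z w / (w - z) \<and> zor_poly f z w \<noteq> 0"
    by (auto simp: zf)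
  define g where "g = zor_poly f z"
  have "continuous_on (cball z e) g" using e(3) by (simp add: g_def holomorphic_on_imp_continuous_on)
  hence "isCont g z" using e(2) continuous_on_interior[of "cball z e" g z] by simp
  hence "g \<midarrow>z\<rightarrow> g z" by (rule isContD)
  moreover have "Ap \<midarrow>z\<rightarrow> Ap z" using Ap_deriv[THEN DERIV_isCont] by (rule isContD)
  ultimately have "(\<lambda>w. Ap w / g w) \<midarrow>z\<rightarrow> Ap z / g z" using e(1) by (intro tendsto_intros) (auto simp: g_def)
  moreover have "\<forall>\<^sub>F w in at z. Ap w / g w = (B w - B z) / (w - z)"
  proof -
    have "\<forall>\<^sub>F w in at z. w \<in> ball z e - {z}" using e(2) by (intro eventually_at_in_open) auto
    thus ?thesis
    proof eventually_elim
      case (elim w)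
      hence w: "f w = g w / (w - z)" "g w \<noteq> 0" "w \<noteq> z" using e(4)[of w] by (auto simp: g_def)
      hence fw: "f w \<noteq> 0" by simp
      hence "\<not> is_pole f w" using pole_value by blast
      thus ?case using B_values(2)[of w] fw w B_values(1)[OF z] by simp
    qed
  qed
  ultimately have "(\<lambda>w. (B w - B z) / (w - z)) \<midarrow>z\<rightarrow> Ap z / g z" by (rule Lim_transform_eventually)
  hence "(B has_field_derivative Ap z / g z) (at z)" by (simp add: has_field_derivative_iff)
  hence "deriv B z = Ap z / g z" by (rule DERIV_imp_deriv)
  moreover have "Ap z \<noteq> 0" using z by (simp add: Ap_zero_iff)
  ultimately show ?thesis using e(1) by (simp add: g_def)
qed

text \<open>
  The Wronskian of \<open>Ap\<close> and \<open>B\<close>, divided by \<open>z ^ (n - 1)\<close>.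
\<close>

definition W :: "complex \<Rightarrow> complex" where
  "W z = z * poly P z * deriv B z - (of_nat n * poly P z + z * poly (pderiv P) z) * B z"

lemma W_mult: "z ^ (n - 1) * W z = Ap z * deriv B z - (of_nat n * z ^ (n - 1) * poly P z + z ^ n * poly (pderiv P) z) * B z"
proof -
  have "z ^ n = z ^ (n - 1) * z" using n by (metis power_minus_mult less_eq_Suc_le One_nat_def)
  thus ?thesis unfolding W_def Ap_def by (simp only:) (simp add: algebra_simps)
qed

text \<open>
  Away from the zeros and poles of \<open>f\<close> a zero of the Wronskian is a critical point; at the nonzero
  zeros and at the poles, which are simple, the Wronskian reduces to one nonzero product.
\<close>

lemma W_nz: "W z \<noteq> 0"
proof (cases "z = 0")
  case True
  thus ?thesis using n P_props(4) B_values(4) by (simp add: W_def)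
next
  case z0: False
  define A' where "A' = of_nat n * z ^ (n - 1) * poly P z + z ^ n * poly (pderiv P) z"
  have "Ap z * deriv B z - A' * B z \<noteq> 0"
  proof (cases "is_pole f z")
    case True
    thus ?thesis using B_values(1) B_pole_simple Ap_zero_iff by simp
  next
    case np: False
    show ?thesis
    proof (cases "f z = 0")
      case True
      hence "z \<in> other_zeros f" using np z0 by (simp add: other_zeros_iff)
      moreover from this have "poly P z = 0" by (simp add: P_root_iff)
      ultimately show ?thesis using B_values(3) P_simple z0 by (simp add: A'_def Ap_def)
    next
      case False
      have A0: "Ap z \<noteq> 0" using False Ap_zero_iff by simp
      have B0: "B z \<noteq> 0" using B_values(2)[OF np False] A0 False by simp
      have "((\<lambda>z. Ap z / B z) has_field_derivative (A' * B z - Ap z * deriv B z) / (B z * B z)) (at z)"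
        using DERIV_divide[OF Ap_deriv B_deriv B0] by (simp add: A'_def)
      moreover have "f = (\<lambda>z. Ap z / B z)" using f_eq by (rule ext)
      ultimately have "deriv f z = (A' * B z - Ap z * deriv B z) / (B z * B z)" by (simp add: DERIV_imp_deriv)
      moreover have "deriv f z \<noteq> 0" using crit[of z] np z0 by (auto simp: critical_point_def)
      ultimately show ?thesis by auto
    qed
  qed
  thus ?thesis using W_mult[of z] unfolding A'_def by auto
qed

lemma log_W: "\<exists>h. h holomorphic_on UNIV \<and> (\<forall>z. exp (h z) = W z)"
proof -
  have "W holomorphic_on UNIV" unfolding W_def[abs_def]
    using B_holomorphic by (intro holomorphic_intros holomorphic_deriv) auto
  then obtain g where "g holomorphic_on UNIV" "\<And>z. z \<in> UNIV \<Longrightarrow> exp (g z) = W z"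
    using holomorphic_logarithm_exists[of UNIV W 0] W_nz by blast
  thus ?thesis by blast
qed

theorem zero_quotient_ex: "\<exists>h. zero_quotient n P B h f"
proof -
  obtain h where h: "h holomorphic_on UNIV" "\<And>z. exp (h z) = W z" using log_W by blast
  have "zero_quotient n P B h f"
    by unfold_locales (use B_holomorphic h f_eq in \<open>auto simp: W_def Ap_def\<close>)
  thus ?thesis by blast
qed

end

section \<open>The Schwarzian derivative as a Riccati equation\<close>

text \<open>
  Maximise \<open>(1 - \<bar>z - z0\<bar>) * \<bar>u z\<bar>\<close> over the unit disc about \<open>z0\<close>.  If the maximum \<open>\<mu>\<close> is attained at \<open>z1\<close>, with
  distance \<open>d\<close> from the boundary, then \<open>\<bar>u\<bar> \<le> 2 * \<mu> / d\<close> on the disc of radius \<open>d / 2\<close> about \<open>z1\<close>, so that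
  Cauchy's inequality gives \<open>\<bar>u' z1\<bar> \<le> 4 * \<mu> / d\<^sup>2\<close>.  The equation turns this into
  \<open>\<mu>\<^sup>2 \<le> 8 * \<mu> + 2 * K\<close>.
\<close>

lemma riccati_bound:
  fixes u :: "complex \<Rightarrow> complex"
  assumes hol: "u holomorphic_on S" and S: "open S" "cball z0 1 \<subseteq> S"
    and K: "\<And>z. z \<in> cball z0 1 \<Longrightarrow> norm (deriv u z - (u z)\<^sup>2 / 2) \<le> K"
  shows "norm (u z0) \<le> 8 + sqrt (2 * K)"
proof -
  define \<phi> where "\<phi> = (\<lambda>z. (1 - norm (z - z0)) * norm (u z))"
  have cu: "continuous_on (cball z0 1) u"
    using holomorphic_on_imp_continuous_on[OF hol] S(2) continuous_on_subset by blast
  hence "continuous_on (cball z0 1) \<phi>" unfolding \<phi>_def by (intro continuous_intros)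
  then obtain z1 where z1: "z1 \<in> cball z0 1" and max: "\<And>z. z \<in> cball z0 1 \<Longrightarrow> \<phi> z \<le> \<phi> z1"
    using continuous_attains_sup[of "cball z0 1" \<phi>] by auto
  define d where "d = 1 - norm (z1 - z0)"
  define \<mu> where "\<mu> = \<phi> z1"
  have K0: "K \<ge> 0" using K[OF z1] norm_ge_zero order.trans by blast
  have z0: "norm (u z0) \<le> \<mu>" using max[of z0] by (simp add: \<phi>_def \<mu>_def)
  have d1: "d \<le> 1" by (simp add: d_def)
  have "\<mu> \<le> 8 + sqrt (2 * K)"
  proof (cases "\<mu> > 0")
    case False
    have "sqrt (2 * K) \<ge> 0" using K0 by simp
    thus ?thesis using False by linarith
  next
    case True
    have "d \<ge> 0" using z1 by (simp add: d_def dist_norm norm_minus_commute)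
    hence d: "d > 0" using True by (cases "d = 0") (auto simp: \<mu>_def \<phi>_def d_def)
    have u1: "norm (u z1) = \<mu> / d" using d by (simp add: \<mu>_def \<phi>_def d_def)
    have sub: "cball z1 (d / 2) \<subseteq> cball z0 1"
    proof
      fix z assume "z \<in> cball z1 (d / 2)"
      hence "dist z0 z \<le> dist z0 z1 + d / 2" using dist_triangle[of z0 z z1] by (simp add: mem_cball)
      moreover have "dist z0 z1 = 1 - d" by (simp add: d_def dist_norm norm_minus_commute)
      ultimately show "z \<in> cball z0 1" using d unfolding mem_cball by linarith
    qed
    have "norm (u x) \<le> 2 * \<mu> / d" if "norm (z1 - x) = d / 2" for x
    proof -
      have "norm (x - z0) \<le> norm (z1 - z0) + d / 2"
        using norm_triangle_ineq[of "x - z1" "z1 - z0"] that by (simp add: norm_minus_commute)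
      moreover have "norm (z1 - z0) = 1 - d" by (simp add: d_def)
      ultimately have x: "d / 2 \<le> 1 - norm (x - z0)" by linarith
      have "x \<in> cball z0 1" using sub that by (auto simp: dist_norm)
      hence "(1 - norm (x - z0)) * norm (u x) \<le> \<mu>" using max by (simp add: \<phi>_def \<mu>_def)
      hence "d / 2 * norm (u x) \<le> \<mu>" using mult_right_mono[OF x, of "norm (u x)"] by simp
      thus ?thesis using d by (simp add: field_simps)
    qed
    moreover have "ball z1 (d / 2) \<subseteq> S" using sub S(2) ball_subset_cball by blast
    hence "u holomorphic_on ball z1 (d / 2)" using hol holomorphic_on_subset by blast
    moreover have "continuous_on (cball z1 (d / 2)) u" using cu sub by (rule continuous_on_subset)
    ultimately have "norm ((deriv ^^ 1) u z1) \<le> fact 1 * (2 * \<mu> / d) / (d / 2) ^ 1"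
      using d by (intro Cauchy_inequality) auto
    hence u': "norm (deriv u z1) \<le> 4 * \<mu> / d\<^sup>2" using d by (simp add: power2_eq_square)
    have "(u z1)\<^sup>2 / 2 = deriv u z1 - (deriv u z1 - (u z1)\<^sup>2 / 2)" by simp
    also have "norm \<dots> \<le> norm (deriv u z1) + norm (deriv u z1 - (u z1)\<^sup>2 / 2)" by (rule norm_triangle_ineq4)
    also have "\<dots> \<le> 4 * \<mu> / d\<^sup>2 + K" using u' K[OF z1] by simp
    finally have "(\<mu> / d)\<^sup>2 / 2 \<le> 4 * \<mu> / d\<^sup>2 + K" by (simp add: norm_divide norm_power u1)
    hence "\<mu>\<^sup>2 \<le> 8 * \<mu> + 2 * K * d\<^sup>2" using d by (simp add: field_simps)
    also have "2 * K * d\<^sup>2 \<le> 2 * K * 1" using K0 d d1 by (intro mult_left_mono power_le_one) auto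
    finally have q: "\<mu> * (\<mu> - 8) \<le> 2 * K" by (simp add: algebra_simps power2_eq_square)
    show ?thesis
    proof (rule ccontr)
      assume "\<not> ?thesis"
      hence less: "sqrt (2 * K) < \<mu> - 8" by simp
      have s0: "sqrt (2 * K) \<ge> 0" using K0 by simp
      have "2 * K = sqrt (2 * K) * sqrt (2 * K)" using K0 by simp
      also have "\<dots> < \<mu> * (\<mu> - 8)" using less s0 by (intro mult_strict_mono) linarith+
      finally show False using q by simp
    qed
  qed
  thus ?thesis using z0 by linarith
qed

context zero_quotient
begin

lemma P_nz: "P \<noteq> 0"
proof
  assume "P = 0"
  hence "poly P 0 = 0" by (simp only: poly_0)
  with P_0 show False by (rule notE)
qed

text \<open>
  The bound on the Schwarzian derivative makes \<open>lder\<close> a solution of a Riccati equation with a right-hand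
  side of quadratic growth.
\<close>

lemma lder_linear_bound:
  assumes O: "(\<lambda>z. schwarzian f z + 2 * z\<^sup>2) \<in> O[at_infinity](\<lambda>z. z)"
  shows "\<exists>C R. \<forall>z. norm z \<ge> R \<longrightarrow> norm (lder z) \<le> C * norm z"
proof -
  obtain c where c: "c > 0" "\<forall>\<^sub>F z in at_infinity. norm (schwarzian f z + 2 * z\<^sup>2) \<le> c * norm z"
    using landau_o.bigE[OF O] by blast
  then obtain R1 where R1: "\<And>z. norm z \<ge> R1 \<Longrightarrow> norm (schwarzian f z + 2 * z\<^sup>2) \<le> c * norm z"
    by (auto simp: eventually_at_infinity)
  obtain C0 R2 where R2: "\<And>z. norm z \<ge> R2 \<Longrightarrow> poly P z \<noteq> 0"
    using pderiv_ratio_bounded(1)[OF P_nz] by blast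
  define R where "R = max 1 (max R1 R2) + 2"
  define S :: "complex set" where "S = {z. norm z > R - 2}"
  have S: "open S" unfolding S_def by (intro open_Collect_less continuous_intros)
  have Sd: "(lder has_field_derivative lder' z) (at z)" and SS: "norm (lder' z - (lder z)\<^sup>2 / 2) \<le> (2 + c) * (norm z)\<^sup>2" if "z \<in> S" for z :: complex
  proof -
    have z: "norm z \<ge> 1" "norm z \<ge> R1" "norm z \<ge> R2" using that by (auto simp: S_def R_def)
    hence nz: "z \<noteq> 0" "poly P z \<noteq> 0" using R2 by auto
    show "(lder has_field_derivative lder' z) (at z)" by (rule lder_deriv[OF nz])
    have "norm (schwarzian f z + 2 * z\<^sup>2 - 2 * z\<^sup>2) \<le> c * norm z + 2 * (norm z)\<^sup>2"
      using R1[OF z(2)] by (intro order.trans[OF norm_triangle_ineq4]) (simp add: norm_mult norm_power)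
    also have "c * norm z \<le> c * (norm z)\<^sup>2" using c(1) z(1) by (intro mult_left_mono self_le_power) auto
    finally show "norm (lder' z - (lder z)\<^sup>2 / 2) \<le> (2 + c) * (norm z)\<^sup>2"
      unfolding schwarzian_lder[OF nz, symmetric] by (simp add: algebra_simps)
  qed
  have hol: "lder holomorphic_on S" unfolding holomorphic_on_open[OF S] using Sd by blast
  have "norm (lder z) \<le> (8 + 2 * sqrt (2 * (2 + c))) * norm z" if z: "norm z \<ge> R" for z
  proof -
    have sub: "cball z 1 \<subseteq> S"
    proof
      fix w assume "w \<in> cball z 1"
      hence "norm (z - w) \<le> 1" by (simp add: dist_norm)
      thus "w \<in> S" using z norm_triangle_ineq2[of z w] by (simp add: S_def)
    qed
    have z1: "norm z \<ge> 1" using z by (simp add: R_def)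
    have "norm (lder z) \<le> 8 + sqrt (2 * ((2 + c) * (2 * norm z)\<^sup>2))"
    proof (rule riccati_bound[OF hol S sub])
      fix w assume w: "w \<in> cball z 1"
      hence "norm (w - z) \<le> 1" by (simp add: dist_norm norm_minus_commute)
      hence "norm w \<le> 2 * norm z" using norm_triangle_ineq2[of w z] z1 by simp
      hence "(2 + c) * (norm w)\<^sup>2 \<le> (2 + c) * (2 * norm z)\<^sup>2" using c(1) by (intro mult_left_mono power_mono) auto
      thus "norm (deriv lder w - (lder w)\<^sup>2 / 2) \<le> (2 + c) * (2 * norm z)\<^sup>2"
        using SS[of w] sub w DERIV_imp_deriv[OF Sd[of w]] by auto
    qed
    also have "2 * ((2 + c) * (2 * norm z)\<^sup>2) = (2 * (2 + c)) * (2 * norm z)\<^sup>2" by simp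
    also have "sqrt \<dots> = sqrt (2 * (2 + c)) * (2 * norm z)"
      unfolding real_sqrt_mult[of "2 * (2 + c)" "(2 * norm z)\<^sup>2"] real_sqrt_abs by simp
    also have "8 + \<dots> \<le> (8 + 2 * sqrt (2 * (2 + c))) * norm z" using z1 by (simp add: algebra_simps)
    finally show ?thesis .
  qed
  thus ?thesis by blast
qed

lemma h_deriv_linear:
  assumes O: "(\<lambda>z. schwarzian f z + 2 * z\<^sup>2) \<in> O[at_infinity](\<lambda>z. z)"
  obtains c0 c1 where "\<And>z. deriv h z = c0 + c1 * z"
proof -
  obtain C1 R1 where R1: "\<And>z. norm z \<ge> R1 \<Longrightarrow> norm (lder z) \<le> C1 * norm z"
    using lder_linear_bound[OF O] by blast
  obtain C2 R2 where R2: "\<And>z. norm z \<ge> R2 \<Longrightarrow> poly P z \<noteq> 0 \<and> norm (z * (poly (pderiv P) z / poly P z)) \<le> C2"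
    using pderiv_ratio_bounded(1)[OF P_nz] by blast
  define C where "C = C1 + of_nat (n + 1) + 2 * C2"
  have "norm (deriv h z) \<le> C * norm z ^ 1" if z: "norm z \<ge> max 1 (max R1 R2)" for z
  proof -
    have z1: "norm z \<ge> 1" using z by simp
    have "norm (of_nat (n + 1) / z) \<le> of_nat (n + 1) * norm z"
    proof -
      have "of_nat (n + 1) / norm z \<le> of_nat (n + 1) / (1::real)" using z1 by (intro divide_left_mono) auto
      also have "\<dots> \<le> of_nat (n + 1) * norm z" using mult_left_mono[OF z1, of "of_nat (n + 1)"] by simp
      finally show ?thesis by (simp only: norm_divide norm_of_nat)
    qed
    moreover have "norm (2 * poly (pderiv P) z / poly P z) \<le> 2 * C2 * norm z"
    proof -
      define p where "p = poly (pderiv P) z / poly P z"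
      have 1: "norm z * norm p \<le> C2" using R2[of z] z unfolding p_def[symmetric] norm_mult by simp
      have "norm p * 1 \<le> norm p * norm z" by (intro mult_left_mono z1) simp
      hence "norm p \<le> C2" using 1 by (simp add: mult.commute)
      moreover have "C2 \<ge> 0" using 1 mult_nonneg_nonneg[OF norm_ge_zero norm_ge_zero] order.trans by blast
      hence "C2 * 1 \<le> C2 * norm z" by (intro mult_left_mono z1)
      moreover have "2 * poly (pderiv P) z / poly P z = 2 * p" by (simp add: p_def)
      hence "norm (2 * poly (pderiv P) z / poly P z) = 2 * norm p" by (simp add: norm_mult)
      ultimately show ?thesis by simp
    qed
    moreover have "norm (lder z) \<le> C1 * norm z" using R1 z by simp
    moreover have "deriv h z = lder z + of_nat (n + 1) / z + 2 * poly (pderiv P) z / poly P z" by (simp add: lder_def)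
    hence "norm (deriv h z) \<le> norm (lder z) + norm (of_nat (n + 1) / z) + norm (2 * poly (pderiv P) z / poly P z)"
      by (metis norm_triangle_ineq norm_triangle_mono order.refl)
    ultimately show ?thesis unfolding C_def by (simp add: distrib_right)
  qed
  note bound = this
  have "deriv h holomorphic_on UNIV" by (intro holomorphic_deriv holh) auto
  from Liouville_polynomial[OF this bound]
  have "deriv h z = (\<Sum>k\<le>1. (deriv ^^ k) (deriv h) 0 / fact k * z ^ k)" for z .
  moreover have "(\<Sum>k\<le>1. c k * z ^ k) = c 0 + c 1 * z" for c :: "nat \<Rightarrow> complex" and z by simp
  ultimately have "deriv h z = (deriv ^^ 0) (deriv h) 0 / fact 0 + (deriv ^^ 1) (deriv h) 0 / fact 1 * z" for z by (rule trans)
  thus thesis by (rule that)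
qed

text \<open>
  Dividing \<open>schwarzian f = lder' - lder\<^sup>2 / 2\<close> by \<open>z\<^sup>2\<close> and letting \<open>z\<close> tend to infinity shows that the slope
  \<open>c1\<close> of \<open>h'\<close> satisfies \<open>c1\<^sup>2 = 4\<close>.
\<close>

lemma h_deriv_gaussian:
  assumes O: "(\<lambda>z. schwarzian f z + 2 * z\<^sup>2) \<in> O[at_infinity](\<lambda>z. z)"
  obtains \<epsilon> a where "\<epsilon> = 1 \<or> \<epsilon> = -1" "\<And>z. deriv h z = 2 * \<epsilon> * (z + a)"
proof -
  obtain c0 c1 where c: "\<And>z. deriv h z = c0 + c1 * z" using h_deriv_linear[OF O] by blast
  have hfun: "deriv h = (\<lambda>z. c0 + c1 * z)" by (intro ext c)
  have d2: "deriv (deriv h) z = c1" for z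
    unfolding hfun by (rule DERIV_imp_deriv) (auto intro!: derivative_eq_intros)
  have inv: "((\<lambda>z::complex. inverse z) \<longlongrightarrow> 0) at_infinity" by (rule tendsto_inverse_0)
  obtain l1 where l1: "((\<lambda>z. poly (pderiv P) z / poly P z) \<longlongrightarrow> l1) at_infinity"
    using poly_ratio_tendsto[OF P_nz, of "pderiv P"] by (auto simp: degree_pderiv)
  obtain l2 where l2: "((\<lambda>z. poly (pderiv (pderiv P)) z / poly P z) \<longlongrightarrow> l2) at_infinity"
    using poly_ratio_tendsto[OF P_nz, of "pderiv (pderiv P)"] by (auto simp: degree_pderiv)
  define N where "N = (of_nat (n + 1) :: complex)"
  have "((\<lambda>z. c0 * inverse z + c1 - N * inverse z * inverse z - 2 * (poly (pderiv P) z / poly P z) * inverse z)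
      \<longlongrightarrow> c0 * 0 + c1 - N * 0 * 0 - 2 * l1 * 0) at_infinity"
    by (intro tendsto_intros inv l1)
  moreover have "\<forall>\<^sub>F z in at_infinity. c0 * inverse z + c1 - N * inverse z * inverse z - 2 * (poly (pderiv P) z / poly P z) * inverse z = lder z * inverse z"
  proof (rule eventually_at_infinityI[of 1])
    fix z :: complex assume "norm z \<ge> 1"
    hence "z \<noteq> 0" by auto
    thus "c0 * inverse z + c1 - N * inverse z * inverse z - 2 * (poly (pderiv P) z / poly P z) * inverse z = lder z * inverse z"
      unfolding lder_def c N_def[symmetric] by (simp add: divide_inverse algebra_simps)
  qed
  ultimately have L: "((\<lambda>z. lder z * inverse z) \<longlongrightarrow> c1) at_infinity" by (simp add: Lim_transform_eventually)
  have "((\<lambda>z. (c1 + N * inverse z * inverse z - 2 * (poly (pderiv (pderiv P)) z / poly P z) + 2 * (poly (pderiv P) z / poly P z)\<^sup>2) * inverse z * inverse z)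
      \<longlongrightarrow> (c1 + N * 0 * 0 - 2 * l2 + 2 * l1\<^sup>2) * 0 * 0) at_infinity"
    by (intro tendsto_intros inv l1 l2)
  hence "((\<lambda>z. (c1 + N * inverse z * inverse z - 2 * (poly (pderiv (pderiv P)) z / poly P z) + 2 * (poly (pderiv P) z / poly P z)\<^sup>2) * inverse z * inverse z
      - (lder z * inverse z)\<^sup>2 / 2) \<longlongrightarrow> (c1 + N * 0 * 0 - 2 * l2 + 2 * l1\<^sup>2) * 0 * 0 - c1\<^sup>2 / 2) at_infinity"
    by (intro tendsto_diff tendsto_divide[OF tendsto_power[OF L] tendsto_const]) simp_all
  moreover have "\<forall>\<^sub>F z in at_infinity. (c1 + N * inverse z * inverse z - 2 * (poly (pderiv (pderiv P)) z / poly P z) + 2 * (poly (pderiv P) z / poly P z)\<^sup>2) * inverse z * inverse z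
      - (lder z * inverse z)\<^sup>2 / 2 = schwarzian f z * inverse z * inverse z"
  proof -
    obtain C0 R2 where R2: "\<And>z. norm z \<ge> R2 \<Longrightarrow> poly P z \<noteq> 0"
      using pderiv_ratio_bounded(1)[OF P_nz] by blast
    show ?thesis
    proof (rule eventually_at_infinityI[of "max 1 R2"])
      fix z :: complex assume "norm z \<ge> max 1 R2"
      hence z: "z \<noteq> 0" "poly P z \<noteq> 0" using R2[of z] by auto
      have alg: "(p2 * q - p1\<^sup>2) / q\<^sup>2 = p2 / q - (p1 / q)\<^sup>2" if "q \<noteq> 0" for p1 p2 q :: complex
        using that by (simp add: field_simps power2_eq_square)
      have l: "lder' z = c1 + N * inverse z * inverse z - 2 * (poly (pderiv (pderiv P)) z / poly P z) + 2 * (poly (pderiv P) z / poly P z)\<^sup>2"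
        unfolding lder'_def d2 N_def[symmetric] times_divide_eq_right[symmetric] alg[OF z(2)] 
        by (simp add: divide_inverse power2_eq_square algebra_simps)
      have alg2: "x * i * i - (y * i)\<^sup>2 / 2 = (x - y\<^sup>2 / 2) * i * i" for x y i :: complex
        by (simp add: power2_eq_square algebra_simps)
      show "(c1 + N * inverse z * inverse z - 2 * (poly (pderiv (pderiv P)) z / poly P z) + 2 * (poly (pderiv P) z / poly P z)\<^sup>2) * inverse z * inverse z
      - (lder z * inverse z)\<^sup>2 / 2 = schwarzian f z * inverse z * inverse z"
        unfolding l[symmetric] schwarzian_lder[OF z] by (rule alg2)
    qed
  qed
  ultimately have S1: "((\<lambda>z. schwarzian f z * inverse z * inverse z) \<longlongrightarrow> - (c1\<^sup>2 / 2)) at_infinity"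
    by (simp add: Lim_transform_eventually)
  have S2: "((\<lambda>z. schwarzian f z * inverse z * inverse z) \<longlongrightarrow> -2) at_infinity"
  proof -
    obtain k where k: "k > 0" "\<forall>\<^sub>F z in at_infinity. norm (schwarzian f z + 2 * z\<^sup>2) \<le> k * norm z"
      using landau_o.bigE[OF O] by blast
    have "((\<lambda>z. (schwarzian f z + 2 * z\<^sup>2) * inverse z * inverse z) \<longlongrightarrow> 0) at_infinity"
    proof (rule Lim_null_comparison)
      show "((\<lambda>z::complex. k * norm (inverse z)) \<longlongrightarrow> 0) at_infinity"
        using tendsto_mult_right_zero[OF tendsto_norm_zero[OF inv]] by simp
      show "\<forall>\<^sub>F z in at_infinity. norm ((schwarzian f z + 2 * z\<^sup>2) * inverse z * inverse z) \<le> k * norm (inverse z)"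
        using k(2) eventually_at_infinityI[of 1 "\<lambda>z::complex. norm z \<ge> 1", simplified]
      proof eventually_elim
        case (elim z)
        have "z \<noteq> 0" using elim by auto
        hence "norm ((schwarzian f z + 2 * z\<^sup>2) * inverse z * inverse z) \<le> k * norm z * norm (inverse z) * norm (inverse z)"
          unfolding norm_mult by (intro mult_right_mono elim) auto
        also have "\<dots> = k * norm (inverse z)" using \<open>z \<noteq> 0\<close> by (simp add: norm_inverse)
        finally show ?case .
      qed
    qed
    hence "((\<lambda>z. (schwarzian f z + 2 * z\<^sup>2) * inverse z * inverse z - 2) \<longlongrightarrow> 0 - 2) at_infinity"
      by (intro tendsto_intros)
    moreover have "\<forall>\<^sub>F z in at_infinity. (schwarzian f z + 2 * z\<^sup>2) * inverse z * inverse z - 2 = schwarzian f z * inverse z * inverse z"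
    proof (rule eventually_at_infinityI[of 1])
      fix z :: complex assume "norm z \<ge> 1"
      hence "z \<noteq> 0" by auto
      hence "z * inverse z = 1" by simp
      moreover have "(x + 2 * z\<^sup>2) * i * i - 2 = x * i * i + 2 * ((z * i)\<^sup>2 - 1)" for x i
        by (simp add: power2_eq_square algebra_simps)
      ultimately show "(schwarzian f z + 2 * z\<^sup>2) * inverse z * inverse z - 2 = schwarzian f z * inverse z * inverse z"
        by simp
    qed
    ultimately show ?thesis by (simp add: Lim_transform_eventually)
  qed
  have "- (c1\<^sup>2 / 2) = -2" using tendsto_unique[OF trivial_limit_at_infinity S1 S2] .
  hence "(c1 - 2) * (c1 + 2) = 0" by (simp add: power2_eq_square algebra_simps)
  hence c1: "c1 = 2 \<or> c1 = -2" by (simp add: eq_neg_iff_add_eq_0)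
  define \<epsilon> where "\<epsilon> = c1 / 2"
  have \<epsilon>: "\<epsilon> = 1 \<or> \<epsilon> = -1" using c1 by (auto simp: \<epsilon>_def)
  moreover have "deriv h z = 2 * \<epsilon> * (z + \<epsilon> * c0 / 2)" for z
    unfolding c using \<epsilon> by (auto simp: \<epsilon>_def field_simps)
  ultimately show thesis by (rule that)
qed

lemma exp_h_gaussian:
  assumes "\<And>z. deriv h z = 2 * \<epsilon> * (z + a)"
  obtains C where "C \<noteq> 0" "\<And>z. exp (h z) = C * exp (\<epsilon> * (z + a)\<^sup>2)"
proof -
  have "((\<lambda>z. h z - \<epsilon> * (z + a)\<^sup>2) has_field_derivative 0) (at z)" for z
    by (rule derivative_eq_intros h_deriv refl)+ (simp add: assms)
  then obtain c where "\<And>z. h z - \<epsilon> * (z + a)\<^sup>2 = c"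
    using has_field_derivative_zero_constant[of UNIV "\<lambda>z. h z - \<epsilon> * (z + a)\<^sup>2"] by auto
  hence "h z = c + \<epsilon> * (z + a)\<^sup>2" for z by (metis diff_add_cancel)
  hence "exp (h z) = exp c * exp (\<epsilon> * (z + a)\<^sup>2)" for z by (simp add: exp_add)
  thus thesis using that[of "exp c"] by simp
qed

end

section \<open>Recovering the kernel polynomial from the asymptotic values\<close>

text \<open>
  As soon as the quotient is below \<open>1 / 4\<close>, the denominator is at most linear in the numerator, and the
  inequality can be solved for \<open>\<bar>g + c\<bar>\<close>.
\<close>

lemma chordal_tendsto_0_imp:
  fixes c :: complex
  assumes "((\<lambda>t. norm (g t + c) / (sqrt 2 * sqrt (1 + (norm (g t))\<^sup>2))) \<longlongrightarrow> 0) F" "norm c = 1"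
  shows "(g \<longlongrightarrow> - c) F"
proof -
  define \<xi> where "\<xi> = (\<lambda>t. norm (g t + c) / (sqrt 2 * sqrt (1 + (norm (g t))\<^sup>2)))"
  have lim: "(\<xi> \<longlongrightarrow> 0) F" using assms(1) by (simp add: \<xi>_def)
  have "\<forall>\<^sub>F t in F. norm (g t + c) \<le> 8 * \<xi> t"
    using order_tendstoD(2)[OF lim, of "1 / 4"]
  proof (rule eventually_mono)
    fix t assume small: "\<xi> t < 1 / 4"
    define x where "x = norm (g t + c)"
    have g: "norm (g t) \<le> x + 1" using norm_triangle_ineq4[of "g t + c" c] assms(2) by (simp add: x_def)
    have "1 + (norm (g t))\<^sup>2 \<le> (1 + norm (g t))\<^sup>2" by (simp add: power2_eq_square algebra_simps)
    hence "sqrt (1 + (norm (g t))\<^sup>2) \<le> 1 + norm (g t)" by (intro real_le_lsqrt) auto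
    hence "sqrt (1 + (norm (g t))\<^sup>2) \<le> 2 + x" using g by linarith
    moreover have "sqrt 2 \<le> 2" by (intro real_le_lsqrt) auto
    ultimately have den: "sqrt 2 * sqrt (1 + (norm (g t))\<^sup>2) \<le> 2 * (2 + x)" by (intro mult_mono) auto
    have pos: "sqrt 2 * sqrt (1 + (norm (g t))\<^sup>2) > 0" by (simp add: add_pos_nonneg)
    have chi0: "\<xi> t \<ge> 0" by (simp add: \<xi>_def)
    have "x = \<xi> t * (sqrt 2 * sqrt (1 + (norm (g t))\<^sup>2))"
      unfolding \<xi>_def x_def using pos by (metis less_irrefl nonzero_divide_eq_eq)
    also have "\<dots> \<le> \<xi> t * (2 * (2 + x))" by (rule mult_left_mono[OF den chi0])
    finally have "x \<le> 4 * \<xi> t + 2 * (\<xi> t * x)" by (simp add: distrib_left mult_ac)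
    moreover have "\<xi> t * x \<le> 1 / 4 * x" by (rule mult_right_mono) (use small in \<open>auto simp: x_def\<close>)
    ultimately show "norm (g t + c) \<le> 8 * \<xi> t" unfolding x_def[symmetric] by linarith
  qed simp
  moreover have "((\<lambda>t. 8 * \<xi> t) \<longlongrightarrow> 0) F" using tendsto_mult_right_zero[OF lim] by simp
  ultimately have "((\<lambda>t. g t + c) \<longlongrightarrow> 0) F" by (rule Lim_null_comparison)
  from tendsto_diff[OF this tendsto_const[of c]] show ?thesis by simp
qed

text \<open>
  A vertical ray may start slightly on the wrong side of the real axis, at depth at most \<open>r\<close>.  Then the real
  part alone keeps it away from the origin.
\<close>

lemma vertical_ray_norm:
  fixes z :: complex
  assumes \<sigma>: "\<sigma> = 1 \<or> \<sigma> = (- 1 :: real)" and z: "norm z \<ge> R + r" "\<sigma> * Im z \<ge> - r" "r \<ge> 0" and t: "t \<ge> 0"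
  shows "norm (z + \<i> * of_real (\<sigma> * t)) \<ge> R"
proof (cases "\<sigma> * Im z \<ge> 0")
  case True
  have "(norm z)\<^sup>2 \<le> (norm (z + \<i> * of_real (\<sigma> * t)))\<^sup>2"
  proof -
    have "(Im z + \<sigma> * t)\<^sup>2 = (Im z)\<^sup>2 + 2 * t * (\<sigma> * Im z) + t\<^sup>2"
      using \<sigma> by (auto simp: power2_eq_square algebra_simps)
    moreover have "2 * t * (\<sigma> * Im z) \<ge> 0" using mult_nonneg_nonneg[OF _ True, of "2 * t"] t by simp
    ultimately have "(Im z)\<^sup>2 \<le> (Im z + \<sigma> * t)\<^sup>2" by simp
    thus ?thesis by (simp add: cmod_power2)
  qed
  hence "norm z \<le> norm (z + \<i> * of_real (\<sigma> * t))" by (rule power2_le_imp_le) simp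
  thus ?thesis using z by linarith
next
  case False
  hence "\<bar>Im z\<bar> \<le> r" using \<sigma> z(2) by auto
  hence "\<bar>Re z\<bar> \<ge> R" using cmod_le[of z] z(1) by linarith
  moreover have "Re (z + \<i> * of_real (\<sigma> * t)) = Re z" by simp
  ultimately show ?thesis using abs_Re_le_cmod[of "z + \<i> * of_real (\<sigma> * t)"] by linarith
qed

context zero_quotient
begin

text \<open>
  The function \<open>1 / f\<close>, whose derivative is an exponential times a rational function.
\<close>

definition g :: "complex \<Rightarrow> complex" where "g z = B z / (z ^ n * poly P z)"

lemma g_deriv:
  assumes "z ^ n * poly P z \<noteq> 0"
  shows "(g has_field_derivative exp (h z) * (z ^ (n - 1) / (z ^ n * poly P z)\<^sup>2)) (at z)"
proof -
  have X: "((\<lambda>z. z ^ n * poly P z) has_field_derivative of_nat n * z ^ (n - 1) * poly P z + z ^ n * poly (pderiv P) z) (at z)"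
    by (rule derivative_eq_intros poly_DERIV refl)+ simp
  have D: "((\<lambda>z. B z / (z ^ n * poly P z)) has_field_derivative
      (deriv B z * (z ^ n * poly P z) - B z * (of_nat n * z ^ (n - 1) * poly P z + z ^ n * poly (pderiv P) z)) / ((z ^ n * poly P z) * (z ^ n * poly P z))) (at z)"
    by (rule DERIV_divide[OF B_deriv X assms])
  have "deriv B z * (z ^ n * poly P z) - B z * (of_nat n * z ^ (n - 1) * poly P z + z ^ n * poly (pderiv P) z) = z ^ (n - 1) * exp (h z)"
    unfolding wr'[of z, symmetric] by (simp only: mult_ac)
  from D[unfolded this] show ?thesis unfolding g_def[abs_def] by (simp only: power2_eq_square times_divide_eq_right mult_ac)
qed

lemma g_factor_bounded:
  "\<exists>M R. \<forall>z. norm z \<ge> R \<longrightarrow> z ^ n * poly P z \<noteq> 0 \<and> norm (z ^ (n - 1) / (z ^ n * poly P z)\<^sup>2) \<le> M"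
proof -
  have "degree (monom 1 n * P) = n + degree P" using P_nz by (simp add: degree_mult_eq degree_monom_eq)
  hence "degree (monom 1 (n - 1) :: complex poly) + 0 \<le> degree ((monom 1 n * P)\<^sup>2)"
    using P_nz by (simp add: degree_monom_eq degree_power_eq)
  moreover have "(monom 1 n * P)\<^sup>2 \<noteq> 0" using P_0 by auto
  ultimately obtain C R where "\<And>z. norm z \<ge> R \<Longrightarrow> poly ((monom 1 n * P)\<^sup>2) z \<noteq> 0
      \<and> norm (z ^ 0 * (poly (monom 1 (n - 1)) z / poly ((monom 1 n * P)\<^sup>2) z)) \<le> C"
    using poly_ratio_bounded[of "(monom 1 n * P)\<^sup>2" "monom 1 (n - 1)" 0] by blast
  thus ?thesis by (intro exI[of _ C] exI[of _ R]) (auto simp: poly_monom)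
qed

lemma chordal_g:
  assumes z: "z ^ n * poly P z \<noteq> 0"
  shows "chordal_dist (sphere_map f z) (Some 0) = 1 / sqrt (1 + (norm (g z))\<^sup>2)" (is ?A)
    and "norm c = 1 \<Longrightarrow> chordal_dist (sphere_map f z) (Some c) = norm (g z + - cnj c) / (sqrt 2 * sqrt (1 + (norm (g z))\<^sup>2))"
proof -
  define X where "X = z ^ n * poly P z"
  have X: "X \<noteq> 0" using z by (simp add: X_def)
  have g: "g z = B z / X" by (simp add: g_def X_def)
  have q: "sqrt (1 + (norm (X / B z))\<^sup>2) = sqrt (1 + (norm (g z))\<^sup>2) / norm (g z)" if "B z \<noteq> 0"
  proof -
    have "1 + (norm (X / B z))\<^sup>2 = (1 + (norm (g z))\<^sup>2) / (norm (g z))\<^sup>2"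
      using that X by (simp add: g norm_divide field_simps)
    thus ?thesis by (simp add: real_sqrt_divide)
  qed
  show ?A
  proof (cases "B z = 0")
    case False
    hence "norm (X / B z) = 1 / norm (g z)" "g z \<noteq> 0" using X by (simp_all add: g norm_divide)
    thus ?thesis using False q[OF False] by (simp add: sphere_f X_def[symmetric])
  qed (simp add: sphere_f g)
  show "chordal_dist (sphere_map f z) (Some c) = norm (g z + - cnj c) / (sqrt 2 * sqrt (1 + (norm (g z))\<^sup>2))" if c: "norm c = 1"
  proof (cases "B z = 0")
    case True
    thus ?thesis using c by (simp add: sphere_f g)
  next
    case False
    have g0: "g z \<noteq> 0" using False X by (simp add: g)
    have cc: "c * cnj c = 1" using c by (simp add: complex_norm_square[symmetric])
    have "X / B z - c = - c * (g z + - cnj c) / g z"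
    proof -
      have "X / B z - c = 1 / g z - c" using False X by (simp add: g)
      also have "\<dots> = (c * cnj c - c * g z) / g z" using g0 unfolding cc by (simp add: field_simps)
      also have "\<dots> = - c * (g z + - cnj c) / g z" by (simp add: algebra_simps)
      finally show ?thesis .
    qed
    hence "norm (X / B z - c) = norm (g z + - cnj c) / norm (g z)" using c by (simp add: norm_divide norm_mult)
    thus ?thesis using False g0 q[OF False] c by (simp add: sphere_f X_def[symmetric])
  qed
qed

text \<open>
  With the opposite sign \<open>1 / f\<close> would have a derivative of Gaussian decay along the positive real axis,
  hence be bounded there, although \<open>f\<close> tends to zero.  The real axis is rotated to the imaginary one in
  order to apply \<open>vertical_increment\<close>.
\<close>

lemma exponent_sign:
  assumes dh: "\<And>z. deriv h z = 2 * \<epsilon> * (z + a)" "\<epsilon> = 1 \<or> \<epsilon> = -1" and asym: "has_asymptotic_value f 0 (Some 0)"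
  shows "\<epsilon> = 1"
proof (rule ccontr)
  assume "\<epsilon> \<noteq> 1"
  hence \<epsilon>: "\<epsilon> = -1" using dh(2) by simp
  obtain C where C: "\<And>z. exp (h z) = C * exp (\<epsilon> * (z + a)\<^sup>2)" using exp_h_gaussian[OF dh(1)] by blast
  obtain M R where MR: "\<And>z. norm z \<ge> R \<Longrightarrow> z ^ n * poly P z \<noteq> 0 \<and> norm (z ^ (n - 1) / (z ^ n * poly P z)\<^sup>2) \<le> M"
    using g_factor_bounded by blast
  define x0 where "x0 = max 1 R + norm a"
  have x0: "x0 > 0" "x0 \<ge> R" using norm_ge_zero[of a] by (simp_all add: x0_def add_pos_nonneg max.coboundedI2 add_increasing2)
  \<comment> \<open>The path starts at \<open>- \<i> * x0\<close> and runs downwards, so that \<open>\<i>\<close> times it is the positive real axis.\<close>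
  have rot: "\<i> * (- \<i> * of_real x0 + \<i> * of_real (- 1 * t)) = of_real (x0 + t)" for t
    by (simp add: algebra_simps)
  have big: "norm (of_real (x0 + t) :: complex) \<ge> R" if "t \<ge> 0" for t
    using that x0 unfolding norm_of_real by linarith
  define b where "b = (\<lambda>z. \<i> * C * ((\<i> * z) ^ (n - 1) / ((\<i> * z) ^ n * poly P (\<i> * z))\<^sup>2))"
  define K where "K = norm C * M * norm (exp ((- \<i> * of_real x0 + (- \<i> * a))\<^sup>2))"
  have M0: "M \<ge> 0" using MR[OF big[of 0]] norm_ge_zero order.trans by blast
  have "norm (g (of_real (x0 + T)) - g (of_real x0)) \<le> K * 2" if T: "T > 0" for T
  proof -
    have "norm ((\<lambda>z. g (\<i> * z)) (- \<i> * of_real x0 + \<i> * of_real (- 1 * T)) - (\<lambda>z. g (\<i> * z)) (- \<i> * of_real x0))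
        \<le> norm C * M * norm (exp ((- \<i> * of_real x0 + (- \<i> * a))\<^sup>2)) * arctan T"
    proof (rule vertical_increment[where b = b])
      show "- 1 * Im (- \<i> * of_real x0 + - \<i> * a) \<ge> 0"
        using abs_Re_le_cmod[of a] by (simp add: x0_def)
      fix t :: real assume t: "t \<ge> 0"
      define z where "z = - \<i> * of_real x0 + \<i> * of_real (- 1 * t)"
      have iz: "\<i> * z = of_real (x0 + t)" unfolding z_def by (rule rot)
      note MRz = MR[OF big[OF t], folded iz]
      have e: "\<epsilon> * (\<i> * z + a)\<^sup>2 = (z + - \<i> * a)\<^sup>2" unfolding \<epsilon> by (simp add: power2_eq_square algebra_simps)
      have "((\<lambda>z. g (\<i> * z)) has_field_derivative exp (h (\<i> * z)) * ((\<i> * z) ^ (n - 1) / ((\<i> * z) ^ n * poly P (\<i> * z))\<^sup>2) * (\<i> * 1)) (at z)"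
        by (rule DERIV_chain2[OF g_deriv DERIV_cmult[OF DERIV_ident]]) (use MRz in blast)
      moreover have "exp (h (\<i> * z)) * ((\<i> * z) ^ (n - 1) / ((\<i> * z) ^ n * poly P (\<i> * z))\<^sup>2) * (\<i> * 1) = exp ((z + - \<i> * a)\<^sup>2) * b z"
        unfolding C e b_def by (simp only: mult_ac mult_1_right mult_1_left)
      moreover have "z + - \<i> * a = - \<i> * of_real x0 + - \<i> * a + \<i> * of_real (- 1 * t)" by (simp add: z_def)
      ultimately show "((\<lambda>z. g (\<i> * z)) has_field_derivative
          exp ((- \<i> * of_real x0 + - \<i> * a + \<i> * of_real (- 1 * t))\<^sup>2) * b (- \<i> * of_real x0 + \<i> * of_real (- 1 * t))) (at (- \<i> * of_real x0 + \<i> * of_real (- 1 * t)))"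
        unfolding z_def[symmetric] by (simp only:)
      have "norm (b z) = norm C * norm ((\<i> * z) ^ (n - 1) / ((\<i> * z) ^ n * poly P (\<i> * z))\<^sup>2)"
        unfolding b_def norm_mult[of "_ * _"] by (simp add: norm_mult)
      also have "\<dots> \<le> norm C * M" using MRz by (intro mult_left_mono) auto
      finally show "norm (b (- \<i> * of_real x0 + \<i> * of_real (- 1 * t))) \<le> norm C * M" unfolding z_def .
    qed (use T in auto)
    also have "\<dots> \<le> K * 2"
      unfolding K_def using arctan_ubound[of T] pi_less_4 M0 by (intro mult_left_mono) auto
    finally show ?thesis using rot[of T] rot[of 0] by simp
  qed
  hence bd: "norm (g (of_real (x0 + T))) \<le> norm (g (of_real x0)) + K * 2" if "T > 0" for T
    using that norm_triangle_ineq2[of "g (of_real (x0 + T))" "g (of_real x0)"] by (smt (verit))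
  define G where "G = norm (g (of_real x0)) + K * 2"
  have "((\<lambda>t. chordal_dist (sphere_map f (of_real (x0 + t))) (Some 0)) \<longlongrightarrow> 0) at_top"
    using asym nontangential_real[OF x0(1)] unfolding has_asymptotic_value_def by blast
  moreover have pos: "1 / sqrt (1 + G\<^sup>2) > 0" by (simp add: add_pos_nonneg)
  ultimately have "\<forall>\<^sub>F t in at_top. chordal_dist (sphere_map f (of_real (x0 + t))) (Some 0) < 1 / sqrt (1 + G\<^sup>2)"
    by (rule order_tendstoD(2))
  moreover have "\<forall>\<^sub>F t in at_top. t > (0::real)" by (rule eventually_gt_at_top)
  ultimately have "\<forall>\<^sub>F t :: real in at_top. False"
  proof eventually_elim
    case (elim t)
    have nz: "of_real (x0 + t) ^ n * poly P (of_real (x0 + t)) \<noteq> 0" using MR[OF big[of t]] elim(2) by simp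
    have "(norm (g (of_real (x0 + t))))\<^sup>2 \<le> G\<^sup>2" using bd[OF elim(2)] unfolding G_def by (intro power_mono) auto
    hence "sqrt (1 + (norm (g (of_real (x0 + t))))\<^sup>2) \<le> sqrt (1 + G\<^sup>2)" by simp
    hence "1 / sqrt (1 + G\<^sup>2) \<le> 1 / sqrt (1 + (norm (g (of_real (x0 + t))))\<^sup>2)"
      by (intro divide_left_mono) (auto intro!: mult_pos_pos add_pos_nonneg)
    thus ?case using elim(1) unfolding chordal_g(1)[OF nz] by linarith
  qed
  thus False by simp
qed

lemma g_vertical_limit:
  assumes \<sigma>: "\<sigma> = 1 \<or> \<sigma> = (-1 :: int)" and asym: "has_asymptotic_value f \<sigma> (Some (\<i> * of_real (of_int \<sigma>)))"
  shows "((\<lambda>t. g (z + \<i> * of_real (of_int \<sigma> * t))) \<longlongrightarrow> - \<i> * of_real (of_int \<sigma>)) at_top"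
proof -
  define x where "x = \<bar>Re z\<bar>"
  \<comment> \<open>The vertical ray through \<open>z\<close> enters the Stokes sector after time \<open>t0\<close>.\<close>
  define t0 where "t0 = 2 * x + 1 + \<bar>Im z\<bar>"
  define \<gamma> where "\<gamma> = (\<lambda>t. z + \<i> * of_real (of_int \<sigma> * (t + t0)))"
  obtain M R where MR: "\<And>z. norm z \<ge> R \<Longrightarrow> z ^ n * poly P z \<noteq> 0 \<and> norm (z ^ (n - 1) / (z ^ n * poly P z)\<^sup>2) \<le> M"
    using g_factor_bounded by blast
  have im: "of_int \<sigma> * Im (\<gamma> t) \<ge> 2 * x + 1 + t" for t
  proof -
    have "of_int \<sigma> * Im (\<gamma> t) = of_int \<sigma> * Im z + (t + t0)" using \<sigma> by (auto simp: \<gamma>_def)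
    moreover have "of_int \<sigma> * Im z \<ge> - \<bar>Im z\<bar>" using \<sigma> by auto
    ultimately show ?thesis unfolding t0_def by linarith
  qed
  have "nontangential_curve \<sigma> \<gamma>"
  proof (rule nontangential_vertical[OF \<sigma> _ _ im])
    show "continuous_on {0..} \<gamma>" unfolding \<gamma>_def by (intro continuous_intros)
  qed (simp_all add: x_def \<gamma>_def)
  hence "((\<lambda>t. chordal_dist (sphere_map f (\<gamma> t)) (Some (\<i> * of_real (of_int \<sigma>)))) \<longlongrightarrow> 0) at_top"
    using asym unfolding has_asymptotic_value_def by blast
  moreover have "\<forall>\<^sub>F t in at_top. chordal_dist (sphere_map f (\<gamma> t)) (Some (\<i> * of_real (of_int \<sigma>)))
      = norm (g (\<gamma> t) + - cnj (\<i> * of_real (of_int \<sigma>))) / (sqrt 2 * sqrt (1 + (norm (g (\<gamma> t)))\<^sup>2))"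
  proof (rule eventually_at_top_linorderI[of "\<bar>R\<bar>"])
    fix t :: real assume t: "t \<ge> \<bar>R\<bar>"
    have "R \<le> of_int \<sigma> * Im (\<gamma> t)" using im[of t] t by (simp add: x_def)
    also have "\<dots> \<le> \<bar>Im (\<gamma> t)\<bar>" using \<sigma> by auto
    also have "\<dots> \<le> norm (\<gamma> t)" by (rule abs_Im_le_cmod)
    finally have "\<gamma> t ^ n * poly P (\<gamma> t) \<noteq> 0" using MR by blast
    thus "chordal_dist (sphere_map f (\<gamma> t)) (Some (\<i> * of_real (of_int \<sigma>)))
      = norm (g (\<gamma> t) + - cnj (\<i> * of_real (of_int \<sigma>))) / (sqrt 2 * sqrt (1 + (norm (g (\<gamma> t)))\<^sup>2))"
      by (rule chordal_g(2)) (use \<sigma> in \<open>auto simp: norm_mult\<close>)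
  qed
  ultimately have "((\<lambda>t. norm (g (\<gamma> t) + - cnj (\<i> * of_real (of_int \<sigma>))) / (sqrt 2 * sqrt (1 + (norm (g (\<gamma> t)))\<^sup>2))) \<longlongrightarrow> 0) at_top"
    by (rule Lim_transform_eventually)
  hence lim: "((\<lambda>t. g (\<gamma> t)) \<longlongrightarrow> - (- cnj (\<i> * of_real (of_int \<sigma>)))) at_top"
    by (rule chordal_tendsto_0_imp) (use \<sigma> in \<open>auto simp: norm_mult\<close>)
  have "filterlim (\<lambda>t::real. t - t0) at_top at_top" by real_asymp
  from filterlim_compose[OF lim this] show ?thesis by (simp add: \<gamma>_def)
qed

end

context zero_quotient
begin

text \<open>
  If \<open>B\<close> is the companion of \<open>z ^ n * P\<close> with a polynomial \<open>s\<close>, then \<open>D a = - s / gauss_limit\<close>.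
\<close>

definition D :: "complex \<Rightarrow> complex \<Rightarrow> complex" where
  "D a z = (B z + z ^ n * poly P z * gauss_prim (z + a) / of_real gauss_limit) * exp (- (z + a)\<^sup>2)"

text \<open>
  The function \<open>G = 1 / f + q / L\<close> has a derivative with a Gaussian factor, and it tends to zero along
  every vertical ray because the asymptotic values \<open>\<plusminus> \<i>\<close> of \<open>f\<close> cancel the limits of the primitive \<open>q\<close>.
  Hence \<open>G\<close> is of Gaussian size, and multiplying by the polynomial \<open>z ^ n * P\<close> gives polynomial growth.
\<close>

lemma D_growth:
  assumes dh: "\<And>z. deriv h z = 2 * (z + a)"
    and asym: "has_asymptotic_value f 1 (Some \<i>)" "has_asymptotic_value f (-1) (Some (- \<i>))"
  obtains K R where "\<And>z. norm z \<ge> R \<Longrightarrow> norm (D a z) \<le> K * norm z ^ (n + degree P)"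
proof -
  define G where "G = (\<lambda>z. g z + gauss_prim (z + a) / of_real gauss_limit)"
  have dh1: "deriv h z = 2 * 1 * (z + a)" for z by (simp add: dh)
  obtain C where C: "\<And>z. exp (h z) = C * exp (1 * (z + a)\<^sup>2)" using exp_h_gaussian[OF dh1] by blast
  obtain M R where MR: "\<And>z. norm z \<ge> R \<Longrightarrow> z ^ n * poly P z \<noteq> 0 \<and> norm (z ^ (n - 1) / (z ^ n * poly P z)\<^sup>2) \<le> M"
    using g_factor_bounded by blast
  define M' where "M' = norm C * M + 1 / gauss_limit"
  define b where "b = (\<lambda>z. C * (z ^ (n - 1) / (z ^ n * poly P z)\<^sup>2) + 1 / of_real gauss_limit)"
  have L0: "of_real gauss_limit \<noteq> (0 :: complex)" using gauss_limit_pos by simp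
  have Gd: "(G has_field_derivative exp ((z + a)\<^sup>2) * b z) (at z)" and bb: "norm (b z) \<le> M'" if z: "norm z \<ge> R" for z
  proof -
    have nz: "z ^ n * poly P z \<noteq> 0" using MR[OF z] by blast
    have q: "((\<lambda>z. gauss_prim (z + a)) has_field_derivative exp ((z + a)\<^sup>2) * 1) (at z)"
      by (rule DERIV_chain2[OF gauss_prim_deriv]) (auto intro!: derivative_eq_intros)
    have "(G has_field_derivative exp (h z) * (z ^ (n - 1) / (z ^ n * poly P z)\<^sup>2) + exp ((z + a)\<^sup>2) * 1 / of_real gauss_limit) (at z)"
      unfolding G_def by (rule DERIV_add[OF g_deriv[OF nz] DERIV_cdivide[OF q]])
    moreover have "exp (h z) * (z ^ (n - 1) / (z ^ n * poly P z)\<^sup>2) + exp ((z + a)\<^sup>2) * 1 / of_real gauss_limit = exp ((z + a)\<^sup>2) * b z"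
      unfolding C b_def mult_1_left distrib_left by (simp only: divide_inverse mult_ac mult_1_left mult_1_right)
    ultimately show "(G has_field_derivative exp ((z + a)\<^sup>2) * b z) (at z)" by (simp only:)
    have "norm (b z) \<le> norm C * norm (z ^ (n - 1) / (z ^ n * poly P z)\<^sup>2) + norm (1 / of_real gauss_limit :: complex)"
      unfolding b_def norm_mult[symmetric] by (rule norm_triangle_ineq)
    also have "norm (1 / of_real gauss_limit :: complex) = 1 / gauss_limit" using gauss_limit_pos by (simp add: norm_divide)
    also have "norm C * norm (z ^ (n - 1) / (z ^ n * poly P z)\<^sup>2) \<le> norm C * M" using MR[OF z] by (intro mult_left_mono) auto
    finally show "norm (b z) \<le> M'" by (simp add: M'_def)
  qed
  have lim: "((\<lambda>t. G (z + \<i> * of_real (of_int \<sigma> * t))) \<longlongrightarrow> 0) at_top" if \<sigma>: "\<sigma> = 1 \<or> \<sigma> = (-1 :: int)" for z \<sigma>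
  proof -
    have "has_asymptotic_value f \<sigma> (Some (\<i> * of_real (of_int \<sigma>)))" using \<sigma> asym by auto
    hence 1: "((\<lambda>t. g (z + \<i> * of_real (of_int \<sigma> * t))) \<longlongrightarrow> - \<i> * of_real (of_int \<sigma>)) at_top"
      by (rule g_vertical_limit[OF \<sigma>])
    have 2: "((\<lambda>t. gauss_prim (z + a + \<i> * of_real (of_int \<sigma> * t)) / of_real gauss_limit) \<longlongrightarrow> \<i> * of_real (of_int \<sigma> * gauss_limit) / of_real gauss_limit) at_top"
      by (rule tendsto_divide[OF gauss_prim_vertical_limit tendsto_const L0]) (use \<sigma> in auto)
    have "((\<lambda>t. g (z + \<i> * of_real (of_int \<sigma> * t)) + gauss_prim (z + a + \<i> * of_real (of_int \<sigma> * t)) / of_real gauss_limit) \<longlongrightarrow> 0) at_top"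
      using tendsto_add[OF 1 2] L0 by simp
    moreover have "z + a + \<i> * of_real (of_int \<sigma> * t) = z + \<i> * of_real (of_int \<sigma> * t) + a" for t by simp
    ultimately show ?thesis unfolding G_def by (simp only:)
  qed
  have G: "norm (G z) \<le> 2 * M' * norm (exp ((z + a)\<^sup>2))" if z: "norm z \<ge> R + norm a" for z
  proof -
    obtain \<sigma> :: int where \<sigma>: "\<sigma> = 1 \<or> \<sigma> = -1" "of_int \<sigma> * Im (z + a) \<ge> 0"
      by (cases "Im (z + a) \<ge> 0") (use that[of 1] that[of "-1"] in auto)
    define \<tau> where "\<tau> = real_of_int \<sigma>"
    have \<tau>: "\<tau> = 1 \<or> \<tau> = -1" "\<tau> * Im (z + a) \<ge> 0" using \<sigma> by (auto simp: \<tau>_def)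
    have "\<tau> * Im z \<ge> - norm a" using \<tau> abs_Im_le_cmod[of a] by auto
    hence ray: "norm (z + \<i> * of_real (\<tau> * t)) \<ge> R" if "t \<ge> 0" for t
      using vertical_ray_norm[OF \<tau>(1) z _ norm_ge_zero that] by simp
    show ?thesis
    proof (rule vertical_decay[where b = b, OF \<tau>])
      fix t :: real assume t: "t \<ge> 0"
      have "z + a + \<i> * of_real (\<tau> * t) = z + \<i> * of_real (\<tau> * t) + a" by simp
      thus "(G has_field_derivative exp ((z + a + \<i> * of_real (\<tau> * t))\<^sup>2) * b (z + \<i> * of_real (\<tau> * t))) (at (z + \<i> * of_real (\<tau> * t)))"
        using Gd[OF ray[OF t]] by (simp only:)
      show "norm (b (z + \<i> * of_real (\<tau> * t))) \<le> M'" by (rule bb[OF ray[OF t]])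
    next
      show "((\<lambda>t. G (z + \<i> * of_real (\<tau> * t))) \<longlongrightarrow> 0) at_top" unfolding \<tau>_def by (rule lim[OF \<sigma>(1)])
    qed
  qed
  have deg: "degree (monom 1 n * P) = n + degree P" using P_nz by (simp add: degree_mult_eq degree_monom_eq)
  obtain K R2 where K: "\<And>z. norm z \<ge> R2 \<Longrightarrow> poly (monom 1 (n + degree P)) z \<noteq> 0
      \<and> norm (z ^ 0 * (poly (monom 1 n * P) z / poly (monom 1 (n + degree P)) z)) \<le> K"
    using poly_ratio_bounded[of "monom 1 (n + degree P)" "monom 1 n * P" 0] deg by (auto simp: degree_monom_eq)
  have "norm (D a z) \<le> K * (2 * M') * norm z ^ (n + degree P)" if "norm z \<ge> max R2 (max R (R + norm a))" for z
  proof -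
    have z: "norm z \<ge> R2" "norm z \<ge> R" "norm z \<ge> R + norm a" using that unfolding max.bounded_iff by blast+
    define X where "X = z ^ n * poly P z"
    have X0: "X \<noteq> 0" using MR[OF z(2)] by (simp add: X_def)
    have "D a z = X * G z * exp (- (z + a)\<^sup>2)"
    proof -
      have "X * (B z / X + q / l) = B z + X * q / l" for q l using X0 by (simp add: distrib_left)
      thus ?thesis unfolding D_def G_def g_def X_def[symmetric] by (simp only:)
    qed
    hence "norm (D a z) = norm X * (norm (G z) * norm (exp (- (z + a)\<^sup>2)))" by (simp only: norm_mult mult_ac)
    also have "norm (G z) * norm (exp (- (z + a)\<^sup>2)) \<le> 2 * M' * norm (exp ((z + a)\<^sup>2)) * norm (exp (- (z + a)\<^sup>2))"
      by (rule mult_right_mono[OF G[OF z(3)] norm_ge_zero])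
    also have "\<dots> = 2 * M'"
    proof -
      have "exp ((z + a)\<^sup>2) * exp (- (z + a)\<^sup>2) = 1" by (simp flip: exp_add)
      hence "norm (exp ((z + a)\<^sup>2)) * norm (exp (- (z + a)\<^sup>2)) = 1" unfolding norm_mult[symmetric] by simp
      thus ?thesis by (simp only: mult.assoc mult_1_right)
    qed
    finally have 1: "norm (D a z) \<le> norm X * (2 * M')" by (simp add: mult_left_mono)
    have "norm (X / z ^ (n + degree P)) \<le> K" "z ^ (n + degree P) \<noteq> 0" using K[OF z(1)] by (auto simp: poly_monom X_def)
    hence "norm X / norm z ^ (n + degree P) \<le> K" "norm z ^ (n + degree P) > 0"
      unfolding norm_divide norm_power[symmetric] by simp_all
    hence "norm X \<le> K * norm z ^ (n + degree P)" using pos_divide_le_eq by blast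
    moreover have "M' \<ge> 0" using bb[OF z(2)] norm_ge_zero order.trans by blast
    ultimately have "norm X * (2 * M') \<le> K * norm z ^ (n + degree P) * (2 * M')" by (intro mult_right_mono) auto
    thus ?thesis using 1 by (simp add: mult_ac)
  qed
  thus thesis by (rule that)
qed

lemma denominator_companion:
  assumes dh: "\<And>z. deriv h z = 2 * (z + a)"
    and asym: "has_asymptotic_value f 1 (Some \<i>)" "has_asymptotic_value f (-1) (Some (- \<i>))"
  obtains s where "B = companion a (monom 1 n * P) s"
proof -
  obtain K R where KR: "\<And>z. norm z \<ge> R \<Longrightarrow> norm (D a z) \<le> K * norm z ^ (n + degree P)"
    using D_growth[OF assms] by blast
  have "gauss_prim holomorphic_on UNIV" unfolding holomorphic_on_open[OF open_UNIV] using gauss_prim_deriv by blast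
  hence "gauss_prim \<circ> (\<lambda>z. z + a) holomorphic_on UNIV"
    by (intro holomorphic_on_compose) (auto intro!: holomorphic_intros intro: holomorphic_on_subset)
  hence "D a holomorphic_on UNIV" unfolding D_def[abs_def] o_def
    using holB gauss_limit_pos by (intro holomorphic_intros) auto
  from Liouville_polynomial[OF this KR]
  have D: "D a z = (\<Sum>k\<le>n + degree P. (deriv ^^ k) (D a) 0 / fact k * z ^ k)" for z .
  define p where "p = (\<Sum>k\<le>n + degree P. monom ((deriv ^^ k) (D a) 0 / fact k) k)"
  have p: "D a z = poly p z" for z by (rule trans[OF D]) (simp only: p_def poly_sum poly_monom)
  define L where "L = (of_real gauss_limit :: complex)"
  have L: "L \<noteq> 0" using gauss_limit_pos by (simp add: L_def)
  have "B z = companion a (monom 1 n * P) (smult (- L) p) z" for z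
  proof -
    have "poly p z * exp ((z + a)\<^sup>2) = B z + z ^ n * poly P z * gauss_prim (z + a) / L"
    proof -
      have "exp (- (z + a)\<^sup>2) * exp ((z + a)\<^sup>2) = 1" by (simp flip: exp_add)
      thus ?thesis unfolding p[symmetric] D_def L_def[symmetric] by (simp only: mult.assoc mult_1_right)
    qed
    moreover have "b = - (X * q + - L * p * E) / L" if "p * E = b + X * q / L" for b X q p E
    proof -
      have "- (X * q + - L * p * E) / L = (L * (p * E) - X * q) / L" by (simp add: mult.assoc)
      also have "\<dots> = b" unfolding that using L by (simp add: distrib_left)
      finally show ?thesis by simp
    qed
    ultimately show ?thesis unfolding companion_def L_def[symmetric] by (simp add: poly_monom)
  qed
  thus thesis using that[of "smult (- L) p"] by blast
qed

end

text \<open>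
  The Wronskian of numerator and denominator is known from \<open>h\<close> on the one hand and from the companion
  form of the denominator on the other; comparing the two shows that \<open>P\<close> is a kernel polynomial.
\<close>

theorem (in F1_hat_fn) kernel_fn_ex:
  "\<exists>a s \<kappa>. kernel_fn a m n P s \<kappa> \<and> f = nevanlinna_fn a n P s"
proof -
  obtain h where "zero_quotient n P B h f" using zero_quotient_ex by blast
  then interpret zq: zero_quotient n P B h f .
  obtain \<epsilon> a where ea: "\<epsilon> = 1 \<or> \<epsilon> = -1" "\<And>z. deriv h z = 2 * \<epsilon> * (z + a)"
    using zq.h_deriv_gaussian[OF schw_O] by blast
  have "\<epsilon> = 1" by (rule zq.exponent_sign[OF ea(2,1) asym_0])
  hence dh: "deriv h z = 2 * (z + a)" for z using ea(2) by simp
  obtain s where s: "B = companion a (monom 1 n * P) s"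
    using zq.denominator_companion[OF dh asym_1 asym_m1] by blast
  obtain C where C: "C \<noteq> 0" "\<And>z. exp (h z) = C * exp (1 * (z + a)\<^sup>2)" using zq.exp_h_gaussian[OF ea(2)] unfolding \<open>\<epsilon> = 1\<close> by blast
  define \<kappa> where "\<kappa> = - of_real gauss_limit * C"
  have "poly (gauss_wronskian a 1 (monom 1 n * P) s) z = \<kappa> * z ^ (n - 1)" for z
  proof -
    have A: "poly (monom 1 n * P) z = z ^ n * poly P z" by (simp add: poly_monom)
    have A': "poly (pderiv (monom 1 n * P)) z = of_nat n * z ^ (n - 1) * poly P z + z ^ n * poly (pderiv P) z"
      by (simp add: pderiv_mult pderiv_monom poly_monom algebra_simps)
    have "z ^ (n - 1) * (C * exp ((z + a)\<^sup>2)) = poly (monom 1 n * P) z * deriv B z - poly (pderiv (monom 1 n * P)) z * B z"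
      unfolding A A' zq.wr' C(2) mult_1_left ..
    also have "\<dots> = - poly (gauss_wronskian a 1 (monom 1 n * P) s) z / of_real gauss_limit * exp ((z + a)\<^sup>2)"
      unfolding s by (rule companion_wronskian)
    finally have e: "z ^ (n - 1) * (C * exp ((z + a)\<^sup>2)) = - poly (gauss_wronskian a 1 (monom 1 n * P) s) z / of_real gauss_limit * exp ((z + a)\<^sup>2)" .
    have aux: "w = - L * c * x" if "x * (c * E) = - w / L * E" "E \<noteq> 0" "L \<noteq> 0" for x c E w L :: complex
    proof -
      have "E * (x * c) = E * (- w / L)" using that(1) by (simp only: mult_ac)
      hence "x * c = - w / L" by (rule mult_left_cancel[OF that(2), THEN iffD1])
      hence "x * c * L = - w / L * L" by (rule arg_cong)
      also have "\<dots> = - w" using that(3) by simp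
      finally have "w = - (x * c * L)" by (simp only: minus_minus)
      thus ?thesis by (simp only: mult_ac minus_mult_left)
    qed
    from aux[OF e exp_not_eq_zero] show ?thesis unfolding \<kappa>_def using gauss_limit_pos by simp
  qed
  hence "poly (gauss_wronskian a 1 (monom 1 n * P) s) = poly (monom \<kappa> (n - 1))"
    by (intro ext) (simp only: poly_monom)
  hence wr: "gauss_wronskian a 1 (monom 1 n * P) s = monom \<kappa> (n - 1)"
    by (rule poly_eq_poly_eq_iff[THEN iffD1])
  have \<kappa>: "\<kappa> \<noteq> 0" using C(1) gauss_limit_pos by (simp add: \<kappa>_def)
  have "P \<in> hermite_kernel a m n" by (rule hermite_kernelI[OF wr _ \<kappa> P_props(1,2) m n]) simp
  hence "kernel_fn a m n P s \<kappa>" using wr \<kappa> m n by unfold_locales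
  moreover have "f = nevanlinna_fn a n P s"
    unfolding nevanlinna_fn_def[abs_def] s[symmetric] using zq.f_eq by (rule ext)
  ultimately show ?thesis by blast
qed

section \<open>The bijection\<close>

theorem corollary3p4:
  fixes m n :: nat
  assumes "m \<ge> 1" and "n \<ge> 1"
  shows "bij_betw (\<lambda>f. - (1 / 4) * schwarzian_coeff f 1) (F1_hat m n)
           {z. poly (generalised_hermite m n) z = 0}"
proof (rule bij_betwI')
  have form: "\<exists>a P s \<kappa>. kernel_fn a m n P s \<kappa> \<and> f = nevanlinna_fn a n P s" if "f \<in> F1_hat m n" for f
  proof -
    interpret F1_hat_fn m n f by unfold_locales (use assms that in auto)
    show ?thesis using kernel_fn_ex by (elim exE) (intro exI)
  qed
  show "- (1 / 4) * schwarzian_coeff f 1 \<in> {z. poly (generalised_hermite m n) z = 0}" if "f \<in> F1_hat m n" for f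
  proof -
    obtain a P s \<kappa> where k: "kernel_fn a m n P s \<kappa>" "f = nevanlinna_fn a n P s" using form[OF \<open>f \<in> F1_hat m n\<close>] by blast
    have "P \<in> hermite_kernel a m n" using kernel_fn.P[OF k(1)] .
    hence "poly (generalised_hermite m n) a = 0" using generalised_hermite_root_iff[OF assms] by blast
    thus ?thesis unfolding k(2) kernel_fn.projection_eq[OF k(1)] by simp
  qed
  show "\<exists>f\<in>F1_hat m n. a = - (1 / 4) * schwarzian_coeff f 1" if root: "a \<in> {z. poly (generalised_hermite m n) z = 0}" for a
  proof -
    obtain P where P: "P \<in> hermite_kernel a m n" using root unfolding mem_Collect_eq generalised_hermite_root_iff[OF assms] by blast
    obtain s \<kappa> where "\<kappa> \<noteq> 0" "gauss_wronskian a 1 (monom 1 n * P) s = monom \<kappa> (n - 1)"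
      using hermite_kernel_wronskian[OF assms(2) P] .
    then interpret kernel_fn a m n P s \<kappa> using assms P by unfold_locales
    show ?thesis
    proof (rule bexI)
      show "a = - (1 / 4) * schwarzian_coeff (nevanlinna_fn a n P s) 1" by (rule projection_eq[symmetric])
    qed (rule in_F1_hat)
  qed
  show "(- (1 / 4) * schwarzian_coeff f 1 = - (1 / 4) * schwarzian_coeff g 1) = (f = g)"
    if fg: "f \<in> F1_hat m n" "g \<in> F1_hat m n" for f g
  proof
    assume eq: "- (1 / 4) * schwarzian_coeff f 1 = - (1 / 4) * schwarzian_coeff g 1"
    obtain a P s \<kappa> where f: "kernel_fn a m n P s \<kappa>" "f = nevanlinna_fn a n P s" using form[OF fg(1)] by blast
    obtain a' P' s' \<kappa>' where g: "kernel_fn a' m n P' s' \<kappa>'" "g = nevanlinna_fn a' n P' s'" using form[OF fg(2)] by blast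
    have a: "a' = a" using eq unfolding f(2) g(2) kernel_fn.projection_eq[OF f(1)] kernel_fn.projection_eq[OF g(1)] by simp
    have P: "P' = P" using hermite_kernel_unique[OF assms(2)] kernel_fn.P[OF f(1)] kernel_fn.P[OF g(1)] unfolding a by blast
    have P0: "P \<noteq> 0" by (rule kernel_fn.P_props(3)[OF f(1)])
    hence "n - 1 \<le> degree (monom 1 n * P)" by (simp add: degree_mult_eq degree_monom_eq)
    hence "s' = s" using gauss_wronskian_unique kernel_fn.wr[OF g(1)] kernel_fn.wr[OF f(1)] P0 unfolding a P
      by (metis monom_eq_0_iff mult_eq_0_iff one_neq_zero)
    thus "f = g" unfolding f(2) g(2) a P by simp
  qed simp
qed

end
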